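(* Let $M$ be a real three-dimensional manifold with a flag structure $(T^1,T^2)$, let $Y\to M$ be its adapted coframe bundle (with its right action of the Borel group $B\subset \mathrm{SL}(3,\mathbb C)$ of upper triangular matrices), and let $\omega,\omega^1,\omega^2,\phi,\omega^1_1,\phi^1,\phi^2,\psi$ be the canonical 1-forms on $Y$. Then the $\mathfrak{sl}(3,\mathbb C)$-valued 1-form $$\pi=\begin{pmatrix} -\frac12\phi-\frac13\omega^1_1 & -\phi^2 & -\frac14\psi\\ \omega^1 & \frac23\omega^1_1 & \frac12\phi^1\\ 2\omega & 2\omega^2 & \frac12\phi-\frac13\omega^1_1\end{pmatrix}$$ is a Cartan connection on $Y\to M$.
   Context: Flag structure: for a real 3-manifold $M$ put $T^{\mathbb C}=TM\otimes\mathbb C$. A flag structure is a choice of two complex line sub-bundles $T^1,T^2\subset T^{\mathbb C}$ with $T^1\cap T^2=\{0\}$ such that $T^1\oplus T^2$ is a contact distribution: locally there is a complex-valued 1-form $\theta$ with $\ker\theta=T^1\oplus T^2$ and $d\theta\wedge\theta$ nowhere zero. The bundle $E$: $E\to M$ is the $\mathbb C^*$-bundle whose fibre at $x$ consists of all complex covectors $\theta$ on $T_xM$ with $\ker\theta=T^1_x\oplus T^2_x$. It carries the tautological 1-form $\omega_\theta=(\text{pull-back of }\theta\text{ to }T_\theta E)$. The coframe bundle $Y$: the fibre of $Y\to E$ over $\varepsilon\in E$ (lying over $x\in M$) is the set of quadruples $(\omega,\omega^1,\omega^2,\phi)$ of complex covectors on $T_\varepsilon E$ where $\omega$ is the tautological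 form, $\omega^1$ and $\omega^2$ are pull-backs of complex covectors on $T_xM$, the first nonzero on $T^1$ and zero on $T^2$, the second zero on $T^1$ and nonzero on $T^2$, and $d\omega=\omega\wedge\phi+\omega^1\wedge\omega^2$ at $\varepsilon$. The same letters $\omega,\omega^1,\omega^2,\phi$ denote the tautological 1-forms on $Y$. Group action: let $H$ be the group of matrices $$\begin{pmatrix}\lambda & v^1\lambda & v^2\lambda & s\\ 0&a^1&0&a^1v^2\\0&0&a^2&-a^2v^1\\0&0&0&1\end{pmatrix},\quad s,v^1,v^2\in\mathbb C,\ a^1,a^2\in\mathbb C^*,\ a^1a^2=\lambda .$$ $H$ acts on $Y$ on the right over $M$ by $(\omega,\omega^1,\omega^2,\phi)\mapsto(\omega,\omega^1,\omega^2,\phi)\cdot A$, the result being a coframe at the point $\lambda\varepsilon$ (covectors at $\varepsilon$ and $\lambda\varepsilon$ being identified by the dilation of $E$ by $\lambda$). The Borel group $B\subset\mathrm{SL}(3,\mathbb C)$ of upper triangular matrices acts on $Y$ through the surjective homomorphism $j:B\to H$ with finite kernel $\mathbb Z/3\mathbb Z$ (the scalar matrices), $$j\begin{pmatrix}a&c&e\\0&\frac1{ab}&d\\0&0&b\end{pmatrix}=\begin{pmatrix}\frac ab&-2a^2d&\frac cb&\frac{4e}b-2acd\\0&a^2b&0&abc\\0&0&\frac1{ab^2}&\frac{2d}b\\0&0&0&1\end{pmatrix}.$$ For $h\in B$, $R_h$ denotes this right action, and for $X\in\mathfrak b=\mathrm{Lie}(B)$ the vertical field is $X^*(y)=\frac{d}{dt}\big|_{t=0}\,y\,e^{tX}$.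 Canonical forms: $\omega^1_1,\phi^1,\phi^2,\psi$ are the unique complex-valued 1-forms on $Y$ for which, with some functions $Q^1,Q^2$ on $Y$, $$d\omega=\omega\wedge\phi+\omega^1\wedge\omega^2,\quad d\omega^1=\tfrac12\omega^1\wedge\phi+\omega^1\wedge\omega^1_1+\omega\wedge\phi^1,\quad d\omega^2=\tfrac12\omega^2\wedge\phi-\omega^2\wedge\omega^1_1+\omega\wedge\phi^2,$$ $$d\phi=\omega^1\wedge\phi^2-\omega^2\wedge\phi^1+\omega\wedge\psi,\qquad d\omega^1_1=\tfrac32\omega^2\wedge\phi^1+\tfrac32\omega^1\wedge\phi^2,$$ $$d\phi^1-\phi^1\wedge\omega^1_1-\tfrac12\omega^1\wedge\psi-\tfrac12\phi\wedge\phi^1=Q^1\,\omega\wedge\omega^2,\qquad d\phi^2+\phi^2\wedge\omega^1_1-\tfrac12\omega^2\wedge\psi-\tfrac12\phi\wedge\phi^2=Q^2\,\omega\wedge\omega^1 .$$ Cartan connection (in the generalized sense used here): a 1-form $\pi:TY\to\mathfrak{sl}(3,\mathbb C)$ such that (0) $\pi_p:T_pY\to\mathfrak{sl}(3,\mathbb C)$ is injective for every $p\in Y$; (1) $\pi(X^* )=X$ for every $X\in\mathfrak b$; (2) $(R_h)^*\pi=\mathrm{Ad}_{h^{-1}}\pi$ for every $h\in B$. (It is not required that $\pi_p$ be an isomorphism; here $\dim_{\mathbb R}Y=13$.) *)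

theory Defs
  imports "HOL-Analysis.Analysis"
begin

section \<open>Smooth maps between open subsets of Euclidean spaces\<close>

primrec Ck_on :: "nat \<Rightarrow> 'a::euclidean_space set \<Rightarrow> ('a \<Rightarrow> 'b::real_normed_vector) \<Rightarrow> bool" where
  "Ck_on 0 S f \<longleftrightarrow> continuous_on S f"
| "Ck_on (Suc k) S f \<longleftrightarrow> f differentiable_on S \<and>
     (\<forall>v. Ck_on k S (\<lambda>x. frechet_derivative f (at x) v))"

text \<open>Only used for open sets.\<close>
definition smooth_on :: "'a::euclidean_space set \<Rightarrow> ('a \<Rightarrow> 'b::real_normed_vector) \<Rightarrow> bool" where
  "smooth_on S f \<longleftrightarrow> (\<forall>k. Ck_on k S f)"

section \<open>Manifolds given by an atlas\<close>

text \<open>A chart is its domain together with its coordinate map; outside the domain the map is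
  irrelevant. A manifold is given by its atlas, from which the set of points and the topology are
  recovered. All manifolds are of class \<open>C\<^sup>\<infinity>\<close>, without boundary, modelled on the
  Euclidean space \<open>'e\<close>.\<close>

type_synonym ('a, 'e) chart = "'a set \<times> ('a \<Rightarrow> 'e)"
type_synonym ('a, 'e) atlas = "('a, 'e) chart set"

definition chart_inv :: "('a, 'e) chart \<Rightarrow> 'e \<Rightarrow> 'a" where
  "chart_inv c = inv_into (fst c) (snd c)"

definition points :: "('a, 'e) atlas \<Rightarrow> 'a set" where
  "points A = \<Union> (fst ` A)"

definition is_open :: "('a, 'e::topological_space) atlas \<Rightarrow> 'a set \<Rightarrow> bool" where
  "is_open A W \<longleftrightarrow> W \<subseteq> points A \<and> (\<forall>c\<in>A. open (snd c ` (W \<inter> fst c)))"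

definition smooth_atlas :: "('a, 'e::euclidean_space) atlas \<Rightarrow> bool" where
  "smooth_atlas A \<longleftrightarrow>
     (\<forall>c\<in>A. inj_on (snd c) (fst c) \<and> open (snd c ` fst c)) \<and>
     (\<forall>c\<in>A. \<forall>c'\<in>A. open (snd c ` (fst c \<inter> fst c')) \<and>
        smooth_on (snd c ` (fst c \<inter> fst c')) (snd c' \<circ> chart_inv c))"

lemma istopology_is_open:
  assumes "smooth_atlas A"
  shows "istopology (is_open A)"
proof -
  have "is_open A (S \<inter> T)" if S: "is_open A S" and T: "is_open A T" for S T
  proof -
    have "open (snd c ` (S \<inter> T \<inter> fst c))" if c: "c \<in> A" for c
    proof -
      have "inj_on (snd c) (fst c)"
        using assms c by (simp add: smooth_atlas_def)
      then have "snd c ` (S \<inter> T \<inter> fst c) = snd c ` (S \<inter> fst c) \<inter> snd c ` (T \<inter> fst c)"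
        unfolding inj_on_def by blast
      then show ?thesis
        using S T c by (simp add: is_open_def open_Int)
    qed
    then show ?thesis
      using S by (auto simp: is_open_def)
  qed
  moreover have "is_open A (\<Union> K)" if K: "\<forall>S\<in>K. is_open A S" for K
  proof -
    have "open (snd c ` (\<Union> K \<inter> fst c))" if c: "c \<in> A" for c
    proof -
      have "snd c ` (\<Union> K \<inter> fst c) = (\<Union>S\<in>K. snd c ` (S \<inter> fst c))"
        by blast
      then show ?thesis
        using K c by (auto simp: is_open_def)
    qed
    then show ?thesis
      using K by (auto simp: is_open_def)
  qed
  ultimately show ?thesis
    by (auto simp: istopology_def)
qed

definition smooth_manifold :: "('a, 'e::euclidean_space) atlas \<Rightarrow> bool" where
  "smooth_manifold A \<longleftrightarrow> smooth_atlas A \<and>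
     Hausdorff_space (topology (is_open A)) \<and> second_countable (topology (is_open A))"

section \<open>Tangent vectors, differentials and complex-valued 1-forms\<close>

text \<open>A preferred chart is selected around every point \<open>p\<close>, and the tangent space at \<open>p\<close> is the
  model space \<open>'e\<close>: a vector \<open>v\<close> stands for the tangent vector at \<open>p\<close> whose components
  in the preferred chart are \<open>v\<close>. Smoothness, differentials and exterior derivatives do not depend
  on the selection.\<close>

definition chart_at :: "('a, 'e) atlas \<Rightarrow> 'a \<Rightarrow> ('a, 'e) chart" where
  "chart_at A p = (SOME c. c \<in> A \<and> p \<in> fst c)"

definition to_chart ::
    "('a, 'e::euclidean_space) atlas \<Rightarrow> ('a, 'e) chart \<Rightarrow> 'a \<Rightarrow> 'e \<Rightarrow> 'e" where
  "to_chart A c p =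
     frechet_derivative (snd c \<circ> chart_inv (chart_at A p)) (at (snd (chart_at A p) p))"

definition from_chart ::
    "('a, 'e::euclidean_space) atlas \<Rightarrow> ('a, 'e) chart \<Rightarrow> 'a \<Rightarrow> 'e \<Rightarrow> 'e" where
  "from_chart A c p = frechet_derivative (snd (chart_at A p) \<circ> chart_inv c) (at (snd c p))"

text \<open>The differential at \<open>p\<close> of a smooth map between manifolds.\<close>
definition tangent_map ::
    "('a, 'e::euclidean_space) atlas \<Rightarrow> ('b, 'f::euclidean_space) atlas \<Rightarrow> ('a \<Rightarrow> 'b) \<Rightarrow> 'a \<Rightarrow> 'e \<Rightarrow> 'f" where
  "tangent_map A A' f p =
     frechet_derivative (snd (chart_at A' (f p)) \<circ> f \<circ> chart_inv (chart_at A p))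
       (at (snd (chart_at A p) p))"

text \<open>The velocity at time \<open>0\<close> of a curve.\<close>
definition velocity ::
    "('a, 'e::euclidean_space) atlas \<Rightarrow> (real \<Rightarrow> 'a) \<Rightarrow> 'e" where
  "velocity A \<gamma> = vector_derivative (snd (chart_at A (\<gamma> 0)) \<circ> \<gamma>) (at 0)"

text \<open>A complex covector is an \<open>\<real>\<close>-linear map into \<open>\<complex>\<close>.\<close>
type_synonym 'e covec = "'e \<Rightarrow> complex"

definition form_comp ::
    "('a, 'e::euclidean_space) atlas \<Rightarrow> ('a \<Rightarrow> 'e covec) \<Rightarrow> ('a, 'e) chart \<Rightarrow> 'e \<Rightarrow> 'e \<Rightarrow> complex" where
  "form_comp A \<alpha> c e x = \<alpha> (chart_inv c x) (from_chart A c (chart_inv c x) e)"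

definition smooth_form ::
    "('a, 'e::euclidean_space) atlas \<Rightarrow> 'a set \<Rightarrow> ('a \<Rightarrow> 'e covec) \<Rightarrow> bool" where
  "smooth_form A W \<alpha> \<longleftrightarrow> (\<forall>p\<in>W. linear (\<alpha> p)) \<and>
     (\<forall>c\<in>A. \<forall>e. smooth_on (snd c ` (W \<inter> fst c)) (form_comp A \<alpha> c e))"

definition wedge :: "'e covec \<Rightarrow> 'e covec \<Rightarrow> 'e \<Rightarrow> 'e \<Rightarrow> complex" (infixl \<open>\<and>\<^sub>f\<close> 70) where
  "(\<alpha> \<and>\<^sub>f \<beta>) u v = \<alpha> u * \<beta> v - \<alpha> v * \<beta> u"

text \<open>The exterior derivative at \<open>p\<close>, evaluated on two tangent vectors at \<open>p\<close>. In the preferred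
  chart at \<open>p\<close> both are extended with constant components, so the bracket term is absent.\<close>
definition ext_deriv ::
    "('a, 'e::euclidean_space) atlas \<Rightarrow> ('a \<Rightarrow> 'e covec) \<Rightarrow> 'a \<Rightarrow> 'e \<Rightarrow> 'e \<Rightarrow> complex" where
  "ext_deriv A \<alpha> p u v =
     (let c = chart_at A p; x = snd c p in
        frechet_derivative (form_comp A \<alpha> c v) (at x) u
      - frechet_derivative (form_comp A \<alpha> c u) (at x) v)"

section \<open>Flag structures on a 3-manifold\<close>

text \<open>The complexification of the tangent space \<open>real ^ 3\<close> is \<open>complex ^ 3\<close>; real linear maps
  and covectors are extended complex linearly.\<close>

definition re_vec :: "complex ^ 3 \<Rightarrow> real ^ 3" where
  "re_vec z = (\<chi> i. Re (z $ i))"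

definition im_vec :: "complex ^ 3 \<Rightarrow> real ^ 3" where
  "im_vec z = (\<chi> i. Im (z $ i))"

definition cx_map :: "(real ^ 3 \<Rightarrow> real ^ 3) \<Rightarrow> complex ^ 3 \<Rightarrow> complex ^ 3" where
  "cx_map L z = (\<chi> i. Complex (L (re_vec z) $ i) (L (im_vec z) $ i))"

definition cx_covec :: "(real ^ 3) covec \<Rightarrow> complex ^ 3 \<Rightarrow> complex" where
  "cx_covec \<theta> z = \<theta> (re_vec z) + \<i> * \<theta> (im_vec z)"

definition cx_ker :: "(real ^ 3) covec \<Rightarrow> (complex ^ 3) set" where
  "cx_ker \<theta> = {z. cx_covec \<theta> z = 0}"

definition smooth_cx_field ::
    "('m, real ^ 3) atlas \<Rightarrow> 'm set \<Rightarrow> ('m \<Rightarrow> complex ^ 3) \<Rightarrow> bool" where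
  "smooth_cx_field A U X \<longleftrightarrow>
     (\<forall>c\<in>A. smooth_on (snd c ` (U \<inter> fst c))
        (\<lambda>x. cx_map (to_chart A c (chart_inv c x)) (X (chart_inv c x))))"

definition cx_line_subbundle ::
    "('m, real ^ 3) atlas \<Rightarrow> ('m \<Rightarrow> (complex ^ 3) set) \<Rightarrow> bool" where
  "cx_line_subbundle A T \<longleftrightarrow>
     (\<forall>p\<in>points A. \<exists>U X. is_open A U \<and> p \<in> U \<and> smooth_cx_field A U X \<and>
        (\<forall>q\<in>U. X q \<noteq> 0 \<and> T q = range (\<lambda>k. k *s X q)))"

definition plane_sum :: "(complex ^ 3) set \<Rightarrow> (complex ^ 3) set \<Rightarrow> (complex ^ 3) set" where
  "plane_sum S T = {x + y | x y. x \<in> S \<and> y \<in> T}"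

definition flag_structure ::
    "('m, real ^ 3) atlas \<Rightarrow> ('m \<Rightarrow> (complex ^ 3) set) \<Rightarrow> ('m \<Rightarrow> (complex ^ 3) set) \<Rightarrow> bool" where
  "flag_structure A T1 T2 \<longleftrightarrow>
     cx_line_subbundle A T1 \<and> cx_line_subbundle A T2 \<and>
     (\<forall>p\<in>points A. T1 p \<inter> T2 p = {0}) \<and>
     (\<forall>p\<in>points A. \<exists>U \<theta>. is_open A U \<and> p \<in> U \<and> smooth_form A U \<theta> \<and>
        (\<forall>q\<in>U. cx_ker (\<theta> q) = plane_sum (T1 q) (T2 q) \<and>
           (\<exists>u v w. ext_deriv A \<theta> q u v * \<theta> q w + ext_deriv A \<theta> q v w * \<theta> q u
                   + ext_deriv A \<theta> q w u * \<theta> q v \<noteq> 0)))"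

section \<open>The group \<open>H\<close> and the homomorphism \<open>j\<close>\<close>

definition mat4 ::
   "complex \<Rightarrow> complex \<Rightarrow> complex \<Rightarrow> complex \<Rightarrow>
    complex \<Rightarrow> complex \<Rightarrow> complex \<Rightarrow> complex \<Rightarrow>
    complex \<Rightarrow> complex \<Rightarrow> complex \<Rightarrow> complex \<Rightarrow>
    complex \<Rightarrow> complex \<Rightarrow> complex \<Rightarrow> complex \<Rightarrow> complex ^ 4 ^ 4" where
  "mat4 a b c d  e f g h  i k l m  n p q r =
     vector [vector [a, b, c, d], vector [e, f, g, h], vector [i, k, l, m], vector [n, p, q, r]]"

definition H_mat :: "complex \<Rightarrow> complex \<Rightarrow> complex \<Rightarrow> complex \<Rightarrow> complex \<Rightarrow> complex ^ 4 ^ 4" where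
  "H_mat a1 a2 v1 v2 s =
     (let l = a1 * a2 in
      mat4 l (v1 * l) (v2 * l) s
           0 a1       0        (a1 * v2)
           0 0        a2       (- a2 * v1)
           0 0        0        1)"

definition H_group :: "(complex ^ 4 ^ 4) set" where
  "H_group = {H_mat a1 a2 v1 v2 s | a1 a2 v1 v2 s. a1 \<noteq> 0 \<and> a2 \<noteq> 0}"

definition borel_group :: "(complex ^ 3 ^ 3) set" where
  "borel_group = {h. det h = 1 \<and> h $ 2 $ 1 = 0 \<and> h $ 3 $ 1 = 0 \<and> h $ 3 $ 2 = 0}"

definition borel_lie :: "(complex ^ 3 ^ 3) set" where
  "borel_lie = {X. trace X = 0 \<and> X $ 2 $ 1 = 0 \<and> X $ 3 $ 1 = 0 \<and> X $ 3 $ 2 = 0}"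

definition j_hom :: "complex ^ 3 ^ 3 \<Rightarrow> complex ^ 4 ^ 4" where
  "j_hom x =
     (let a = x $ 1 $ 1; c = x $ 1 $ 2; e = x $ 1 $ 3; d = x $ 2 $ 3; b = x $ 3 $ 3 in
      mat4 (a / b) (- 2 * a\<^sup>2 * d) (c / b)          (4 * e / b - 2 * a * c * d)
           0       (a\<^sup>2 * b)       0                (a * b * c)
           0       0              (1 / (a * b\<^sup>2))  (2 * d / b)
           0       0              0                1)"

text \<open>On \<open>vec\<close> the library operations \<open>*\<close> and \<open>^\<close> act componentwise, so matrix powers are
  spelled out.\<close>
primrec mat_pow :: "complex ^ 3 ^ 3 \<Rightarrow> nat \<Rightarrow> complex ^ 3 ^ 3" where
  "mat_pow X 0 = mat 1"
| "mat_pow X (Suc n) = X ** mat_pow X n"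

definition mat_exp :: "complex ^ 3 ^ 3 \<Rightarrow> complex ^ 3 ^ 3" where
  "mat_exp X = (\<Sum>n. (1 / fact n) *\<^sub>R mat_pow X n)"

lemma mat4_nth:
  "mat4 a b c d e f g h i k l m n p q r $ 1 = vector [a, b, c, d]"
  "mat4 a b c d e f g h i k l m n p q r $ 2 = vector [e, f, g, h]"
  "mat4 a b c d e f g h i k l m n p q r $ 3 = vector [i, k, l, m]"
  "mat4 a b c d e f g h i k l m n p q r $ 4 = vector [n, p, q, r]"
  by (simp_all add: mat4_def vector_def)

lemma vector_4_nth:
  "(vector [x, y, z, w] :: 'a::zero ^ 4) $ 1 = x"
  "(vector [x, y, z, w] :: 'a::zero ^ 4) $ 2 = y"
  "(vector [x, y, z, w] :: 'a::zero ^ 4) $ 3 = z"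
  "(vector [x, y, z, w] :: 'a::zero ^ 4) $ 4 = w"
  by (simp_all add: vector_def)

lemma j_hom_in_H_group:
  assumes "h \<in> borel_group"
  shows "j_hom h \<in> H_group"
proof -
  let ?a = "h $ 1 $ 1" and ?c = "h $ 1 $ 2" and ?d = "h $ 2 $ 3" and ?e = "h $ 1 $ 3" and ?b = "h $ 3 $ 3"
  have ab: "?a \<noteq> 0" "?b \<noteq> 0"
    using assms by (auto simp: borel_group_def det_3)
  have "j_hom h = H_mat (?a\<^sup>2 * ?b) (1 / (?a * ?b\<^sup>2)) (- 2 * ?a * ?b * ?d) (?c / ?a) (4 * ?e / ?b - 2 * ?a * ?c * ?d)"
    using ab by (simp add: j_hom_def H_mat_def Let_def power2_eq_square mult_ac)
  then show ?thesis
    using ab unfolding H_group_def by force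
qed

section \<open>The bundles \<open>E\<close> and \<open>Y\<close>\<close>

type_synonym 'm Ept = "'m \<times> (real ^ 3) covec"
type_synonym Emod = "(real ^ 3) \<times> complex"
type_synonym coframe = "Emod covec \<times> Emod covec \<times> Emod covec \<times> Emod covec"
type_synonym 'm Ypt = "'m Ept \<times> coframe"
type_synonym Ymod = "Emod \<times> complex \<times> complex \<times> complex \<times> complex"

definition dilate :: "complex \<Rightarrow> 'm Ept \<Rightarrow> 'm Ept" where
  "dilate l \<epsilon> = (fst \<epsilon>, \<lambda>u. l * snd \<epsilon> u)"

text \<open>The product \<open>(\<omega>, \<omega>\<^sup>1, \<omega>\<^sup>2, \<phi>) \<cdot> A\<close> of a row of covectors with a matrix.\<close>
definition coframe_mult :: "coframe \<Rightarrow> complex ^ 4 ^ 4 \<Rightarrow> coframe" where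
  "coframe_mult q A =
     (case q of (w, w1, w2, f) \<Rightarrow>
        let col = (\<lambda>k v. w v * A $ 1 $ k + w1 v * A $ 2 $ k + w2 v * A $ 3 $ k + f v * A $ 4 $ k)
        in (col 1, col 2, col 3, col 4))"

definition coframe_pull :: "(Emod \<Rightarrow> Emod) \<Rightarrow> coframe \<Rightarrow> coframe" where
  "coframe_pull L q = (case q of (w, w1, w2, f) \<Rightarrow> (w \<circ> L, w1 \<circ> L, w2 \<circ> L, f \<circ> L))"

context
  fixes A :: "('m, real ^ 3) atlas"
    and T1 T2 :: "'m \<Rightarrow> (complex ^ 3) set"
begin

definition E_set :: "'m Ept set" where
  "E_set = {(x, \<theta>). x \<in> points A \<and> linear \<theta> \<and> cx_ker \<theta> = plane_sum (T1 x) (T2 x)}"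

text \<open>A chart of \<open>M\<close> and a smooth local section \<open>\<theta>\<^sub>0\<close> of \<open>E\<close> give the chart
  \<open>(x, \<lambda> \<theta>\<^sub>0(x)) \<mapsto> (x, \<lambda>)\<close> of \<open>E\<close>.\<close>
definition E_atlas :: "('m Ept, Emod) atlas" where
  "E_atlas =
     {({\<epsilon> \<in> E_set. fst \<epsilon> \<in> U}, \<lambda>\<epsilon>. (snd c (fst \<epsilon>), THE l. \<epsilon> = dilate l (fst \<epsilon>, \<theta>0 (fst \<epsilon>)))) | c U \<theta>0.
        c \<in> A \<and> is_open A U \<and> U \<subseteq> fst c \<and> smooth_form A U \<theta>0 \<and> (\<forall>x\<in>U. (x, \<theta>0 x) \<in> E_set)}"

definition E_taut :: "'m Ept \<Rightarrow> Emod covec" where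
  "E_taut \<epsilon> = snd \<epsilon> \<circ> tangent_map E_atlas A fst \<epsilon>"

definition Y_set :: "'m Ypt set" where
  "Y_set = {(\<epsilon>, w, w1, w2, f). \<epsilon> \<in> E_set \<and> w = E_taut \<epsilon> \<and>
     (\<exists>\<alpha>. linear \<alpha> \<and> w1 = \<alpha> \<circ> tangent_map E_atlas A fst \<epsilon> \<and>
        (\<forall>z \<in> T1 (fst \<epsilon>) - {0}. cx_covec \<alpha> z \<noteq> 0) \<and> (\<forall>z \<in> T2 (fst \<epsilon>). cx_covec \<alpha> z = 0)) \<and>
     (\<exists>\<alpha>. linear \<alpha> \<and> w2 = \<alpha> \<circ> tangent_map E_atlas A fst \<epsilon> \<and>
        (\<forall>z \<in> T1 (fst \<epsilon>). cx_covec \<alpha> z = 0) \<and> (\<forall>z \<in> T2 (fst \<epsilon>) - {0}. cx_covec \<alpha> z \<noteq> 0)) \<and>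
     linear f \<and>
     (\<forall>u v. ext_deriv E_atlas E_taut \<epsilon> u v = (w \<and>\<^sub>f f) u v + (w1 \<and>\<^sub>f w2) u v)}"

text \<open>The right action of \<open>H\<close>. Covectors at \<open>\<epsilon>\<close> become covectors at \<open>\<lambda>\<epsilon>\<close> by pull-back along
  the inverse dilation.\<close>
definition H_act :: "'m Ypt \<Rightarrow> complex ^ 4 ^ 4 \<Rightarrow> 'm Ypt" where
  "H_act y h =
     (let l = h $ 1 $ 1; \<epsilon>' = dilate l (fst y) in
        (\<epsilon>', coframe_pull (tangent_map E_atlas E_atlas (dilate (1 / l)) \<epsilon>') (coframe_mult (snd y) h)))"

text \<open>A chart of \<open>E\<close> and a smooth local section \<open>\<sigma>\<close> of \<open>Y \<rightarrow> E\<close> (a smooth adapted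
  coframe on an open \<open>W\<close>) give the chart \<open>\<sigma>(\<epsilon>) \<cdot> h \<mapsto> (\<epsilon>, h)\<close> of \<open>Y\<close>, where
  \<open>h\<close> ranges over the subgroup \<open>\<lambda> = 1\<close> of \<open>H\<close>, with coordinates
  \<open>a\<^sup>1, v\<^sup>1, v\<^sup>2, s\<close>.\<close>
definition Y_atlas :: "('m Ypt, Ymod) atlas" where
  "Y_atlas =
     {({y \<in> Y_set. fst y \<in> W},
       \<lambda>y. (snd C (fst y),
            THE (a, v1, v2, s). a \<noteq> 0 \<and>
              y = H_act (fst y, \<eta> (fst y), \<eta>1 (fst y), \<eta>2 (fst y), \<zeta> (fst y)) (H_mat a (1 / a) v1 v2 s)))
      | C W \<eta> \<eta>1 \<eta>2 \<zeta>.
        C \<in> E_atlas \<and> is_open E_atlas W \<and> W \<subseteq> fst C \<and>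
        smooth_form E_atlas W \<eta> \<and> smooth_form E_atlas W \<eta>1 \<and>
        smooth_form E_atlas W \<eta>2 \<and> smooth_form E_atlas W \<zeta> \<and>
        (\<forall>\<epsilon>\<in>W. (\<epsilon>, \<eta> \<epsilon>, \<eta>1 \<epsilon>, \<eta>2 \<epsilon>, \<zeta> \<epsilon>) \<in> Y_set)}"

definition B_act :: "complex ^ 3 ^ 3 \<Rightarrow> 'm Ypt \<Rightarrow> 'm Ypt" where
  "B_act h y = H_act y (j_hom h)"

definition fund_field :: "complex ^ 3 ^ 3 \<Rightarrow> 'm Ypt \<Rightarrow> Ymod" where
  "fund_field X y = velocity Y_atlas (\<lambda>t. B_act (mat_exp (t *\<^sub>R X)) y)"

section \<open>The canonical forms on \<open>Y\<close>\<close>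

definition Y_\<omega> :: "'m Ypt \<Rightarrow> Ymod covec" where
  "Y_\<omega> y = (case snd y of (w, w1, w2, f) \<Rightarrow> w \<circ> tangent_map Y_atlas E_atlas fst y)"

definition Y_\<omega>1 :: "'m Ypt \<Rightarrow> Ymod covec" where
  "Y_\<omega>1 y = (case snd y of (w, w1, w2, f) \<Rightarrow> w1 \<circ> tangent_map Y_atlas E_atlas fst y)"

definition Y_\<omega>2 :: "'m Ypt \<Rightarrow> Ymod covec" where
  "Y_\<omega>2 y = (case snd y of (w, w1, w2, f) \<Rightarrow> w2 \<circ> tangent_map Y_atlas E_atlas fst y)"

definition Y_\<phi> :: "'m Ypt \<Rightarrow> Ymod covec" where
  "Y_\<phi> y = (case snd y of (w, w1, w2, f) \<Rightarrow> f \<circ> tangent_map Y_atlas E_atlas fst y)"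

text \<open>The forms \<open>\<omega>\<^sup>1\<^sub>1, \<phi>\<^sup>1, \<phi>\<^sup>2, \<psi>\<close> are determined on \<open>Y\<close> by these equations; their uniqueness
  is not part of the definition.\<close>
definition canonical_forms ::
   "('m Ypt \<Rightarrow> Ymod covec) \<Rightarrow> ('m Ypt \<Rightarrow> Ymod covec) \<Rightarrow> ('m Ypt \<Rightarrow> Ymod covec) \<Rightarrow>
    ('m Ypt \<Rightarrow> Ymod covec) \<Rightarrow> bool" where
  "canonical_forms \<omega>11 \<phi>1 \<phi>2 \<psi> \<longleftrightarrow>
     smooth_form Y_atlas Y_set \<omega>11 \<and> smooth_form Y_atlas Y_set \<phi>1 \<and>
     smooth_form Y_atlas Y_set \<phi>2 \<and> smooth_form Y_atlas Y_set \<psi> \<and>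
     (\<exists>Q1 Q2 :: 'm Ypt \<Rightarrow> complex. \<forall>y\<in>Y_set. \<forall>u v.
        ext_deriv Y_atlas Y_\<omega> y u v = (Y_\<omega> y \<and>\<^sub>f Y_\<phi> y) u v + (Y_\<omega>1 y \<and>\<^sub>f Y_\<omega>2 y) u v \<and>
        ext_deriv Y_atlas Y_\<omega>1 y u v =
          1/2 * (Y_\<omega>1 y \<and>\<^sub>f Y_\<phi> y) u v + (Y_\<omega>1 y \<and>\<^sub>f \<omega>11 y) u v + (Y_\<omega> y \<and>\<^sub>f \<phi>1 y) u v \<and>
        ext_deriv Y_atlas Y_\<omega>2 y u v =
          1/2 * (Y_\<omega>2 y \<and>\<^sub>f Y_\<phi> y) u v - (Y_\<omega>2 y \<and>\<^sub>f \<omega>11 y) u v + (Y_\<omega> y \<and>\<^sub>f \<phi>2 y) u v \<and>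
        ext_deriv Y_atlas Y_\<phi> y u v =
          (Y_\<omega>1 y \<and>\<^sub>f \<phi>2 y) u v - (Y_\<omega>2 y \<and>\<^sub>f \<phi>1 y) u v + (Y_\<omega> y \<and>\<^sub>f \<psi> y) u v \<and>
        ext_deriv Y_atlas \<omega>11 y u v =
          3/2 * (Y_\<omega>2 y \<and>\<^sub>f \<phi>1 y) u v + 3/2 * (Y_\<omega>1 y \<and>\<^sub>f \<phi>2 y) u v \<and>
        ext_deriv Y_atlas \<phi>1 y u v - (\<phi>1 y \<and>\<^sub>f \<omega>11 y) u v
          - 1/2 * (Y_\<omega>1 y \<and>\<^sub>f \<psi> y) u v - 1/2 * (Y_\<phi> y \<and>\<^sub>f \<phi>1 y) u v
          = Q1 y * (Y_\<omega> y \<and>\<^sub>f Y_\<omega>2 y) u v \<and>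
        ext_deriv Y_atlas \<phi>2 y u v + (\<phi>2 y \<and>\<^sub>f \<omega>11 y) u v
          - 1/2 * (Y_\<omega>2 y \<and>\<^sub>f \<psi> y) u v - 1/2 * (Y_\<phi> y \<and>\<^sub>f \<phi>2 y) u v
          = Q2 y * (Y_\<omega> y \<and>\<^sub>f Y_\<omega>1 y) u v)"

section \<open>Cartan connections in the generalized sense\<close>

text \<open>The first two conjuncts say that \<open>\<pi>\<close> is a smooth 1-form with values in \<open>\<ss>\<ll>(3, \<complex>)\<close>; only
  injectivity of each \<open>\<pi>\<^sub>y\<close> is demanded, not bijectivity.\<close>
definition cartan_connection :: "('m Ypt \<Rightarrow> Ymod \<Rightarrow> complex ^ 3 ^ 3) \<Rightarrow> bool" where
  "cartan_connection \<pi> \<longleftrightarrow>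
     (\<forall>i k. smooth_form Y_atlas Y_set (\<lambda>y v. \<pi> y v $ i $ k)) \<and>
     (\<forall>y\<in>Y_set. \<forall>v. trace (\<pi> y v) = 0) \<and>
     (\<forall>y\<in>Y_set. inj (\<pi> y)) \<and>
     (\<forall>X\<in>borel_lie. \<forall>y\<in>Y_set. \<pi> y (fund_field X y) = X) \<and>
     (\<forall>h\<in>borel_group. \<forall>y\<in>Y_set. \<forall>v.
        \<pi> (B_act h y) (tangent_map Y_atlas Y_atlas (B_act h) y v) = matrix_inv h ** \<pi> y v ** h)"

end

end

theory Submission
  imports Defs
begin

text \<open>Up to the corner entry, the structure equations say \<open>d\<pi> + \<pi> \<and> \<pi> = K\<close> with \<open>K\<close> semi-basic. Since \<open>R\<^sub>h\<close> acts on the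
  tautological coframe by \<open>j(h)\<close>, the form \<open>Ad\<^sub>h R\<^sub>h\<^sup>* \<pi>\<close> has the same tautological entries as \<open>\<pi>\<close>, and it satisfies
  equations of the same shape. By Cartan's lemma these determine the remaining entries, which is equivariance. Contracting
  the structure equations with \<open>X\<^sup>*\<close>, whose flow acts on the tautological forms by \<open>j\<close>, likewise gives
  \<open>\<pi>(X\<^sup>*) = X\<close>. A vector killed by \<open>\<omega>, \<omega>\<^sup>1, \<omega>\<^sup>2\<close> is a fundamental vector, so the last identity makes \<open>\<pi>\<close>
  injective.\<close>

text \<open>Cartan's lemma alone leaves four functions free: it uses only the equations for the
  differentials of the tautological forms. The freedom is removed by the equations for the
  differentials of \<open>\<omega>\<^sup>1\<^sub>1\<close> and \<open>\<phi>\<^sup>1\<close>,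
  whatever values \<open>Q\<^sup>1\<close> takes. The shape of the equations survives conjugation
  because the curvature is strictly upper triangular. An upper triangular matrix merely rescales its
  entries (1,2) and (2,3), and the corner (1,3), on which no structure equation bears since none
  involves d\<psi>, stays in the corner. The bulk of the work is making the bundles concrete. E and
  Y are sets of covectors with one chart for each smooth local section, so sections must be built. A
  contact form \<theta> of M with d\<theta> = \<theta> \<and> \<beta> + \<alpha>1 \<and> \<alpha>2
  yields at the point l\<theta> of E the coframe (l\<theta>, l\<alpha>1, \<alpha>2, \<beta> - dl/l).
  In the charts of Y built on this coframe the group acts by rational formulas, and flows of
  fundamental fields turn into derivatives of functions of one variable.\<close>

section \<open>Calculus of smooth maps\<close>

abbreviation fd :: "('a::real_normed_vector \<Rightarrow> 'b::real_normed_vector) \<Rightarrow> 'a \<Rightarrow> 'a \<Rightarrow> 'b" where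
  "fd f x \<equiv> frechet_derivative f (at x)"

lemma fd_eqI: "(f has_derivative f') (at x) \<Longrightarrow> fd f x = f'"
  using frechet_derivative_at by metis

lemma fd_cong:
  assumes "open S" "x \<in> S" "\<And>y. y \<in> S \<Longrightarrow> f y = g y"
  shows "fd f x = fd g x"
proof -
  have "(f has_derivative f') (at x) \<longleftrightarrow> (g has_derivative f') (at x)" for f'
    using assms has_derivative_transform_within_open[of f f' x UNIV S g]
      has_derivative_transform_within_open[of g f' x UNIV S f] by auto
  then show ?thesis
    unfolding frechet_derivative_def by presburger
qed

lemma differentiable_cong_open:
  assumes "open S" "x \<in> S" "\<And>y. y \<in> S \<Longrightarrow> f y = g y" "f differentiable (at x)"
  shows "g differentiable (at x)"
  using assms has_derivative_transform_within_open[of f _ x UNIV S g]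
  unfolding differentiable_def by auto

lemma differentiable_on_openD: "f differentiable_on S \<Longrightarrow> open S \<Longrightarrow> x \<in> S \<Longrightarrow> f differentiable (at x)"
  by (simp add: differentiable_on_eq_differentiable_at)

text \<open>A derivative at x sees a whole neighbourhood of x, so agreement on S passes to the
  derivatives because S is open.\<close>

lemma Ck_on_cong:
  assumes "open S" "\<And>x. x \<in> S \<Longrightarrow> f x = g x" "Ck_on k S f"
  shows "Ck_on k S g"
  using assms(2,3)
proof (induction k arbitrary: f g)
  case 0
  then show ?case by (metis Ck_on.simps(1) continuous_on_cong)
next
  case (Suc k)
  have "Ck_on k S (\<lambda>x. fd g x v)" for v
    by (rule Suc.IH[of "\<lambda>x. fd f x v"]) (use Suc.prems fd_cong[OF \<open>open S\<close>, of _ f g] in auto)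
  moreover have "g differentiable_on S"
    using Suc.prems differentiable_cong_open[OF \<open>open S\<close>, of _ f g] assms(1)
    by (auto simp: differentiable_on_eq_differentiable_at)
  ultimately show ?case by simp
qed

lemma Ck_on_subset: "Ck_on k S f \<Longrightarrow> T \<subseteq> S \<Longrightarrow> Ck_on k T f"
proof (induction k arbitrary: f)
  case 0
  then show ?case by (auto intro: continuous_on_subset)
next
  case (Suc k)
  then show ?case by (auto intro: differentiable_on_subset)
qed

lemma Ck_on_SucD: "Ck_on (Suc k) S f \<Longrightarrow> Ck_on k S f"
proof (induction k arbitrary: f)
  case 0
  then show ?case by (auto intro: differentiable_imp_continuous_on)
qed auto

text \<open>Glues smoothness for functions without a global formula, such as quotients whose usable
  denominator changes from point to point.\<close>

lemma Ck_on_local: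
  assumes "\<And>x. x \<in> S \<Longrightarrow> \<exists>T. open T \<and> x \<in> T \<and> Ck_on k T f"
  shows "Ck_on k S f"
  using assms
proof (induction k arbitrary: f)
  case 0
  then show ?case
    by simp (metis continuous_at_imp_continuous_on continuous_on_eq_continuous_at)
next
  case (Suc k)
  have "f differentiable_on S"
    unfolding differentiable_on_def
  proof
    fix x assume "x \<in> S"
    then obtain T where "open T" "x \<in> T" "f differentiable_on T"
      using Suc.prems by force
    then show "f differentiable at x within S"
      by (meson differentiable_at_withinI differentiable_on_openD)
  qed
  moreover have "Ck_on k S (\<lambda>x. fd f x v)" for v
    by (rule Suc.IH) (use Suc.prems in force)
  ultimately show ?case by simp
qed

lemma Ck_on_const: "Ck_on k S (\<lambda>x. c)"
  by (induction k arbitrary: c) auto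

lemma Ck_on_bounded_linear:
  assumes "bounded_linear f"
  shows "Ck_on k S f"
proof (cases k)
  case 0
  then show ?thesis using assms by (simp add: linear_continuous_on)
next
  case (Suc n)
  have "fd f x = f" for x
    using assms by (simp add: bounded_linear_imp_has_derivative fd_eqI)
  then show ?thesis
    using Suc assms by (simp add: Ck_on_const bounded_linear_imp_differentiable_on)
qed

lemma Ck_on_add:
  assumes "open S" "Ck_on k S f" "Ck_on k S g"
  shows "Ck_on k S (\<lambda>x. f x + g x)"
  using assms(2,3)
proof (induction k arbitrary: f g)
  case 0
  then show ?case by (auto intro: continuous_intros)
next
  case (Suc k)
  have "Ck_on k S (\<lambda>x. fd (\<lambda>x. f x + g x) x v)" for v
  proof (rule Ck_on_cong[OF \<open>open S\<close>])
    show "Ck_on k S (\<lambda>x. fd f x v + fd g x v)"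
      using Suc by auto
    fix x assume "x \<in> S"
    then have "(f has_derivative fd f x) (at x)" "(g has_derivative fd g x) (at x)"
      using Suc.prems \<open>open S\<close> by (auto simp: frechet_derivative_works[symmetric] differentiable_on_openD)
    then show "fd f x v + fd g x v = fd (\<lambda>x. f x + g x) x v"
      by (simp add: fd_eqI[OF has_derivative_add])
  qed
  then show ?case using Suc.prems by auto
qed

lemma Ck_on_sum:
  assumes "open S" "finite I" "\<And>i. i \<in> I \<Longrightarrow> Ck_on k S (f i)"
  shows "Ck_on k S (\<lambda>x. \<Sum>i\<in>I. f i x)"
  using assms(2,3) by (induction I rule: finite_induct) (auto intro: Ck_on_const Ck_on_add[OF assms(1)])

lemma Ck_on_bilinear:
  assumes "bounded_bilinear B" "open S" "Ck_on k S f" "Ck_on k S g"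
  shows "Ck_on k S (\<lambda>x. B (f x) (g x))"
  using assms(3,4)
proof (induction k arbitrary: f g)
  case 0
  then show ?case by (auto intro: bounded_bilinear.continuous_on[OF assms(1)])
next
  case (Suc k)
  have D: "((\<lambda>x. B (f x) (g x)) has_derivative (\<lambda>v. B (f x) (fd g x v) + B (fd f x v) (g x))) (at x)"
    if "x \<in> S" for x
    by (rule bounded_bilinear.FDERIV[OF assms(1)])
      (use that Suc.prems \<open>open S\<close> in \<open>auto simp: frechet_derivative_works[symmetric] differentiable_on_openD\<close>)
  have "Ck_on k S (\<lambda>x. fd (\<lambda>x. B (f x) (g x)) x v)" for v
  proof (rule Ck_on_cong[OF \<open>open S\<close>])
    show "Ck_on k S (\<lambda>x. B (f x) (fd g x v) + B (fd f x v) (g x))"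
      using Suc.prems Suc.prems[THEN Ck_on_SucD] by (intro Ck_on_add[OF \<open>open S\<close>] Suc.IH) auto
    show "B (f x) (fd g x v) + B (fd f x v) (g x) = fd (\<lambda>x. B (f x) (g x)) x v" if "x \<in> S" for x
      by (simp add: fd_eqI[OF D[OF that]])
  qed
  then show ?case
    using D \<open>open S\<close> by (auto simp: differentiable_on_eq_differentiable_at differentiable_def)
qed

lemma linear_sum_Basis:
  fixes L :: "'b::euclidean_space \<Rightarrow> 'c::real_vector"
  assumes "linear L"
  shows "L w = (\<Sum>b\<in>Basis. (w \<bullet> b) *\<^sub>R L b)"
proof -
  have "L w = L (\<Sum>b\<in>Basis. (w \<bullet> b) *\<^sub>R b)"
    by (simp add: euclidean_representation)
  then show ?thesis
    using assms by (simp add: linear_sum linear_scale)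
qed

text \<open>The chain rule gives \<open>fd g (f x) (fd f x v)\<close>, where the direction moves
  with x, while the induction hypothesis only covers fixed directions. Expanding
  \<open>fd f x v\<close> in the basis separates the two dependences and leaves products of
  functions already under control.\<close>

lemma Ck_on_compose:
  fixes f :: "'a::euclidean_space \<Rightarrow> 'b::euclidean_space" and g :: "'b \<Rightarrow> 'c::real_normed_vector"
  assumes "open S" "open T" "f ` S \<subseteq> T" "Ck_on k S f" "Ck_on k T g"
  shows "Ck_on k S (\<lambda>x. g (f x))"
  using assms(4,5)
proof (induction k arbitrary: g)
  case 0
  then show ?case
    using assms(3) by (auto intro: continuous_on_compose2[of T g S f])
next
  case (Suc k)
  have D: "((\<lambda>x. g (f x)) has_derivative (\<lambda>v. fd g (f x) (fd f x v))) (at x)" and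
      lin: "linear (fd g (f x))" if "x \<in> S" for x
  proof -
    have "f differentiable (at x)" "g differentiable (at (f x))"
      using that Suc.prems assms by (auto intro: differentiable_on_openD)
    then show "((\<lambda>x. g (f x)) has_derivative (\<lambda>v. fd g (f x) (fd f x v))) (at x)" "linear (fd g (f x))"
      by (auto intro: linear_frechet_derivative has_derivative_compose[of f "fd f x" x UNIV g "fd g (f x)"]
        simp: frechet_derivative_works)
  qed
  have "Ck_on k S (\<lambda>x. fd (\<lambda>x. g (f x)) x v)" for v
  proof (rule Ck_on_cong[OF \<open>open S\<close>])
    have "Ck_on k S (\<lambda>x. fd f x v \<bullet> b)" for b
      by (rule Ck_on_bilinear[OF bounded_bilinear_inner \<open>open S\<close> _ Ck_on_const]) (use Suc.prems in auto)
    moreover have "Ck_on k S (\<lambda>x. fd g (f x) b)" for b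
      using Suc.prems(2) by (intro Suc.IH Suc.prems(1)[THEN Ck_on_SucD]) auto
    ultimately show "Ck_on k S (\<lambda>x. \<Sum>b\<in>Basis. (fd f x v \<bullet> b) *\<^sub>R fd g (f x) b)"
      by (intro Ck_on_sum[OF \<open>open S\<close>] Ck_on_bilinear[OF bounded_bilinear_scaleR \<open>open S\<close>]) auto
    show "(\<Sum>b\<in>Basis. (fd f x v \<bullet> b) *\<^sub>R fd g (f x) b) = fd (\<lambda>x. g (f x)) x v" if "x \<in> S" for x
      using linear_sum_Basis[OF lin[OF that], of "fd f x v"] by (simp add: fd_eqI[OF D[OF that]])
  qed
  then show ?case
    using D \<open>open S\<close> by (auto simp: differentiable_on_eq_differentiable_at differentiable_def)
qed

lemma Ck_on_bounded_linear_compose: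
  assumes "bounded_linear L" "open S" "Ck_on k S f"
  shows "Ck_on k S (\<lambda>x. L (f x))"
  using assms(3)
proof (induction k arbitrary: f)
  case 0
  then show ?case by (auto intro: bounded_linear.continuous_on[OF assms(1)])
next
  case (Suc k)
  have D: "((\<lambda>x. L (f x)) has_derivative (\<lambda>v. L (fd f x v))) (at x)" if "x \<in> S" for x
    using Suc.prems that \<open>open S\<close>
    by (intro bounded_linear.has_derivative[OF assms(1)])
      (auto simp: frechet_derivative_works[symmetric] differentiable_on_openD)
  have "Ck_on k S (\<lambda>x. fd (\<lambda>x. L (f x)) x v)" for v
    by (rule Ck_on_cong[OF \<open>open S\<close> _ Suc.IH[of "\<lambda>x. fd f x v"]])
      (use Suc.prems in \<open>auto simp: fd_eqI[OF D]\<close>)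
  then show ?case
    using D \<open>open S\<close> by (auto simp: differentiable_on_eq_differentiable_at differentiable_def)
qed

text \<open>The induction closes up because the derivative in direction v is -v times the square of
  the inverse, a product of functions already known to be of class k.\<close>

lemma Ck_on_inverse: "Ck_on k (- {0}) (inverse :: complex \<Rightarrow> complex)"
proof (induction k)
  case 0
  then show ?case by (auto intro: continuous_intros)
next
  case (Suc k)
  have D: "(inverse has_derivative (\<lambda>v. - (inverse z * v * inverse z))) (at z)" if "z \<noteq> 0" for z :: complex
    using that by (rule has_derivative_inverse')
  have op: "open (- {0::complex})" by auto
  have "Ck_on k (- {0}) (\<lambda>z::complex. fd inverse z v)" for v
  proof (rule Ck_on_cong[OF op])
    have "Ck_on k (- {0}) (\<lambda>z::complex. inverse z * inverse z)"
      by (intro Ck_on_bilinear[OF bounded_bilinear_mult op] Suc)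
    then show "Ck_on k (- {0}) (\<lambda>z::complex. (- v) * (inverse z * inverse z))"
      by (intro Ck_on_bilinear[OF bounded_bilinear_mult op Ck_on_const])
    show "(- v) * (inverse z * inverse z) = fd inverse z v" if "z \<in> - {0}" for z
      using that fd_eqI[OF D, of z] by simp
  qed
  moreover have "(inverse :: complex \<Rightarrow> complex) differentiable_on - {0}"
    using D op by (auto simp: differentiable_on_eq_differentiable_at differentiable_def)
  ultimately show ?case by simp
qed

lemma smooth_on_cong:
  "smooth_on S f \<Longrightarrow> open S \<Longrightarrow> (\<And>x. x \<in> S \<Longrightarrow> f x = g x) \<Longrightarrow> smooth_on S g"
  unfolding smooth_on_def using Ck_on_cong[of S f g] by blast

lemma smooth_on_subset: "smooth_on S f \<Longrightarrow> T \<subseteq> S \<Longrightarrow> smooth_on T f"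
  by (auto simp: smooth_on_def intro: Ck_on_subset)

lemma smooth_on_local:
  assumes "\<And>x. x \<in> S \<Longrightarrow> \<exists>T. open T \<and> x \<in> T \<and> smooth_on T f"
  shows "smooth_on S f"
  unfolding smooth_on_def using assms by (intro allI Ck_on_local) (auto simp: smooth_on_def)

lemma smooth_on_fd: "smooth_on S f \<Longrightarrow> smooth_on S (\<lambda>x. fd f x v)"
  unfolding smooth_on_def using Ck_on.simps(2) by blast

lemma smooth_on_differentiable: "smooth_on S f \<Longrightarrow> open S \<Longrightarrow> x \<in> S \<Longrightarrow> f differentiable (at x)"
  unfolding smooth_on_def by (meson Ck_on.simps(2) differentiable_on_openD)

lemma smooth_on_has_derivative:
  "smooth_on S f \<Longrightarrow> open S \<Longrightarrow> x \<in> S \<Longrightarrow> (f has_derivative fd f x) (at x)"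
  using smooth_on_differentiable frechet_derivative_works by blast

lemma smooth_on_linear_fd: "smooth_on S f \<Longrightarrow> open S \<Longrightarrow> x \<in> S \<Longrightarrow> linear (fd f x)"
  using smooth_on_differentiable linear_frechet_derivative by blast

lemma smooth_on_continuous_on: "smooth_on S f \<Longrightarrow> continuous_on S f"
  unfolding smooth_on_def using Ck_on.simps(1) by blast

lemma smooth_on_const: "smooth_on S (\<lambda>x. c)"
  by (simp add: smooth_on_def Ck_on_const)

lemma smooth_on_bounded_linear: "bounded_linear f \<Longrightarrow> smooth_on S f"
  by (simp add: smooth_on_def Ck_on_bounded_linear)

lemma smooth_on_bounded_linear_compose:
  "bounded_linear L \<Longrightarrow> open S \<Longrightarrow> smooth_on S f \<Longrightarrow> smooth_on S (\<lambda>x. L (f x))"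
  unfolding smooth_on_def using Ck_on_bounded_linear_compose[of L S _ f] by blast

lemma smooth_on_ident: "smooth_on S (\<lambda>x. x)"
  by (rule smooth_on_bounded_linear) (rule bounded_linear_ident)

lemma smooth_on_compose:
  fixes f :: "'a::euclidean_space \<Rightarrow> 'b::euclidean_space"
  shows "open S \<Longrightarrow> open T \<Longrightarrow> f ` S \<subseteq> T \<Longrightarrow> smooth_on S f \<Longrightarrow> smooth_on T g \<Longrightarrow> smooth_on S (\<lambda>x. g (f x))"
  unfolding smooth_on_def using Ck_on_compose[of S T f _ g] by blast

lemma smooth_on_add: "open S \<Longrightarrow> smooth_on S f \<Longrightarrow> smooth_on S g \<Longrightarrow> smooth_on S (\<lambda>x. f x + g x)"
  by (simp add: smooth_on_def Ck_on_add)

lemma smooth_on_sum: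
  "open S \<Longrightarrow> finite I \<Longrightarrow> (\<And>i. i \<in> I \<Longrightarrow> smooth_on S (f i)) \<Longrightarrow> smooth_on S (\<lambda>x. \<Sum>i\<in>I. f i x)"
  by (simp add: smooth_on_def Ck_on_sum)

lemma smooth_on_bilinear:
  "bounded_bilinear B \<Longrightarrow> open S \<Longrightarrow> smooth_on S f \<Longrightarrow> smooth_on S g \<Longrightarrow> smooth_on S (\<lambda>x. B (f x) (g x))"
  by (simp add: smooth_on_def Ck_on_bilinear)

lemmas smooth_on_mult = smooth_on_bilinear[OF bounded_bilinear_mult]
lemmas smooth_on_scaleR = smooth_on_bilinear[OF bounded_bilinear_scaleR]
lemmas smooth_on_minus = smooth_on_bounded_linear_compose[OF bounded_linear_minus[OF bounded_linear_ident]]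
lemmas smooth_on_fst = smooth_on_bounded_linear_compose[OF bounded_linear_fst]
lemmas smooth_on_snd = smooth_on_bounded_linear_compose[OF bounded_linear_snd]

lemma smooth_on_diff: "open S \<Longrightarrow> smooth_on S f \<Longrightarrow> smooth_on S g \<Longrightarrow> smooth_on S (\<lambda>x. f x - g x)"
  using smooth_on_add[of S f "\<lambda>x. - g x"] smooth_on_minus by fastforce

lemma smooth_on_Pair:
  assumes "open S" "smooth_on S f" "smooth_on S g"
  shows "smooth_on S (\<lambda>x. (f x, g x))"
proof -
  have "bounded_linear (\<lambda>x. (x, 0))" "bounded_linear (\<lambda>x. (0, x))"
    by (intro bounded_linear_Pair bounded_linear_ident bounded_linear_zero)+
  from this[THEN smooth_on_bounded_linear_compose[OF _ assms(1)]]
  have "smooth_on S (\<lambda>x. (f x, 0) + (0, g x))"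
    using assms by (intro smooth_on_add) auto
  then show ?thesis by simp
qed

lemma smooth_on_inverse:
  fixes f :: "'a::euclidean_space \<Rightarrow> complex"
  assumes "open S" "smooth_on S f" "\<And>x. x \<in> S \<Longrightarrow> f x \<noteq> 0"
  shows "smooth_on S (\<lambda>x. inverse (f x))"
proof (rule smooth_on_compose[of S "- {0}" f])
  show "smooth_on (- {0}) (inverse :: complex \<Rightarrow> complex)"
    unfolding smooth_on_def using Ck_on_inverse by blast
qed (use assms in auto)

lemma smooth_on_divide:
  fixes f g :: "'a::euclidean_space \<Rightarrow> complex"
  assumes "open S" "smooth_on S f" "smooth_on S g" "\<And>x. x \<in> S \<Longrightarrow> g x \<noteq> 0"
  shows "smooth_on S (\<lambda>x. f x / g x)"
  using smooth_on_mult[OF assms(1,2) smooth_on_inverse[OF assms(1,3,4)]] by (simp add: divide_inverse)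

lemmas smooth_on_intros = smooth_on_const smooth_on_ident smooth_on_add smooth_on_diff smooth_on_minus
  smooth_on_mult smooth_on_scaleR smooth_on_fst smooth_on_snd smooth_on_Pair smooth_on_inverse
  smooth_on_divide smooth_on_sum

text \<open>Meant for factors r that are known only through \<open>THE\<close> or
  \<open>SOME\<close>: near each point r is the quotient of F i by some G i without zeros there, and
  smoothness is local.\<close>

lemma smooth_on_ratio:
  fixes r :: "'a::euclidean_space \<Rightarrow> complex"
  assumes "open S" "\<And>i. smooth_on S (F i)" "\<And>i. smooth_on S (G i)"
    and eq: "\<And>i x. x \<in> S \<Longrightarrow> F i x = r x * G i x"
    and nz: "\<And>x. x \<in> S \<Longrightarrow> \<exists>i. G i x \<noteq> 0"
  shows "smooth_on S r"
proof (rule smooth_on_local)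
  fix x assume "x \<in> S"
  then obtain i where i: "G i x \<noteq> 0" using nz by blast
  let ?T = "{y \<in> S. G i y \<noteq> 0}"
  have "?T = S \<inter> G i -` (- {0})" by auto
  then have op: "open ?T"
    using continuous_open_preimage[OF smooth_on_continuous_on[OF assms(3)] assms(1), of "- {0}" i]
    by auto
  have "smooth_on ?T (\<lambda>y. F i y / G i y)"
    using op assms(2,3) by (intro smooth_on_divide) (auto intro: smooth_on_subset)
  then have "smooth_on ?T r"
    using op by (rule smooth_on_cong) (use eq in auto)
  then show "\<exists>T. open T \<and> x \<in> T \<and> smooth_on T r"
    using op i \<open>x \<in> S\<close> by blast
qed

subsection \<open>Symmetry of second derivatives\<close>

text \<open>The numerator is symmetric in u and v, so computing the limit with either vector
  differentiated first yields the symmetry of second derivatives. The mean value theorem is applied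
  in direction u to the increment of f along t v; the resulting difference of values of
  \<open>fd f y u\<close> is expanded to first order at x.\<close>

lemma second_difference_quotient:
  fixes f :: "'a::real_normed_vector \<Rightarrow> real"
  assumes "open S" "x \<in> S" "\<And>y. y \<in> S \<Longrightarrow> f differentiable (at y)"
    and D: "((\<lambda>y. fd f y u) has_derivative D) (at x)"
  shows "((\<lambda>t. (f (x + t *\<^sub>R u + t *\<^sub>R v) - f (x + t *\<^sub>R u) - f (x + t *\<^sub>R v) + f x) / t\<^sup>2) \<longlongrightarrow> D v)
    (at_right 0)"
proof (rule tendstoI)
  fix e :: real assume "e > 0"
  define K where "K = 2 * (norm u + norm v) + 1"
  have "norm u + norm v \<ge> 0" by simp
  then have K: "K > 0" "norm u + norm v < K"
    unfolding K_def by argo+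
  define e' where "e' = e / (4 * K)"
  have "e' > 0" using \<open>e > 0\<close> K by (simp add: e'_def)
  obtain r where r: "r > 0" "ball x r \<subseteq> S"
    using assms(1,2) openE by blast
  obtain d where d: "d > 0" and lin: "bounded_linear D"
    and dd: "\<And>y. norm (y - x) < d \<Longrightarrow> \<bar>fd f y u - fd f x u - D (y - x)\<bar> \<le> e' * norm (y - x)"
    using D \<open>e' > 0\<close> unfolding has_derivative_at_alt by (metis real_norm_def)
  define m where "m = min d r / K"
  have m: "m > 0" using d r K by (simp add: m_def)
  have small: "norm (a *\<^sub>R u + b *\<^sub>R v) \<le> t * K" and small': "norm (a *\<^sub>R u + b *\<^sub>R v) < d"
      and smallr: "x + a *\<^sub>R u + b *\<^sub>R v \<in> S"
    if "0 < t" "t < m" "0 \<le> a" "a \<le> t" "0 \<le> b" "b \<le> t" for a b t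
  proof -
    have "norm (a *\<^sub>R u + b *\<^sub>R v) \<le> a * norm u + b * norm v"
      using norm_triangle_ineq[of "a *\<^sub>R u" "b *\<^sub>R v"] that by simp
    also have "\<dots> \<le> t * norm u + t * norm v"
      using that by (intro add_mono mult_right_mono) auto
    also have "\<dots> \<le> t * K" using K that by (simp add: distrib_left[symmetric])
    finally show *: "norm (a *\<^sub>R u + b *\<^sub>R v) \<le> t * K" .
    have "t * K < min d r" using that K by (simp add: m_def field_simps)
    with * show "norm (a *\<^sub>R u + b *\<^sub>R v) < d" by linarith
    have "dist x (x + w) = norm w" for w by (metis add_diff_cancel_left' dist_commute dist_norm)
    then have "dist x (x + (a *\<^sub>R u + b *\<^sub>R v)) < r" using * \<open>t * K < min d r\<close> by simp
    then show "x + a *\<^sub>R u + b *\<^sub>R v \<in> S" using r by (auto simp: algebra_simps)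
  qed
  have "dist ((f (x + t *\<^sub>R u + t *\<^sub>R v) - f (x + t *\<^sub>R u) - f (x + t *\<^sub>R v) + f x) / t\<^sup>2) (D v) < e"
    if t: "0 < t" "t < m" for t
  proof -
    define \<phi> where "\<phi> a = f (x + a *\<^sub>R u + t *\<^sub>R v) - f (x + a *\<^sub>R u)" for a
    have deriv: "((\<lambda>a. f (x + a *\<^sub>R u + b *\<^sub>R v)) has_real_derivative fd f (x + a *\<^sub>R u + b *\<^sub>R v) u) (at a)"
      if "0 \<le> a" "a \<le> t" "0 \<le> b" "b \<le> t" for a b
    proof -
      have df: "(f has_derivative fd f (x + a *\<^sub>R u + b *\<^sub>R v)) (at (x + a *\<^sub>R u + b *\<^sub>R v))"
        using assms(3) smallr[OF t that] frechet_derivative_works by blast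
      have "((\<lambda>a. x + a *\<^sub>R u + b *\<^sub>R v) has_derivative (\<lambda>h. h *\<^sub>R u)) (at a)"
        by (auto intro!: derivative_eq_intros)
      from has_derivative_compose[OF this df]
      have "((\<lambda>a. f (x + a *\<^sub>R u + b *\<^sub>R v)) has_derivative (\<lambda>h. fd f (x + a *\<^sub>R u + b *\<^sub>R v) u * h)) (at a)"
        using linear_scale[OF has_derivative_linear[OF df]] by (simp add: mult.commute)
      then show ?thesis
        by (simp add: has_field_derivative_def)
    qed
    have "\<exists>\<xi>. 0 < \<xi> \<and> \<xi> < t \<and> \<phi> t - \<phi> 0 = (t - 0) * (fd f (x + \<xi> *\<^sub>R u + t *\<^sub>R v) u - fd f (x + \<xi> *\<^sub>R u) u)"
      unfolding \<phi>_def
      apply (rule MVT2[OF t(1)])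
      subgoal for a using deriv[of a t] deriv[of a 0] t by (auto intro!: DERIV_diff)
      done
    then obtain \<xi> where xi: "0 < \<xi>" "\<xi> < t"
      and eq: "\<phi> t - \<phi> 0 = t * (fd f (x + \<xi> *\<^sub>R u + t *\<^sub>R v) u - fd f (x + \<xi> *\<^sub>R u) u)" by auto
    have 1: "\<bar>fd f (x + \<xi> *\<^sub>R u + t *\<^sub>R v) u - fd f x u - D (\<xi> *\<^sub>R u + t *\<^sub>R v)\<bar> \<le> e' * (t * K)"
      using dd[of "x + \<xi> *\<^sub>R u + t *\<^sub>R v"] small[OF t, of \<xi> t] small'[OF t, of \<xi> t] xi t \<open>e' > 0\<close>
      by (smt (verit) add.assoc add_diff_cancel_left' mult_left_mono)
    have 2: "\<bar>fd f (x + \<xi> *\<^sub>R u) u - fd f x u - D (\<xi> *\<^sub>R u)\<bar> \<le> e' * (t * K)"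
      using dd[of "x + \<xi> *\<^sub>R u"] small[OF t, of \<xi> 0] small'[OF t, of \<xi> 0] xi t \<open>e' > 0\<close>
      by (smt (verit) add.right_neutral add_diff_cancel_left' mult_left_mono scaleR_zero_left)
    have "D (\<xi> *\<^sub>R u + t *\<^sub>R v) - D (\<xi> *\<^sub>R u) = t * D v"
      using lin by (simp add: bounded_linear.linear linear_add linear_scale)
    with 1 2 have "\<bar>(fd f (x + \<xi> *\<^sub>R u + t *\<^sub>R v) u - fd f (x + \<xi> *\<^sub>R u) u) - t * D v\<bar> \<le> 2 * (e' * (t * K))"
      by linarith
    also have "2 * (e' * (t * K)) = t * (e / 2)" using K by (simp add: e'_def)
    finally have 3: "\<bar>(fd f (x + \<xi> *\<^sub>R u + t *\<^sub>R v) u - fd f (x + \<xi> *\<^sub>R u) u) - t * D v\<bar> \<le> t * (e / 2)" .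
    have quot: "(\<phi> t - \<phi> 0) / t\<^sup>2 - D v = ((fd f (x + \<xi> *\<^sub>R u + t *\<^sub>R v) u - fd f (x + \<xi> *\<^sub>R u) u) - t * D v) / t"
      using t by (simp add: eq power2_eq_square field_simps)
    have "\<bar>(\<phi> t - \<phi> 0) / t\<^sup>2 - D v\<bar> \<le> e / 2"
      unfolding quot abs_divide using 3 t by (simp add: pos_divide_le_eq mult.commute)
    then show ?thesis
      using \<open>e > 0\<close> by (simp add: \<phi>_def dist_real_def algebra_simps)
  qed
  then show "\<forall>\<^sub>F t in at_right 0.
      dist ((f (x + t *\<^sub>R u + t *\<^sub>R v) - f (x + t *\<^sub>R u) - f (x + t *\<^sub>R v) + f x) / t\<^sup>2) (D v) < e"
    unfolding eventually_at_right_field using m by blast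
qed

lemma second_derivative_symmetric_real:
  fixes f :: "'a::real_normed_vector \<Rightarrow> real"
  assumes "open S" "x \<in> S" "\<And>y. y \<in> S \<Longrightarrow> f differentiable (at y)"
    and "((\<lambda>y. fd f y u) has_derivative D) (at x)" "((\<lambda>y. fd f y v) has_derivative D') (at x)"
  shows "D v = D' u"
proof (rule tendsto_unique[of "at_right (0::real)"])
  show "((\<lambda>t. (f (x + t *\<^sub>R u + t *\<^sub>R v) - f (x + t *\<^sub>R u) - f (x + t *\<^sub>R v) + f x) / t\<^sup>2) \<longlongrightarrow> D v) (at_right 0)"
    using assms by (intro second_difference_quotient)
  have "((\<lambda>t. (f (x + t *\<^sub>R v + t *\<^sub>R u) - f (x + t *\<^sub>R v) - f (x + t *\<^sub>R u) + f x) / t\<^sup>2) \<longlongrightarrow> D' u) (at_right 0)"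
    using assms by (intro second_difference_quotient)
  then show "((\<lambda>t. (f (x + t *\<^sub>R u + t *\<^sub>R v) - f (x + t *\<^sub>R u) - f (x + t *\<^sub>R v) + f x) / t\<^sup>2) \<longlongrightarrow> D' u) (at_right 0)"
    by (simp add: algebra_simps)
qed auto

lemma second_derivative_symmetric:
  fixes f :: "'a::euclidean_space \<Rightarrow> 'b::euclidean_space"
  assumes "open S" "x \<in> S" "smooth_on S f"
  shows "fd (\<lambda>y. fd f y u) x v = fd (\<lambda>y. fd f y v) x u"
\<comment> \<open>The mean value theorem behind the real case needs real values, so both sides are
  tested against basis vectors.\<close>
proof (rule euclidean_eqI)
  fix b :: 'b assume "b \<in> Basis"
  have D: "((\<lambda>y. f y \<bullet> b) has_derivative (\<lambda>w. fd f y w \<bullet> b)) (at y)" if "y \<in> S" for y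
    using smooth_on_has_derivative[OF assms(3,1) that] by (rule has_derivative_inner_left)
  have D2: "((\<lambda>y. fd (\<lambda>y. f y \<bullet> b) y w) has_derivative (\<lambda>z. fd (\<lambda>y. fd f y w) x z \<bullet> b)) (at x)" for w
  proof (rule has_derivative_transform_within_open[OF _ assms(1,2)])
    show "((\<lambda>y. fd f y w \<bullet> b) has_derivative (\<lambda>z. fd (\<lambda>y. fd f y w) x z \<bullet> b)) (at x)"
      using smooth_on_has_derivative[OF smooth_on_fd[OF assms(3)] assms(1,2)] by (rule has_derivative_inner_left)
    show "fd f y w \<bullet> b = fd (\<lambda>y. f y \<bullet> b) y w" if "y \<in> S" for y
      using fd_eqI[OF D[OF that]] by simp
  qed
  show "fd (\<lambda>y. fd f y u) x v \<bullet> b = fd (\<lambda>y. fd f y v) x u \<bullet> b"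
    by (rule second_derivative_symmetric_real[OF assms(1,2) _ D2 D2])
      (use D in \<open>auto simp: differentiable_def\<close>)
qed

section \<open>Changes of coordinates\<close>

lemma open_Collect_mem: "smooth_on S g \<Longrightarrow> open S \<Longrightarrow> open T \<Longrightarrow> open {x \<in> S. g x \<in> T}"
  using continuous_open_preimage[OF smooth_on_continuous_on, of S g T]
  by (simp add: vimage_def Int_def)

text \<open>The single matrix behind all changes of components: \<open>from_chart\<close> and
  \<open>to_chart\<close> are its instances with the preferred chart at one end, so the cocycle rule
  \<open>jac_comp\<close> yields all conversion rules.\<close>

definition jac :: "('a, 'e::euclidean_space) chart \<Rightarrow> ('a, 'e) chart \<Rightarrow> 'e \<Rightarrow> 'e \<Rightarrow> 'e" where
  "jac c c' x = fd (\<lambda>x. snd c' (chart_inv c x)) x"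

lemma from_chart_eq: "from_chart A c p = jac c (chart_at A p) (snd c p)"
  by (simp add: from_chart_def jac_def comp_def)

lemma to_chart_eq: "to_chart A c p = jac (chart_at A p) c (snd (chart_at A p) p)"
  by (simp add: to_chart_def jac_def comp_def)

lemma chart_at: "p \<in> points A \<Longrightarrow> chart_at A p \<in> A \<and> p \<in> fst (chart_at A p)"
  unfolding chart_at_def points_def by (rule someI_ex) auto

lemma chart_points: "c \<in> A \<Longrightarrow> p \<in> fst c \<Longrightarrow> p \<in> points A"
  by (auto simp: points_def)

lemma chart_at_chart:
  assumes "c \<in> A" "p \<in> fst c"
  shows "chart_at A p \<in> A" "p \<in> fst (chart_at A p)"
  using chart_at[OF chart_points[OF assms]] by auto

context
  fixes A :: "('a, 'e::euclidean_space) atlas"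
  assumes A: "smooth_atlas A"
begin

lemma chart_inj: "c \<in> A \<Longrightarrow> inj_on (snd c) (fst c)"
  using A by (simp add: smooth_atlas_def)

lemma chart_inv_left: "c \<in> A \<Longrightarrow> p \<in> fst c \<Longrightarrow> chart_inv c (snd c p) = p"
  by (simp add: chart_inv_def chart_inj)

lemma open_overlap: "c \<in> A \<Longrightarrow> c' \<in> A \<Longrightarrow> open (snd c ` (fst c \<inter> fst c'))"
  using A by (simp add: smooth_atlas_def)

lemma open_chart_image: "c \<in> A \<Longrightarrow> open (snd c ` fst c)"
  using A by (simp add: smooth_atlas_def)

lemma trans_smooth: "c \<in> A \<Longrightarrow> c' \<in> A \<Longrightarrow>
    smooth_on (snd c ` (fst c \<inter> fst c')) (\<lambda>x. snd c' (chart_inv c x))"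
  using A by (simp add: smooth_atlas_def comp_def)

lemma is_open_chart: "c \<in> A \<Longrightarrow> is_open A (fst c)"
  using open_overlap by (auto simp: is_open_def points_def Int_commute)

lemma is_open_points: "is_open A (points A)"
proof -
  have "points A \<inter> fst c = fst c" if "c \<in> A" for c
    using that by (auto simp: points_def)
  then show ?thesis
    using open_chart_image by (auto simp: is_open_def)
qed

lemma is_open_inter: "is_open A U \<Longrightarrow> is_open A V \<Longrightarrow> is_open A (U \<inter> V)"
  using istopology_is_open[OF A] by (simp add: istopology_def)

lemma trans_has_derivative:
  assumes "c \<in> A" "c' \<in> A" "p \<in> fst c" "p \<in> fst c'"
  shows "((\<lambda>x. snd c' (chart_inv c x)) has_derivative jac c c' (snd c p)) (at (snd c p))"
  unfolding jac_def using assms by (intro smooth_on_has_derivative[OF trans_smooth open_overlap]) auto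

lemma jac_linear:
  assumes "c \<in> A" "c' \<in> A" "p \<in> fst c" "p \<in> fst c'"
  shows "linear (jac c c' (snd c p))"
  using trans_has_derivative[OF assms] has_derivative_linear by blast

lemma jac_comp:
  assumes "c \<in> A" "c' \<in> A" "c'' \<in> A" "p \<in> fst c" "p \<in> fst c'" "p \<in> fst c''"
  shows "jac c' c'' (snd c' p) (jac c c' (snd c p) e) = jac c c'' (snd c p) e"
proof -
  have "((\<lambda>x. snd c'' (chart_inv c' (snd c' (chart_inv c x)))) has_derivative
      (\<lambda>e. jac c' c'' (snd c' p) (jac c c' (snd c p) e))) (at (snd c p))"
    by (rule has_derivative_compose[OF trans_has_derivative])
      (use assms trans_has_derivative[of c' c'' p] in \<open>auto simp: chart_inv_left\<close>)
  then have "((\<lambda>x. snd c'' (chart_inv c x)) has_derivative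
      (\<lambda>e. jac c' c'' (snd c' p) (jac c c' (snd c p) e))) (at (snd c p))"
    by (rule has_derivative_transform_within_open[OF _ open_overlap[OF assms(1,2)]])
      (use assms in \<open>auto simp: chart_inv_left\<close>)
  then show ?thesis
    using fd_eqI unfolding jac_def by metis
qed

lemma jac_id:
  assumes "c \<in> A" "p \<in> fst c"
  shows "jac c c (snd c p) e = e"
proof -
  have "((\<lambda>x. snd c (chart_inv c x)) has_derivative (\<lambda>e. e)) (at (snd c p))"
    by (rule has_derivative_transform_within_open[OF has_derivative_ident open_chart_image[OF assms(1)]])
      (use assms in \<open>auto simp: chart_inv_left\<close>)
  then show ?thesis
    using fd_eqI unfolding jac_def by metis
qed

lemma from_chart_linear: "c \<in> A \<Longrightarrow> p \<in> fst c \<Longrightarrow> linear (from_chart A c p)"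
  unfolding from_chart_eq by (simp add: jac_linear chart_at_chart)

lemma to_chart_linear: "c \<in> A \<Longrightarrow> p \<in> fst c \<Longrightarrow> linear (to_chart A c p)"
  unfolding to_chart_eq by (simp add: jac_linear chart_at_chart)

lemma from_chart_jac:
  assumes "c \<in> A" "c' \<in> A" "p \<in> fst c" "p \<in> fst c'"
  shows "from_chart A c' p (jac c c' (snd c p) e) = from_chart A c p e"
  unfolding from_chart_eq using assms by (simp add: jac_comp chart_at_chart)

lemma to_from_chart_jac:
  assumes "c \<in> A" "c' \<in> A" "p \<in> fst c" "p \<in> fst c'"
  shows "to_chart A c' p (from_chart A c p e) = jac c c' (snd c p) e"
  unfolding from_chart_eq to_chart_eq using assms by (simp add: jac_comp chart_at_chart)

lemma to_from_chart: "c \<in> A \<Longrightarrow> p \<in> fst c \<Longrightarrow> to_chart A c p (from_chart A c p e) = e"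
  by (simp add: to_from_chart_jac jac_id)

lemma from_to_chart: "c \<in> A \<Longrightarrow> p \<in> fst c \<Longrightarrow> from_chart A c p (to_chart A c p e) = e"
  unfolding from_chart_eq to_chart_eq by (simp add: jac_comp jac_id chart_at_chart)

lemma from_chart_at: "p \<in> points A \<Longrightarrow> from_chart A (chart_at A p) p e = e"
  unfolding from_chart_eq by (simp add: jac_id chart_at)

end

lemma is_open_chart_preimage:
  assumes A: "smooth_atlas A" and c: "c \<in> A" and V: "open V"
  shows "is_open A {p \<in> fst c. snd c p \<in> V}"
  unfolding is_open_def
proof (intro conjI ballI)
  show "{p \<in> fst c. snd c p \<in> V} \<subseteq> points A" using c by (auto simp: points_def)
  fix c' assume c': "c' \<in> A"
  have "snd c' ` ({p \<in> fst c. snd c p \<in> V} \<inter> fst c') = {x \<in> snd c' ` (fst c' \<inter> fst c). snd c (chart_inv c' x) \<in> V}"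
    by (auto simp: chart_inv_left[OF A c'])
  then show "open (snd c' ` ({p \<in> fst c. snd c p \<in> V} \<inter> fst c'))"
    using open_Collect_mem[OF trans_smooth[OF A c' c] open_overlap[OF A c' c] V] by simp
qed

subsection \<open>Smooth maps\<close>

definition rep :: "('a, 'e) chart \<Rightarrow> ('b, 'f) chart \<Rightarrow> ('a \<Rightarrow> 'b) \<Rightarrow> 'e \<Rightarrow> 'f" where
  "rep c c' f x = snd c' (f (chart_inv c x))"

definition smooth_at ::
    "('a, 'e::euclidean_space) atlas \<Rightarrow> ('b, 'f::euclidean_space) atlas \<Rightarrow> ('a \<Rightarrow> 'b) \<Rightarrow> 'a \<Rightarrow> bool" where
  "smooth_at A A' f p \<longleftrightarrow> (\<exists>c\<in>A. \<exists>c'\<in>A'. p \<in> fst c \<and> f p \<in> fst c' \<and>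
     (\<exists>V. open V \<and> snd c p \<in> V \<and> V \<subseteq> snd c ` fst c \<and> (\<forall>x\<in>V. f (chart_inv c x) \<in> fst c') \<and>
        smooth_on V (rep c c' f)))"

lemma smooth_at_points: "smooth_at A A' f p \<Longrightarrow> p \<in> points A" "smooth_at A A' f p \<Longrightarrow> f p \<in> points A'"
  by (auto simp: smooth_at_def points_def)

context
  fixes A :: "('a, 'e::euclidean_space) atlas" and A' :: "('b, 'f::euclidean_space) atlas"
  assumes A: "smooth_atlas A" and A': "smooth_atlas A'"
begin

text \<open>One good pair of charts implies every pair is good. The target side is shrunk to the
  overlap of the two target charts, and its preimage under the change of source chart is the
  neighbourhood sought.\<close>

lemma smooth_atE:
  assumes "smooth_at A A' f p" and c: "c \<in> A" "p \<in> fst c" and c': "c' \<in> A'" "f p \<in> fst c'"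
  obtains V where "open V" "snd c p \<in> V" "V \<subseteq> snd c ` fst c"
    "\<And>x. x \<in> V \<Longrightarrow> f (chart_inv c x) \<in> fst c'" "smooth_on V (rep c c' f)"
proof -
  obtain c0 c0' V0 where c0: "c0 \<in> A" "p \<in> fst c0" and c0': "c0' \<in> A'" "f p \<in> fst c0'"
    and V0: "open V0" "snd c0 p \<in> V0" "V0 \<subseteq> snd c0 ` fst c0"
      "\<And>x. x \<in> V0 \<Longrightarrow> f (chart_inv c0 x) \<in> fst c0'" "smooth_on V0 (rep c0 c0' f)"
    using assms(1) unfolding smooth_at_def by blast
  note l = chart_inv_left[OF A c(1)] chart_inv_left[OF A c0(1)] chart_inv_left[OF A' c0'(1)]
  define V1 where "V1 = {x \<in> V0. rep c0 c0' f x \<in> snd c0' ` (fst c0' \<inter> fst c')}"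
  have V1: "open V1" "V1 \<subseteq> V0"
    using open_Collect_mem[OF V0(5,1) open_overlap[OF A' c0'(1) c'(1)]] by (auto simp: V1_def)
  have V1in: "f (chart_inv c0 x) \<in> fst c'" if "x \<in> V1" for x
    using that V0(4) chart_inj[OF A' c0'(1)] by (auto simp: V1_def rep_def inj_on_def)
  define V where "V = {x \<in> snd c ` (fst c \<inter> fst c0). snd c0 (chart_inv c x) \<in> V1}"
  have V: "open V" "V \<subseteq> snd c ` (fst c \<inter> fst c0)"
    using open_Collect_mem[OF trans_smooth[OF A c(1) c0(1)] open_overlap[OF A c(1) c0(1)] V1(1)]
    by (auto simp: V_def)
  have bk: "chart_inv c0 (snd c0 (chart_inv c x)) = chart_inv c x" if "x \<in> V" for x
    using that V(2) l c c0 by auto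
  have memc: "f (chart_inv c x) \<in> fst c'" if "x \<in> V" for x
    using V1in[of "snd c0 (chart_inv c x)"] that bk[OF that] by (simp add: V_def)
  have memc0: "f (chart_inv c x) \<in> fst c0'" if "x \<in> V" for x
    using V0(4)[of "snd c0 (chart_inv c x)"] V1(2) that bk[OF that] by (auto simp: V_def)
  have "snd c p \<in> V"
    using c c0 c' c0' V0 l by (auto simp: V_def V1_def rep_def)
  moreover have "smooth_on V (rep c c' f)"
  proof (rule smooth_on_cong[OF _ V(1)])
    have s1: "smooth_on V1 (\<lambda>x. snd c' (chart_inv c0' (rep c0 c0' f x)))"
      by (rule smooth_on_compose[OF V1(1) open_overlap[OF A' c0'(1) c'(1)] _ smooth_on_subset[OF V0(5) V1(2)]
            trans_smooth[OF A' c0'(1) c'(1)]]) (auto simp: V1_def)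
    show "smooth_on V (\<lambda>x. snd c' (chart_inv c0' (rep c0 c0' f (snd c0 (chart_inv c x)))))"
      by (rule smooth_on_compose[OF V(1) V1(1) _ smooth_on_subset[OF trans_smooth[OF A c(1) c0(1)] V(2)] s1])
        (auto simp: V_def)
    show "snd c' (chart_inv c0' (rep c0 c0' f (snd c0 (chart_inv c x)))) = rep c c' f x" if "x \<in> V" for x
      using bk[OF that] memc0[OF that] l c0' by (simp add: rep_def)
  qed
  ultimately show thesis
    using that[of V] V memc by blast
qed

lemma smooth_at_rep_has_derivative:
  assumes "smooth_at A A' f p" "c \<in> A" "p \<in> fst c" "c' \<in> A'" "f p \<in> fst c'"
  shows "(rep c c' f has_derivative fd (rep c c' f) (snd c p)) (at (snd c p))"
  by (rule smooth_atE[OF assms]) (rule smooth_on_has_derivative)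

lemma fd_rep_change_target:
  assumes "smooth_at A A' f p" "c \<in> A" "p \<in> fst c" "c' \<in> A'" "f p \<in> fst c'" "d' \<in> A'" "f p \<in> fst d'"
  shows "fd (rep c d' f) (snd c p) e = jac c' d' (snd c' (f p)) (fd (rep c c' f) (snd c p) e)"
proof -
  obtain V where V: "open V" "snd c p \<in> V" "\<And>x. x \<in> V \<Longrightarrow> f (chart_inv c x) \<in> fst c'"
    using smooth_atE[OF assms(1-5)] by metis
  have *: "rep c c' f (snd c p) = snd c' (f p)"
    using assms by (simp add: rep_def chart_inv_left[OF A])
  have "((\<lambda>x. snd d' (chart_inv c' (rep c c' f x))) has_derivative
      (\<lambda>e. jac c' d' (snd c' (f p)) (fd (rep c c' f) (snd c p) e))) (at (snd c p))"
    by (rule has_derivative_compose[OF smooth_at_rep_has_derivative[OF assms(1-5)]])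
      (use assms trans_has_derivative[OF A'] * in auto)
  then have "(rep c d' f has_derivative
      (\<lambda>e. jac c' d' (snd c' (f p)) (fd (rep c c' f) (snd c p) e))) (at (snd c p))"
    by (rule has_derivative_transform_within_open[OF _ V(1,2)])
      (use assms V(3) in \<open>auto simp: rep_def chart_inv_left[OF A']\<close>)
  then show ?thesis
    using fd_eqI by metis
qed

lemma fd_rep_change_source:
  assumes "smooth_at A A' f p" "c \<in> A" "p \<in> fst c" "d \<in> A" "p \<in> fst d" "c' \<in> A'" "f p \<in> fst c'"
  shows "fd (rep d c' f) (snd d p) (jac c d (snd c p) e) = fd (rep c c' f) (snd c p) e"
proof -
  have "((\<lambda>x. rep d c' f (snd d (chart_inv c x))) has_derivative
      (\<lambda>e. fd (rep d c' f) (snd d p) (jac c d (snd c p) e))) (at (snd c p))"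
    by (rule has_derivative_compose[OF trans_has_derivative[OF A]])
      (use assms smooth_at_rep_has_derivative[of f p d c'] chart_inv_left[OF A] in auto)
  then have "(rep c c' f has_derivative (\<lambda>e. fd (rep d c' f) (snd d p) (jac c d (snd c p) e))) (at (snd c p))"
    by (rule has_derivative_transform_within_open[OF _ open_overlap[OF A assms(2,4)]])
      (use assms in \<open>auto simp: rep_def chart_inv_left[OF A]\<close>)
  then show ?thesis
    using fd_eqI by metis
qed

lemma tangent_map_eq_rep: "tangent_map A A' f p = fd (rep (chart_at A p) (chart_at A' (f p)) f) (snd (chart_at A p) p)"
  by (simp add: tangent_map_def rep_def[abs_def] comp_def)

lemma tangent_map_from_chart:
  assumes "smooth_at A A' f p" "c \<in> A" "p \<in> fst c" "c' \<in> A'" "f p \<in> fst c'"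
  shows "tangent_map A A' f p (from_chart A c p e) = from_chart A' c' (f p) (fd (rep c c' f) (snd c p) e)"
proof -
  let ?d = "chart_at A p" and ?d' = "chart_at A' (f p)"
  have d: "?d \<in> A" "p \<in> fst ?d" "?d' \<in> A'" "f p \<in> fst ?d'"
    using chart_at[OF smooth_at_points(1)[OF assms(1)]] chart_at[OF smooth_at_points(2)[OF assms(1)]] by auto
  have "tangent_map A A' f p (from_chart A c p e) = fd (rep c ?d' f) (snd c p) e"
    unfolding tangent_map_eq_rep from_chart_eq using assms d by (intro fd_rep_change_source)
  also have "\<dots> = from_chart A' c' (f p) (fd (rep c c' f) (snd c p) e)"
    unfolding from_chart_eq using assms d by (intro fd_rep_change_target)
  finally show ?thesis .
qed

lemma tangent_map_linear: "smooth_at A A' f p \<Longrightarrow> linear (tangent_map A A' f p)"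
  unfolding tangent_map_eq_rep
  by (rule has_derivative_linear[OF smooth_at_rep_has_derivative]) (simp_all add: chart_at smooth_at_points)

end

text \<open>The form in which projections, dilations and the group action are handled: one pair of
  charts and one coordinate formula g valid on the whole source chart give both smoothness and the
  differential.\<close>

lemma smooth_at_coordI:
  fixes A :: "('a, 'e::euclidean_space) atlas" and A' :: "('b, 'f::euclidean_space) atlas"
  assumes A: "smooth_atlas A" "smooth_atlas A'" and c: "c \<in> A" "p \<in> fst c" "c' \<in> A'"
    and dom: "\<And>q. q \<in> fst c \<Longrightarrow> f q \<in> fst c'" and val: "\<And>q. q \<in> fst c \<Longrightarrow> snd c' (f q) = g (snd c q)"
    and g: "smooth_on (snd c ` fst c) g"
  shows "smooth_at A A' f p"
    and "tangent_map A A' f p (from_chart A c p e) = from_chart A' c' (f p) (fd g (snd c p) e)"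
proof -
  have op: "open (snd c ` fst c)" using open_chart_image[OF A(1) c(1)] .
  have p: "snd c p \<in> snd c ` fst c" using c(2) by blast
  have rep: "rep c c' f x = g x" "f (chart_inv c x) \<in> fst c'" if "x \<in> snd c ` fst c" for x
    using that by (auto simp: rep_def val dom chart_inv_left[OF A(1) c(1)])
  have "smooth_on (snd c ` fst c) (rep c c' f)"
    by (rule smooth_on_cong[OF g op]) (simp add: rep)
  then show 1: "smooth_at A A' f p"
    unfolding smooth_at_def using c dom[OF c(2)] op p rep(2) by blast
  have "fd (rep c c' f) (snd c p) = fd g (snd c p)"
    by (rule fd_cong[OF op p]) (rule rep(1))
  then show "tangent_map A A' f p (from_chart A c p e) = from_chart A' c' (f p) (fd g (snd c p) e)"
    using tangent_map_from_chart[OF A 1 c dom[OF c(2)], of e] by simp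
qed

lemma smooth_at_compose:
  fixes A :: "('a, 'e::euclidean_space) atlas" and A' :: "('b, 'f::euclidean_space) atlas"
    and A'' :: "('c, 'g::euclidean_space) atlas"
  assumes A: "smooth_atlas A" "smooth_atlas A'" "smooth_atlas A''"
    and f: "smooth_at A A' f p" and g: "smooth_at A' A'' g (f p)"
  shows "smooth_at A A'' (\<lambda>q. g (f q)) p"
    and "tangent_map A A'' (\<lambda>q. g (f q)) p v = tangent_map A' A'' g (f p) (tangent_map A A' f p v)"
proof -
  let ?c = "chart_at A p" and ?c' = "chart_at A' (f p)" and ?c'' = "chart_at A'' (g (f p))"
  have c: "?c \<in> A" "p \<in> fst ?c" "?c' \<in> A'" "f p \<in> fst ?c'" "?c'' \<in> A''" "g (f p) \<in> fst ?c''"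
    using chart_at[OF smooth_at_points(1)[OF f]] chart_at[OF smooth_at_points(1)[OF g]]
      chart_at[OF smooth_at_points(2)[OF g]] by auto
  obtain V where V: "open V" "snd ?c p \<in> V" "V \<subseteq> snd ?c ` fst ?c"
    "\<And>x. x \<in> V \<Longrightarrow> f (chart_inv ?c x) \<in> fst ?c'" "smooth_on V (rep ?c ?c' f)"
    using smooth_atE[OF A(1,2) f c(1-4)] by metis
  obtain V' where V': "open V'" "snd ?c' (f p) \<in> V'" "V' \<subseteq> snd ?c' ` fst ?c'"
    "\<And>x. x \<in> V' \<Longrightarrow> g (chart_inv ?c' x) \<in> fst ?c''" "smooth_on V' (rep ?c' ?c'' g)"
    using smooth_atE[OF A(2,3) g c(3-6)] by metis
  define W where "W = {x \<in> V. rep ?c ?c' f x \<in> V'}"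
  have W: "open W" "W \<subseteq> V"
    using open_Collect_mem[OF V(5,1) V'(1)] by (auto simp: W_def)
  have p: "rep ?c ?c' f (snd ?c p) = snd ?c' (f p)"
    using c by (simp add: rep_def chart_inv_left[OF A(1)])
  then have pW: "snd ?c p \<in> W" using V V' by (simp add: W_def)
  have bk: "chart_inv ?c' (rep ?c ?c' f x) = f (chart_inv ?c x)" if "x \<in> W" for x
    using that W(2) V(4) c(3) by (auto simp: rep_def chart_inv_left[OF A(2)])
  have eq: "rep ?c' ?c'' g (rep ?c ?c' f x) = rep ?c ?c'' (\<lambda>q. g (f q)) x" if "x \<in> W" for x
    using bk[OF that] by (simp add: rep_def)
  have "smooth_on W (\<lambda>x. rep ?c' ?c'' g (rep ?c ?c' f x))"
    by (rule smooth_on_compose[OF W(1) V'(1) _ smooth_on_subset[OF V(5) W(2)] V'(5)]) (auto simp: W_def)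
  then have "smooth_on W (rep ?c ?c'' (\<lambda>q. g (f q)))"
    by (rule smooth_on_cong[OF _ W(1)]) (use eq in auto)
  moreover have "g (f (chart_inv ?c x)) \<in> fst ?c''" if "x \<in> W" for x
    using V'(4)[of "rep ?c ?c' f x"] bk[OF that] that by (simp add: W_def)
  moreover have "W \<subseteq> snd ?c ` fst ?c" using W V by blast
  ultimately show "smooth_at A A'' (\<lambda>q. g (f q)) p"
    unfolding smooth_at_def using c W(1) pW by blast
  have "((\<lambda>x. rep ?c' ?c'' g (rep ?c ?c' f x)) has_derivative
      (\<lambda>v. tangent_map A' A'' g (f p) (tangent_map A A' f p v))) (at (snd ?c p))"
    unfolding tangent_map_eq_rep[OF A(1,2)] tangent_map_eq_rep[OF A(2,3)]
    by (rule has_derivative_compose[OF smooth_at_rep_has_derivative[OF A(1,2) f c(1-4)]])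
      (use smooth_at_rep_has_derivative[OF A(2,3) g c(3-6)] p in simp)
  then have "(rep ?c ?c'' (\<lambda>q. g (f q)) has_derivative
      (\<lambda>v. tangent_map A' A'' g (f p) (tangent_map A A' f p v))) (at (snd ?c p))"
    by (rule has_derivative_transform_within_open[OF _ W(1) pW]) (use eq in auto)
  then show "tangent_map A A'' (\<lambda>q. g (f q)) p v = tangent_map A' A'' g (f p) (tangent_map A A' f p v)"
    unfolding tangent_map_eq_rep[OF A(1,3)] using fd_eqI by metis
qed

lemma velocity_from_chart:
  fixes A :: "('a, 'e::euclidean_space) atlas"
  assumes A: "smooth_atlas A" and c: "c \<in> A" and near: "\<forall>\<^sub>F t in nhds 0. \<gamma> t \<in> fst c"
    and w: "((\<lambda>t. snd c (\<gamma> t)) has_vector_derivative w) (at 0)"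
  shows "velocity A \<gamma> = from_chart A c (\<gamma> 0) w"
proof -
  let ?d = "chart_at A (\<gamma> 0)"
  have 0: "\<gamma> 0 \<in> fst c" using near eventually_nhds_x_imp_x by blast
  have d: "?d \<in> A" "\<gamma> 0 \<in> fst ?d"
    using chart_at[OF chart_points[OF c 0]] by auto
  obtain N where N: "open N" "0 \<in> N" "\<And>t. t \<in> N \<Longrightarrow> \<gamma> t \<in> fst c"
    using near unfolding eventually_nhds by blast
  have "((\<lambda>t. snd ?d (chart_inv c (snd c (\<gamma> t)))) has_derivative
      (\<lambda>h. from_chart A c (\<gamma> 0) (h *\<^sub>R w))) (at 0)"
    unfolding from_chart_eq
    by (rule has_derivative_compose[OF w[unfolded has_vector_derivative_def] trans_has_derivative[OF A c d(1) 0 d(2)]])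
  then have "((\<lambda>t. snd ?d (\<gamma> t)) has_derivative (\<lambda>h. from_chart A c (\<gamma> 0) (h *\<^sub>R w))) (at 0)"
    by (rule has_derivative_transform_within_open[OF _ N(1,2)]) (simp add: chart_inv_left[OF A c] N(3))
  then have "((\<lambda>t. snd ?d (\<gamma> t)) has_vector_derivative from_chart A c (\<gamma> 0) w) (at 0)"
    unfolding has_vector_derivative_def using from_chart_linear[OF A c 0] by (simp add: linear_scale)
  then show ?thesis
    unfolding velocity_def comp_def by (rule vector_derivative_at)
qed

subsection \<open>Differential forms\<close>

lemma fd_linear_parameter:
  fixes a :: "'f::euclidean_space \<Rightarrow> 'f \<Rightarrow> 'b::real_normed_vector"
  assumes V: "open V" "x \<in> V" and a: "\<And>b. smooth_on V (a b)" "\<And>y. y \<in> V \<Longrightarrow> linear (\<lambda>w. a w y)"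
  shows "fd (a w) x h = (\<Sum>b\<in>Basis. (w \<bullet> b) *\<^sub>R fd (a b) x h)"
proof -
  have "((\<lambda>y. \<Sum>b\<in>Basis. (w \<bullet> b) *\<^sub>R a b y) has_derivative (\<lambda>h. \<Sum>b\<in>Basis. (w \<bullet> b) *\<^sub>R fd (a b) x h)) (at x)"
    by (intro has_derivative_sum has_derivative_scaleR_right smooth_on_has_derivative[OF a(1) V])
  then have "(a w has_derivative (\<lambda>h. \<Sum>b\<in>Basis. (w \<bullet> b) *\<^sub>R fd (a b) x h)) (at x)"
    by (rule has_derivative_transform_within_open[OF _ V]) (use linear_sum_Basis[OF a(2)] in auto)
  then show ?thesis by (simp add: fd_eqI)
qed

text \<open>The pull-back of a along G has the components a (fd G z e) (G z). Differentiating them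
  produces a term with the second derivative of G, which is symmetric and cancels under
  antisymmetrisation. With G a change of chart this makes d independent of charts; with G a map in
  coordinates it makes d natural.\<close>

lemma pullback_exterior:
  fixes a :: "'f::euclidean_space \<Rightarrow> 'f \<Rightarrow> complex" and G :: "'e::euclidean_space \<Rightarrow> 'f"
  assumes V: "open V" "x \<in> V" "smooth_on V G" and V': "open V'" "G ` V \<subseteq> V'"
    and a: "\<And>b. smooth_on V' (a b)" "\<And>y. y \<in> V' \<Longrightarrow> linear (\<lambda>w. a w y)"
  shows "smooth_on V (\<lambda>z. a (fd G z e) (G z))"
    and "fd (\<lambda>z. a (fd G z v) (G z)) x u - fd (\<lambda>z. a (fd G z u) (G z)) x v
       = fd (a (fd G x v)) (G x) (fd G x u) - fd (a (fd G x u)) (G x) (fd G x v)"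
proof -
  have expand: "a w y = (\<Sum>b\<in>Basis. (w \<bullet> b) *\<^sub>R a b y)" if "y \<in> V'" for w y
    by (rule linear_sum_Basis[OF a(2)[OF that]])
  have sG: "smooth_on V (\<lambda>z. a b (G z))" for b
    by (rule smooth_on_compose[OF V(1) V' V(3) a(1)])
  have "smooth_on V (\<lambda>z. fd G z e \<bullet> b)" for b
    by (intro smooth_on_bounded_linear_compose[OF bounded_linear_inner_left V(1)] smooth_on_fd V)
  then have "smooth_on V (\<lambda>z. \<Sum>b\<in>Basis. (fd G z e \<bullet> b) *\<^sub>R a b (G z))"
    by (intro smooth_on_intros V sG) auto
  then show "smooth_on V (\<lambda>z. a (fd G z e) (G z))"
    by (rule smooth_on_cong[OF _ V(1)]) (use expand V' in auto)
  have Gx: "G x \<in> V'" using V V' by blast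
  have dG: "(G has_derivative fd G x) (at x)" using V smooth_on_has_derivative by blast
  have da: "(a b has_derivative fd (a b) (G x)) (at (G x))" for b
    using smooth_on_has_derivative[OF a(1) V'(1) Gx] .
  have lin: "fd (a w) (G x) h = (\<Sum>b\<in>Basis. (w \<bullet> b) *\<^sub>R fd (a b) (G x) h)" for w h
    by (rule fd_linear_parameter[OF V'(1) Gx a])
  have D: "fd (\<lambda>z. a (fd G z e) (G z)) x h
      = a (fd (\<lambda>z. fd G z e) x h) (G x) + fd (a (fd G x e)) (G x) (fd G x h)" for e h
  proof -
    have "((\<lambda>z. fd G z e) has_derivative fd (\<lambda>z. fd G z e) x) (at x)"
      using smooth_on_has_derivative[OF smooth_on_fd[OF V(3)] V(1,2)] .
    then have "((\<lambda>z. \<Sum>b\<in>Basis. (fd G z e \<bullet> b) *\<^sub>R a b (G z)) has_derivative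
       (\<lambda>h. \<Sum>b\<in>Basis. (fd G x e \<bullet> b) *\<^sub>R fd (a b) (G x) (fd G x h) + (fd (\<lambda>z. fd G z e) x h \<bullet> b) *\<^sub>R a b (G x))) (at x)"
      by (intro has_derivative_sum has_derivative_scaleR has_derivative_inner_left has_derivative_compose[OF dG da])
    then have "((\<lambda>z. a (fd G z e) (G z)) has_derivative
       (\<lambda>h. \<Sum>b\<in>Basis. (fd G x e \<bullet> b) *\<^sub>R fd (a b) (G x) (fd G x h) + (fd (\<lambda>z. fd G z e) x h \<bullet> b) *\<^sub>R a b (G x))) (at x)"
      by (rule has_derivative_transform_within_open[OF _ V(1,2)]) (use expand V' in auto)
    then show ?thesis
      by (simp add: fd_eqI sum.distrib lin[of "fd G x e"] expand[OF Gx, of "fd (\<lambda>z. fd G z e) x h"])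
  qed
  show "fd (\<lambda>z. a (fd G z v) (G z)) x u - fd (\<lambda>z. a (fd G z u) (G z)) x v
       = fd (a (fd G x v)) (G x) (fd G x u) - fd (a (fd G x u)) (G x) (fd G x v)"
    unfolding D second_derivative_symmetric[OF V, of u v] by simp
qed

lemma form_comp_at:
  assumes "smooth_atlas A" "c \<in> A" "p \<in> fst c"
  shows "form_comp A \<alpha> c e (snd c p) = \<alpha> p (from_chart A c p e)"
  using assms by (simp add: form_comp_def chart_inv_left)

lemma form_comp_linear:
  assumes "smooth_atlas A" "c \<in> A" "p \<in> fst c" "linear (\<alpha> p)"
  shows "linear (\<lambda>e. form_comp A \<alpha> c e (snd c p))"
  using linear_compose[OF from_chart_linear[OF assms(1-3)] assms(4)] form_comp_at[OF assms(1-3)]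
  by (simp add: comp_def)

lemma ext_comp_linear:
  fixes A :: "('a, 'e::euclidean_space) atlas"
  assumes A: "smooth_atlas A" and W: "smooth_form A W \<alpha>" "is_open A W" and c: "c \<in> A" "z \<in> snd c ` (W \<inter> fst c)"
  shows "linear (\<lambda>v. fd (form_comp A \<alpha> c v) z u)"
proof -
  have op: "open (snd c ` (W \<inter> fst c))" using W(2) c(1) by (simp add: is_open_def)
  have "linear (\<lambda>w. form_comp A \<alpha> c w y)" if "y \<in> snd c ` (W \<inter> fst c)" for y
    using that form_comp_linear[OF A c(1)] W(1) by (auto simp: smooth_form_def)
  then have "fd (form_comp A \<alpha> c v) z u = (\<Sum>b\<in>Basis. (v \<bullet> b) *\<^sub>R fd (form_comp A \<alpha> c b) z u)" for v
    using W(1) c(1) by (intro fd_linear_parameter[OF op c(2)]) (auto simp: smooth_form_def)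
  then have eq: "(\<lambda>v. fd (form_comp A \<alpha> c v) z u) = (\<lambda>v. \<Sum>b\<in>Basis. (v \<bullet> b) *\<^sub>R fd (form_comp A \<alpha> c b) z u)"
    by (rule ext)
  have "linear (\<lambda>v. \<Sum>b\<in>Basis. (v \<bullet> b) *\<^sub>R D b)" for D :: "'e \<Rightarrow> complex"
    by (simp add: linear_iff inner_add_left scaleR_add_left sum.distrib scaleR_sum_right)
  then show ?thesis by (subst eq)
qed

lemma form_comp_change:
  assumes "smooth_atlas A" "c \<in> A" "p \<in> fst c" "c' \<in> A" "p \<in> fst c'"
  shows "form_comp A \<alpha> c e (snd c p) = form_comp A \<alpha> c' (jac c c' (snd c p) e) (snd c' p)"
  using assms by (simp add: form_comp_at from_chart_jac)

lemma smooth_formD: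
  assumes "smooth_form A W \<alpha>"
  shows "p \<in> W \<Longrightarrow> linear (\<alpha> p)" "c \<in> A \<Longrightarrow> smooth_on (snd c ` (W \<inter> fst c)) (form_comp A \<alpha> c e)"
  using assms by (auto simp: smooth_form_def)

lemma smooth_form_subset: "smooth_form A W \<alpha> \<Longrightarrow> V \<subseteq> W \<Longrightarrow> smooth_form A V \<alpha>"
  unfolding smooth_form_def by (blast intro: smooth_on_subset)

lemma is_openD: "is_open A W \<Longrightarrow> c \<in> A \<Longrightarrow> open (snd c ` (W \<inter> fst c))"
  by (simp add: is_open_def)

text \<open>Components in another chart are the pull-back of those in c along the change of chart,
  so checking c alone is enough for a form living inside its domain.\<close>

lemma smooth_form_chartI:
  assumes A: "smooth_atlas A" and c: "c \<in> A" "W \<subseteq> fst c" "is_open A W"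
    and lin: "\<And>p. p \<in> W \<Longrightarrow> linear (\<alpha> p)" and sm: "\<And>e. smooth_on (snd c ` W) (form_comp A \<alpha> c e)"
  shows "smooth_form A W \<alpha>"
  unfolding smooth_form_def
proof (intro conjI ballI allI lin)
  fix c' e assume c': "c' \<in> A"
  let ?V = "snd c' ` (W \<inter> fst c')" and ?G = "\<lambda>x. snd c (chart_inv c' x)"
  have WV: "snd c ` (W \<inter> fst c) = snd c ` W" using c(2) by (simp add: Int_absorb2)
  have V: "open ?V" using c' c(3) by (simp add: is_openD)
  have sm': "smooth_on ?V ?G"
    by (rule smooth_on_subset[OF trans_smooth[OF A c' c(1)]]) (use c(2) in auto)
  have bk: "chart_inv c' (snd c' p) = p" "chart_inv c (snd c p) = p" if "p \<in> W \<inter> fst c'" for p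
    using that c(2) chart_inv_left[OF A c(1)] chart_inv_left[OF A c'] by auto
  show "smooth_on ?V (form_comp A \<alpha> c' e)"
  proof (rule smooth_on_cong[OF _ V])
    show "smooth_on ?V (\<lambda>x. form_comp A \<alpha> c (fd ?G x e) (?G x))"
    \<comment> \<open>\<open>pullback_exterior\<close> is stated at a point of the domain, so an
      empty overlap is treated apart.\<close>
    proof (cases "?V = {}")
      case False
      then obtain x where "x \<in> ?V" by blast
      then show ?thesis
      proof (rule pullback_exterior(1)[OF V _ sm' _ _ sm])
        show "open (snd c ` W)" using is_openD[OF c(3,1)] WV by simp
        show "?G ` ?V \<subseteq> snd c ` W" using bk by auto
        show "linear (\<lambda>w. form_comp A \<alpha> c w y)" if "y \<in> snd c ` W" for y
          using that form_comp_linear[OF A c(1)] lin c(2) by auto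
      qed
    qed (auto intro: smooth_on_local)
    fix x assume "x \<in> ?V"
    then obtain p where p: "x = snd c' p" "p \<in> W" "p \<in> fst c'" by auto
    then show "form_comp A \<alpha> c (fd ?G x e) (?G x) = form_comp A \<alpha> c' e x"
      using form_comp_change[OF A c' p(3) c(1), of \<alpha> e] c(2) bk[of p] by (auto simp: jac_def)
  qed
qed

text \<open>Naturality of d under the change of charts: the definition through the preferred chart
  agrees with the coordinate formula in every chart, in particular in the explicit charts of E and
  Y.\<close>

lemma ext_deriv_from_chart:
  assumes A: "smooth_atlas A" and W: "smooth_form A W \<alpha>" "is_open A W" "p \<in> W" and c: "c \<in> A" "p \<in> fst c"
  shows "ext_deriv A \<alpha> p (from_chart A c p u) (from_chart A c p v)
    = fd (form_comp A \<alpha> c v) (snd c p) u - fd (form_comp A \<alpha> c u) (snd c p) v"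
proof -
  let ?d = "chart_at A p"
  have d: "?d \<in> A" "p \<in> fst ?d" using chart_at[OF chart_points[OF c]] by auto
  let ?G = "\<lambda>x. snd ?d (chart_inv c x)"
  let ?V = "snd c ` (W \<inter> fst c \<inter> fst ?d)" and ?V' = "snd ?d ` (W \<inter> fst ?d)"
  have V: "open ?V"
    using is_openD[OF is_open_inter[OF A W(2) is_open_chart[OF A d(1)]] c(1)]
    by (simp add: Int_assoc Int_commute Int_left_commute)
  have G: "smooth_on ?V ?G"
    by (rule smooth_on_subset[OF trans_smooth[OF A c(1) d(1)]]) auto
  have xV: "snd c p \<in> ?V" using W c d by blast
  have V': "open ?V'" "?G ` ?V \<subseteq> ?V'"
    using is_openD[OF W(2) d(1)] chart_inv_left[OF A c(1)] by auto
  have lin: "linear (\<lambda>w. form_comp A \<alpha> ?d w y)" if "y \<in> ?V'" for y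
    using that form_comp_linear[OF A d(1)] smooth_formD(1)[OF W(1)] by auto
  have F: "form_comp A \<alpha> ?d (fd ?G z e) (?G z) = form_comp A \<alpha> c e z" if "z \<in> ?V" for z e
    using that form_comp_change[OF A c(1) _ d(1), of _ \<alpha> e] chart_inv_left[OF A c(1)] by (auto simp: jac_def)
  have "fd (form_comp A \<alpha> c e) (snd c p) = fd (\<lambda>z. form_comp A \<alpha> ?d (fd ?G z e) (?G z)) (snd c p)" for e
    using F by (intro fd_cong[OF V xV]) auto
  moreover have "?G (snd c p) = snd ?d p" "fd ?G (snd c p) = from_chart A c p"
    using chart_inv_left[OF A c] by (simp_all add: from_chart_eq jac_def)
  ultimately show ?thesis
    using pullback_exterior(2)[where v = v and u = u, OF V xV G V' smooth_formD(2)[OF W(1) d(1)] lin]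
    by (simp add: ext_deriv_def Let_def)
qed

definition pull ::
    "('a, 'e::euclidean_space) atlas \<Rightarrow> ('b, 'f::euclidean_space) atlas \<Rightarrow> ('a \<Rightarrow> 'b) \<Rightarrow> ('b \<Rightarrow> 'f covec) \<Rightarrow> 'a \<Rightarrow> 'e covec" where
  "pull A A' f \<alpha> p v = \<alpha> (f p) (tangent_map A A' f p v)"

lemma pull_form_comp_local:
  assumes A: "smooth_atlas A" "smooth_atlas A'" and f: "\<And>q. q \<in> W \<Longrightarrow> smooth_at A A' f q" "is_open A W"
    and \<alpha>: "smooth_form A' W' \<alpha>" "is_open A' W'" and fW: "f ` W \<subseteq> W'"
    and c: "c \<in> A" "p \<in> W" "p \<in> fst c" "c' \<in> A'" "f p \<in> fst c'"
  obtains V where "open V" "snd c p \<in> V" "V \<subseteq> snd c ` (W \<inter> fst c)" "smooth_on V (rep c c' f)" "rep c c' f ` V \<subseteq> snd c' ` (W' \<inter> fst c')"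
     "\<And>x e. x \<in> V \<Longrightarrow> form_comp A (pull A A' f \<alpha>) c e x = form_comp A' \<alpha> c' (fd (rep c c' f) x e) (rep c c' f x)"
proof -
  obtain V0 where V0: "open V0" "snd c p \<in> V0" "V0 \<subseteq> snd c ` fst c"
    "\<And>x. x \<in> V0 \<Longrightarrow> f (chart_inv c x) \<in> fst c'" "smooth_on V0 (rep c c' f)"
    using smooth_atE[OF A f(1)[OF c(2)] c(1,3,4,5)] by metis
  let ?V = "V0 \<inter> snd c ` (W \<inter> fst c)"
  have V: "open ?V" using V0(1) is_openD[OF f(2) c(1)] by auto
  have memc: "rep c c' f x \<in> snd c' ` (W' \<inter> fst c')" if "x \<in> ?V" for x
    using that V0(4)[of x] fW chart_inv_left[OF A(1) c(1)] by (auto simp: rep_def)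
  have "form_comp A (pull A A' f \<alpha>) c e x = form_comp A' \<alpha> c' (fd (rep c c' f) x e) (rep c c' f x)"
    if "x \<in> ?V" for x e
  proof -
    obtain q where q: "x = snd c q" "q \<in> W" "q \<in> fst c" using \<open>x \<in> ?V\<close> by auto
    have q': "chart_inv c x = q" "f q \<in> fst c'" "rep c c' f x = snd c' (f q)"
      using q V0(4)[of x] that chart_inv_left[OF A(1) c(1) q(3)] by (auto simp: rep_def)
    then show ?thesis
      using q form_comp_at[OF A(1) c(1) q(3), of "pull A A' f \<alpha>" e] form_comp_at[OF A(2) c(4), of "f q" \<alpha>]
        tangent_map_from_chart[OF A f(1)[OF q(2)] c(1) q(3) c(4) q'(2), of e]
      by (simp add: pull_def)
  qed
  moreover have "smooth_on ?V (rep c c' f)" using V0(5) by (rule smooth_on_subset) auto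
  ultimately show thesis
    using that[of ?V] V V0 c memc by blast
qed

lemma ext_deriv_pull:
  assumes A: "smooth_atlas A" "smooth_atlas A'" and f: "\<And>q. q \<in> W \<Longrightarrow> smooth_at A A' f q" "is_open A W"
    and \<alpha>: "smooth_form A' W' \<alpha>" "is_open A' W'" and fW: "f ` W \<subseteq> W'" and p: "p \<in> W"
  shows "ext_deriv A (pull A A' f \<alpha>) p u v = ext_deriv A' \<alpha> (f p) (tangent_map A A' f p u) (tangent_map A A' f p v)"
proof -
  let ?c = "chart_at A p" and ?c' = "chart_at A' (f p)"
  have c: "?c \<in> A" "p \<in> fst ?c" "?c' \<in> A'" "f p \<in> fst ?c'"
    using chart_at[OF smooth_at_points(1)[OF f(1)[OF p]]] chart_at[OF smooth_at_points(2)[OF f(1)[OF p]]] by auto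
  obtain V where V: "open V" "snd ?c p \<in> V" "V \<subseteq> snd ?c ` (W \<inter> fst ?c)" "smooth_on V (rep ?c ?c' f)"
    "rep ?c ?c' f ` V \<subseteq> snd ?c' ` (W' \<inter> fst ?c')"
    and eq: "\<And>x e. x \<in> V \<Longrightarrow> form_comp A (pull A A' f \<alpha>) ?c e x = form_comp A' \<alpha> ?c' (fd (rep ?c ?c' f) x e) (rep ?c ?c' f x)"
    using pull_form_comp_local[OF A f \<alpha> fW c(1) p c(2-4)] by metis
  have lin: "linear (\<lambda>w. form_comp A' \<alpha> ?c' w y)" if "y \<in> snd ?c' ` (W' \<inter> fst ?c')" for y
    using that form_comp_linear[OF A(2) c(3)] smooth_formD(1)[OF \<alpha>(1)] by auto
  have "fd (form_comp A (pull A A' f \<alpha>) ?c e) (snd ?c p)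
      = fd (\<lambda>x. form_comp A' \<alpha> ?c' (fd (rep ?c ?c' f) x e) (rep ?c ?c' f x)) (snd ?c p)" for e
    using eq by (intro fd_cong[OF V(1,2)]) auto
  moreover have "rep ?c ?c' f (snd ?c p) = snd ?c' (f p)"
    using c chart_inv_left[OF A(1)] by (simp add: rep_def)
  ultimately show ?thesis
    using pullback_exterior(2)[where v = v and u = u, OF V(1,2,4) is_openD[OF \<alpha>(2) c(3)] V(5) smooth_formD(2)[OF \<alpha>(1) c(3)] lin]
    by (simp add: ext_deriv_def Let_def tangent_map_eq_rep[OF A])
qed

lemma smooth_form_pull:
  assumes A: "smooth_atlas A" "smooth_atlas A'" and f: "\<And>q. q \<in> W \<Longrightarrow> smooth_at A A' f q" "is_open A W"
    and \<alpha>: "smooth_form A' W' \<alpha>" "is_open A' W'" and fW: "f ` W \<subseteq> W'"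
  shows "smooth_form A W (pull A A' f \<alpha>)"
  unfolding smooth_form_def
proof (intro conjI ballI allI)
  fix p assume p: "p \<in> W"
  show "linear (pull A A' f \<alpha> p)"
    using linear_compose[OF tangent_map_linear[OF A f(1)[OF p]] smooth_formD(1)[OF \<alpha>(1), of "f p"]] p fW
    by (auto simp: pull_def[abs_def] comp_def)
next
  fix c e assume c: "c \<in> A"
  show "smooth_on (snd c ` (W \<inter> fst c)) (form_comp A (pull A A' f \<alpha>) c e)"
  proof (rule smooth_on_local)
    fix x assume "x \<in> snd c ` (W \<inter> fst c)"
    then obtain p where p: "x = snd c p" "p \<in> W" "p \<in> fst c" by auto
    let ?c' = "chart_at A' (f p)"
    have c': "?c' \<in> A'" "f p \<in> fst ?c'" using chart_at[OF smooth_at_points(1)[OF f(1)[OF p(2)]]] chart_at[OF smooth_at_points(2)[OF f(1)[OF p(2)]]] by auto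
    obtain V where V: "open V" "snd c p \<in> V" "V \<subseteq> snd c ` (W \<inter> fst c)" "smooth_on V (rep c ?c' f)"
      "rep c ?c' f ` V \<subseteq> snd ?c' ` (W' \<inter> fst ?c')"
      and eq: "\<And>x e. x \<in> V \<Longrightarrow> form_comp A (pull A A' f \<alpha>) c e x = form_comp A' \<alpha> ?c' (fd (rep c ?c' f) x e) (rep c ?c' f x)"
      using pull_form_comp_local[OF A f \<alpha> fW c p(2,3) c'] by metis
    have lin: "linear (\<lambda>w. form_comp A' \<alpha> ?c' w y)" if "y \<in> snd ?c' ` (W' \<inter> fst ?c')" for y
      using that form_comp_linear[OF A(2) c'(1)] smooth_formD(1)[OF \<alpha>(1)] by auto
    have "smooth_on V (form_comp A (pull A A' f \<alpha>) c e)"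
      by (rule smooth_on_cong[OF pullback_exterior(1)[OF V(1,2,4) is_openD[OF \<alpha>(2) c'(1)] V(5) smooth_formD(2)[OF \<alpha>(1) c'(1)] lin] V(1)])
        (use eq in auto)
    then show "\<exists>T. open T \<and> x \<in> T \<and> smooth_on T (form_comp A (pull A A' f \<alpha>) c e)"
      using V p by blast
  qed
qed

lemma ext_deriv_linear_comb:
  assumes A: "smooth_atlas A" and W: "is_open A W" "p \<in> W"
    and \<alpha>: "\<And>i. i \<in> I \<Longrightarrow> smooth_form A W (\<alpha> i)" "finite I"
  shows "ext_deriv A (\<lambda>q v. \<Sum>i\<in>I. k i * \<alpha> i q v) p u v = (\<Sum>i\<in>I. k i * ext_deriv A (\<alpha> i) p u v)"
proof -
  let ?c = "chart_at A p"
  have p: "p \<in> points A" using W by (auto simp: is_open_def)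
  have c: "?c \<in> A" "p \<in> fst ?c" using chart_at[OF p] by auto
  have "fd (form_comp A (\<lambda>q v. \<Sum>i\<in>I. k i * \<alpha> i q v) ?c e) (snd ?c p) h
      = (\<Sum>i\<in>I. k i * fd (form_comp A (\<alpha> i) ?c e) (snd ?c p) h)" for e h
  proof -
    have D: "((\<lambda>x. \<Sum>i\<in>I. k i * form_comp A (\<alpha> i) ?c e x) has_derivative
        (\<lambda>h. \<Sum>i\<in>I. k i * fd (form_comp A (\<alpha> i) ?c e) (snd ?c p) h)) (at (snd ?c p))"
      by (intro has_derivative_sum has_derivative_mult_right
          smooth_on_has_derivative[OF smooth_formD(2)[OF \<alpha>(1) c(1)] is_openD[OF W(1) c(1)]])
        (use W c in auto)
    moreover have "form_comp A (\<lambda>q v. \<Sum>i\<in>I. k i * \<alpha> i q v) ?c e = (\<lambda>x. \<Sum>i\<in>I. k i * form_comp A (\<alpha> i) ?c e x)"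
      by (simp add: form_comp_def fun_eq_iff)
    ultimately show ?thesis by (simp only: fd_eqI[OF D])
  qed
  then show ?thesis
    by (simp add: ext_deriv_def Let_def sum_subtractf[symmetric] right_diff_distrib)
qed

lemma smooth_form_linear_comb:
  assumes \<alpha>: "\<And>i. i \<in> I \<Longrightarrow> smooth_form A W (\<alpha> i)" "finite I" and W: "is_open A W"
  shows "smooth_form A W (\<lambda>q v. \<Sum>i\<in>I. k i * \<alpha> i q v)"
  unfolding smooth_form_def
proof (intro conjI ballI allI)
  fix p assume "p \<in> W"
  then have "linear (\<alpha> i p)" if "i \<in> I" for i using smooth_formD(1)[OF \<alpha>(1)[OF that]] by blast
  then show "linear (\<lambda>v. \<Sum>i\<in>I. k i * \<alpha> i p v)"
    by (intro linear_compose_sum ballI linear_compose[of "\<alpha> _ p" "\<lambda>z. k _ * z", unfolded comp_def])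
      (auto simp: linear_iff algebra_simps)
next
  fix c e assume c: "c \<in> A"
  have "smooth_on (snd c ` (W \<inter> fst c)) (\<lambda>x. \<Sum>i\<in>I. k i * form_comp A (\<alpha> i) c e x)"
    by (intro smooth_on_intros is_openD[OF W c] \<alpha>(2) smooth_formD(2)[OF \<alpha>(1) c])
  then show "smooth_on (snd c ` (W \<inter> fst c)) (form_comp A (\<lambda>q v. \<Sum>i\<in>I. k i * \<alpha> i q v) c e)"
    by (simp add: form_comp_def[abs_def])
qed

section \<open>Complex covectors\<close>

lemma re_vec_add: "re_vec (z + w) = re_vec z + re_vec w"
  and im_vec_add: "im_vec (z + w) = im_vec z + im_vec w"
  and re_vec_smult: "re_vec (k *s z) = Re k *\<^sub>R re_vec z - Im k *\<^sub>R im_vec z"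
  and im_vec_smult: "im_vec (k *s z) = Re k *\<^sub>R im_vec z + Im k *\<^sub>R re_vec z"
  by (simp_all add: re_vec_def im_vec_def vec_eq_iff)

definition cx_vec :: "real ^ 3 \<Rightarrow> complex ^ 3" where
  "cx_vec u = (\<chi> i. of_real (u $ i))"

lemma re_cx_vec [simp]: "re_vec (cx_vec u) = u" and im_cx_vec [simp]: "im_vec (cx_vec u) = 0"
  by (simp_all add: re_vec_def im_vec_def cx_vec_def vec_eq_iff)

lemma cx_covec_cx_vec [simp]: "linear \<theta> \<Longrightarrow> cx_covec \<theta> (cx_vec u) = \<theta> u"
  by (simp add: cx_covec_def linear_0)

lemma cx_covec_add: "linear \<theta> \<Longrightarrow> cx_covec \<theta> (z + w) = cx_covec \<theta> z + cx_covec \<theta> w"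
  by (simp add: cx_covec_def re_vec_add im_vec_add linear_add algebra_simps)

lemma cx_covec_smult:
  assumes "linear \<theta>" shows "cx_covec \<theta> (k *s z) = k * cx_covec \<theta> z"
proof -
  have "Complex (Re k) (Im k) = k" by simp
  then have k: "k = of_real (Re k) + \<i> * of_real (Im k)" by (metis Complex_eq)
  have "cx_covec \<theta> (k *s z) = (of_real (Re k) + \<i> * of_real (Im k)) * cx_covec \<theta> z"
    using assms unfolding cx_covec_def re_vec_smult im_vec_smult
    by (simp add: linear_add linear_diff linear_scale) (simp add: scaleR_conv_of_real algebra_simps)
  then show ?thesis using k by simp
qed

lemma cx_covec_scale: "cx_covec (\<lambda>u. k * \<theta> u) z = k * cx_covec \<theta> z"
  by (simp add: cx_covec_def algebra_simps)

lemma cx_covec_sum: "cx_covec (\<lambda>u. \<theta> u + \<theta>' u) z = cx_covec \<theta> z + cx_covec \<theta>' z"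
  by (simp add: cx_covec_def algebra_simps)

lemma cx_covec_diff: "linear \<theta> \<Longrightarrow> cx_covec \<theta> (z - w) = cx_covec \<theta> z - cx_covec \<theta> w"
  using cx_covec_add[of \<theta> "z - w" w] by simp

lemma linear_mult_left: "linear \<theta> \<Longrightarrow> linear (\<lambda>u. (k::complex) * \<theta> u)"
  by (simp add: linear_iff algebra_simps)

text \<open>A suitable complex multiple of u0 subtracted from u lies in the complexified kernel of
  \<theta>. Working over the complex numbers is essential: dx + i dy and dx - i dy have the same
  real kernel without being proportional.\<close>

lemma covec_multiple:
  assumes "linear \<theta>" "linear \<alpha>" "\<theta> u0 \<noteq> 0" "cx_ker \<theta> \<subseteq> cx_ker \<alpha>"
  shows "\<alpha> u = \<alpha> u0 / \<theta> u0 * \<theta> u"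
proof -
  let ?z = "cx_vec u - (\<theta> u / \<theta> u0) *s cx_vec u0"
  have "cx_covec \<theta> ?z = 0" using assms by (simp add: cx_covec_diff cx_covec_smult)
  then have "cx_covec \<alpha> ?z = 0" using assms(4) by (auto simp: cx_ker_def)
  then show ?thesis using assms by (simp add: cx_covec_diff cx_covec_smult)
qed

section \<open>The bundle \<open>E\<close>\<close>

lemma smooth_on_compose_fst:
  assumes "open S" "open L" "smooth_on S g"
  shows "smooth_on (S \<times> L) (\<lambda>q. g (fst q))"
  using assms by (intro smooth_on_compose[of "S \<times> L" S fst g])
    (auto intro: open_Times smooth_on_bounded_linear bounded_linear_fst)

locale flag_manifold =
  fixes A :: "('m, real ^ 3) atlas" and T1 T2 :: "'m \<Rightarrow> (complex ^ 3) set"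
  assumes man: "smooth_manifold A" and flag: "flag_structure A T1 T2"
begin

abbreviation "ES \<equiv> E_set A T1 T2"
abbreviation "EA \<equiv> E_atlas A T1 T2"

lemma smA: "smooth_atlas A"
  using man by (simp add: smooth_manifold_def)

lemma line_subbundle_fibre:
  assumes "cx_line_subbundle A T" "x \<in> points A"
  shows "\<exists>X. X \<noteq> 0 \<and> T x = range (\<lambda>k. k *s X)"
proof -
  obtain U and X :: "'m \<Rightarrow> complex ^ 3" where
    "is_open A U \<and> x \<in> U \<and> smooth_cx_field A U X \<and> (\<forall>q\<in>U. X q \<noteq> 0 \<and> T q = range (\<lambda>k. k *s X q))"
    using bspec[OF assms(1)[unfolded cx_line_subbundle_def] assms(2)] by (elim exE) (rule that)
  then have "X x \<noteq> 0 \<and> T x = range (\<lambda>k. k *s X x)" by simp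
  then show ?thesis by (rule exI)
qed

lemma T1_line: "x \<in> points A \<Longrightarrow> \<exists>X. X \<noteq> 0 \<and> T1 x = range (\<lambda>k. k *s X)"
  and T2_line: "x \<in> points A \<Longrightarrow> \<exists>X. X \<noteq> 0 \<and> T2 x = range (\<lambda>k. k *s X)"
  using flag by (simp_all add: flag_structure_def line_subbundle_fibre)

lemma T12: "x \<in> points A \<Longrightarrow> T1 x \<inter> T2 x = {0}"
  using flag by (simp add: flag_structure_def)

lemma contact_form:
  assumes "x \<in> points A"
  obtains U \<theta> where "is_open A U" "x \<in> U" "smooth_form A U \<theta>" "\<And>q. q \<in> U \<Longrightarrow> (q, \<theta> q) \<in> ES"
    "\<And>q. q \<in> U \<Longrightarrow> \<exists>u v w. ext_deriv A \<theta> q u v * \<theta> q w + ext_deriv A \<theta> q v w * \<theta> q u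
                   + ext_deriv A \<theta> q w u * \<theta> q v \<noteq> 0"
proof -
  have *: "\<forall>p\<in>points A. \<exists>U \<theta>. is_open A U \<and> p \<in> U \<and> smooth_form A U \<theta> \<and>
        (\<forall>q\<in>U. cx_ker (\<theta> q) = plane_sum (T1 q) (T2 q) \<and>
           (\<exists>u v w. ext_deriv A \<theta> q u v * \<theta> q w + ext_deriv A \<theta> q v w * \<theta> q u
                   + ext_deriv A \<theta> q w u * \<theta> q v \<noteq> 0))"
    using flag unfolding flag_structure_def by (elim conjE)
  obtain U \<theta> where U: "is_open A U \<and> x \<in> U \<and> smooth_form A U \<theta> \<and>
        (\<forall>q\<in>U. cx_ker (\<theta> q) = plane_sum (T1 q) (T2 q) \<and>
           (\<exists>u v w. ext_deriv A \<theta> q u v * \<theta> q w + ext_deriv A \<theta> q v w * \<theta> q u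
                   + ext_deriv A \<theta> q w u * \<theta> q v \<noteq> 0))"
    using bspec[OF * assms] by (elim exE) (rule that)
  then have "(q, \<theta> q) \<in> ES" if "q \<in> U" for q
    using that by (auto simp: E_set_def is_open_def smooth_form_def)
  with U show thesis
    by (intro that[of U \<theta>]) simp_all
qed

lemma E_setD:
  assumes "(x, \<theta>) \<in> ES"
  shows "x \<in> points A" "linear \<theta>" "cx_ker \<theta> = plane_sum (T1 x) (T2 x)"
  using assms by (auto simp: E_set_def)

text \<open>The contact condition excludes a zero of the local form \<theta>0, and a covector with
  the same complexified kernel as a nonzero one is nonzero.\<close>

lemma E_nonzero:
  assumes "(x, \<theta>) \<in> ES"
  obtains u where "\<theta> u \<noteq> 0"
proof -
  obtain U \<theta>0 where "is_open A U" "smooth_form A U \<theta>0" and U: "x \<in> U" "\<And>q. q \<in> U \<Longrightarrow> (q, \<theta>0 q) \<in> ES"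
    "\<And>q. q \<in> U \<Longrightarrow> \<exists>u v w. ext_deriv A \<theta>0 q u v * \<theta>0 q w + ext_deriv A \<theta>0 q v w * \<theta>0 q u
                   + ext_deriv A \<theta>0 q w u * \<theta>0 q v \<noteq> 0"
    by (rule contact_form[OF E_setD(1)[OF assms]]) (rule that)
  have "\<exists>u. \<theta>0 x u \<noteq> 0"
  proof (rule ccontr)
    assume "\<not> (\<exists>u. \<theta>0 x u \<noteq> 0)"
    then show False using U(3)[OF U(1)] by simp
  qed
  then obtain u where u: "\<theta>0 x u \<noteq> 0" by (rule exE)
  have "cx_vec u \<notin> cx_ker (\<theta>0 x)" using u E_setD(2)[OF U(2)[OF U(1)]] by (simp add: cx_ker_def)
  then have "cx_vec u \<notin> cx_ker \<theta>" using E_setD(3)[OF U(2)[OF U(1)]] E_setD(3)[OF assms] by simp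
  then show thesis using that E_setD(2)[OF assms] by (simp add: cx_ker_def)
qed

lemma E_scale:
  assumes "(x, \<theta>) \<in> ES" "l \<noteq> 0"
  shows "(x, \<lambda>u. l * \<theta> u) \<in> ES"
  using assms by (auto simp: E_set_def linear_mult_left cx_ker_def cx_covec_scale)

lemma E_proportional:
  assumes "(x, \<theta>) \<in> ES" "(x, \<theta>') \<in> ES"
  obtains l where "l \<noteq> 0" "\<theta> = (\<lambda>u. l * \<theta>' u)"
proof -
  obtain u0 where u0: "\<theta>' u0 \<noteq> 0" using E_nonzero[OF assms(2)] .
  have *: "\<theta> u = \<theta> u0 / \<theta>' u0 * \<theta>' u" for u
    using assms E_setD u0 by (intro covec_multiple) auto
  obtain u1 where "\<theta> u1 \<noteq> 0" using E_nonzero[OF assms(1)] .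
  then have "\<theta> u0 / \<theta>' u0 \<noteq> 0" using *[of u1] by auto
  then show thesis using that[of "\<theta> u0 / \<theta>' u0"] * by blast
qed

lemma fst_dilate [simp]: "fst (dilate l \<epsilon>) = fst \<epsilon>"
  by (simp add: dilate_def)

lemma dilate_dilate: "dilate k (dilate l \<epsilon>) = dilate (k * l) \<epsilon>"
  by (simp add: dilate_def mult.assoc)

lemma dilate_1 [simp]: "dilate 1 \<epsilon> = \<epsilon>"
  by (simp add: dilate_def)

lemma dilate_in: "\<epsilon> \<in> ES \<Longrightarrow> l \<noteq> 0 \<Longrightarrow> dilate l \<epsilon> \<in> ES"
  using E_scale[of "fst \<epsilon>" "snd \<epsilon>" l] by (simp add: dilate_def)

section \<open>Charts of E attached to a local contact form\<close>

definition Edata :: "('m, real ^ 3) chart \<Rightarrow> 'm set \<Rightarrow> ('m \<Rightarrow> (real ^ 3) covec) \<Rightarrow> bool" where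
  "Edata c U \<theta> \<longleftrightarrow> c \<in> A \<and> is_open A U \<and> U \<subseteq> fst c \<and> smooth_form A U \<theta> \<and> (\<forall>x\<in>U. (x, \<theta> x) \<in> ES)"

definition Echart :: "('m, real ^ 3) chart \<Rightarrow> 'm set \<Rightarrow> ('m \<Rightarrow> (real ^ 3) covec) \<Rightarrow> ('m Ept, Emod) chart" where
  "Echart c U \<theta> = ({\<epsilon> \<in> ES. fst \<epsilon> \<in> U}, \<lambda>\<epsilon>. (snd c (fst \<epsilon>), THE l. \<epsilon> = dilate l (fst \<epsilon>, \<theta> (fst \<epsilon>))))"

lemma E_atlas_eq: "EA = {Echart c U \<theta> | c U \<theta>. Edata c U \<theta>}"
  by (simp add: E_atlas_def Echart_def Edata_def)

lemma EdataD:
  assumes "Edata c U \<theta>"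
  shows "c \<in> A" "is_open A U" "U \<subseteq> fst c" "smooth_form A U \<theta>" "x \<in> U \<Longrightarrow> (x, \<theta> x) \<in> ES"
  using assms by (auto simp: Edata_def)

lemma Echart_in: "Edata c U \<theta> \<Longrightarrow> Echart c U \<theta> \<in> EA"
  unfolding E_atlas_eq by blast

lemma E_atlasE:
  assumes "C \<in> EA" obtains c U \<theta> where "C = Echart c U \<theta>" "Edata c U \<theta>"
  using assms unfolding E_atlas_eq by blast

lemma Echart_dom: "\<epsilon> \<in> fst (Echart c U \<theta>) \<longleftrightarrow> \<epsilon> \<in> ES \<and> fst \<epsilon> \<in> U"
  by (simp add: Echart_def)

lemma Echart_val:
  assumes "Edata c U \<theta>" "x \<in> U"
  shows "snd (Echart c U \<theta>) (x, \<lambda>u. l * \<theta> x u) = (snd c x, l)"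
proof -
  obtain u where "\<theta> x u \<noteq> 0" using E_nonzero EdataD(5)[OF assms] by blast
  then have "(\<lambda>u. l * \<theta> x u) = (\<lambda>u. k * \<theta> x u) \<longleftrightarrow> k = l" for k
    by (auto simp: fun_eq_iff)
  then show ?thesis by (simp add: Echart_def dilate_def)
qed

lemma Echart_pt: "Edata c U \<theta> \<Longrightarrow> x \<in> U \<Longrightarrow> l \<noteq> 0 \<Longrightarrow> (x, \<lambda>u. l * \<theta> x u) \<in> fst (Echart c U \<theta>)"
  using E_scale EdataD(5) by (simp add: Echart_dom)

lemma Echart_cases:
  assumes "Edata c U \<theta>" "\<epsilon> \<in> fst (Echart c U \<theta>)"
  obtains x l where "x \<in> U" "l \<noteq> 0" "\<epsilon> = (x, \<lambda>u. l * \<theta> x u)"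
proof -
  obtain x \<theta>' where \<epsilon>: "\<epsilon> = (x, \<theta>')" by fastforce
  then have "(x, \<theta>') \<in> ES" "x \<in> U" using assms(2) by (auto simp: Echart_dom)
  then show thesis using E_proportional[of x \<theta>' "\<theta> x"] EdataD(5)[OF assms(1)] that \<epsilon> by metis
qed

lemma Echart_inj:
  assumes "Edata c U \<theta>" shows "inj_on (snd (Echart c U \<theta>)) (fst (Echart c U \<theta>))"
proof (rule inj_onI)
  fix \<epsilon> \<epsilon>' assume e: "\<epsilon> \<in> fst (Echart c U \<theta>)" "\<epsilon>' \<in> fst (Echart c U \<theta>)"
    and eq: "snd (Echart c U \<theta>) \<epsilon> = snd (Echart c U \<theta>) \<epsilon>'"
  obtain x l x' l' where x: "x \<in> U" "\<epsilon> = (x, \<lambda>u. l * \<theta> x u)" "x' \<in> U" "\<epsilon>' = (x', \<lambda>u. l' * \<theta> x' u)"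
    using Echart_cases[OF assms] e by metis
  then have "snd c x = snd c x'" "l = l'"
    using eq Echart_val[OF assms] by auto
  then show "\<epsilon> = \<epsilon>'"
    using x chart_inj[OF smA EdataD(1)[OF assms]] EdataD(3)[OF assms] by (auto simp: inj_on_def)
qed

lemma Echart_image:
  assumes "Edata c U \<theta>" "V \<subseteq> U"
  shows "snd (Echart c U \<theta>) ` {\<epsilon> \<in> ES. fst \<epsilon> \<in> V} = (snd c ` V) \<times> (- {0::complex})"
proof (intro equalityI subsetI)
  fix q assume "q \<in> snd (Echart c U \<theta>) ` {\<epsilon> \<in> ES. fst \<epsilon> \<in> V}"
  then obtain \<epsilon> where e: "q = snd (Echart c U \<theta>) \<epsilon>" "\<epsilon> \<in> ES" "fst \<epsilon> \<in> V" by auto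
  then obtain x l where "x \<in> U" "l \<noteq> 0" "\<epsilon> = (x, \<lambda>u. l * \<theta> x u)"
    using Echart_cases[OF assms(1), of \<epsilon>] assms(2) by (auto simp: Echart_dom)
  then show "q \<in> (snd c ` V) \<times> (- {0})"
    using e Echart_val[OF assms(1)] by auto
next
  fix q assume "q \<in> (snd c ` V) \<times> (- {0::complex})"
  then obtain x l where q: "q = (snd c x, l)" "x \<in> V" "l \<noteq> 0" by auto
  then have "(x, \<lambda>u. l * \<theta> x u) \<in> {\<epsilon> \<in> ES. fst \<epsilon> \<in> V}" "q = snd (Echart c U \<theta>) (x, \<lambda>u. l * \<theta> x u)"
    using Echart_pt[OF assms(1), of x l] Echart_val[OF assms(1), of x l] assms(2) by (auto simp: Echart_dom)
  then show "q \<in> snd (Echart c U \<theta>) ` {\<epsilon> \<in> ES. fst \<epsilon> \<in> V}" by blast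
qed

lemma Echart_inv:
  assumes "Edata c U \<theta>" "x \<in> U" "l \<noteq> 0"
  shows "chart_inv (Echart c U \<theta>) (snd c x, l) = (x, \<lambda>u. l * \<theta> x u)"
  unfolding chart_inv_def
  using inv_into_f_f[OF Echart_inj[OF assms(1)] Echart_pt[OF assms]] Echart_val[OF assms(1,2)] by simp

lemma open_base_image:
  assumes "Edata c U \<theta>" "is_open A V" "V \<subseteq> U"
  shows "open (snd c ` V)"
proof -
  have "V \<inter> fst c = V" using assms EdataD(3) by blast
  then show ?thesis using is_openD[OF assms(2) EdataD(1)[OF assms(1)]] by simp
qed

text \<open>Two proportional smooth forms have a smooth ratio where the second has no zeros: at each
  point some component of \<theta>' can serve as denominator in
  \<open>smooth_on_ratio\<close>.\<close>

lemma scale_factor_smooth: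
  assumes "Edata c U \<theta>" "Edata c' U' \<theta>'" and r: "\<And>x u. x \<in> U \<inter> U' \<Longrightarrow> \<theta> x u = r x * \<theta>' x u"
  shows "smooth_on (snd c ` (U \<inter> U')) (\<lambda>z. r (chart_inv c z))"
proof -
  note D = EdataD[OF assms(1)] EdataD[OF assms(2)]
  have UU: "U \<inter> U' \<inter> fst c = U \<inter> U'" using D(3) by blast
  have op: "open (snd c ` (U \<inter> U'))"
    using open_base_image[OF assms(1) is_open_inter[OF smA D(2,7)]] by blast
  have "smooth_on (snd c ` (U \<inter> U')) (form_comp A \<theta> c e)"
    "smooth_on (snd c ` (U \<inter> U')) (form_comp A \<theta>' c e)" for e
    using smooth_formD(2)[OF smooth_form_subset[OF D(4), of "U \<inter> U'"] D(1)]
      smooth_formD(2)[OF smooth_form_subset[OF D(9), of "U \<inter> U'"] D(1)] by (simp_all add: UU)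
  then show ?thesis
  proof (rule smooth_on_ratio[OF op])
    fix z assume "z \<in> snd c ` (U \<inter> U')"
    then obtain x where x: "z = snd c x" "x \<in> U" "x \<in> U'" "x \<in> fst c" using D(3) by auto
    then show "form_comp A \<theta> c e z = r (chart_inv c z) * form_comp A \<theta>' c e z" for e
      using r by (simp add: form_comp_at[OF smA D(1)] chart_inv_left[OF smA D(1)])
    obtain u where "\<theta>' x u \<noteq> 0" using E_nonzero D(10)[OF x(3)] by blast
    then show "\<exists>e. form_comp A \<theta>' c e z \<noteq> 0"
      using x by (intro exI[of _ "to_chart A c x u"]) (simp add: form_comp_at[OF smA D(1)] from_to_chart[OF smA D(1)])
  qed
qed

lemma E_atlas_smooth: "smooth_atlas EA"
  unfolding smooth_atlas_def
proof (intro conjI ballI)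
  fix C assume "C \<in> EA"
  then obtain c U \<theta> where C: "C = Echart c U \<theta>" "Edata c U \<theta>" by (rule E_atlasE)
  note D = EdataD[OF C(2)]
  show "inj_on (snd C) (fst C)" using C Echart_inj by simp
  have "fst C = {\<epsilon> \<in> ES. fst \<epsilon> \<in> U}" by (simp add: C Echart_def)
  then have "snd C ` fst C = (snd c ` U) \<times> (- {0})" using Echart_image[OF C(2)] C by simp
  then show "open (snd C ` fst C)"
    using open_base_image[OF C(2) D(2)] by (auto intro!: open_Times)
  fix C' assume "C' \<in> EA"
  then obtain c' U' \<theta>' where C': "C' = Echart c' U' \<theta>'" "Edata c' U' \<theta>'" by (rule E_atlasE)
  note D' = EdataD[OF C'(2)]
  have "fst C \<inter> fst C' = {\<epsilon> \<in> ES. fst \<epsilon> \<in> U \<inter> U'}" by (auto simp: C C' Echart_def)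
  then have im: "snd C ` (fst C \<inter> fst C') = (snd c ` (U \<inter> U')) \<times> (- {0})"
    using Echart_image[OF C(2), of "U \<inter> U'"] C by simp
  have op: "open (snd c ` (U \<inter> U'))"
    using open_base_image[OF C(2) is_open_inter[OF smA D(2) D'(2)]] by blast
  show "open (snd C ` (fst C \<inter> fst C'))"
    unfolding im using op by (auto intro!: open_Times)
  define r where "r x = (SOME r. \<theta> x = (\<lambda>u. r * \<theta>' x u))" for x
  have r: "\<theta> x u = r x * \<theta>' x u" if "x \<in> U \<inter> U'" for x u
  proof -
    have "\<exists>r. \<theta> x = (\<lambda>u. r * \<theta>' x u)"
      using E_proportional[of x "\<theta> x" "\<theta>' x"] D(5) D'(5) that by blast
    then have "\<theta> x = (\<lambda>u. r x * \<theta>' x u)" unfolding r_def by (rule someI_ex)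
    then show ?thesis by metis
  qed
  note op' = op open_Compl[OF closed_singleton[of "0::complex"]]
  show "smooth_on (snd C ` (fst C \<inter> fst C')) (snd C' \<circ> chart_inv C)"
    unfolding im
  proof (rule smooth_on_cong)
    show opp: "open ((snd c ` (U \<inter> U')) \<times> (- {0::complex}))" using op' by (rule open_Times)
    have "smooth_on (snd c ` (U \<inter> U')) (\<lambda>z. snd c' (chart_inv c z))"
      by (rule smooth_on_subset[OF trans_smooth[OF smA D(1) D'(1)]]) (use D(3) D'(3) in blast)
    then show "smooth_on ((snd c ` (U \<inter> U')) \<times> (- {0})) (\<lambda>q. (snd c' (chart_inv c (fst q)), snd q * r (chart_inv c (fst q))))"
      using scale_factor_smooth[OF C(2) C'(2) r]
      by (intro smooth_on_intros opp smooth_on_compose_fst[OF op'])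
    fix q assume "q \<in> (snd c ` (U \<inter> U')) \<times> (- {0::complex})"
    then obtain x l where q: "q = (snd c x, l)" "x \<in> U" "x \<in> U'" "l \<noteq> 0" by auto
    have "(\<lambda>u. l * \<theta> x u) = (\<lambda>u. l * r x * \<theta>' x u)"
      using r[of x] q by (auto simp: mult.assoc)
    then show "(snd c' (chart_inv c (fst q)), snd q * r (chart_inv c (fst q))) = (snd C' \<circ> chart_inv C) q"
      using q D(3) Echart_inv[OF C(2) q(2,4)] Echart_val[OF C'(2) q(3), of "l * r x"] chart_inv_left[OF smA D(1), of x]
      by (auto simp: C C')
  qed
qed

lemma is_open_restrict:
  assumes "c \<in> A" "is_open A U" shows "is_open A (U \<inter> fst c)"
  using assms by (intro is_open_inter smA is_open_chart)

lemma E_points: "points EA = ES"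
proof (intro equalityI subsetI)
  fix \<epsilon> assume "\<epsilon> \<in> points EA"
  then show "\<epsilon> \<in> ES" by (auto simp: points_def E_atlas_eq Echart_def)
next
  fix \<epsilon> assume e: "\<epsilon> \<in> ES"
  then have x: "fst \<epsilon> \<in> points A" using E_setD(1)[of "fst \<epsilon>" "snd \<epsilon>"] by simp
  then obtain U \<theta> where U: "is_open A U" "fst \<epsilon> \<in> U" "smooth_form A U \<theta>" "\<And>q. q \<in> U \<Longrightarrow> (q, \<theta> q) \<in> ES"
    using contact_form by metis
  let ?c = "chart_at A (fst \<epsilon>)"
  have c: "?c \<in> A" "fst \<epsilon> \<in> fst ?c" using chart_at[OF x] by auto
  have "Edata ?c (U \<inter> fst ?c) \<theta>"
    using U c is_open_restrict smooth_form_subset[OF U(3)] by (simp add: Edata_def)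
  from Echart_in[OF this] show "\<epsilon> \<in> points EA"
    using e U(2) c unfolding points_def by (intro UnionI[of "fst (Echart ?c (U \<inter> fst ?c) \<theta>)"]) (auto simp: Echart_dom)
qed

section \<open>Projection and dilations of E in coordinates\<close>

lemma smooth_at_E_fst:
  assumes "Edata c U \<theta>" "\<epsilon> \<in> fst (Echart c U \<theta>)"
  shows "smooth_at EA A fst \<epsilon>"
    and "tangent_map EA A fst \<epsilon> (from_chart EA (Echart c U \<theta>) \<epsilon> e) = from_chart A c (fst \<epsilon>) (fst e)"
proof -
  note D = EdataD[OF assms(1)]
  note * = smooth_at_coordI[OF E_atlas_smooth smA Echart_in[OF assms(1)] assms(2) D(1), of fst fst]
  have dom: "fst q \<in> fst c" "snd c (fst q) = fst (snd (Echart c U \<theta>) q)" if "q \<in> fst (Echart c U \<theta>)" for q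
    using that D(3) by (auto simp: Echart_def)
  have sm: "smooth_on S fst" for S :: "Emod set" by (rule smooth_on_bounded_linear[OF bounded_linear_fst])
  show "smooth_at EA A fst \<epsilon>" by (rule *(1)[OF dom sm])
  have "fd fst x = (fst :: Emod \<Rightarrow> _)" for x
    by (rule fd_eqI) (auto intro: derivative_intros)
  then show "tangent_map EA A fst \<epsilon> (from_chart EA (Echart c U \<theta>) \<epsilon> e) = from_chart A c (fst \<epsilon>) (fst e)"
    using *(2)[OF dom sm] by simp
qed

lemma Echart_dilate:
  assumes "Edata c U \<theta>" "\<epsilon> \<in> fst (Echart c U \<theta>)" "k \<noteq> 0"
  shows "dilate k \<epsilon> \<in> fst (Echart c U \<theta>)"
    and "snd (Echart c U \<theta>) (dilate k \<epsilon>) = (fst (snd (Echart c U \<theta>) \<epsilon>), k * snd (snd (Echart c U \<theta>) \<epsilon>))"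
proof -
  show "dilate k \<epsilon> \<in> fst (Echart c U \<theta>)"
    using assms by (auto simp: Echart_dom dilate_in)
  obtain x l where x: "x \<in> U" "l \<noteq> 0" "\<epsilon> = (x, \<lambda>u. l * \<theta> x u)" using Echart_cases[OF assms(1,2)] .
  then have "dilate k \<epsilon> = (x, \<lambda>u. (k * l) * \<theta> x u)" by (simp add: dilate_def mult.assoc)
  then show "snd (Echart c U \<theta>) (dilate k \<epsilon>) = (fst (snd (Echart c U \<theta>) \<epsilon>), k * snd (snd (Echart c U \<theta>) \<epsilon>))"
    using x Echart_val[OF assms(1) x(1)] by simp
qed

lemma smooth_at_dilate:
  assumes "Edata c U \<theta>" "\<epsilon> \<in> fst (Echart c U \<theta>)" "k \<noteq> 0"
  shows "smooth_at EA EA (dilate k) \<epsilon>"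
    and "tangent_map EA EA (dilate k) \<epsilon> (from_chart EA (Echart c U \<theta>) \<epsilon> (u, m))
       = from_chart EA (Echart c U \<theta>) (dilate k \<epsilon>) (u, k * m)"
proof -
  let ?g = "\<lambda>q :: Emod. (fst q, k * snd q)"
  note C = Echart_in[OF assms(1)]
  note * = smooth_at_coordI[OF E_atlas_smooth E_atlas_smooth C assms(2) C, of "dilate k" ?g]
  note dom = Echart_dilate[OF assms(1) _ assms(3)]
  have sm: "smooth_on (snd (Echart c U \<theta>) ` fst (Echart c U \<theta>)) ?g"
    by (intro smooth_on_intros open_chart_image[OF E_atlas_smooth C])
  show "smooth_at EA EA (dilate k) \<epsilon>" by (rule *(1)[OF dom sm])
  have "fd ?g x = ?g" for x
    by (rule fd_eqI) (auto intro!: derivative_eq_intros)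
  then show "tangent_map EA EA (dilate k) \<epsilon> (from_chart EA (Echart c U \<theta>) \<epsilon> (u, m))
       = from_chart EA (Echart c U \<theta>) (dilate k \<epsilon>) (u, k * m)"
    using *(2)[OF dom sm] by simp
qed

section \<open>The tautological form of E and its differential\<close>

abbreviation "taut \<equiv> E_taut A T1 T2"
abbreviation "TE \<equiv> tangent_map EA A fst"

lemma taut_from_chart:
  assumes "Edata c U \<theta>" "x \<in> U" "l \<noteq> 0"
  shows "taut (x, \<lambda>u. l * \<theta> x u) (from_chart EA (Echart c U \<theta>) (x, \<lambda>u. l * \<theta> x u) e)
    = l * form_comp A \<theta> c (fst e) (snd c x)"
  using assms EdataD[OF assms(1)] Echart_pt[OF assms] smooth_at_E_fst(2)[OF assms(1) Echart_pt[OF assms], of e]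
  by (simp add: E_taut_def form_comp_at[OF smA EdataD(1)[OF assms(1)]] subsetD)

lemma E_cases:
  assumes "\<epsilon> \<in> ES"
  obtains c U \<theta> where "Edata c U \<theta>" "\<epsilon> \<in> fst (Echart c U \<theta>)"
proof -
  have "chart_at EA \<epsilon> \<in> EA" "\<epsilon> \<in> fst (chart_at EA \<epsilon>)" using chart_at[of \<epsilon> EA] assms E_points by auto
  then show thesis using E_atlasE[of "chart_at EA \<epsilon>"] that by metis
qed

lemma TE_linear: "\<epsilon> \<in> ES \<Longrightarrow> linear (TE \<epsilon>)"
  by (metis E_cases smooth_at_E_fst(1) tangent_map_linear[OF E_atlas_smooth smA])

lemma TE_surj:
  assumes "\<epsilon> \<in> ES" shows "\<exists>e. TE \<epsilon> e = u"
proof -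
  obtain c U \<theta> where C: "Edata c U \<theta>" "\<epsilon> \<in> fst (Echart c U \<theta>)" using E_cases[OF assms] .
  then have "fst \<epsilon> \<in> fst c" using EdataD(3)[OF C(1)] by (auto simp: Echart_dom)
  then have "TE \<epsilon> (from_chart EA (Echart c U \<theta>) \<epsilon> (to_chart A c (fst \<epsilon>) u, 0)) = u"
    using smooth_at_E_fst(2)[OF C] from_to_chart[OF smA EdataD(1)[OF C(1)]] by simp
  then show ?thesis by blast
qed

lemma taut_smooth: "smooth_form EA ES taut"
  unfolding smooth_form_def
proof (intro conjI ballI allI)
  fix \<epsilon> assume "\<epsilon> \<in> ES"
  then show "linear (taut \<epsilon>)"
    unfolding E_taut_def using linear_compose[OF TE_linear] E_setD(2)[of "fst \<epsilon>" "snd \<epsilon>"] by simp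
next
  fix C and e :: Emod assume "C \<in> EA"
  then obtain c U \<theta> where C: "C = Echart c U \<theta>" "Edata c U \<theta>" by (rule E_atlasE)
  note D = EdataD[OF C(2)]
  have im: "snd C ` (ES \<inter> fst C) = (snd c ` U) \<times> (- {0})"
    using Echart_image[OF C(2), of U] by (simp add: C Int_def Echart_dom conj_assoc)
  have op: "open (snd c ` U)" "open (- {0::complex})"
    using open_base_image[OF C(2) D(2)] by auto
  have U: "U \<inter> fst c = U" using D(3) by blast
  have sm: "smooth_on (snd c ` U) (form_comp A \<theta> c (fst e))"
    using smooth_formD(2)[OF D(4,1), of "fst e"] by (simp add: U)
  show "smooth_on (snd C ` (ES \<inter> fst C)) (form_comp EA taut C e)"
    unfolding im
  proof (rule smooth_on_cong)
    show opp: "open (snd c ` U \<times> (- {0::complex}))" using op by (rule open_Times)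
    show "smooth_on (snd c ` U \<times> (- {0})) (\<lambda>q. snd q * form_comp A \<theta> c (fst e) (fst q))"
      using sm by (intro smooth_on_intros opp smooth_on_compose_fst op)
    fix q assume "q \<in> snd c ` U \<times> (- {0::complex})"
    then obtain x l where q: "q = (snd c x, l)" "x \<in> U" "l \<noteq> 0" by auto
    then show "snd q * form_comp A \<theta> c (fst e) (fst q) = form_comp EA taut C e q"
      using taut_from_chart[OF C(2) q(2,3), of e]
      by (simp add: form_comp_def Echart_inv[OF C(2)] C)
  qed
qed

text \<open>In the coordinates (x, l) the tautological form is l\<theta>, whose differential is dl
  \<and> \<theta> + l d\<theta>; here m and m' are the dl-components of the two vectors.\<close>

lemma ext_deriv_taut:
  assumes "Edata c U \<theta>" "x \<in> U" "l \<noteq> 0"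
  defines "z \<equiv> snd c x" and "\<epsilon> \<equiv> (x, \<lambda>u. l * \<theta> x u)" and "C \<equiv> Echart c U \<theta>"
  shows "ext_deriv EA taut \<epsilon> (from_chart EA C \<epsilon> (u, m)) (from_chart EA C \<epsilon> (u', m'))
    = m * form_comp A \<theta> c u' z - m' * form_comp A \<theta> c u z
      + l * (fd (form_comp A \<theta> c u') z u - fd (form_comp A \<theta> c u) z u')"
proof -
  note D = EdataD[OF assms(1)]
  have C: "C \<in> EA" "\<epsilon> \<in> fst C" using Echart_in assms(1) Echart_pt[OF assms(1-3)] by (auto simp: C_def \<epsilon>_def)
  have op: "open (snd c ` U)" "open (- {0::complex})"
    using open_base_image[OF assms(1) D(2)] by auto
  have U: "U \<inter> fst c = U" using D(3) by blast
  have q: "(z, l) \<in> snd c ` U \<times> (- {0})" using assms by auto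
  have Ce: "snd C \<epsilon> = (z, l)" using Echart_val[OF assms(1,2)] by (simp add: C_def \<epsilon>_def z_def)
  have "fd (form_comp EA taut C (v, n)) (z, l) (w, k)
      = k * form_comp A \<theta> c v z + l * fd (form_comp A \<theta> c v) z w" for v n w k
  proof -
    have "z \<in> snd c ` U" using assms by auto
    then have "(form_comp A \<theta> c v has_derivative fd (form_comp A \<theta> c v) z) (at (fst (z, l)))"
      using smooth_on_has_derivative[OF smooth_formD(2)[OF D(4,1), of v]] U op(1) by simp
    from has_derivative_compose[OF has_derivative_fst[OF has_derivative_ident] this]
    have "((\<lambda>q. snd q * form_comp A \<theta> c v (fst q)) has_derivative
        (\<lambda>h. l * fd (form_comp A \<theta> c v) z (fst h) + snd h * form_comp A \<theta> c v z)) (at (z, l))"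
      by (auto intro!: derivative_eq_intros)
    then have "(form_comp EA taut C (v, n) has_derivative
        (\<lambda>h. l * fd (form_comp A \<theta> c v) z (fst h) + snd h * form_comp A \<theta> c v z)) (at (z, l))"
    proof (rule has_derivative_transform_within_open[OF _ open_Times[OF op] q])
      fix q assume "q \<in> snd c ` U \<times> (- {0::complex})"
      then obtain x l where q: "q = (snd c x, l)" "x \<in> U" "l \<noteq> 0" by auto
      then show "snd q * form_comp A \<theta> c v (fst q) = form_comp EA taut C (v, n) q"
        using taut_from_chart[OF assms(1) q(2,3), of "(v, n)"]
        by (simp add: form_comp_def Echart_inv[OF assms(1)] C_def)
    qed
    then show ?thesis by (simp add: fd_eqI)
  qed
  moreover have "is_open EA ES" using is_open_points[OF E_atlas_smooth] E_points by simp
  moreover have "\<epsilon> \<in> ES" using C(2) by (simp add: C_def Echart_dom)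
  ultimately show ?thesis
    using ext_deriv_from_chart[OF E_atlas_smooth taut_smooth _ _ C, of "(u, m)" "(u', m')"]
    by (simp add: Ce algebra_simps)
qed

end

section \<open>Adapted coframes on the base\<close>

lemma re_cx_map [simp]: "re_vec (cx_map L z) = L (re_vec z)" and im_cx_map [simp]: "im_vec (cx_map L z) = L (im_vec z)"
  by (simp_all add: re_vec_def im_vec_def cx_map_def vec_eq_iff)

lemma cx_vec_eqI: "re_vec z = re_vec w \<Longrightarrow> im_vec z = im_vec w \<Longrightarrow> z = w"
  by (simp add: re_vec_def im_vec_def vec_eq_iff complex_eq_iff)

lemma cx_covec_cx_map: "cx_covec (\<lambda>u. \<theta> (L u)) z = cx_covec \<theta> (cx_map L z)"
  by (simp add: cx_covec_def)

lemma cx_map_smult: "linear L \<Longrightarrow> cx_map L (k *s z) = k *s cx_map L z"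
  by (rule cx_vec_eqI) (simp_all add: re_vec_smult im_vec_smult linear_add linear_diff linear_scale)

lemma cx_map_diff: "linear L \<Longrightarrow> cx_map L (z - w) = cx_map L z - cx_map L w"
proof -
  have "re_vec (z - w) = re_vec z - re_vec w" "im_vec (z - w) = im_vec z - im_vec w" for z w
    by (simp_all add: re_vec_def im_vec_def vec_eq_iff)
  then show "linear L \<Longrightarrow> cx_map L (z - w) = cx_map L z - cx_map L w"
    by (intro cx_vec_eqI) (simp_all add: linear_diff)
qed

lemma cx_covec_component: "cx_covec (\<lambda>v. of_real (v $ j) * p) w = w $ j * p"
proof -
  have "w $ j = of_real (Re (w $ j)) + \<i> * of_real (Im (w $ j))" by (rule complex_eq)
  then show ?thesis by (simp add: cx_covec_def re_vec_def im_vec_def ring_distribs(2)[symmetric] mult.assoc[symmetric])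
qed

text \<open>A 2 by 2 minor of v and w in the coordinates j and k. As a covector in v it kills w and
  the basis vector of the third index, which makes it a candidate for a leg of an adapted
  coframe.\<close>

definition minor :: "3 \<Rightarrow> 3 \<Rightarrow> complex ^ 3 \<Rightarrow> real ^ 3 \<Rightarrow> complex" where
  "minor j k w v = of_real (v $ j) * w $ k - of_real (v $ k) * w $ j"

lemma cx_covec_minor: "cx_covec (minor j k w) z = z $ j * w $ k - z $ k * w $ j"
proof -
  have eq: "minor j k w = (\<lambda>v. of_real (v $ j) * w $ k + of_real (v $ k) * (- (w $ j)))"
    by (simp add: minor_def fun_eq_iff)
  show ?thesis by (simp only: eq cx_covec_sum cx_covec_component) simp
qed

lemma linear_minor: "linear (minor j k w)"
  by (simp add: linear_iff minor_def) (simp add: scaleR_conv_of_real algebra_simps)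

lemma minor_wedge:
  "minor j k w u * minor j k w' v - minor j k w v * minor j k w' u
    = (of_real (u $ j) * of_real (v $ k) - of_real (u $ k) * of_real (v $ j)) * (w $ j * w' $ k - w $ k * w' $ j)"
  by (simp add: minor_def algebra_simps)

lemma index_3_complete:
  fixes i :: 3
  obtains j k where "i \<noteq> j" "j \<noteq> k" "i \<noteq> k" "(UNIV :: 3 set) = {i, j, k}"
proof -
  have U: "(UNIV :: 3 set) = {1, 2, 3}" using exhaust_3 by auto
  consider "i = 1" | "i = 2" | "i = 3" using exhaust_3 by blast
  then show thesis
  proof cases
    case 1 then show ?thesis using that[of 2 3] U by auto
  next
    case 2 then show ?thesis using that[of 1 3] U by auto
  next
    case 3 then show ?thesis using that[of 1 2] U by auto
  qed
qed

lemma real3_expand: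
  fixes u :: "real ^ 3"
  assumes "i \<noteq> j" "j \<noteq> k" "i \<noteq> k" "(UNIV :: 3 set) = {i, j, k}"
  shows "u = (u $ i) *\<^sub>R axis i 1 + (u $ j) *\<^sub>R axis j 1 + (u $ k) *\<^sub>R axis k 1"
proof -
  have "m = i \<or> m = j \<or> m = k" for m using assms(4) by blast
  then show ?thesis using assms(1-3) by (auto simp: vec_eq_iff axis_def)
qed

text \<open>\<beta> is the contraction of \<Omega> with the basis vector \<open>axis i 1\<close>,
  divided by the value of \<theta> there. Then \<Omega> - \<theta> \<and> \<beta> is annihilated by
  that vector, and in dimension three such a 2-form is a multiple of dx_j \<and> dx_k.\<close>

lemma two_form_split:
  fixes \<Omega> :: "real ^ 3 \<Rightarrow> real ^ 3 \<Rightarrow> complex"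
  assumes ijk: "i \<noteq> j" "j \<noteq> k" "i \<noteq> k" "(UNIV :: 3 set) = {i, j, k}"
    and lin: "\<And>u. linear (\<Omega> u)" and alt: "\<And>u v. \<Omega> u v = - \<Omega> v u" and \<theta>: "linear \<theta>" "\<theta> (axis i 1) \<noteq> 0"
  defines "\<beta> \<equiv> \<lambda>v. \<Omega> (axis i 1) v / \<theta> (axis i 1)"
  defines "\<kappa> \<equiv> \<Omega> (axis j 1) (axis k 1) - (\<theta> (axis j 1) * \<beta> (axis k 1) - \<theta> (axis k 1) * \<beta> (axis j 1))"
  shows "\<Omega> u v = \<theta> u * \<beta> v - \<theta> v * \<beta> u + \<kappa> * (of_real (u $ j) * of_real (v $ k) - of_real (u $ k) * of_real (v $ j))"
proof -
  define F where "F u v = \<Omega> u v - (\<theta> u * \<beta> v - \<theta> v * \<beta> u)" for u v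
  have same: "\<Omega> u u = 0" for u using alt[of u u] by simp
  have bl: "linear \<beta>"
    using linear_mult_left[OF lin, of "1 / \<theta> (axis i 1)" "axis i 1"] by (simp add: \<beta>_def)
  have Fl: "linear (F u)" for u
    using linear_add[OF lin] linear_scale[OF lin] linear_add[OF bl] linear_scale[OF bl] linear_add[OF \<theta>(1)] linear_scale[OF \<theta>(1)]
    by (simp add: linear_iff F_def scaleR_conv_of_real algebra_simps)
  have Fa: "F u v = - F v u" for u v
    using alt[of u v] by (simp add: F_def)
  have Fs: "F u u = 0" for u using same by (simp add: F_def)
  have F0: "F (axis i 1) v = 0" for v
    using \<theta> same by (simp add: F_def \<beta>_def)
  have Fl2: "F u v = u $ i *\<^sub>R F (axis i 1) v + u $ j *\<^sub>R F (axis j 1) v + u $ k *\<^sub>R F (axis k 1) v" for u v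
  proof -
    have "F v u = u $ i *\<^sub>R F v (axis i 1) + u $ j *\<^sub>R F v (axis j 1) + u $ k *\<^sub>R F v (axis k 1)"
      by (subst real3_expand[OF ijk, of u]) (simp only: linear_add[OF Fl] linear_scale[OF Fl])
    then show ?thesis
      using Fa[of u v] Fa[of v "axis i 1"] Fa[of v "axis j 1"] Fa[of v "axis k 1"] by simp
  qed
  have Fr: "F w v = v $ i *\<^sub>R F w (axis i 1) + v $ j *\<^sub>R F w (axis j 1) + v $ k *\<^sub>R F w (axis k 1)" for w v
    by (subst real3_expand[OF ijk, of v]) (simp only: linear_add[OF Fl] linear_scale[OF Fl])
  have z: "F w (axis i 1) = 0" for w using Fa[of w] F0 by simp
  have "F u v = u $ j *\<^sub>R (v $ k *\<^sub>R F (axis j 1) (axis k 1)) - u $ k *\<^sub>R (v $ j *\<^sub>R F (axis j 1) (axis k 1))"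
    by (simp add: Fl2[of u v] F0 Fr[of "axis j 1" v] Fr[of "axis k 1" v] z Fs Fa[of "axis k 1" "axis j 1"])
  moreover have "F (axis j 1) (axis k 1) = \<kappa>" by (simp add: F_def \<kappa>_def)
  ultimately have "F u v = \<kappa> * (of_real (u $ j) * of_real (v $ k) - of_real (u $ k) * of_real (v $ j))"
    by (simp add: scaleR_conv_of_real algebra_simps)
  then show ?thesis unfolding F_def diff_eq_eq by (simp only: add.commute)
qed

lemma plane_sumI: "x \<in> S \<Longrightarrow> y \<in> T \<Longrightarrow> x + y \<in> plane_sum S T"
  unfolding plane_sum_def by blast

context flag_manifold
begin

lemma smooth_section:
  assumes "cx_line_subbundle A T" "x \<in> points A"
  obtains U X where "is_open A U" "x \<in> U" "smooth_cx_field A U X"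
    "\<And>q. q \<in> U \<Longrightarrow> X q \<noteq> 0" "\<And>q. q \<in> U \<Longrightarrow> T q = range (\<lambda>k. k *s X q)"
proof -
  obtain U and X :: "'m \<Rightarrow> complex ^ 3" where
    "is_open A U \<and> x \<in> U \<and> smooth_cx_field A U X \<and> (\<forall>q\<in>U. X q \<noteq> 0 \<and> T q = range (\<lambda>k. k *s X q))"
    using bspec[OF assms(1)[unfolded cx_line_subbundle_def] assms(2)] by (elim exE) (rule that)
  then show thesis by (intro that[of U X]) simp_all
qed

definition adapted ::
    "'m \<Rightarrow> (real ^ 3) covec \<Rightarrow> (real ^ 3) covec \<Rightarrow> bool" where
  "adapted x \<alpha> \<alpha>' \<longleftrightarrow> linear \<alpha> \<and> linear \<alpha>' \<and>
     (\<forall>z\<in>T1 x - {0}. cx_covec \<alpha> z \<noteq> 0) \<and> (\<forall>z\<in>T2 x. cx_covec \<alpha> z = 0) \<and>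
     (\<forall>z\<in>T1 x. cx_covec \<alpha>' z = 0) \<and> (\<forall>z\<in>T2 x - {0}. cx_covec \<alpha>' z \<noteq> 0)"

lemma adapted_spanI:
  assumes "linear \<alpha>" "linear \<alpha>'" "T1 x = range (\<lambda>k. k *s X1)" "T2 x = range (\<lambda>k. k *s X2)"
    "cx_covec \<alpha> X1 \<noteq> 0" "cx_covec \<alpha> X2 = 0" "cx_covec \<alpha>' X1 = 0" "cx_covec \<alpha>' X2 \<noteq> 0"
  shows "adapted x \<alpha> \<alpha>'"
  using assms by (auto simp: adapted_def cx_covec_smult)

text \<open>\<open>e\<^sub>i\<close> is transversal to the contact plane, so covectors annihilating \<open>e\<^sub>i\<close> may be prescribed on \<open>T\<^sup>1\<close> and
  \<open>T\<^sup>2\<close>.\<close>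

lemma adapted_pointwise:
  assumes x: "x \<in> points A" "(x, \<theta>) \<in> ES" and L: "linear L" "\<And>u. L' (L u) = u" "linear L'" "\<And>u. L (L' u) = u"
    and X: "T1 x = range (\<lambda>k. k *s X1)" "T2 x = range (\<lambda>k. k *s X2)" "X1 \<noteq> 0" "X2 \<noteq> 0"
    and ijk: "i \<noteq> j" "j \<noteq> k" "i \<noteq> k" "(UNIV :: 3 set) = {i, j, k}" and i: "\<theta> (L' (axis i 1)) \<noteq> 0"
  defines "Y1 \<equiv> cx_map L X1" and "Y2 \<equiv> cx_map L X2"
  shows "Y2 $ j * Y1 $ k - Y2 $ k * Y1 $ j \<noteq> 0"
proof
  assume D: "Y2 $ j * Y1 $ k - Y2 $ k * Y1 $ j = 0"
  have mem: "a *s X1 \<in> T1 x" "b *s X2 \<in> T2 x" for a b using X by auto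
  note lt = E_setD(2)[OF x(2)]
  have "X1 + 0 *s X2 \<in> plane_sum (T1 x) (T2 x)" "0 *s X1 + X2 \<in> plane_sum (T1 x) (T2 x)"
    using plane_sumI[OF mem(1)[of 1] mem(2)[of 0]] plane_sumI[OF mem(1)[of 0] mem(2)[of 1]] by simp_all
  then have \<theta>X: "cx_covec \<theta> X1 = 0" "cx_covec \<theta> X2 = 0"
    using E_setD(3)[OF x(2)] by (auto simp: cx_ker_def)
  have inv: "cx_map L' (cx_map L z) = z" for z
    by (rule cx_vec_eqI) (simp_all add: L)
  have i0: "w $ i = 0" if "cx_covec (\<lambda>u. \<theta> (L' u)) w = 0" "w $ j = 0" "w $ k = 0" for w
  proof -
    have lin': "linear (\<lambda>u. \<theta> (L' u))" using linear_compose[OF L(3) lt] by (simp add: comp_def)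
    have "m = i \<or> m = j \<or> m = k" for m using ijk(4) by blast
    then have "w = w $ i *s cx_vec (axis i 1)"
      using that ijk by (auto simp: vec_eq_iff cx_vec_def axis_def)
    then have "cx_covec (\<lambda>u. \<theta> (L' u)) w = w $ i * \<theta> (L' (axis i 1))"
      using cx_covec_smult[OF lin', of "w $ i" "cx_vec (axis i 1)"] lin' by simp
    then show ?thesis using that i by simp
  qed
  have zero: "w = 0" if "cx_covec \<theta> w = 0" "cx_map L w $ j = 0" "cx_map L w $ k = 0" for w
  proof -
    have "cx_covec (\<lambda>u. \<theta> (L' u)) (cx_map L w) = 0" using that inv by (simp add: cx_covec_cx_map)
    then have "cx_map L w $ i = 0" using i0 that by blast
    moreover have "m = i \<or> m = j \<or> m = k" for m using ijk(4) by blast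
    ultimately have "cx_map L w = 0" using that unfolding vec_eq_iff by (metis zero_index)
    then have "w = cx_map L' 0" using inv[of w] by simp
    also have "\<dots> = 0" using cx_map_smult[OF L(3), of 0 0] by simp
    finally show ?thesis .
  qed
  \<comment> \<open>A relation between the (j,k)-parts of Y1 and Y2 lifts to X1 and X2: the
    combination lies in the contact plane and has no j- and k-components, so it vanishes by
    \<open>zero\<close>. The two lines meet only in 0, hence both summands are 0.\<close>
  have comb: "a = 0 \<and> b = 0" if "a * Y1 $ j = b * Y2 $ j" "a * Y1 $ k = b * Y2 $ k" for a b
  proof -
    let ?w = "a *s X1 - b *s X2"
    have "cx_map L ?w = a *s Y1 - b *s Y2" by (simp add: cx_map_diff cx_map_smult L Y1_def Y2_def)
    moreover have "cx_covec \<theta> ?w = 0" using \<theta>X by (simp add: cx_covec_diff[OF lt] cx_covec_smult[OF lt])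
    ultimately have "?w = 0" using that by (intro zero) simp_all
    then have "a *s X1 \<in> T1 x \<inter> T2 x" "b *s X2 \<in> T1 x \<inter> T2 x" using mem(1)[of a] mem(2)[of b] by auto
    then have "a *s X1 = 0" "b *s X2 = 0" using T12[OF x(1)] by auto
    then show ?thesis using X(3,4) by (auto simp: vec_eq_iff)
  qed
  have "Y2 $ j * Y1 $ k = Y2 $ k * Y1 $ j" using D by simp
  \<comment> \<open>A vanishing determinant makes both coordinate pairs, the one at j and the one at
    k, coefficients of such a relation.\<close>
  then have "Y2 $ j = 0 \<and> Y1 $ j = 0" "Y2 $ k = 0 \<and> Y1 $ k = 0"
    using comb[of "Y2 $ j" "Y1 $ j"] comb[of "Y2 $ k" "Y1 $ k"] by (simp_all add: mult.commute)
  then have "X1 = 0" using zero[of X1] \<theta>X by (simp add: Y1_def)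
  then show False using X by simp
qed

text \<open>In coordinates where one basis vector is transversal to the contact plane, d\<theta>
  splits as \<theta> \<and> \<beta> + \<kappa> dx_j \<and> dx_k. The minor built from X2 kills T2
  and is nonzero on T1, and symmetrically for X1. Their wedge product is \<Delta> dx_j \<and> dx_k
  with \<Delta> nonzero by \<open>adapted_pointwise\<close>, so the factor \<kappa> / \<Delta> on
  the second one turns the product into the wanted part of d\<theta>.\<close>

lemma adapted_coframe:
  assumes x0: "x0 \<in> points A"
  obtains c U \<theta> \<alpha>1 \<alpha>2 \<beta> where "Edata c U \<theta>" "x0 \<in> U" "smooth_form A U \<alpha>1" "smooth_form A U \<alpha>2" "smooth_form A U \<beta>"
    "\<And>x. x \<in> U \<Longrightarrow> adapted x (\<alpha>1 x) (\<alpha>2 x)"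
    "\<And>x u v. x \<in> U \<Longrightarrow> ext_deriv A \<theta> x u v = (\<theta> x \<and>\<^sub>f \<beta> x) u v + (\<alpha>1 x \<and>\<^sub>f \<alpha>2 x) u v"
proof -
  have sub: "cx_line_subbundle A T1" "cx_line_subbundle A T2" using flag by (auto simp: flag_structure_def)
  obtain U1 X1 where U1: "is_open A U1" "x0 \<in> U1" "smooth_cx_field A U1 X1"
    "\<And>q. q \<in> U1 \<Longrightarrow> X1 q \<noteq> 0" "\<And>q. q \<in> U1 \<Longrightarrow> T1 q = range (\<lambda>k. k *s X1 q)"
    by (rule smooth_section[OF sub(1) x0]) (rule that)
  obtain U2 X2 where U2: "is_open A U2" "x0 \<in> U2" "smooth_cx_field A U2 X2"
    "\<And>q. q \<in> U2 \<Longrightarrow> X2 q \<noteq> 0" "\<And>q. q \<in> U2 \<Longrightarrow> T2 q = range (\<lambda>k. k *s X2 q)"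
    by (rule smooth_section[OF sub(2) x0]) (rule that)
  obtain U0 \<theta> where U0: "is_open A U0" "x0 \<in> U0" "smooth_form A U0 \<theta>" "\<And>q. q \<in> U0 \<Longrightarrow> (q, \<theta> q) \<in> ES"
    "\<And>q. q \<in> U0 \<Longrightarrow> \<exists>u v w. ext_deriv A \<theta> q u v * \<theta> q w + ext_deriv A \<theta> q v w * \<theta> q u
                   + ext_deriv A \<theta> q w u * \<theta> q v \<noteq> 0"
    by (rule contact_form[OF x0]) (rule that)
  define c where "c = chart_at A x0"
  have c: "c \<in> A" "x0 \<in> fst c" using chart_at[OF x0] by (auto simp: c_def)
  let ?\<theta> = "form_comp A \<theta> c"
  obtain u0 where "\<theta> x0 u0 \<noteq> 0" using E_nonzero[OF U0(4)[OF U0(2)]] .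
  then have nz: "?\<theta> (to_chart A c x0 u0) (snd c x0) \<noteq> 0"
    by (simp add: form_comp_at[OF smA c] from_to_chart[OF smA c])
  have "\<exists>i. ?\<theta> (axis i 1) (snd c x0) \<noteq> 0"
  proof (rule ccontr)
    assume "\<not> (\<exists>i. ?\<theta> (axis i 1) (snd c x0) \<noteq> 0)"
    then have "?\<theta> b (snd c x0) = 0" if "b \<in> Basis" for b
      using that by (auto simp: Basis_vec_def)
    then show False
      using nz linear_sum_Basis[OF form_comp_linear[where \<alpha> = \<theta>, OF smA c smooth_formD(1)[OF U0(3,2)]], of "to_chart A c x0 u0"] by simp
  qed
  then obtain i where i: "?\<theta> (axis i 1) (snd c x0) \<noteq> 0" ..
  obtain j k where ijk: "i \<noteq> j" "j \<noteq> k" "i \<noteq> k" "(UNIV :: 3 set) = {i, j, k}" by (rule index_3_complete)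
  define V where "V = {z \<in> snd c ` (U0 \<inter> fst c). ?\<theta> (axis i 1) z \<in> - {0}}"
  have V: "open V" unfolding V_def
    by (rule open_Collect_mem[OF smooth_formD(2)[OF U0(3) c(1)] is_openD[OF U0(1) c(1)]]) auto
  define U where "U = U0 \<inter> U1 \<inter> U2 \<inter> {p \<in> fst c. snd c p \<in> V}"
  have U: "is_open A U" unfolding U_def
    by (intro is_open_inter[OF smA] U0 U1 U2 is_open_chart_preimage[OF smA c(1) V])
  have Uc: "U \<subseteq> fst c" "U \<inter> fst c = U" by (auto simp: U_def)
  have op: "open (snd c ` U)" using is_openD[OF U c(1)] Uc by simp
  have x0U: "x0 \<in> U" using U0 U1 U2 c i by (auto simp: U_def V_def)
  have \<theta>U: "smooth_form A U \<theta>" by (rule smooth_form_subset[OF U0(3)]) (auto simp: U_def)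
  have ED: "Edata c U \<theta>" using c U Uc \<theta>U U0(4) by (auto simp: Edata_def U_def)
  have \<theta>i: "?\<theta> (axis i 1) z \<noteq> 0" if "z \<in> snd c ` U" for z using that by (auto simp: U_def V_def)
  have s\<theta>: "smooth_on (snd c ` U) (?\<theta> e)" for e using smooth_formD(2)[OF \<theta>U c(1)] Uc by simp
  define Y where "Y X z = cx_map (to_chart A c (chart_inv c z)) (X (chart_inv c z))" for X z
  have sY: "smooth_on (snd c ` U) (Y X1)" "smooth_on (snd c ` U) (Y X2)"
  proof -
    have "smooth_on (snd c ` (U1 \<inter> fst c)) (Y X1)" "smooth_on (snd c ` (U2 \<inter> fst c)) (Y X2)"
      using U1(3) U2(3) c(1) unfolding smooth_cx_field_def Y_def by blast+
    then show "smooth_on (snd c ` U) (Y X1)" "smooth_on (snd c ` U) (Y X2)"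
      by (auto elim!: smooth_on_subset simp: U_def)
  qed
  have sYc: "smooth_on (snd c ` U) (\<lambda>z. Y X1 z $ m)" "smooth_on (snd c ` U) (\<lambda>z. Y X2 z $ m)" for m
    by (rule smooth_on_bounded_linear_compose[OF bounded_linear_vec_nth op]; rule sY)+
  define \<Omega> where "\<Omega> z u v = fd (?\<theta> v) z u - fd (?\<theta> u) z v" for z u v
  have s\<Omega>: "smooth_on (snd c ` U) (\<lambda>z. \<Omega> z u v)" for u v
    unfolding \<Omega>_def by (intro smooth_on_intros op smooth_on_fd s\<theta>)
  define \<beta>' where "\<beta>' z v = \<Omega> z (axis i 1) v / ?\<theta> (axis i 1) z" for z v
  define \<kappa> where "\<kappa> z = \<Omega> z (axis j 1) (axis k 1) - (?\<theta> (axis j 1) z * \<beta>' z (axis k 1) - ?\<theta> (axis k 1) z * \<beta>' z (axis j 1))" for z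
  define \<Delta> where "\<Delta> z = Y X2 z $ j * Y X1 z $ k - Y X2 z $ k * Y X1 z $ j" for z
  have s\<beta>: "smooth_on (snd c ` U) (\<lambda>z. \<beta>' z v)" for v
    unfolding \<beta>'_def by (intro smooth_on_intros op s\<Omega> s\<theta> \<theta>i)
  have s\<kappa>: "smooth_on (snd c ` U) \<kappa>"
    unfolding \<kappa>_def[abs_def] by (intro smooth_on_intros op s\<Omega> s\<theta> s\<beta>)
  have s\<Delta>: "smooth_on (snd c ` U) \<Delta>"
    unfolding \<Delta>_def[abs_def] by (intro smooth_on_intros op sYc)
  have pt: "\<Delta> (snd c x) \<noteq> 0" "linear (\<Omega> (snd c x) u)" "\<Omega> (snd c x) u v = - \<Omega> (snd c x) v u"
    "linear (\<lambda>u. ?\<theta> u (snd c x))" "ext_deriv A \<theta> x (from_chart A c x u) (from_chart A c x v) = \<Omega> (snd c x) u v"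
    if x: "x \<in> U" for x u v
  proof -
    have xc: "x \<in> fst c" "snd c x \<in> snd c ` (U \<inter> fst c)" and xs: "x \<in> U0" "x \<in> U1" "x \<in> U2"
      using x Uc by (auto simp: U_def)
    have YX: "Y X (snd c x) = cx_map (to_chart A c x) (X x)" for X
      by (simp add: Y_def chart_inv_left[OF smA c(1) xc(1)])
    have "\<theta> x (from_chart A c x (axis i 1)) \<noteq> 0"
      using \<theta>i[of "snd c x"] x by (simp add: form_comp_at[OF smA c(1) xc(1)])
    then show "\<Delta> (snd c x) \<noteq> 0"
      unfolding \<Delta>_def YX
      by (intro adapted_pointwise[where L' = "from_chart A c x", OF chart_points[OF c(1) xc(1)] U0(4)[OF xs(1)]
           to_chart_linear[OF smA c(1) xc(1)] _ from_chart_linear[OF smA c(1) xc(1)] _ U1(5)[OF xs(2)] U2(5)[OF xs(3)]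
           U1(4)[OF xs(2)] U2(4)[OF xs(3)] ijk])
        (simp_all add: from_to_chart[OF smA c(1) xc(1)] to_from_chart[OF smA c(1) xc(1)])
    show lt: "linear (\<lambda>u. ?\<theta> u (snd c x))"
      by (rule form_comp_linear[where \<alpha> = \<theta>, OF smA c(1) xc(1) smooth_formD(1)[OF \<theta>U x]])
    have "linear (fd (?\<theta> u) (snd c x))"
      using smooth_on_linear_fd[OF s\<theta> op] x by auto
    then show "linear (\<Omega> (snd c x) u)"
      unfolding \<Omega>_def by (intro linear_compose_sub ext_comp_linear[OF smA \<theta>U U c(1) xc(2)])
    show "\<Omega> (snd c x) u v = - \<Omega> (snd c x) v u" by (simp add: \<Omega>_def)
    show "ext_deriv A \<theta> x (from_chart A c x u) (from_chart A c x v) = \<Omega> (snd c x) u v"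
      unfolding \<Omega>_def by (rule ext_deriv_from_chart[OF smA \<theta>U U x c(1) xc(1)])
  qed
  have split: "\<Omega> z u v = ?\<theta> u z * \<beta>' z v - ?\<theta> v z * \<beta>' z u
      + \<kappa> z * (of_real (u $ j) * of_real (v $ k) - of_real (u $ k) * of_real (v $ j))" if z: "z \<in> snd c ` U" for z u v
  proof -
    obtain x where x: "z = snd c x" "x \<in> U" using z by blast
    show ?thesis
      unfolding \<kappa>_def \<beta>'_def x(1)
      by (rule two_form_split[OF ijk pt(2,3,4)[OF x(2)] \<theta>i[OF z, unfolded x(1)]])
  qed
  \<comment> \<open>If \<kappa> vanished at x, then d\<theta> would equal \<theta> \<and> \<beta>
    there, and the cyclic sum that expresses d\<theta> \<and> \<theta> would be zero, against the
    contact condition.\<close>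
  have \<kappa>nz: "\<kappa> (snd c x) \<noteq> 0" if x: "x \<in> U" for x
  proof
    assume k0: "\<kappa> (snd c x) = 0"
    have xc: "x \<in> fst c" using x Uc by auto
    obtain u v w where uvw: "ext_deriv A \<theta> x u v * \<theta> x w + ext_deriv A \<theta> x v w * \<theta> x u + ext_deriv A \<theta> x w u * \<theta> x v \<noteq> 0"
      using U0(5)[of x] x by (auto simp: U_def)
    have e: "ext_deriv A \<theta> x u v = \<theta> x u * \<beta>' (snd c x) (to_chart A c x v) - \<theta> x v * \<beta>' (snd c x) (to_chart A c x u)" for u v
      using pt(5)[OF x, of "to_chart A c x u" "to_chart A c x v"] split[of "snd c x" "to_chart A c x u" "to_chart A c x v"] x k0
      by (simp add: form_comp_at[OF smA c(1) xc] from_to_chart[OF smA c(1) xc])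
    show False using uvw unfolding e by (simp add: algebra_simps)
  qed
  define \<alpha>1 where "\<alpha>1 x u = minor j k (Y X2 (snd c x)) (to_chart A c x u)" for x u
  define \<alpha>2 where "\<alpha>2 x u = \<kappa> (snd c x) / \<Delta> (snd c x) * minor j k (Y X1 (snd c x)) (to_chart A c x u)" for x u
  define \<beta> where "\<beta> x u = \<beta>' (snd c x) (to_chart A c x u)" for x u
  have fc: "form_comp A \<alpha>1 c e z = minor j k (Y X2 z) e" "form_comp A \<alpha>2 c e z = \<kappa> z / \<Delta> z * minor j k (Y X1 z) e"
    "form_comp A \<beta> c e z = \<beta>' z e" if z: "z \<in> snd c ` U" for z e
  proof -
    obtain x where x: "z = snd c x" "x \<in> U" "x \<in> fst c" using z Uc by blast
    show "form_comp A \<alpha>1 c e z = minor j k (Y X2 z) e" "form_comp A \<alpha>2 c e z = \<kappa> z / \<Delta> z * minor j k (Y X1 z) e"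
      "form_comp A \<beta> c e z = \<beta>' z e"
      by (simp_all add: x form_comp_at[OF smA c(1) x(3)] \<alpha>1_def \<alpha>2_def \<beta>_def to_from_chart[OF smA c(1) x(3)])
  qed
  have \<beta>lin: "linear (\<beta>' (snd c x))" if "x \<in> U" for x
    using linear_mult_left[OF pt(2)[OF that], of "1 / ?\<theta> (axis i 1) (snd c x)" "axis i 1"] by (simp add: \<beta>'_def[abs_def])
  have lin: "linear (\<alpha>1 x)" "linear (\<alpha>2 x)" "linear (\<beta> x)" if "x \<in> U" for x
  proof -
    have l: "linear (to_chart A c x)" using that Uc by (intro to_chart_linear[OF smA c(1)]) auto
    show "linear (\<alpha>1 x)" "linear (\<alpha>2 x)" "linear (\<beta> x)"
      unfolding \<alpha>1_def[abs_def] \<alpha>2_def[abs_def] \<beta>_def[abs_def]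
      using linear_compose[OF l linear_minor] linear_mult_left[OF linear_compose[OF l linear_minor]]
        linear_compose[OF l \<beta>lin[OF that]]
      unfolding comp_def by blast+
  qed
  have sm: "smooth_on (snd c ` U) (\<lambda>z. minor j k (Y X1 z) e)" "smooth_on (snd c ` U) (\<lambda>z. minor j k (Y X2 z) e)" for e
    unfolding minor_def by (intro smooth_on_intros op sYc)+
  have \<Delta>nz: "\<Delta> z \<noteq> 0" if "z \<in> snd c ` U" for z using pt(1) that by auto
  have sm\<alpha>1: "smooth_form A U \<alpha>1"
    by (rule smooth_form_chartI[OF smA c(1) Uc(1) U lin(1)], assumption,
        rule smooth_on_cong[OF sm(2) op]) (simp add: fc)
  have "smooth_on (snd c ` U) (form_comp A \<alpha>2 c e)" for e
    by (rule smooth_on_cong[OF smooth_on_mult[OF op smooth_on_divide[OF op s\<kappa> s\<Delta> \<Delta>nz] sm(1)[of e]] op]) (simp_all add: fc)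
  then have sm\<alpha>2: "smooth_form A U \<alpha>2"
    by (intro smooth_form_chartI[OF smA c(1) Uc(1) U lin(2)])
  have sm\<beta>: "smooth_form A U \<beta>"
    by (rule smooth_form_chartI[OF smA c(1) Uc(1) U lin(3)], assumption,
        rule smooth_on_cong[OF s\<beta> op]) (simp add: fc)
  have ad: "adapted x (\<alpha>1 x) (\<alpha>2 x)" if x: "x \<in> U" for x
  proof (rule adapted_spanI[OF lin(1,2)[OF x] U1(5) U2(5)])
    show "x \<in> U1" "x \<in> U2" using x by (auto simp: U_def)
    have xc: "x \<in> fst c" using x Uc by auto
    have YX: "cx_map (to_chart A c x) (X x) = Y X (snd c x)" for X
      by (simp add: Y_def chart_inv_left[OF smA c(1) xc])
    have a1: "cx_covec (\<alpha>1 x) (X x) = Y X (snd c x) $ j * Y X2 (snd c x) $ k - Y X (snd c x) $ k * Y X2 (snd c x) $ j" for X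
      unfolding \<alpha>1_def[abs_def] cx_covec_cx_map cx_covec_minor YX ..
    have a2: "cx_covec (\<alpha>2 x) (X x) = \<kappa> (snd c x) / \<Delta> (snd c x) *
        (Y X (snd c x) $ j * Y X1 (snd c x) $ k - Y X (snd c x) $ k * Y X1 (snd c x) $ j)" for X
      unfolding \<alpha>2_def[abs_def] cx_covec_scale cx_covec_cx_map cx_covec_minor YX ..
    show "cx_covec (\<alpha>1 x) (X1 x) \<noteq> 0" using pt(1)[OF x] by (simp add: a1 \<Delta>_def mult.commute)
    show "cx_covec (\<alpha>1 x) (X2 x) = 0" "cx_covec (\<alpha>2 x) (X1 x) = 0" by (simp_all add: a1 a2)
    show "cx_covec (\<alpha>2 x) (X2 x) \<noteq> 0" using pt(1)[OF x] \<kappa>nz[OF x] by (simp add: a2 \<Delta>_def)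
  qed
  have d\<theta>: "ext_deriv A \<theta> x u v = (\<theta> x \<and>\<^sub>f \<beta> x) u v + (\<alpha>1 x \<and>\<^sub>f \<alpha>2 x) u v" if x: "x \<in> U" for x u v
  proof -
    have xc: "x \<in> fst c" using x Uc by auto
    let ?u = "to_chart A c x u" and ?v = "to_chart A c x v" and ?z = "snd c x"
    have "(\<alpha>1 x \<and>\<^sub>f \<alpha>2 x) u v = \<kappa> ?z / \<Delta> ?z * (minor j k (Y X2 ?z) ?u * minor j k (Y X1 ?z) ?v - minor j k (Y X2 ?z) ?v * minor j k (Y X1 ?z) ?u)"
      by (simp add: wedge_def \<alpha>1_def \<alpha>2_def algebra_simps)
    also have "\<dots> = \<kappa> ?z * (of_real (?u $ j) * of_real (?v $ k) - of_real (?u $ k) * of_real (?v $ j))"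
      unfolding minor_wedge \<Delta>_def[symmetric] using pt(1)[OF x] by simp
    finally show ?thesis
      using pt(5)[OF x, of ?u ?v] split[of ?z ?u ?v] x
      by (simp add: form_comp_at[OF smA c(1) xc] from_to_chart[OF smA c(1) xc] wedge_def \<beta>_def)
  qed
  show thesis by (rule that[OF ED x0U sm\<alpha>1 sm\<alpha>2 sm\<beta> ad d\<theta>])
qed

end

section \<open>The coframe bundle\<close>

text \<open>The complex linear extension of g at the complexified vector p + iq, encoded by the pair
  p, q so that no complexified type is formed.\<close>

definition cx_eval :: "('v \<Rightarrow> complex) \<Rightarrow> 'v \<Rightarrow> 'v \<Rightarrow> complex" where
  "cx_eval g p q = g p + \<i> * g q"

text \<open>Complex linear independence, expressed by a dual frame in the complexified space. Real
  vectors cannot serve: for w and its conjugate, say, no real vector has w = 1 and conjugate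
  0.\<close>

definition coframe_indep :: "('v \<Rightarrow> complex) \<Rightarrow> ('v \<Rightarrow> complex) \<Rightarrow> ('v \<Rightarrow> complex) \<Rightarrow> bool" where
  "coframe_indep w w1 w2 \<longleftrightarrow> (\<exists>p0 q0 p1 q1 p2 q2.
     cx_eval w p0 q0 = 1 \<and> cx_eval w1 p0 q0 = 0 \<and> cx_eval w2 p0 q0 = 0 \<and>
     cx_eval w p1 q1 = 0 \<and> cx_eval w1 p1 q1 = 1 \<and> cx_eval w2 p1 q1 = 0 \<and>
     cx_eval w p2 q2 = 0 \<and> cx_eval w1 p2 q2 = 0 \<and> cx_eval w2 p2 q2 = 1)"

text \<open>Contraction with the vector dual to w shows that g is a multiple of w. Contraction with
  the vector dual to w1 then makes k w2 a multiple of w, and evaluation on the vector dual to w2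
  gives k = 0.\<close>

lemma two_form_zero:
  assumes "coframe_indep w w1 w2"
    and F: "\<And>u v. w u * g v - w v * g u + k * (w1 u * w2 v - w1 v * w2 u) = 0"
  shows "k = 0" and "\<exists>s. \<forall>v. g v = s * w v"
proof -
  obtain p0 q0 p1 q1 p2 q2 where
    E: "cx_eval w p0 q0 = 1" "cx_eval w1 p0 q0 = 0" "cx_eval w2 p0 q0 = 0"
     "cx_eval w p1 q1 = 0" "cx_eval w1 p1 q1 = 1" "cx_eval w2 p1 q1 = 0"
     "cx_eval w p2 q2 = 0" "cx_eval w1 p2 q2 = 0" "cx_eval w2 p2 q2 = 1"
    using assms(1) unfolding coframe_indep_def by blast
  have ev: "cx_eval w p q * g v - w v * cx_eval g p q + k * (cx_eval w1 p q * w2 v - w1 v * cx_eval w2 p q) = 0" for p q v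
  proof -
    have "cx_eval w p q * g v - w v * cx_eval g p q + k * (cx_eval w1 p q * w2 v - w1 v * cx_eval w2 p q)
      = (w p * g v - w v * g p + k * (w1 p * w2 v - w1 v * w2 p)) + \<i> * (w q * g v - w v * g q + k * (w1 q * w2 v - w1 v * w2 q))"
      by (simp add: cx_eval_def algebra_simps)
    then show ?thesis by (simp only: F) simp
  qed
  have g: "g v = cx_eval g p0 q0 * w v" for v using ev[of p0 q0 v] by (simp add: E)
  then show "\<exists>s. \<forall>v. g v = s * w v" by blast
  define G where "G = cx_eval g p1 q1"
  have kw: "k * w2 v = w v * G" for v using ev[of p1 q1 v] by (simp add: E G_def)
  have "k * cx_eval w2 p2 q2 = k * w2 p2 + \<i> * (k * w2 q2)" by (simp add: cx_eval_def algebra_simps)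
  also have "\<dots> = cx_eval w p2 q2 * G" unfolding kw by (simp add: cx_eval_def algebra_simps)
  finally show "k = 0" by (simp add: E)
qed

text \<open>The action of the subgroup \<lambda> = 1 of H, whose second diagonal parameter is 1 / a.
  It moves coframes within one fibre of Y over E, so covectors need no transport, and (a, v1, v2, s)
  become the fibre coordinates of the charts.\<close>

definition twist :: "coframe \<Rightarrow> complex \<times> complex \<times> complex \<times> complex \<Rightarrow> coframe" where
  "twist q t = (case q of (w, w1, w2, f) \<Rightarrow> case t of (a, v1, v2, s) \<Rightarrow>
     (w, \<lambda>v. v1 * w v + a * w1 v, \<lambda>v. v2 * w v + 1 / a * w2 v,
      \<lambda>v. s * w v + a * v2 * w1 v - 1 / a * v1 * w2 v + f v))"

lemma coframe_mult_H_mat: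
  "coframe_mult (w, w1, w2, f) (H_mat a1 a2 v1 v2 s) =
     (\<lambda>v. a1 * a2 * w v, \<lambda>v. v1 * (a1 * a2) * w v + a1 * w1 v, \<lambda>v. v2 * (a1 * a2) * w v + a2 * w2 v,
      \<lambda>v. s * w v + a1 * v2 * w1 v - a2 * v1 * w2 v + f v)"
  by (simp add: coframe_mult_def H_mat_def Let_def mat4_nth vector_4_nth mult_ac)

lemma H_mat_11: "H_mat a1 a2 v1 v2 s $ 1 $ 1 = a1 * a2"
  by (simp add: H_mat_def Let_def mat4_nth vector_4_nth)

context flag_manifold
begin

section \<open>Fibres of Y over E\<close>

abbreviation "YS \<equiv> Y_set A T1 T2"
abbreviation "YA \<equiv> Y_atlas A T1 T2"

lemma Y_set_iff:
  "(\<epsilon>, w, w1, w2, f) \<in> YS \<longleftrightarrow> \<epsilon> \<in> ES \<and> w = taut \<epsilon> \<and>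
     (\<exists>\<alpha>1 \<alpha>2. adapted (fst \<epsilon>) \<alpha>1 \<alpha>2 \<and> w1 = \<alpha>1 \<circ> TE \<epsilon> \<and> w2 = \<alpha>2 \<circ> TE \<epsilon>) \<and> linear f \<and>
     (\<forall>u v. ext_deriv EA taut \<epsilon> u v = (w \<and>\<^sub>f f) u v + (w1 \<and>\<^sub>f w2) u v)"
  unfolding Y_set_def adapted_def by simp blast

lemma Y_set_E: "y \<in> YS \<Longrightarrow> fst y \<in> ES"
  by (auto simp: Y_set_def)

lemma ker_contains: "(x, \<theta>) \<in> ES \<Longrightarrow> z \<in> T1 x \<Longrightarrow> cx_covec \<theta> z = 0"
  "(x, \<theta>) \<in> ES \<Longrightarrow> z \<in> T2 x \<Longrightarrow> cx_covec \<theta> z = 0"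
proof -
  have 0: "0 \<in> T1 x" "0 \<in> T2 x" if "(x, \<theta>) \<in> ES" using T12[OF E_setD(1)[OF that]] by auto
  show "(x, \<theta>) \<in> ES \<Longrightarrow> z \<in> T1 x \<Longrightarrow> cx_covec \<theta> z = 0"
    using plane_sumI[of z "T1 x" 0 "T2 x"] 0 E_setD(3) by (auto simp: cx_ker_def)
  show "(x, \<theta>) \<in> ES \<Longrightarrow> z \<in> T2 x \<Longrightarrow> cx_covec \<theta> z = 0"
    using plane_sumI[of 0 "T1 x" z "T2 x"] 0 E_setD(3) by (auto simp: cx_ker_def)
qed

lemma adaptedD:
  assumes "adapted x \<alpha> \<alpha>'"
  shows "linear \<alpha>" "linear \<alpha>'" "\<And>z. z \<in> T1 x \<Longrightarrow> z \<noteq> 0 \<Longrightarrow> cx_covec \<alpha> z \<noteq> 0" "\<And>z. z \<in> T2 x \<Longrightarrow> cx_covec \<alpha> z = 0"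
    "\<And>z. z \<in> T1 x \<Longrightarrow> cx_covec \<alpha>' z = 0" "\<And>z. z \<in> T2 x \<Longrightarrow> z \<noteq> 0 \<Longrightarrow> cx_covec \<alpha>' z \<noteq> 0"
  using assms by (auto simp: adapted_def)

lemma line_generators:
  assumes "x \<in> points A"
  obtains X1 X2 where "X1 \<in> T1 x" "X1 \<noteq> 0" "X2 \<in> T2 x" "X2 \<noteq> 0"
    "T1 x = range (\<lambda>k. k *s X1)" "T2 x = range (\<lambda>k. k *s X2)"
proof -
  obtain X1 X2 where X: "X1 \<noteq> 0" "T1 x = range (\<lambda>k. k *s X1)" "X2 \<noteq> 0" "T2 x = range (\<lambda>k. k *s X2)"
    using T1_line[OF assms] T2_line[OF assms] by (elim exE conjE) (rule that)
  moreover have "X1 \<in> range (\<lambda>k. k *s X1)" "X2 \<in> range (\<lambda>k. k *s X2)"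
    by (auto intro: range_eqI[of _ _ 1])
  ultimately show thesis by (intro that[of X1 X2]) simp_all
qed

lemma plane_covec:
  assumes "(x, \<theta>) \<in> ES" "linear \<alpha>" "X1 \<in> T1 x" "X1 \<noteq> 0" "X2 \<in> T2 x" "X2 \<noteq> 0"
    and "T1 x = range (\<lambda>k. k *s X1)" "T2 x = range (\<lambda>k. k *s X2)" "cx_covec \<alpha> X1 = 0" "cx_covec \<alpha> X2 = 0"
  shows "\<exists>k. \<forall>u. \<alpha> u = k * \<theta> u"
proof -
  obtain u0 where u0: "\<theta> u0 \<noteq> 0" using E_nonzero[OF assms(1)] .
  have "cx_ker \<theta> \<subseteq> cx_ker \<alpha>"
  proof
    fix z assume "z \<in> cx_ker \<theta>"
    then obtain a b where "z = a *s X1 + b *s X2"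
      unfolding E_setD(3)[OF assms(1)] plane_sum_def assms(7,8) by blast
    then show "z \<in> cx_ker \<alpha>"
      using assms(9,10) by (simp add: cx_ker_def cx_covec_add[OF assms(2)] cx_covec_smult[OF assms(2)])
  qed
  from covec_multiple[OF E_setD(2)[OF assms(1)] assms(2) u0 this] show ?thesis by blast
qed

text \<open>Subtracting the multiple that matches the values on a generator of T1, respectively T2,
  leaves a covector that vanishes on the whole contact plane, hence a multiple of \<theta>.\<close>

lemma adapted_related:
  assumes "(x, \<theta>) \<in> ES" "adapted x \<alpha>1 \<alpha>2" "adapted x \<alpha>1' \<alpha>2'"
  obtains a b v1 v2 where "a \<noteq> 0" "b \<noteq> 0" "\<And>u. \<alpha>1 u = v1 * \<theta> u + a * \<alpha>1' u" "\<And>u. \<alpha>2 u = v2 * \<theta> u + b * \<alpha>2' u"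
proof -
  obtain X1 X2 where X: "X1 \<in> T1 x" "X1 \<noteq> 0" "X2 \<in> T2 x" "X2 \<noteq> 0"
    "T1 x = range (\<lambda>k. k *s X1)" "T2 x = range (\<lambda>k. k *s X2)" using line_generators[OF E_setD(1)[OF assms(1)]] .
  note D = adaptedD[OF assms(2)] and D' = adaptedD[OF assms(3)]
  define a where "a = cx_covec \<alpha>1 X1 / cx_covec \<alpha>1' X1"
  define b where "b = cx_covec \<alpha>2 X2 / cx_covec \<alpha>2' X2"
  have ab: "a \<noteq> 0" "b \<noteq> 0" using X D D' by (simp_all add: a_def b_def)
  have *: "linear (\<lambda>u. \<alpha> u + - k * \<alpha>' u)" if "linear \<alpha>" "linear \<alpha>'" for \<alpha> \<alpha>' :: "(real ^ 3) covec" and k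
    using that by (intro linear_compose_add linear_mult_left)
  have "cx_covec (\<lambda>u. \<alpha>1 u + - a * \<alpha>1' u) X1 = 0" "cx_covec (\<lambda>u. \<alpha>1 u + - a * \<alpha>1' u) X2 = 0"
    "cx_covec (\<lambda>u. \<alpha>2 u + - b * \<alpha>2' u) X1 = 0" "cx_covec (\<lambda>u. \<alpha>2 u + - b * \<alpha>2' u) X2 = 0"
    unfolding cx_covec_sum cx_covec_scale using X(1-4) D(3-6) D'(3-6) by (simp_all add: a_def b_def)
  note 0 = this
  have "\<exists>k. \<forall>u. \<alpha>1 u + - a * \<alpha>1' u = k * \<theta> u"
    by (rule plane_covec[OF assms(1) *[OF D(1) D'(1)] X 0(1,2)])
  moreover have "\<exists>k. \<forall>u. \<alpha>2 u + - b * \<alpha>2' u = k * \<theta> u"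
    by (rule plane_covec[OF assms(1) *[OF D(2) D'(2)] X 0(3,4)])
  ultimately obtain v1 v2 where v: "\<And>u. \<alpha>1 u + - a * \<alpha>1' u = v1 * \<theta> u" "\<And>u. \<alpha>2 u + - b * \<alpha>2' u = v2 * \<theta> u" by blast
  show thesis
    by (rule that[OF ab, of v1 v2]) (use v in \<open>simp_all add: algebra_simps\<close>)
qed

text \<open>Normalised generators of T1 and T2 are dual to the two legs; a vector with \<theta> = 1
  becomes the third dual vector after its T1- and T2-parts are removed.\<close>

lemma adapted_dual:
  assumes "(x, \<theta>) \<in> ES" "adapted x \<alpha>1 \<alpha>2"
  shows "\<exists>z0 z1 z2. cx_covec \<theta> z0 = 1 \<and> cx_covec \<alpha>1 z0 = 0 \<and> cx_covec \<alpha>2 z0 = 0 \<and>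
    cx_covec \<theta> z1 = 0 \<and> cx_covec \<alpha>1 z1 = 1 \<and> cx_covec \<alpha>2 z1 = 0 \<and>
    cx_covec \<theta> z2 = 0 \<and> cx_covec \<alpha>1 z2 = 0 \<and> cx_covec \<alpha>2 z2 = 1"
proof -
  obtain X1 X2 where X: "X1 \<in> T1 x" "X1 \<noteq> 0" "X2 \<in> T2 x" "X2 \<noteq> 0"
    "T1 x = range (\<lambda>k. k *s X1)" "T2 x = range (\<lambda>k. k *s X2)" using line_generators[OF E_setD(1)[OF assms(1)]] .
  note D = adaptedD[OF assms(2)] and t = E_setD(2)[OF assms(1)]
  obtain u0 where u0: "\<theta> u0 \<noteq> 0" using E_nonzero[OF assms(1)] .
  define z1 z2 w where "z1 = (1 / cx_covec \<alpha>1 X1) *s X1" and "z2 = (1 / cx_covec \<alpha>2 X2) *s X2"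
    and "w = (1 / \<theta> u0) *s cx_vec u0"
  have 1: "cx_covec \<theta> z1 = 0" "cx_covec \<alpha>1 z1 = 1" "cx_covec \<alpha>2 z1 = 0"
    "cx_covec \<theta> z2 = 0" "cx_covec \<alpha>1 z2 = 0" "cx_covec \<alpha>2 z2 = 1" "cx_covec \<theta> w = 1"
    using X D u0 ker_contains[OF assms(1)] by (simp_all add: z1_def z2_def w_def cx_covec_smult t)
  show ?thesis
    by (rule exI[of _ "w - cx_covec \<alpha>1 w *s z1 - cx_covec \<alpha>2 w *s z2"], rule exI[of _ z1], rule exI[of _ z2])
      (simp add: 1 D(1,2) t cx_covec_diff cx_covec_smult)
qed

lemma Y_coframe_indep:
  assumes "(\<epsilon>, w, w1, w2, f) \<in> YS"
  shows "coframe_indep w w1 w2"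
proof -
  obtain \<alpha>1 \<alpha>2 where \<alpha>: "\<epsilon> \<in> ES" "w = taut \<epsilon>" "adapted (fst \<epsilon>) \<alpha>1 \<alpha>2" "w1 = \<alpha>1 \<circ> TE \<epsilon>" "w2 = \<alpha>2 \<circ> TE \<epsilon>"
    using assms unfolding Y_set_iff by blast
  have e: "(fst \<epsilon>, snd \<epsilon>) \<in> ES" using \<alpha>(1) by simp
  obtain z0 z1 z2 where z: "cx_covec (snd \<epsilon>) z0 = 1 \<and> cx_covec \<alpha>1 z0 = 0 \<and> cx_covec \<alpha>2 z0 = 0 \<and>
    cx_covec (snd \<epsilon>) z1 = 0 \<and> cx_covec \<alpha>1 z1 = 1 \<and> cx_covec \<alpha>2 z1 = 0 \<and>
    cx_covec (snd \<epsilon>) z2 = 0 \<and> cx_covec \<alpha>1 z2 = 0 \<and> cx_covec \<alpha>2 z2 = 1"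
    using adapted_dual[OF e \<alpha>(3)] by blast
  obtain g where g: "\<And>u. TE \<epsilon> (g u) = u" using TE_surj[OF \<alpha>(1)] by metis
  have "cx_eval w (g (re_vec z)) (g (im_vec z)) = cx_covec (snd \<epsilon>) z"
    "cx_eval w1 (g (re_vec z)) (g (im_vec z)) = cx_covec \<alpha>1 z"
    "cx_eval w2 (g (re_vec z)) (g (im_vec z)) = cx_covec \<alpha>2 z" for z
    by (simp_all add: \<alpha>(2,4,5) E_taut_def cx_eval_def cx_covec_def g)
  then show ?thesis
    unfolding coframe_indep_def using z by metis
qed

lemma Y_linear:
  assumes "(\<epsilon>, w, w1, w2, f) \<in> YS"
  shows "linear w" "linear w1" "linear w2" "linear f"
proof -
  obtain \<alpha>1 \<alpha>2 where \<alpha>: "\<epsilon> \<in> ES" "w = taut \<epsilon>" "adapted (fst \<epsilon>) \<alpha>1 \<alpha>2" "w1 = \<alpha>1 \<circ> TE \<epsilon>" "w2 = \<alpha>2 \<circ> TE \<epsilon>" "linear f"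
    using assms unfolding Y_set_iff by blast
  show "linear w" using smooth_formD(1)[OF taut_smooth \<alpha>(1)] \<alpha>(2) by simp
  show "linear w1" "linear w2" using adaptedD(1,2)[OF \<alpha>(3)] TE_linear[OF \<alpha>(1)] \<alpha>(4,5) linear_compose by auto
  show "linear f" by (rule \<alpha>(6))
qed

text \<open>Adding multiples of \<omega> to the two legs changes their wedge product by multiples of
  \<omega> \<and> \<omega>1 and \<omega> \<and> \<omega>2. The new terms in \<phi> cancel exactly
  these, which explains the last column of the matrices in H.\<close>

lemma Y_twist_in:
  assumes "(\<epsilon>, q) \<in> YS" "fst t \<noteq> 0"
  shows "(\<epsilon>, twist q t) \<in> YS"
proof -
  obtain w w1 w2 f where q: "q = (w, w1, w2, f)" by (cases q)
  obtain a v1 v2 s where t: "t = (a, v1, v2, s)" by (cases t)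
  have a: "a \<noteq> 0" using assms t by simp
  obtain \<alpha>1 \<alpha>2 where \<alpha>: "\<epsilon> \<in> ES" "w = taut \<epsilon>" "adapted (fst \<epsilon>) \<alpha>1 \<alpha>2" "w1 = \<alpha>1 \<circ> TE \<epsilon>" "w2 = \<alpha>2 \<circ> TE \<epsilon>" "linear f"
    and d: "\<And>u v. ext_deriv EA taut \<epsilon> u v = (w \<and>\<^sub>f f) u v + (w1 \<and>\<^sub>f w2) u v"
    using assms(1) unfolding q Y_set_iff by blast
  have e: "(fst \<epsilon>, snd \<epsilon>) \<in> ES" using \<alpha>(1) by simp
  note D = adaptedD[OF \<alpha>(3)]
  let ?\<alpha>1 = "\<lambda>u. v1 * snd \<epsilon> u + a * \<alpha>1 u" and ?\<alpha>2 = "\<lambda>u. v2 * snd \<epsilon> u + 1 / a * \<alpha>2 u"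
  have lin: "linear ?\<alpha>1" "linear ?\<alpha>2"
    using E_setD(2)[OF e] D(1,2) by (intro linear_compose_add linear_mult_left; simp)+
  have ad: "adapted (fst \<epsilon>) ?\<alpha>1 ?\<alpha>2"
    using lin D ker_contains[OF e] a unfolding adapted_def
    by (simp add: cx_covec_sum cx_covec_scale cx_covec_scale[of "1 / a", simplified])
  note L = Y_linear[OF assms(1)[unfolded q]]
  have lf: "linear (\<lambda>v. s * w v + a * v2 * w1 v - 1 / a * v1 * w2 v + f v)"
    by (intro linear_compose_add linear_compose_sub linear_mult_left L)
  have "ext_deriv EA taut \<epsilon> u v = (w \<and>\<^sub>f (\<lambda>v. s * w v + a * v2 * w1 v - 1 / a * v1 * w2 v + f v)) u v
      + ((\<lambda>v. v1 * w v + a * w1 v) \<and>\<^sub>f (\<lambda>v. v2 * w v + 1 / a * w2 v)) u v" for u v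
    unfolding d wedge_def using a by (simp add: field_simps)
  moreover have "(\<lambda>v. v1 * w v + a * w1 v) = ?\<alpha>1 \<circ> TE \<epsilon>" "(\<lambda>v. v2 * w v + 1 / a * w2 v) = ?\<alpha>2 \<circ> TE \<epsilon>"
    by (simp_all add: fun_eq_iff \<alpha>(2,4,5) E_taut_def)
  ultimately show ?thesis
    unfolding q t twist_def split Y_set_iff using \<alpha>(1,2) ad lf by blast
qed

text \<open>The two expressions for d\<omega> subtract to \<omega> \<and> g + (ab - 1) \<omega>1
  \<and> \<omega>2 = 0. By \<open>two_form_zero\<close> this forces b = 1 / a and g = s \<omega>,
  and s is the last parameter.\<close>

lemma Y_fibre_ex:
  assumes "(\<epsilon>, q) \<in> YS" "(\<epsilon>, q') \<in> YS"
  obtains t where "fst t \<noteq> 0" "q = twist q' t"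
proof -
  obtain w w1 w2 f where q: "q = (w, w1, w2, f)" by (cases q)
  obtain w' w1' w2' f' where q': "q' = (w', w1', w2', f')" by (cases q')
  obtain \<alpha>1 \<alpha>2 where \<alpha>: "\<epsilon> \<in> ES" "w = taut \<epsilon>" "adapted (fst \<epsilon>) \<alpha>1 \<alpha>2" "w1 = \<alpha>1 \<circ> TE \<epsilon>" "w2 = \<alpha>2 \<circ> TE \<epsilon>"
    and d: "\<And>u v. ext_deriv EA taut \<epsilon> u v = (w \<and>\<^sub>f f) u v + (w1 \<and>\<^sub>f w2) u v"
    using assms(1) unfolding q Y_set_iff by blast
  obtain \<alpha>1' \<alpha>2' where \<alpha>': "w' = taut \<epsilon>" "adapted (fst \<epsilon>) \<alpha>1' \<alpha>2'" "w1' = \<alpha>1' \<circ> TE \<epsilon>" "w2' = \<alpha>2' \<circ> TE \<epsilon>"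
    and d': "\<And>u v. ext_deriv EA taut \<epsilon> u v = (w' \<and>\<^sub>f f') u v + (w1' \<and>\<^sub>f w2') u v"
    using assms(2) unfolding q' Y_set_iff by blast
  have e: "(fst \<epsilon>, snd \<epsilon>) \<in> ES" using \<alpha>(1) by simp
  obtain a b v1 v2 where ab: "a \<noteq> 0" "b \<noteq> 0" and
    r: "\<And>u. \<alpha>1 u = v1 * snd \<epsilon> u + a * \<alpha>1' u" "\<And>u. \<alpha>2 u = v2 * snd \<epsilon> u + b * \<alpha>2' u"
    by (rule adapted_related[OF e \<alpha>(3) \<alpha>'(2)]) (rule that)
  have ww: "w = w'" using \<alpha> \<alpha>' by simp
  have r1: "w1 v = v1 * w' v + a * w1' v" and r2: "w2 v = v2 * w' v + b * w2' v" for v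
    by (simp_all add: \<alpha> \<alpha>' r E_taut_def)
  have 0: "w' u * (f v - f' v - a * v2 * w1' v + b * v1 * w2' v) - w' v * (f u - f' u - a * v2 * w1' u + b * v1 * w2' u)
      + (a * b - 1) * (w1' u * w2' v - w1' v * w2' u) = 0" for u v
    using d[of u v] unfolding d' wedge_def ww r1 r2 by (simp add: algebra_simps)
  note z = two_form_zero[OF Y_coframe_indep[OF assms(2)[unfolded q']] 0]
  have "b = 1 / a" using z(1) ab by (simp add: field_simps)
  obtain s where s: "\<And>v. f v - f' v - a * v2 * w1' v + b * v1 * w2' v = s * w' v" using z(2) by blast
  have "f v = s * w' v + a * v2 * w1' v - b * v1 * w2' v + f' v" for v
    using s[of v] by (simp add: algebra_simps)
  then have "q = twist q' (a, v1, v2, s)"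
    using r1 r2 ww by (simp add: q q' twist_def \<open>b = 1 / a\<close> fun_eq_iff)
  then show thesis using that[of "(a, v1, v2, s)"] ab by simp
qed

lemma twist_inj:
  assumes "(\<epsilon>, q) \<in> YS" "twist q t = twist q t'" "fst t \<noteq> 0" "fst t' \<noteq> 0"
  shows "t = t'"
proof -
  obtain w w1 w2 f where q: "q = (w, w1, w2, f)" by (cases q)
  obtain a v1 v2 s where t: "t = (a, v1, v2, s)" by (cases t)
  obtain a' v1' v2' s' where t': "t' = (a', v1', v2', s')" by (cases t')
  obtain p0 q0 p1 q1 p2 q2 where
    E: "cx_eval w p0 q0 = 1" "cx_eval w1 p0 q0 = 0" "cx_eval w2 p0 q0 = 0"
     "cx_eval w p1 q1 = 0" "cx_eval w1 p1 q1 = 1" "cx_eval w2 p1 q1 = 0"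
    using Y_coframe_indep[OF assms(1)[unfolded q]] unfolding coframe_indep_def by blast
  have c: "(\<lambda>v. v1 * w v + a * w1 v) = (\<lambda>v. v1' * w v + a' * w1 v)"
    "(\<lambda>v. v2 * w v + 1 / a * w2 v) = (\<lambda>v. v2' * w v + 1 / a' * w2 v)"
    "(\<lambda>v. s * w v + a * v2 * w1 v - 1 / a * v1 * w2 v + f v) = (\<lambda>v. s' * w v + a' * v2' * w1 v - 1 / a' * v1' * w2 v + f v)"
    using assms(2) by (simp_all add: q t t' twist_def)
  have eq: "v1 * w v + a * w1 v = v1' * w v + a' * w1 v" "v2 * w v + 1 / a * w2 v = v2' * w v + 1 / a' * w2 v"
    "s * w v + a * v2 * w1 v - 1 / a * v1 * w2 v + f v = s' * w v + a' * v2' * w1 v - 1 / a' * v1' * w2 v + f v" for v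
    using c[THEN fun_cong, of v] by auto
  have ev: "v1 * cx_eval w p q + a * cx_eval w1 p q = v1' * cx_eval w p q + a' * cx_eval w1 p q"
    "v2 * cx_eval w p q + 1 / a * cx_eval w2 p q = v2' * cx_eval w p q + 1 / a' * cx_eval w2 p q"
    "s * cx_eval w p q + a * v2 * cx_eval w1 p q - 1 / a * v1 * cx_eval w2 p q
      = s' * cx_eval w p q + a' * v2' * cx_eval w1 p q - 1 / a' * v1' * cx_eval w2 p q" for p q
  proof -
    have *: "x1 = y1 \<Longrightarrow> x2 = y2 \<Longrightarrow> x1 + \<i> * x2 = y1 + \<i> * y2" for x1 x2 y1 y2 by simp
    show "v1 * cx_eval w p q + a * cx_eval w1 p q = v1' * cx_eval w p q + a' * cx_eval w1 p q"
      using *[OF eq(1)[of p] eq(1)[of q]] by (simp add: cx_eval_def algebra_simps)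
    show "v2 * cx_eval w p q + 1 / a * cx_eval w2 p q = v2' * cx_eval w p q + 1 / a' * cx_eval w2 p q"
      using *[OF eq(2)[of p] eq(2)[of q]] by (simp add: cx_eval_def algebra_simps)
    show "s * cx_eval w p q + a * v2 * cx_eval w1 p q - 1 / a * v1 * cx_eval w2 p q
      = s' * cx_eval w p q + a' * v2' * cx_eval w1 p q - 1 / a' * v1' * cx_eval w2 p q"
      using *[OF eq(3)[of p] eq(3)[of q]] by (simp add: cx_eval_def algebra_simps)
  qed
  show ?thesis
    using ev(1)[of p0 q0] ev(1)[of p1 q1] ev(2)[of p0 q0] ev(3)[of p0 q0] by (simp add: E t t')
qed

lemma tangent_map_dilate_1:
  assumes "\<epsilon> \<in> ES" shows "tangent_map EA EA (dilate 1) \<epsilon> v = v"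
proof -
  obtain c U \<theta> where C: "Edata c U \<theta>" "\<epsilon> \<in> fst (Echart c U \<theta>)" using E_cases[OF assms] .
  obtain u m where um: "to_chart EA (Echart c U \<theta>) \<epsilon> v = (u, m)" by fastforce
  then show ?thesis
    using smooth_at_dilate(2)[OF C, of 1 u m] from_to_chart[OF E_atlas_smooth Echart_in[OF C(1)] C(2), of v] by simp
qed

text \<open>For \<lambda> = 1 the transport is along the identity dilation, so the
  \<open>THE\<close> in the charts of \<open>Y_atlas\<close> asks for the parameters of a
  twist.\<close>

lemma H_act_unit:
  assumes "\<epsilon> \<in> ES" "a \<noteq> 0"
  shows "H_act A T1 T2 (\<epsilon>, q) (H_mat a (1 / a) v1 v2 s) = (\<epsilon>, twist q (a, v1, v2, s))"
proof -
  obtain w w1 w2 f where q: "q = (w, w1, w2, f)" by (cases q)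
  have "tangent_map EA EA (dilate 1) \<epsilon> = (\<lambda>v. v)" using tangent_map_dilate_1[OF assms(1)] by auto
  then show ?thesis
    using assms(2)
    by (simp add: H_act_def Let_def H_mat_11 q coframe_mult_H_mat coframe_pull_def twist_def comp_def)
qed

section \<open>Charts of Y attached to a local section over E\<close>

definition Ydata :: "('m Ept, Emod) chart \<Rightarrow> 'm Ept set \<Rightarrow> ('m Ept \<Rightarrow> coframe) \<Rightarrow> bool" where
  "Ydata C W \<sigma> \<longleftrightarrow> C \<in> EA \<and> is_open EA W \<and> W \<subseteq> fst C \<and>
     smooth_form EA W (\<lambda>\<epsilon>. fst (\<sigma> \<epsilon>)) \<and> smooth_form EA W (\<lambda>\<epsilon>. fst (snd (\<sigma> \<epsilon>))) \<and>
     smooth_form EA W (\<lambda>\<epsilon>. fst (snd (snd (\<sigma> \<epsilon>)))) \<and> smooth_form EA W (\<lambda>\<epsilon>. snd (snd (snd (\<sigma> \<epsilon>)))) \<and>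
     (\<forall>\<epsilon>\<in>W. (\<epsilon>, \<sigma> \<epsilon>) \<in> YS)"

lemma YdataD:
  assumes "Ydata C W \<sigma>"
  shows "C \<in> EA" "is_open EA W" "W \<subseteq> fst C"
     "smooth_form EA W (\<lambda>\<epsilon>. fst (\<sigma> \<epsilon>))" "smooth_form EA W (\<lambda>\<epsilon>. fst (snd (\<sigma> \<epsilon>)))"
     "smooth_form EA W (\<lambda>\<epsilon>. fst (snd (snd (\<sigma> \<epsilon>))))" "smooth_form EA W (\<lambda>\<epsilon>. snd (snd (snd (\<sigma> \<epsilon>))))"
     "\<epsilon> \<in> W \<Longrightarrow> (\<epsilon>, \<sigma> \<epsilon>) \<in> YS" "\<epsilon> \<in> W \<Longrightarrow> \<epsilon> \<in> ES"
  using assms Y_set_E[of "(\<epsilon>, \<sigma> \<epsilon>)"] by (simp_all add: Ydata_def)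

definition Ychart :: "('m Ept, Emod) chart \<Rightarrow> 'm Ept set \<Rightarrow> ('m Ept \<Rightarrow> coframe) \<Rightarrow> ('m Ypt, Ymod) chart" where
  "Ychart C W \<sigma> = ({y \<in> YS. fst y \<in> W}, \<lambda>y. (snd C (fst y),
     THE (a, v1, v2, s). a \<noteq> 0 \<and> y = H_act A T1 T2 (fst y, \<sigma> (fst y)) (H_mat a (1 / a) v1 v2 s)))"

lemma Y_atlas_eq: "YA = {Ychart C W \<sigma> | C W \<sigma>. Ydata C W \<sigma>}"
proof (intro equalityI subsetI)
  fix c assume "c \<in> YA"
  then obtain C W \<eta> \<eta>1 \<eta>2 \<zeta> where c: "c = ({y \<in> YS. fst y \<in> W}, \<lambda>y. (snd C (fst y), THE (a, v1, v2, s). a \<noteq> 0 \<and>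
              y = H_act A T1 T2 (fst y, \<eta> (fst y), \<eta>1 (fst y), \<eta>2 (fst y), \<zeta> (fst y)) (H_mat a (1 / a) v1 v2 s)))"
     and "C \<in> EA" "is_open EA W" "W \<subseteq> fst C"
        "smooth_form EA W \<eta>" "smooth_form EA W \<eta>1" "smooth_form EA W \<eta>2" "smooth_form EA W \<zeta>"
        "\<forall>\<epsilon>\<in>W. (\<epsilon>, \<eta> \<epsilon>, \<eta>1 \<epsilon>, \<eta>2 \<epsilon>, \<zeta> \<epsilon>) \<in> YS"
    unfolding Y_atlas_def mem_Collect_eq by (elim exE conjE) (rule that)
  then have "Ydata C W (\<lambda>\<epsilon>. (\<eta> \<epsilon>, \<eta>1 \<epsilon>, \<eta>2 \<epsilon>, \<zeta> \<epsilon>))" "c = Ychart C W (\<lambda>\<epsilon>. (\<eta> \<epsilon>, \<eta>1 \<epsilon>, \<eta>2 \<epsilon>, \<zeta> \<epsilon>))"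
    by (simp_all add: Ydata_def Ychart_def)
  then show "c \<in> {Ychart C W \<sigma> | C W \<sigma>. Ydata C W \<sigma>}" by blast
next
  fix c assume "c \<in> {Ychart C W \<sigma> | C W \<sigma>. Ydata C W \<sigma>}"
  then obtain C W \<sigma> where c: "c = Ychart C W \<sigma>" "Ydata C W \<sigma>" by blast
  show "c \<in> YA"
    unfolding Y_atlas_def c(1) Ychart_def
    by (rule CollectI, rule exI[of _ C], rule exI[of _ W], rule exI[of _ "\<lambda>\<epsilon>. fst (\<sigma> \<epsilon>)"], rule exI[of _ "\<lambda>\<epsilon>. fst (snd (\<sigma> \<epsilon>))"],
        rule exI[of _ "\<lambda>\<epsilon>. fst (snd (snd (\<sigma> \<epsilon>)))"], rule exI[of _ "\<lambda>\<epsilon>. snd (snd (snd (\<sigma> \<epsilon>)))"])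
      (use c(2) in \<open>simp add: Ydata_def\<close>)
qed

lemma Ychart_in: "Ydata C W \<sigma> \<Longrightarrow> Ychart C W \<sigma> \<in> YA"
  unfolding Y_atlas_eq by blast

lemma Y_atlasE:
  assumes "c \<in> YA" obtains C W \<sigma> where "c = Ychart C W \<sigma>" "Ydata C W \<sigma>"
  using assms unfolding Y_atlas_eq by blast

lemma Ychart_dom: "y \<in> fst (Ychart C W \<sigma>) \<longleftrightarrow> y \<in> YS \<and> fst y \<in> W"
  by (simp add: Ychart_def)

lemma Ychart_val:
  assumes "Ydata C W \<sigma>" "\<epsilon> \<in> W" "fst t \<noteq> 0"
  shows "snd (Ychart C W \<sigma>) (\<epsilon>, twist (\<sigma> \<epsilon>) t) = (snd C \<epsilon>, t)"
proof -
  note D = YdataD[OF assms(1)]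
  have "(case t' of (a, v1, v2, s) \<Rightarrow> a \<noteq> 0 \<and> (\<epsilon>, twist (\<sigma> \<epsilon>) t) = H_act A T1 T2 (\<epsilon>, \<sigma> \<epsilon>) (H_mat a (1 / a) v1 v2 s)) \<longleftrightarrow> t' = t" for t'
    using twist_inj[OF D(8)[OF assms(2)], of t t'] assms(3)
    by (cases t') (auto simp: H_act_unit[OF D(9)[OF assms(2)]])
  then show ?thesis by (simp add: Ychart_def case_prod_unfold)
qed

lemma Ychart_pt: "Ydata C W \<sigma> \<Longrightarrow> \<epsilon> \<in> W \<Longrightarrow> fst t \<noteq> 0 \<Longrightarrow> (\<epsilon>, twist (\<sigma> \<epsilon>) t) \<in> fst (Ychart C W \<sigma>)"
  using Y_twist_in YdataD(8) by (simp add: Ychart_dom)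

lemma Ychart_cases:
  assumes "Ydata C W \<sigma>" "y \<in> fst (Ychart C W \<sigma>)"
  obtains \<epsilon> t where "\<epsilon> \<in> W" "fst t \<noteq> 0" "y = (\<epsilon>, twist (\<sigma> \<epsilon>) t)"
proof -
  obtain \<epsilon> q where y: "y = (\<epsilon>, q)" by (cases y)
  then have "(\<epsilon>, q) \<in> YS" "\<epsilon> \<in> W" using assms(2) by (auto simp: Ychart_dom)
  then show thesis using Y_fibre_ex[OF _ YdataD(8)[OF assms(1)], of \<epsilon> q] that y by metis
qed

lemma Ychart_inj:
  assumes "Ydata C W \<sigma>" shows "inj_on (snd (Ychart C W \<sigma>)) (fst (Ychart C W \<sigma>))"
proof (rule inj_onI)
  fix y y' assume y: "y \<in> fst (Ychart C W \<sigma>)" "y' \<in> fst (Ychart C W \<sigma>)"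
    and eq: "snd (Ychart C W \<sigma>) y = snd (Ychart C W \<sigma>) y'"
  note D = YdataD[OF assms]
  obtain \<epsilon> t where 1: "\<epsilon> \<in> W" "fst t \<noteq> 0" "y = (\<epsilon>, twist (\<sigma> \<epsilon>) t)" by (rule Ychart_cases[OF assms y(1)])
  obtain \<epsilon>' t' where 2: "\<epsilon>' \<in> W" "fst t' \<noteq> 0" "y' = (\<epsilon>', twist (\<sigma> \<epsilon>') t')" by (rule Ychart_cases[OF assms y(2)])
  have "snd C \<epsilon> = snd C \<epsilon>'" "t = t'"
    using eq 1 2 Ychart_val[OF assms] by auto
  moreover have "\<epsilon> = \<epsilon>'" using calculation(1) chart_inj[OF E_atlas_smooth D(1)] D(3) 1(1) 2(1) by (meson inj_onD subsetD)
  ultimately show "y = y'" using 1 2 by simp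
qed

lemma Ychart_image:
  assumes "Ydata C W \<sigma>" "V \<subseteq> W"
  shows "snd (Ychart C W \<sigma>) ` {y \<in> YS. fst y \<in> V} = (snd C ` V) \<times> ((- {0::complex}) \<times> (UNIV :: (complex \<times> complex \<times> complex) set))"
proof (intro equalityI subsetI)
  fix q assume "q \<in> snd (Ychart C W \<sigma>) ` {y \<in> YS. fst y \<in> V}"
  then obtain y where y: "q = snd (Ychart C W \<sigma>) y" "y \<in> YS" "fst y \<in> V" by auto
  then have "y \<in> fst (Ychart C W \<sigma>)" using assms(2) by (auto simp: Ychart_dom)
  then obtain \<epsilon> t where "\<epsilon> \<in> W" "fst t \<noteq> 0" "y = (\<epsilon>, twist (\<sigma> \<epsilon>) t)" by (rule Ychart_cases[OF assms(1)])
  then show "q \<in> (snd C ` V) \<times> ((- {0::complex}) \<times> (UNIV :: (complex \<times> complex \<times> complex) set))"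
    using y Ychart_val[OF assms(1)] by (cases t) auto
next
  fix q assume "q \<in> (snd C ` V) \<times> ((- {0::complex}) \<times> (UNIV :: (complex \<times> complex \<times> complex) set))"
  then have "fst q \<in> snd C ` V" and t: "fst (snd q) \<noteq> 0" by auto
  then obtain \<epsilon> where "fst q = snd C \<epsilon>" "\<epsilon> \<in> V" by blast
  with t obtain t where q: "q = (snd C \<epsilon>, t)" "\<epsilon> \<in> V" "fst t \<noteq> 0"
    by (intro that[of "snd q"]) (simp_all add: prod_eq_iff)
  then have "(\<epsilon>, twist (\<sigma> \<epsilon>) t) \<in> {y \<in> YS. fst y \<in> V}" "q = snd (Ychart C W \<sigma>) (\<epsilon>, twist (\<sigma> \<epsilon>) t)"
    using Ychart_pt[OF assms(1), of \<epsilon> t] Ychart_val[OF assms(1), of \<epsilon> t] assms(2) by (auto simp: Ychart_dom)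
  then show "q \<in> snd (Ychart C W \<sigma>) ` {y \<in> YS. fst y \<in> V}" by blast
qed

lemma Ychart_inv:
  assumes "Ydata C W \<sigma>" "\<epsilon> \<in> W" "fst t \<noteq> 0"
  shows "chart_inv (Ychart C W \<sigma>) (snd C \<epsilon>, t) = (\<epsilon>, twist (\<sigma> \<epsilon>) t)"
  unfolding chart_inv_def
  using inv_into_f_f[OF Ychart_inj[OF assms(1)] Ychart_pt[OF assms]] Ychart_val[OF assms] by simp

lemma open_E_image:
  assumes "Ydata C W \<sigma>" "is_open EA V" "V \<subseteq> W"
  shows "open (snd C ` V)"
proof -
  have "V \<inter> fst C = V" using assms YdataD(3) by blast
  then show ?thesis using is_openD[OF assms(2) YdataD(1)[OF assms(1)]] by simp
qed

end

text \<open>Supplies components on real vectors that do not vanish, the denominators for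
  \<open>smooth_on_ratio\<close> in the transition functions of Y.\<close>

lemma coframe_indep_nonzero:
  assumes "coframe_indep w w1 w2"
  shows "\<exists>u. w u \<noteq> 0" "\<exists>u v. w1 u * w v - w1 v * w u \<noteq> 0"
proof -
  obtain p0 q0 p1 q1 where
    E: "cx_eval w p0 q0 = 1" "cx_eval w1 p0 q0 = 0" "cx_eval w p1 q1 = 0" "cx_eval w1 p1 q1 = 1"
    using assms unfolding coframe_indep_def by blast
  show "\<exists>u. w u \<noteq> 0"
  proof (rule ccontr)
    assume "\<not> (\<exists>u. w u \<noteq> 0)"
    then show False using E(1) by (simp add: cx_eval_def)
  qed
  show "\<exists>u v. w1 u * w v - w1 v * w u \<noteq> 0"
  proof (rule ccontr)
    assume "\<not> (\<exists>u v. w1 u * w v - w1 v * w u \<noteq> 0)"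
    then have 0: "w1 u * w v - w1 v * w u = 0" for u v by blast
    have "cx_eval w1 p1 q1 * cx_eval w p0 q0 - cx_eval w1 p0 q0 * cx_eval w p1 q1
      = (w1 p1 * w p0 - w1 p0 * w p1) + \<i> * (w1 p1 * w q0 - w1 q0 * w p1)
        + \<i> * (w1 q1 * w p0 - w1 p0 * w q1) - (w1 q1 * w q0 - w1 q0 * w q1)"
      by (simp add: cx_eval_def algebra_simps)
    also have "\<dots> = 0" by (simp only: 0) simp
    finally show False by (simp add: E)
  qed
qed

abbreviation chart_params :: "(complex \<times> complex \<times> complex \<times> complex) set" where
  "chart_params \<equiv> (- {0}) \<times> UNIV"

lemma open_chart_params: "open chart_params"
  by (intro open_Times) auto

lemma twist_apply:
  "fst (twist q t) v = fst q v"
  "fst (snd (twist q t)) v = fst (snd t) * fst q v + fst t * fst (snd q) v"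
  "fst (snd (snd (twist q t))) v = fst (snd (snd t)) * fst q v + 1 / fst t * fst (snd (snd q)) v"
  "snd (snd (snd (twist q t))) v = snd (snd (snd t)) * fst q v + fst t * fst (snd (snd t)) * fst (snd q) v
     - 1 / fst t * fst (snd t) * fst (snd (snd q)) v + snd (snd (snd q)) v"
  by (simp_all add: twist_def case_prod_unfold)

section \<open>Smoothness of the transition functions of Y\<close>

context flag_manifold
begin

lemma open_chart_product:
  assumes "Ydata C W \<sigma>" "is_open EA V" "V \<subseteq> W"
  shows "open (snd C ` V \<times> chart_params)"
  using open_E_image[OF assms] open_chart_params by (rule open_Times)

lemma section_comp_at:
  assumes "Ydata C W \<sigma>" "\<epsilon> \<in> W"
  shows "form_comp EA \<alpha> C u (snd C \<epsilon>) = \<alpha> \<epsilon> (from_chart EA C \<epsilon> u)"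
  using form_comp_at[OF E_atlas_smooth YdataD(1)[OF assms(1)], of \<epsilon> \<alpha> u] YdataD(3)[OF assms(1)] assms(2) by blast

lemma section_comp_smooth:
  assumes "Ydata C W \<sigma>" "is_open EA V" "V \<subseteq> W" "smooth_form EA V \<alpha>"
  shows "smooth_on (snd C ` V) (form_comp EA \<alpha> C u)"
proof -
  have "V \<inter> fst C = V" using assms YdataD(3) by blast
  then show ?thesis using smooth_formD(2)[OF assms(4) YdataD(1)[OF assms(1)], of u] by simp
qed

lemma param_smooth:
  assumes S: "open S"
  shows "smooth_on (S \<times> chart_params) (\<lambda>q. fst (snd q))" "smooth_on (S \<times> chart_params) (\<lambda>q. fst (snd (snd q)))"
    "smooth_on (S \<times> chart_params) (\<lambda>q. fst (snd (snd (snd q))))" "smooth_on (S \<times> chart_params) (\<lambda>q. snd (snd (snd (snd q))))"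
    "smooth_on (S \<times> chart_params) (\<lambda>q. 1 / fst (snd q))"
proof -
  have op: "open (S \<times> chart_params)" using S open_chart_params by (rule open_Times)
  show "smooth_on (S \<times> chart_params) (\<lambda>q. fst (snd q))" "smooth_on (S \<times> chart_params) (\<lambda>q. fst (snd (snd q)))"
    "smooth_on (S \<times> chart_params) (\<lambda>q. fst (snd (snd (snd q))))" "smooth_on (S \<times> chart_params) (\<lambda>q. snd (snd (snd (snd q))))"
    by (intro smooth_on_intros op)+
  show "smooth_on (S \<times> chart_params) (\<lambda>q. 1 / fst (snd q))"
    by (intro smooth_on_intros op) auto
qed

text \<open>The new fibre coordinates are given by a \<open>THE\<close> and are recovered from
  linear relations between smooth components. Taking the wedge product of the \<omega>1-relation
  with \<omega> eliminates the coefficient of \<omega> and isolates a'. Once a' is smooth, division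
  by components of \<omega> gives v1' and v2', and with these also s'.\<close>

lemma Y_transition_smooth:
  assumes Y: "Ydata C W \<sigma>" and Y': "Ydata C' W' \<sigma>'"
  shows "smooth_on (snd C ` (W \<inter> W') \<times> chart_params)
     (\<lambda>q. snd (snd (Ychart C' W' \<sigma>') (chart_inv (Ychart C W \<sigma>) q)))"
proof -
  note D = YdataD[OF Y] and D' = YdataD[OF Y']
  let ?V = "W \<inter> W'"
  let ?S = "snd C ` ?V"
  let ?im = "?S \<times> chart_params"
  define t' where "t' q = snd (snd (Ychart C' W' \<sigma>') (chart_inv (Ychart C W \<sigma>) q))" for q
  have V: "is_open EA ?V" using is_open_inter[OF E_atlas_smooth D(2) D'(2)] .
  have S: "open ?S" using open_E_image[OF Y V] by blast
  have op: "open ?im" using S open_chart_params by (rule open_Times)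
  have sub: "?V \<subseteq> W" "?V \<subseteq> W'" by auto
  define h0 h1 h2 h3 where "h0 = form_comp EA (\<lambda>\<epsilon>. fst (\<sigma> \<epsilon>)) C" and "h1 = form_comp EA (\<lambda>\<epsilon>. fst (snd (\<sigma> \<epsilon>))) C"
    and "h2 = form_comp EA (\<lambda>\<epsilon>. fst (snd (snd (\<sigma> \<epsilon>)))) C" and "h3 = form_comp EA (\<lambda>\<epsilon>. snd (snd (snd (\<sigma> \<epsilon>)))) C"
  define k1 k2 k3 where "k1 = form_comp EA (\<lambda>\<epsilon>. fst (snd (\<sigma>' \<epsilon>))) C"
    and "k2 = form_comp EA (\<lambda>\<epsilon>. fst (snd (snd (\<sigma>' \<epsilon>)))) C" and "k3 = form_comp EA (\<lambda>\<epsilon>. snd (snd (snd (\<sigma>' \<epsilon>)))) C"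
  have sm: "smooth_on ?im (\<lambda>q. h0 u (fst q))" "smooth_on ?im (\<lambda>q. h1 u (fst q))"
    "smooth_on ?im (\<lambda>q. h2 u (fst q))" "smooth_on ?im (\<lambda>q. h3 u (fst q))"
    "smooth_on ?im (\<lambda>q. k1 u (fst q))" "smooth_on ?im (\<lambda>q. k2 u (fst q))" "smooth_on ?im (\<lambda>q. k3 u (fst q))" for u
    unfolding h0_def h1_def h2_def h3_def k1_def k2_def k3_def
    by (intro smooth_on_compose_fst[OF S open_chart_params] section_comp_smooth[OF Y V sub(1)];
        rule smooth_form_subset[OF D(4) sub(1)] smooth_form_subset[OF D(5) sub(1)] smooth_form_subset[OF D(6) sub(1)]
          smooth_form_subset[OF D(7) sub(1)] smooth_form_subset[OF D'(5) sub(2)] smooth_form_subset[OF D'(6) sub(2)]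
          smooth_form_subset[OF D'(7) sub(2)])+
  define w1 where "w1 u q = fst (snd (snd q)) * h0 u (fst q) + fst (snd q) * h1 u (fst q)" for u and q :: Ymod
  define w2 where "w2 u q = fst (snd (snd (snd q))) * h0 u (fst q) + 1 / fst (snd q) * h2 u (fst q)" for u and q :: Ymod
  define f where "f u q = snd (snd (snd (snd q))) * h0 u (fst q) + fst (snd q) * fst (snd (snd (snd q))) * h1 u (fst q)
     - 1 / fst (snd q) * fst (snd (snd q)) * h2 u (fst q) + h3 u (fst q)" for u and q :: Ymod
  have smw: "smooth_on ?im (w1 u)" "smooth_on ?im (w2 u)" "smooth_on ?im (f u)" for u
    unfolding w1_def[abs_def] w2_def[abs_def] f_def[abs_def]
    by (intro smooth_on_add smooth_on_diff smooth_on_mult op sm param_smooth[OF S])+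
  have key: "w1 u q = fst (snd (t' q)) * h0 u (fst q) + fst (t' q) * k1 u (fst q)"
    "w2 u q = fst (snd (snd (t' q))) * h0 u (fst q) + 1 / fst (t' q) * k2 u (fst q)"
    "f u q = snd (snd (snd (t' q))) * h0 u (fst q) + fst (t' q) * fst (snd (snd (t' q))) * k1 u (fst q)
       - 1 / fst (t' q) * fst (snd (t' q)) * k2 u (fst q) + k3 u (fst q)"
    "fst (t' q) \<noteq> 0" "\<exists>u. h0 u (fst q) \<noteq> 0" "\<exists>u. k1 (fst u) (fst q) * h0 (snd u) (fst q) - k1 (snd u) (fst q) * h0 (fst u) (fst q) \<noteq> 0"
    if q: "q \<in> ?im" for q u
  proof -
    have "fst q \<in> ?S" "fst (snd q) \<noteq> 0" using q by auto
    then obtain \<epsilon> where "fst q = snd C \<epsilon>" "\<epsilon> \<in> ?V" by blast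
    then obtain t where e: "q = (snd C \<epsilon>, t)" "\<epsilon> \<in> W" "\<epsilon> \<in> W'" "fst t \<noteq> 0"
      using \<open>fst (snd q) \<noteq> 0\<close> by (intro that[of "snd q"]) (auto simp: prod_eq_iff)
    have y: "chart_inv (Ychart C W \<sigma>) q = (\<epsilon>, twist (\<sigma> \<epsilon>) t)"
      unfolding e(1) by (rule Ychart_inv[OF Y e(2,4)])
    have yin: "(\<epsilon>, twist (\<sigma> \<epsilon>) t) \<in> YS" using Y_twist_in[OF D(8)[OF e(2)] e(4)] .
    obtain r where r: "fst r \<noteq> 0" "twist (\<sigma> \<epsilon>) t = twist (\<sigma>' \<epsilon>) r"
      using Y_fibre_ex[OF yin D'(8)[OF e(3)]] .
    have tq: "t' q = r" unfolding t'_def y r(2) using Ychart_val[OF Y' e(3) r(1)] by simp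
    have 0: "fst (\<sigma>' \<epsilon>) = fst (\<sigma> \<epsilon>)"
      using r(2) twist_apply(1)[of "\<sigma> \<epsilon>" t] twist_apply(1)[of "\<sigma>' \<epsilon>" r] by auto
    have h: "h0 u (fst q) = fst (\<sigma> \<epsilon>) (from_chart EA C \<epsilon> u)" "h1 u (fst q) = fst (snd (\<sigma> \<epsilon>)) (from_chart EA C \<epsilon> u)"
      "h2 u (fst q) = fst (snd (snd (\<sigma> \<epsilon>))) (from_chart EA C \<epsilon> u)" "h3 u (fst q) = snd (snd (snd (\<sigma> \<epsilon>))) (from_chart EA C \<epsilon> u)"
      "k1 u (fst q) = fst (snd (\<sigma>' \<epsilon>)) (from_chart EA C \<epsilon> u)"
      "k2 u (fst q) = fst (snd (snd (\<sigma>' \<epsilon>))) (from_chart EA C \<epsilon> u)" "k3 u (fst q) = snd (snd (snd (\<sigma>' \<epsilon>))) (from_chart EA C \<epsilon> u)" for u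
      by (simp_all add: h0_def h1_def h2_def h3_def k1_def k2_def k3_def e(1) section_comp_at[OF Y e(2)])
    note T = arg_cong[OF r(2), of "\<lambda>x. fst (snd x) (from_chart EA C \<epsilon> u)"]
      arg_cong[OF r(2), of "\<lambda>x. fst (snd (snd x)) (from_chart EA C \<epsilon> u)"]
      arg_cong[OF r(2), of "\<lambda>x. snd (snd (snd x)) (from_chart EA C \<epsilon> u)"]
    have q2: "snd q = t" by (simp add: e)
    show "w1 u q = fst (snd (t' q)) * h0 u (fst q) + fst (t' q) * k1 u (fst q)"
      "w2 u q = fst (snd (snd (t' q))) * h0 u (fst q) + 1 / fst (t' q) * k2 u (fst q)"
      "f u q = snd (snd (snd (t' q))) * h0 u (fst q) + fst (t' q) * fst (snd (snd (t' q))) * k1 u (fst q)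
       - 1 / fst (t' q) * fst (snd (t' q)) * k2 u (fst q) + k3 u (fst q)"
      using T unfolding twist_apply w1_def w2_def f_def tq h q2 0 by simp_all
    show "fst (t' q) \<noteq> 0" using tq r by simp
    obtain w w1 w2 f where s: "\<sigma>' \<epsilon> = (w, w1, w2, f)" by (cases "\<sigma>' \<epsilon>")
    note N = coframe_indep_nonzero[OF Y_coframe_indep[OF D'(8)[OF e(3), unfolded s]]]
    have eC: "\<epsilon> \<in> fst C" using D(3) e(2) by blast
    note ft = from_to_chart[OF E_atlas_smooth D(1) eC]
    obtain X where "w X \<noteq> 0" using N(1) by blast
    then show "\<exists>u. h0 u (fst q) \<noteq> 0"
      unfolding h 0[symmetric] s by (intro exI[of _ "to_chart EA C \<epsilon> X"]) (simp add: ft)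
    obtain X Z where "w1 X * w Z - w1 Z * w X \<noteq> 0" using N(2) by blast
    then show "\<exists>u. k1 (fst u) (fst q) * h0 (snd u) (fst q) - k1 (snd u) (fst q) * h0 (fst u) (fst q) \<noteq> 0"
      unfolding h 0[symmetric] s by (intro exI[of _ "(to_chart EA C \<epsilon> X, to_chart EA C \<epsilon> Z)"]) (simp add: ft)
  qed
  have sa: "smooth_on ?im (\<lambda>q. fst (t' q))"
    by (rule smooth_on_ratio[where F = "\<lambda>u q. w1 (fst u) q * h0 (snd u) (fst q) - w1 (snd u) q * h0 (fst u) (fst q)"
          and G = "\<lambda>u q. k1 (fst u) (fst q) * h0 (snd u) (fst q) - k1 (snd u) (fst q) * h0 (fst u) (fst q)", OF op _ _ _ key(6)])
      (intro smooth_on_diff smooth_on_mult op sm smw | simp add: key(1) algebra_simps)+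
  have sia: "smooth_on ?im (\<lambda>q. 1 / fst (t' q))"
    by (intro smooth_on_divide smooth_on_const op sa key(4))
  have sv1: "smooth_on ?im (\<lambda>q. fst (snd (t' q)))"
    by (rule smooth_on_ratio[where F = "\<lambda>u q. w1 u q - fst (t' q) * k1 u (fst q)" and G = "\<lambda>u q. h0 u (fst q)", OF op _ _ _ key(5)])
      (intro smooth_on_diff smooth_on_mult op sm smw sa | simp add: key(1))+
  have sv2: "smooth_on ?im (\<lambda>q. fst (snd (snd (t' q))))"
    by (rule smooth_on_ratio[where F = "\<lambda>u q. w2 u q - 1 / fst (t' q) * k2 u (fst q)" and G = "\<lambda>u q. h0 u (fst q)", OF op _ _ _ key(5)])
      (intro smooth_on_diff smooth_on_mult op sm smw sia | simp add: key(2))+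
  have ss: "smooth_on ?im (\<lambda>q. snd (snd (snd (t' q))))"
    by (rule smooth_on_ratio[where F = "\<lambda>u q. f u q - fst (t' q) * fst (snd (snd (t' q))) * k1 u (fst q)
       + 1 / fst (t' q) * fst (snd (t' q)) * k2 u (fst q) - k3 u (fst q)" and G = "\<lambda>u q. h0 u (fst q)", OF op _ _ _ key(5)])
      (intro smooth_on_add smooth_on_diff smooth_on_mult op sm smw sa sia sv1 sv2 | simp add: key(3))+
  have "smooth_on ?im (\<lambda>q. (fst (t' q), fst (snd (t' q)), fst (snd (snd (t' q))), snd (snd (snd (t' q)))))"
    by (intro smooth_on_Pair op sa sv1 sv2 ss)
  then show ?thesis by (simp add: t'_def)
qed

lemma Y_atlas_smooth: "smooth_atlas YA"
  unfolding smooth_atlas_def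
proof (intro conjI ballI)
  fix c assume "c \<in> YA"
  then obtain C W \<sigma> where c: "c = Ychart C W \<sigma>" "Ydata C W \<sigma>" by (rule Y_atlasE)
  note D = YdataD[OF c(2)]
  show "inj_on (snd c) (fst c)" using c Ychart_inj by simp
  have "fst c = {y \<in> YS. fst y \<in> W}" by (simp add: c Ychart_def)
  then have "snd c ` fst c = snd C ` W \<times> chart_params" using Ychart_image[OF c(2)] c by simp
  then show "open (snd c ` fst c)" using open_chart_product[OF c(2) D(2)] by simp
  fix c' assume "c' \<in> YA"
  then obtain C' W' \<sigma>' where c': "c' = Ychart C' W' \<sigma>'" "Ydata C' W' \<sigma>'" by (rule Y_atlasE)
  note D' = YdataD[OF c'(2)]
  have V: "is_open EA (W \<inter> W')" using is_open_inter[OF E_atlas_smooth D(2) D'(2)] .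
  have "fst c \<inter> fst c' = {y \<in> YS. fst y \<in> W \<inter> W'}" by (auto simp: c c' Ychart_def)
  then have im: "snd c ` (fst c \<inter> fst c') = snd C ` (W \<inter> W') \<times> chart_params"
    using Ychart_image[OF c(2), of "W \<inter> W'"] c by simp
  have S: "open (snd C ` (W \<inter> W'))" using open_E_image[OF c(2) V] by blast
  have op: "open (snd C ` (W \<inter> W') \<times> chart_params)" using S open_chart_params by (rule open_Times)
  show "open (snd c ` (fst c \<inter> fst c'))" unfolding im by (rule op)
  show "smooth_on (snd c ` (fst c \<inter> fst c')) (snd c' \<circ> chart_inv c)"
    unfolding im
  proof (rule smooth_on_cong[OF _ op])
    have "smooth_on (snd C ` (W \<inter> W')) (\<lambda>z. snd C' (chart_inv C z))"
      by (rule smooth_on_subset[OF trans_smooth[OF E_atlas_smooth D(1) D'(1)]]) (use D(3) D'(3) in blast)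
    then show "smooth_on (snd C ` (W \<inter> W') \<times> chart_params) (\<lambda>q. (snd C' (chart_inv C (fst q)), snd (snd c' (chart_inv c q))))"
      unfolding c(1) c'(1)
      by (intro smooth_on_Pair op smooth_on_compose_fst[OF S open_chart_params] Y_transition_smooth[OF c(2) c'(2)])
    fix q assume "q \<in> snd C ` (W \<inter> W') \<times> chart_params"
    then have "fst q \<in> snd C ` (W \<inter> W')" and nz: "fst (snd q) \<noteq> 0" by auto
    then obtain \<epsilon> where e: "fst q = snd C \<epsilon>" "\<epsilon> \<in> W" "\<epsilon> \<in> W'" by blast
    have "chart_inv c q = (\<epsilon>, twist (\<sigma> \<epsilon>) (snd q))"
      using Ychart_inv[OF c(2) e(2) nz] e(1) c(1) by (metis prod.collapse)
    moreover have "chart_inv C (fst q) = \<epsilon>" using chart_inv_left[OF E_atlas_smooth D(1), of \<epsilon>] D(3) e by auto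
    ultimately show "(snd C' (chart_inv C (fst q)), snd (snd c' (chart_inv c q))) = (snd c' \<circ> chart_inv c) q"
      by (simp add: c'(1) Ychart_def)
  qed
qed

subsection \<open>Sections adapted to a coframe of the base\<close>

definition Bdata where
  "Bdata c U \<theta> \<alpha>1 \<alpha>2 \<beta> \<longleftrightarrow> Edata c U \<theta> \<and> smooth_form A U \<alpha>1 \<and> smooth_form A U \<alpha>2 \<and> smooth_form A U \<beta> \<and>
    (\<forall>x\<in>U. adapted x (\<alpha>1 x) (\<alpha>2 x)) \<and>
    (\<forall>x\<in>U. \<forall>u v. ext_deriv A \<theta> x u v = (\<theta> x \<and>\<^sub>f \<beta> x) u v + (\<alpha>1 x \<and>\<^sub>f \<alpha>2 x) u v)"

lemma BdataD:
  assumes "Bdata c U \<theta> \<alpha>1 \<alpha>2 \<beta>"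
  shows "Edata c U \<theta>" "smooth_form A U \<alpha>1" "smooth_form A U \<alpha>2" "smooth_form A U \<beta>"
    "x \<in> U \<Longrightarrow> adapted x (\<alpha>1 x) (\<alpha>2 x)"
    "x \<in> U \<Longrightarrow> ext_deriv A \<theta> x u v = (\<theta> x \<and>\<^sub>f \<beta> x) u v + (\<alpha>1 x \<and>\<^sub>f \<alpha>2 x) u v"
  using assms by (simp_all add: Bdata_def)

lemma Bdata_ex:
  assumes "x \<in> points A"
  obtains c U \<theta> \<alpha>1 \<alpha>2 \<beta> where "Bdata c U \<theta> \<alpha>1 \<alpha>2 \<beta>" "x \<in> U"
proof -
  obtain c U \<theta> \<alpha>1 \<alpha>2 \<beta> where *: "Edata c U \<theta>" "x \<in> U" "smooth_form A U \<alpha>1" "smooth_form A U \<alpha>2" "smooth_form A U \<beta>"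
    "\<And>x. x \<in> U \<Longrightarrow> adapted x (\<alpha>1 x) (\<alpha>2 x)"
    "\<And>x u v. x \<in> U \<Longrightarrow> ext_deriv A \<theta> x u v = (\<theta> x \<and>\<^sub>f \<beta> x) u v + (\<alpha>1 x \<and>\<^sub>f \<alpha>2 x) u v"
    by (rule adapted_coframe[OF assms]) (rule that)
  show thesis by (rule that[of c U \<theta> \<alpha>1 \<alpha>2 \<beta>]) (use * in \<open>simp_all add: Bdata_def\<close>)
qed

text \<open>At l\<theta> this is (l\<theta>, l\<alpha>1, \<alpha>2, \<beta> - dl/l), with base
  covectors pulled back to E and dl read off as \<open>snd (to_chart EA C \<epsilon> v)\<close>.
  Since d(l\<theta>) = dl \<and> \<theta> + l d\<theta>, the term -dl/l in the last leg produces dl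
  \<and> \<theta>.\<close>

definition sect ::
    "('m, real ^ 3) chart \<Rightarrow> 'm set \<Rightarrow> ('m \<Rightarrow> (real ^ 3) covec) \<Rightarrow> ('m \<Rightarrow> (real ^ 3) covec) \<Rightarrow>
     ('m \<Rightarrow> (real ^ 3) covec) \<Rightarrow> ('m \<Rightarrow> (real ^ 3) covec) \<Rightarrow> 'm Ept \<Rightarrow> coframe" where
  "sect c U \<theta> \<alpha>1 \<alpha>2 \<beta> \<epsilon> = (let C = Echart c U \<theta>; l = snd (snd C \<epsilon>) in
     (taut \<epsilon>, \<lambda>v. l * \<alpha>1 (fst \<epsilon>) (TE \<epsilon> v), \<lambda>v. \<alpha>2 (fst \<epsilon>) (TE \<epsilon> v),
      \<lambda>v. \<beta> (fst \<epsilon>) (TE \<epsilon> v) - snd (to_chart EA C \<epsilon> v) / l))"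

lemma sect_from_chart:
  fixes u :: "real ^ 3" and m :: complex
  assumes B: "Bdata c U \<theta> \<alpha>1 \<alpha>2 \<beta>" and x: "x \<in> U" "l \<noteq> 0"
  defines "\<epsilon> \<equiv> (x, \<lambda>u. l * \<theta> x u)" and "C \<equiv> Echart c U \<theta>" and "z \<equiv> snd c x"
  defines "e \<equiv> from_chart EA C \<epsilon> (u, m)"
  shows "fst (sect c U \<theta> \<alpha>1 \<alpha>2 \<beta> \<epsilon>) e = l * form_comp A \<theta> c u z"
    "fst (snd (sect c U \<theta> \<alpha>1 \<alpha>2 \<beta> \<epsilon>)) e = l * form_comp A \<alpha>1 c u z"
    "fst (snd (snd (sect c U \<theta> \<alpha>1 \<alpha>2 \<beta> \<epsilon>))) e = form_comp A \<alpha>2 c u z"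
    "snd (snd (snd (sect c U \<theta> \<alpha>1 \<alpha>2 \<beta> \<epsilon>))) e = form_comp A \<beta> c u z - m / l"
proof -
  note E = BdataD(1)[OF B]
  note D = EdataD[OF E]
  have xc: "x \<in> fst c" using x D(3) by blast
  have eC: "\<epsilon> \<in> fst C" unfolding \<epsilon>_def C_def by (rule Echart_pt[OF E x])
  have T: "TE \<epsilon> e = from_chart A c x u"
    using smooth_at_E_fst(2)[OF E eC[unfolded C_def], of "(u, m)"] by (simp add: e_def C_def \<epsilon>_def)
  have l: "snd (snd C \<epsilon>) = l" using Echart_val[OF E x(1)] by (simp add: C_def \<epsilon>_def)
  have t: "to_chart EA C \<epsilon> e = (u, m)"
    unfolding e_def using to_from_chart[OF E_atlas_smooth _ eC] Echart_in[OF E] by (simp add: C_def)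
  show "fst (sect c U \<theta> \<alpha>1 \<alpha>2 \<beta> \<epsilon>) e = l * form_comp A \<theta> c u z"
    using taut_from_chart[OF E x, of "(u, m)"] by (simp add: sect_def Let_def e_def \<epsilon>_def C_def z_def)
  show "fst (snd (sect c U \<theta> \<alpha>1 \<alpha>2 \<beta> \<epsilon>)) e = l * form_comp A \<alpha>1 c u z"
    "fst (snd (snd (sect c U \<theta> \<alpha>1 \<alpha>2 \<beta> \<epsilon>))) e = form_comp A \<alpha>2 c u z"
    "snd (snd (snd (sect c U \<theta> \<alpha>1 \<alpha>2 \<beta> \<epsilon>))) e = form_comp A \<beta> c u z - m / l"
    using l T t by (simp_all add: sect_def Let_def C_def[symmetric] z_def form_comp_at[OF smA D(1) xc]) (simp_all add: \<epsilon>_def)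
qed

lemma sect_in_Y:
  assumes B: "Bdata c U \<theta> \<alpha>1 \<alpha>2 \<beta>" and "\<epsilon> \<in> fst (Echart c U \<theta>)"
  shows "(\<epsilon>, sect c U \<theta> \<alpha>1 \<alpha>2 \<beta> \<epsilon>) \<in> YS"
proof -
  note E = BdataD(1)[OF B]
  note D = EdataD[OF E]
  let ?C = "Echart c U \<theta>" and ?s = "sect c U \<theta> \<alpha>1 \<alpha>2 \<beta> \<epsilon>"
  obtain x l where x: "x \<in> U" "l \<noteq> 0" "\<epsilon> = (x, \<lambda>u. l * \<theta> x u)" by (rule Echart_cases[OF E assms(2)])
  have l: "snd (snd ?C \<epsilon>) = l" using Echart_val[OF E x(1)] by (simp add: x)
  have xc: "x \<in> fst c" using x D(3) by blast
  have eS: "\<epsilon> \<in> ES" using assms(2) by (simp add: Echart_dom)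
  note ad = adaptedD[OF BdataD(5)[OF B x(1)]]
  have "adapted (fst \<epsilon>) (\<lambda>u. l * \<alpha>1 x u) (\<alpha>2 x)"
    using ad x(2) by (simp add: adapted_def x(3) cx_covec_scale linear_mult_left)
  moreover have "fst (snd ?s) = (\<lambda>u. l * \<alpha>1 x u) \<circ> TE \<epsilon>" "fst (snd (snd ?s)) = \<alpha>2 x \<circ> TE \<epsilon>" "fst ?s = taut \<epsilon>"
    using l by (simp_all add: sect_def Let_def fun_eq_iff) (simp_all add: x)
  moreover have "linear (snd (snd (snd ?s)))"
  proof -
    have "linear (\<lambda>v. \<beta> x (TE \<epsilon> v))"
      using linear_compose[OF TE_linear[OF eS] smooth_formD(1)[OF BdataD(4)[OF B] x(1)]] by (simp add: comp_def)
    moreover have "linear (\<lambda>v. 1 / l * snd (to_chart EA ?C \<epsilon> v))"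
      using linear_compose[OF to_chart_linear[OF E_atlas_smooth Echart_in[OF E] assms(2)] linear_snd]
      by (intro linear_mult_left) (simp add: comp_def)
    ultimately have "linear (\<lambda>v. \<beta> x (TE \<epsilon> v) - 1 / l * snd (to_chart EA ?C \<epsilon> v))" by (rule linear_compose_sub)
    moreover have "snd (snd (snd ?s)) = (\<lambda>v. \<beta> x (TE \<epsilon> v) - 1 / l * snd (to_chart EA ?C \<epsilon> v))"
      using l by (simp add: sect_def Let_def) (simp add: x)
    ultimately show ?thesis by simp
  qed
  moreover have "ext_deriv EA taut \<epsilon> u v = (fst ?s \<and>\<^sub>f snd (snd (snd ?s))) u v + (fst (snd ?s) \<and>\<^sub>f fst (snd (snd ?s))) u v" for u v
  proof -
    obtain p m where p: "to_chart EA ?C \<epsilon> u = (p, m)" by fastforce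
    obtain r n where r: "to_chart EA ?C \<epsilon> v = (r, n)" by fastforce
    have uv: "u = from_chart EA ?C \<epsilon> (p, m)" "v = from_chart EA ?C \<epsilon> (r, n)"
      using from_to_chart[OF E_atlas_smooth Echart_in[OF E] assms(2)] p r by metis+
    let ?f = "\<lambda>\<alpha> u. form_comp A \<alpha> c u (snd c x)"
    have dd: "fd (form_comp A \<theta> c r) (snd c x) p - fd (form_comp A \<theta> c p) (snd c x) r
      = ?f \<theta> p * ?f \<beta> r - ?f \<theta> r * ?f \<beta> p + (?f \<alpha>1 p * ?f \<alpha>2 r - ?f \<alpha>1 r * ?f \<alpha>2 p)"
      using ext_deriv_from_chart[OF smA D(4,2) x(1) D(1) xc, of p r] BdataD(6)[OF B x(1)]
      by (simp add: wedge_def form_comp_at[OF smA D(1) xc])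
    show ?thesis
      unfolding uv x(3) wedge_def ext_deriv_taut[OF E x(1,2)] dd sect_from_chart[OF B x(1,2)] using x(2)
      by (simp add: field_simps)
  qed
  ultimately have "(\<epsilon>, fst ?s, fst (snd ?s), fst (snd (snd ?s)), snd (snd (snd ?s))) \<in> YS"
    unfolding Y_set_iff using eS by blast
  then show ?thesis by simp
qed

lemma sect_Ydata:
  assumes B: "Bdata c U \<theta> \<alpha>1 \<alpha>2 \<beta>"
  shows "Ydata (Echart c U \<theta>) (fst (Echart c U \<theta>)) (sect c U \<theta> \<alpha>1 \<alpha>2 \<beta>)"
proof -
  note E = BdataD(1)[OF B]
  note D = EdataD[OF E]
  let ?C = "Echart c U \<theta>" and ?s = "sect c U \<theta> \<alpha>1 \<alpha>2 \<beta>"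
  have C: "?C \<in> EA" by (rule Echart_in[OF E])
  have im: "snd ?C ` fst ?C = (snd c ` U) \<times> (- {0::complex})"
    using Echart_image[OF E, of U] by (simp add: Echart_def)
  have op: "open (snd c ` U)" "open (- {0::complex})" using open_base_image[OF E D(2)] by auto
  have opp: "open ((snd c ` U) \<times> (- {0::complex}))" using op by (rule open_Times)
  have Uc: "U \<inter> fst c = U" using D(3) by blast
  have lin: "linear (fst (?s \<epsilon>))" "linear (fst (snd (?s \<epsilon>)))" "linear (fst (snd (snd (?s \<epsilon>))))" "linear (snd (snd (snd (?s \<epsilon>))))"
    if "\<epsilon> \<in> fst ?C" for \<epsilon>
    using Y_linear[of \<epsilon> "fst (?s \<epsilon>)" "fst (snd (?s \<epsilon>))" "fst (snd (snd (?s \<epsilon>)))" "snd (snd (snd (?s \<epsilon>)))"] sect_in_Y[OF B that] by simp_all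
  have main: "smooth_form EA (fst ?C) F"
    if lin: "\<And>\<epsilon>. \<epsilon> \<in> fst ?C \<Longrightarrow> linear (F \<epsilon>)"
      and g: "\<And>u m. smooth_on ((snd c ` U) \<times> (- {0::complex})) (g u m)"
      and eq: "\<And>x l u m. x \<in> U \<Longrightarrow> l \<noteq> 0 \<Longrightarrow> F (x, \<lambda>u. l * \<theta> x u) (from_chart EA ?C (x, \<lambda>u. l * \<theta> x u) (u, m)) = g u m (snd c x, l)"
    for F g
  proof (rule smooth_form_chartI[OF E_atlas_smooth C order_refl is_open_chart[OF E_atlas_smooth C] lin], assumption)
    fix e :: Emod
    obtain u m where e: "e = (u, m)" by fastforce
    show "smooth_on (snd ?C ` fst ?C) (form_comp EA F ?C e)"
      unfolding im
    proof (rule smooth_on_cong[OF g opp])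
      fix q assume "q \<in> (snd c ` U) \<times> (- {0::complex})"
      then obtain x l where q: "q = (snd c x, l)" "x \<in> U" "l \<noteq> 0" by auto
      then show "g u m q = form_comp EA F ?C e q"
        using eq[OF q(2,3), of u m] by (simp add: form_comp_def Echart_inv[OF E] e)
    qed
  qed
  have sm: "smooth_on (snd c ` U) (form_comp A \<alpha> c u)" if "smooth_form A U \<alpha>" for \<alpha> u
    using smooth_formD(2)[OF that D(1), of u] Uc by simp
  note sm' = smooth_on_compose_fst[OF op sm]
  have "smooth_form EA (fst ?C) (\<lambda>\<epsilon>. fst (?s \<epsilon>))"
    by (rule main[OF lin(1), where g = "\<lambda>u m q. snd q * form_comp A \<theta> c u (fst q)"])
      (intro smooth_on_intros sm' opp D BdataD[OF B] | simp add: sect_from_chart[OF B])+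
  moreover have "smooth_form EA (fst ?C) (\<lambda>\<epsilon>. fst (snd (?s \<epsilon>)))"
    by (rule main[OF lin(2), where g = "\<lambda>u m q. snd q * form_comp A \<alpha>1 c u (fst q)"])
      (intro smooth_on_intros sm' opp BdataD[OF B] | simp add: sect_from_chart[OF B])+
  moreover have "smooth_form EA (fst ?C) (\<lambda>\<epsilon>. fst (snd (snd (?s \<epsilon>))))"
    by (rule main[OF lin(3), where g = "\<lambda>u m q. form_comp A \<alpha>2 c u (fst q)"])
      (intro smooth_on_intros sm' opp BdataD[OF B] | simp add: sect_from_chart[OF B])+
  moreover have "smooth_form EA (fst ?C) (\<lambda>\<epsilon>. snd (snd (snd (?s \<epsilon>))))"
    by (rule main[OF lin(4), where g = "\<lambda>u m q. form_comp A \<beta> c u (fst q) - m / snd q"])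
      (intro smooth_on_intros sm' opp BdataD[OF B] | force simp: sect_from_chart[OF B])+
  ultimately show ?thesis
    unfolding Ydata_def using C is_open_chart[OF E_atlas_smooth C] sect_in_Y[OF B] by simp
qed

text \<open>The charts built on \<open>sect\<close> already cover Y. In them a dilation only
  multiplies the coordinate l, so the later computations with the action are carried out
  there.\<close>

lemma Y_special_chart:
  assumes "y \<in> YS"
  obtains c U \<theta> \<alpha>1 \<alpha>2 \<beta> where "Bdata c U \<theta> \<alpha>1 \<alpha>2 \<beta>"
    "y \<in> fst (Ychart (Echart c U \<theta>) (fst (Echart c U \<theta>)) (sect c U \<theta> \<alpha>1 \<alpha>2 \<beta>))"
proof -
  have e: "fst y \<in> ES" using Y_set_E[OF assms] .
  then have "fst (fst y) \<in> points A" using E_setD(1)[of "fst (fst y)" "snd (fst y)"] by simp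
  then obtain c U \<theta> \<alpha>1 \<alpha>2 \<beta> where "Bdata c U \<theta> \<alpha>1 \<alpha>2 \<beta>" "fst (fst y) \<in> U" by (rule Bdata_ex)
  then show thesis using that assms e by (auto simp: Ychart_dom Echart_dom)
qed

lemma Y_points: "points YA = YS"
proof (intro equalityI subsetI)
  fix y assume "y \<in> points YA"
  then show "y \<in> YS" by (auto simp: points_def Y_atlas_eq Ychart_def)
next
  fix y assume "y \<in> YS"
  then obtain c U \<theta> \<alpha>1 \<alpha>2 \<beta> where B: "Bdata c U \<theta> \<alpha>1 \<alpha>2 \<beta>"
    "y \<in> fst (Ychart (Echart c U \<theta>) (fst (Echart c U \<theta>)) (sect c U \<theta> \<alpha>1 \<alpha>2 \<beta>))" by (rule Y_special_chart)
  then show "y \<in> points YA" using chart_points[OF Ychart_in[OF sect_Ydata[OF B(1)]]] by blast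
qed

lemma Y_open: "is_open YA YS"
  using is_open_points[OF Y_atlas_smooth] Y_points by simp

subsection \<open>The tautological forms on \<open>Y\<close>\<close>

abbreviation "TY \<equiv> tangent_map YA EA fst"

lemma smooth_at_Y_fst:
  assumes "Ydata C W \<sigma>" "y \<in> fst (Ychart C W \<sigma>)"
  shows "smooth_at YA EA fst y"
    and "TY y (from_chart YA (Ychart C W \<sigma>) y e) = from_chart EA C (fst y) (fst e)"
proof -
  note D = YdataD[OF assms(1)]
  note * = smooth_at_coordI[OF Y_atlas_smooth E_atlas_smooth Ychart_in[OF assms(1)] assms(2) D(1), of fst fst]
  have dom: "fst q \<in> fst C" "snd C (fst q) = fst (snd (Ychart C W \<sigma>) q)" if "q \<in> fst (Ychart C W \<sigma>)" for q
    using that D(3) by (auto simp: Ychart_def)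
  have sm: "smooth_on S fst" for S :: "Ymod set" by (rule smooth_on_bounded_linear[OF bounded_linear_fst])
  show "smooth_at YA EA fst y" by (rule *(1)[OF dom sm])
  have "fd fst x = (fst :: Ymod \<Rightarrow> _)" for x
    by (rule fd_eqI) (auto intro: derivative_intros)
  then show "TY y (from_chart YA (Ychart C W \<sigma>) y e) = from_chart EA C (fst y) (fst e)"
    using *(2)[OF dom sm] by simp
qed

lemma TY_linear: "y \<in> YS \<Longrightarrow> linear (TY y)"
  by (metis Y_special_chart sect_Ydata smooth_at_Y_fst(1) tangent_map_linear[OF Y_atlas_smooth E_atlas_smooth])

lemma TY_surj:
  assumes "y \<in> YS" shows "\<exists>e. TY y e = u"
proof -
  obtain c U \<theta> \<alpha>1 \<alpha>2 \<beta> where B: "Bdata c U \<theta> \<alpha>1 \<alpha>2 \<beta>"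
    "y \<in> fst (Ychart (Echart c U \<theta>) (fst (Echart c U \<theta>)) (sect c U \<theta> \<alpha>1 \<alpha>2 \<beta>))" using Y_special_chart[OF assms] .
  then have "fst y \<in> fst (Echart c U \<theta>)" by (simp add: Ychart_dom)
  then have "from_chart EA (Echart c U \<theta>) (fst y) (to_chart EA (Echart c U \<theta>) (fst y) u) = u"
    by (rule from_to_chart[OF E_atlas_smooth Echart_in[OF BdataD(1)[OF B(1)]]])
  then have "TY y (from_chart YA (Ychart (Echart c U \<theta>) (fst (Echart c U \<theta>)) (sect c U \<theta> \<alpha>1 \<alpha>2 \<beta>)) y
      (to_chart EA (Echart c U \<theta>) (fst y) u, 0)) = u"
    using smooth_at_Y_fst(2)[OF sect_Ydata[OF B(1)] B(2)] by (simp only: fst_conv)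
  then show ?thesis by (rule exI)
qed

lemma Y_forms:
  "Y_\<omega> A T1 T2 y v = fst (snd y) (TY y v)"
  "Y_\<omega>1 A T1 T2 y v = fst (snd (snd y)) (TY y v)"
  "Y_\<omega>2 A T1 T2 y v = fst (snd (snd (snd y))) (TY y v)"
  "Y_\<phi> A T1 T2 y v = snd (snd (snd (snd y))) (TY y v)"
  by (simp_all add: Y_\<omega>_def Y_\<omega>1_def Y_\<omega>2_def Y_\<phi>_def case_prod_unfold)

lemma Y_form_comp:
  assumes Y: "Ydata C W \<sigma>" "\<epsilon> \<in> W" "fst t \<noteq> 0"
  defines "h \<equiv> \<lambda>g u. form_comp EA (\<lambda>\<epsilon>. g (\<sigma> \<epsilon>)) C u (snd C \<epsilon>)"
  shows "form_comp YA (Y_\<omega> A T1 T2) (Ychart C W \<sigma>) e (snd C \<epsilon>, t) = h fst (fst e)"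
    "form_comp YA (Y_\<omega>1 A T1 T2) (Ychart C W \<sigma>) e (snd C \<epsilon>, t) = fst (snd t) * h fst (fst e) + fst t * h (\<lambda>q. fst (snd q)) (fst e)"
    "form_comp YA (Y_\<omega>2 A T1 T2) (Ychart C W \<sigma>) e (snd C \<epsilon>, t)
       = fst (snd (snd t)) * h fst (fst e) + 1 / fst t * h (\<lambda>q. fst (snd (snd q))) (fst e)"
    "form_comp YA (Y_\<phi> A T1 T2) (Ychart C W \<sigma>) e (snd C \<epsilon>, t)
       = snd (snd (snd t)) * h fst (fst e) + fst t * fst (snd (snd t)) * h (\<lambda>q. fst (snd q)) (fst e)
         - 1 / fst t * fst (snd t) * h (\<lambda>q. fst (snd (snd q))) (fst e) + h (\<lambda>q. snd (snd (snd q))) (fst e)"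
  by (simp_all only: form_comp_def[of YA] Ychart_inv[OF Y] Y_forms smooth_at_Y_fst(2)[OF Y(1) Ychart_pt[OF Y]]
      h_def section_comp_at[OF Y(1,2)] snd_conv fst_conv twist_apply)

lemma Y_forms_linear:
  assumes "y \<in> YS"
  shows "linear (Y_\<omega> A T1 T2 y)" "linear (Y_\<omega>1 A T1 T2 y)" "linear (Y_\<omega>2 A T1 T2 y)" "linear (Y_\<phi> A T1 T2 y)"
proof -
  obtain \<epsilon> w w1 w2 f where y: "y = (\<epsilon>, w, w1, w2, f)" by (cases y)
  note L = Y_linear[OF assms[unfolded y]] and T = TY_linear[OF assms]
  show "linear (Y_\<omega> A T1 T2 y)" "linear (Y_\<omega>1 A T1 T2 y)" "linear (Y_\<omega>2 A T1 T2 y)" "linear (Y_\<phi> A T1 T2 y)"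
    using linear_compose[OF T L(1)] linear_compose[OF T L(2)] linear_compose[OF T L(3)] linear_compose[OF T L(4)]
    by (simp_all add: y Y_\<omega>_def Y_\<omega>1_def Y_\<omega>2_def Y_\<phi>_def)
qed

lemma Y_forms_smooth:
  "smooth_form YA YS (Y_\<omega> A T1 T2)" "smooth_form YA YS (Y_\<omega>1 A T1 T2)"
  "smooth_form YA YS (Y_\<omega>2 A T1 T2)" "smooth_form YA YS (Y_\<phi> A T1 T2)"
proof -
  have "smooth_on (snd c ` (YS \<inter> fst c)) (form_comp YA (Y_\<omega> A T1 T2) c e) \<and>
        smooth_on (snd c ` (YS \<inter> fst c)) (form_comp YA (Y_\<omega>1 A T1 T2) c e) \<and>
        smooth_on (snd c ` (YS \<inter> fst c)) (form_comp YA (Y_\<omega>2 A T1 T2) c e) \<and>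
        smooth_on (snd c ` (YS \<inter> fst c)) (form_comp YA (Y_\<phi> A T1 T2) c e)" if cY: "c \<in> YA" for c e
  proof -
    obtain C W \<sigma> where c: "c = Ychart C W \<sigma>" "Ydata C W \<sigma>" using Y_atlasE[OF cY] .
    note D = YdataD[OF c(2)]
    have S: "open (snd C ` W)" using open_E_image[OF c(2) D(2)] by blast
    have op: "open (snd C ` W \<times> chart_params)" using S open_chart_params by (rule open_Times)
    have im: "snd c ` (YS \<inter> fst c) = snd C ` W \<times> chart_params"
      using Ychart_image[OF c(2), of W] by (simp add: c(1) Ychart_def Int_def conj_assoc)
    have pt: "\<exists>\<epsilon>\<in>W. q = (snd C \<epsilon>, snd q) \<and> fst (snd q) \<noteq> 0" if "q \<in> snd C ` W \<times> chart_params" for q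
    proof -
      have "fst q \<in> snd C ` W" "fst (snd q) \<noteq> 0" using that by auto
      then show ?thesis by (auto simp: prod_eq_iff)
    qed
    define h where "h g u q = form_comp EA (\<lambda>\<epsilon>. g (\<sigma> \<epsilon>)) C u (fst q)" for g :: "coframe \<Rightarrow> Emod covec" and u and q :: Ymod
    have sm: "smooth_on (snd C ` W \<times> chart_params) (h fst u)" "smooth_on (snd C ` W \<times> chart_params) (h (\<lambda>q. fst (snd q)) u)"
      "smooth_on (snd C ` W \<times> chart_params) (h (\<lambda>q. fst (snd (snd q))) u)"
      "smooth_on (snd C ` W \<times> chart_params) (h (\<lambda>q. snd (snd (snd q))) u)" for u
      unfolding h_def[abs_def]
      by (intro smooth_on_compose_fst[OF S open_chart_params] section_comp_smooth[OF c(2) D(2)] order_refl D)+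
    note eq = Y_form_comp[OF c(2), folded c(1)]
    have F: "form_comp YA (Y_\<omega> A T1 T2) c e q = h fst (fst e) q"
      "form_comp YA (Y_\<omega>1 A T1 T2) c e q = fst (snd (snd q)) * h fst (fst e) q + fst (snd q) * h (\<lambda>q. fst (snd q)) (fst e) q"
      "form_comp YA (Y_\<omega>2 A T1 T2) c e q
         = fst (snd (snd (snd q))) * h fst (fst e) q + 1 / fst (snd q) * h (\<lambda>q. fst (snd (snd q))) (fst e) q"
      "form_comp YA (Y_\<phi> A T1 T2) c e q
         = snd (snd (snd (snd q))) * h fst (fst e) q + fst (snd q) * fst (snd (snd (snd q))) * h (\<lambda>q. fst (snd q)) (fst e) q
           - 1 / fst (snd q) * fst (snd (snd q)) * h (\<lambda>q. fst (snd (snd q))) (fst e) q + h (\<lambda>q. snd (snd (snd q))) (fst e) q"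
      if q: "q \<in> snd C ` W \<times> chart_params" for q
    proof -
      obtain \<epsilon> where e: "\<epsilon> \<in> W" "q = (snd C \<epsilon>, snd q)" "fst (snd q) \<noteq> 0" using pt[OF q] by blast
      have f: "fst q = snd C \<epsilon>" using e(2) by (metis fst_conv)
      show "form_comp YA (Y_\<omega> A T1 T2) c e q = h fst (fst e) q"
        "form_comp YA (Y_\<omega>1 A T1 T2) c e q = fst (snd (snd q)) * h fst (fst e) q + fst (snd q) * h (\<lambda>q. fst (snd q)) (fst e) q"
        "form_comp YA (Y_\<omega>2 A T1 T2) c e q
         = fst (snd (snd (snd q))) * h fst (fst e) q + 1 / fst (snd q) * h (\<lambda>q. fst (snd (snd q))) (fst e) q"
        "form_comp YA (Y_\<phi> A T1 T2) c e q
         = snd (snd (snd (snd q))) * h fst (fst e) q + fst (snd q) * fst (snd (snd (snd q))) * h (\<lambda>q. fst (snd q)) (fst e) q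
           - 1 / fst (snd q) * fst (snd (snd q)) * h (\<lambda>q. fst (snd (snd q))) (fst e) q + h (\<lambda>q. snd (snd (snd q))) (fst e) q"
        using eq[OF e(1,3), of e] unfolding h_def f e(2)[symmetric] by simp_all
    qed
    show ?thesis
      unfolding im
      by (intro conjI smooth_on_cong[OF _ op F(1)[symmetric]] smooth_on_cong[OF _ op F(2)[symmetric]]
          smooth_on_cong[OF _ op F(3)[symmetric]] smooth_on_cong[OF _ op F(4)[symmetric]])
        (intro smooth_on_add smooth_on_diff smooth_on_mult op sm param_smooth[OF S] | assumption)+
  qed
  then show "smooth_form YA YS (Y_\<omega> A T1 T2)" "smooth_form YA YS (Y_\<omega>1 A T1 T2)"
    "smooth_form YA YS (Y_\<omega>2 A T1 T2)" "smooth_form YA YS (Y_\<phi> A T1 T2)"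
    using Y_forms_linear unfolding smooth_form_def by blast+
qed

lemma Y_forms_indep:
  assumes "y \<in> YS"
  shows "coframe_indep (Y_\<omega> A T1 T2 y) (Y_\<omega>1 A T1 T2 y) (Y_\<omega>2 A T1 T2 y)"
proof -
  obtain \<epsilon> w w1 w2 f where y: "y = (\<epsilon>, w, w1, w2, f)" by (cases y)
  obtain g where g: "\<And>u. TY y (g u) = u" using TY_surj[OF assms] by metis
  obtain p0 q0 p1 q1 p2 q2 where N:
    "cx_eval w p0 q0 = 1 \<and> cx_eval w1 p0 q0 = 0 \<and> cx_eval w2 p0 q0 = 0 \<and>
     cx_eval w p1 q1 = 0 \<and> cx_eval w1 p1 q1 = 1 \<and> cx_eval w2 p1 q1 = 0 \<and>
     cx_eval w p2 q2 = 0 \<and> cx_eval w1 p2 q2 = 0 \<and> cx_eval w2 p2 q2 = 1"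
    using Y_coframe_indep[OF assms[unfolded y]] unfolding coframe_indep_def by blast
  show ?thesis
    unfolding coframe_indep_def cx_eval_def Y_forms
    apply (rule exI[of _ "g p0"], rule exI[of _ "g q0"], rule exI[of _ "g p1"], rule exI[of _ "g q1"],
        rule exI[of _ "g p2"], rule exI[of _ "g q2"])
    apply (simp only: g)
    using N by (simp add: cx_eval_def y)
qed

end

section \<open>One-parameter subgroups\<close>

lemma mat_pow_bound:
  assumes "\<And>i j. cmod (X $ i $ j) \<le> M"
  shows "cmod (mat_pow X n $ i $ j) \<le> (3 * M) ^ n"
proof (induction n arbitrary: i j)
  case 0
  then show ?case by (simp add: mat_def)
next
  case (Suc n)
  have M: "0 \<le> M" using assms[of i j] norm_ge_zero order_trans by blast
  have "cmod (mat_pow X (Suc n) $ i $ j) \<le> (\<Sum>k\<in>UNIV. cmod (X $ i $ k * mat_pow X n $ k $ j))"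
    by (simp add: matrix_matrix_mult_def norm_sum)
  also have "\<dots> \<le> (\<Sum>k\<in>(UNIV :: 3 set). M * (3 * M) ^ n)"
    unfolding norm_mult using M by (intro sum_mono mult_mono assms Suc.IH) auto
  finally show ?case by simp
qed

lemma mat_pow_scaleR: "mat_pow (t *\<^sub>R X) n $ i $ j = of_real t ^ n * mat_pow X n $ i $ j"
proof (induction n arbitrary: i j)
  case (Suc n)
  then show ?case
    by (simp add: matrix_matrix_mult_def Suc scaleR_conv_of_real[of t "_ :: complex"] sum_distrib_left mult_ac)
qed simp

text \<open>Each entry is a power series in one variable, dominated by the exponential series of 3 M
  |z|, the 3 counting the terms in an entry of a matrix product. Letting the variable be complex
  allows termwise differentiation at 0.\<close>

lemma mat_exp_entry:
  fixes X :: "complex ^ 3 ^ 3"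
  defines "f \<equiv> \<lambda>i j z. \<Sum>n. mat_pow X n $ i $ j / fact n * z ^ n"
  shows "mat_exp (t *\<^sub>R X) $ i $ j = f i j (of_real t)"
    and "(f i j has_field_derivative X $ i $ j) (at 0)" and "f i j 0 = mat 1 $ i $ j"
proof -
  define M where "M = Max (range (\<lambda>(i, j). cmod (X $ i $ j)))"
  have M: "cmod (X $ i $ j) \<le> M" for i j
    unfolding M_def by (rule Max_ge) (auto intro: range_eqI[of _ _ "(i, j)"])
  have sm: "summable (\<lambda>n. mat_pow X n $ i $ j / fact n * z ^ n)" for i j z
  proof (rule summable_comparison_test[OF _ summable_exp[of "3 * M * cmod z"]], intro exI allI impI)
    fix n
    have "cmod (mat_pow X n $ i $ j / fact n * z ^ n) = cmod (mat_pow X n $ i $ j) * (inverse (fact n) * cmod z ^ n)"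
      by (simp add: norm_mult norm_divide norm_power norm_inverse divide_inverse)
    also have "\<dots> \<le> (3 * M) ^ n * (inverse (fact n) * cmod z ^ n)"
      by (intro mult_right_mono mat_pow_bound[OF M]) simp
    finally show "cmod (mat_pow X n $ i $ j / fact n * z ^ n) \<le> inverse (fact n) * (3 * M * cmod z) ^ n"
      by (simp add: power_mult_distrib mult_ac)
  qed
  have "(\<lambda>n. (1 / fact n) *\<^sub>R mat_pow (t *\<^sub>R X) n) sums (\<chi> i j. f i j (of_real t))"
    unfolding sums_def
  proof (intro vec_tendstoI)
    fix i j
    have "(\<lambda>n. \<Sum>k<n. mat_pow X k $ i $ j / fact k * of_real t ^ k) \<longlonglongrightarrow> f i j (of_real t)"
      using summable_sums[OF sm] unfolding sums_def f_def .
    then show "(\<lambda>n. (\<Sum>k<n. (1 / fact k) *\<^sub>R mat_pow (t *\<^sub>R X) k) $ i $ j) \<longlonglongrightarrow> (\<chi> i j. f i j (of_real t)) $ i $ j"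
      by (simp add: sum_component mat_pow_scaleR scaleR_conv_of_real[of _ "_ :: complex"] field_simps)
  qed
  then show "mat_exp (t *\<^sub>R X) $ i $ j = f i j (of_real t)"
    unfolding mat_exp_def by (simp add: sums_unique[symmetric])
  define c where "c n = mat_pow X n $ i $ j / fact n" for n
  have "((\<lambda>z. \<Sum>n. c n * z ^ n) has_field_derivative (\<Sum>n. diffs c n * 0 ^ n)) (at 0)"
    by (rule termdiffs_strong_converges_everywhere) (use sm in \<open>simp add: c_def\<close>)
  moreover have "diffs c 0 = X $ i $ j"
    by (simp add: diffs_def c_def)
  ultimately show "(f i j has_field_derivative X $ i $ j) (at 0)"
    by (simp add: c_def f_def)
  have "f i j 0 = c 0" unfolding f_def using powser_zero[of c] by (simp only: c_def)
  then show "f i j 0 = mat 1 $ i $ j" by (simp add: c_def)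
qed

section \<open>The action in adapted coordinates\<close>

lemma j_hom_eq:
  assumes "h $ 1 $ 1 \<noteq> 0" "h $ 3 $ 3 \<noteq> 0"
  shows "j_hom h = H_mat ((h $ 1 $ 1)\<^sup>2 * h $ 3 $ 3) (1 / (h $ 1 $ 1 * (h $ 3 $ 3)\<^sup>2)) (- 2 * h $ 1 $ 1 * h $ 3 $ 3 * h $ 2 $ 3)
      (h $ 1 $ 2 / h $ 1 $ 1) (4 * h $ 1 $ 3 / h $ 3 $ 3 - 2 * h $ 1 $ 1 * h $ 1 $ 2 * h $ 2 $ 3)"
  using assms by (simp add: j_hom_def H_mat_def Let_def power2_eq_square mult_ac)

text \<open>Fibre coordinates, in a chart built on \<open>sect\<close>, after acting by
  \<open>H_mat k1 k2 w1 w2 r\<close>. The section at the dilated point carries k1 k2 l in front of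
  \<alpha>1, so the factor k1 of the action leaves a / k2; the divisions in the other coordinates
  come from the same comparison.\<close>

definition act_params :: "complex \<Rightarrow> complex \<Rightarrow> complex \<Rightarrow> complex \<Rightarrow> complex \<Rightarrow>
    complex \<times> complex \<times> complex \<times> complex \<Rightarrow> complex \<times> complex \<times> complex \<times> complex" where
  "act_params k1 k2 w1 w2 r t = (case t of (a, v1, v2, s) \<Rightarrow>
     (a / k2, w1 + v1 / k2, w2 + v2 / k1, (r + k1 * w2 * v1 - k2 * w1 * v2 + s) / (k1 * k2)))"

context flag_manifold
begin

abbreviation "SY c U \<theta> \<alpha>1 \<alpha>2 \<beta> \<equiv> Ychart (Echart c U \<theta>) (fst (Echart c U \<theta>)) (sect c U \<theta> \<alpha>1 \<alpha>2 \<beta>)"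

lemma H_act_twist:
  assumes B: "Bdata c U \<theta> \<alpha>1 \<alpha>2 \<beta>" and x: "x \<in> U" "l \<noteq> 0" and t: "fst t \<noteq> 0" and k: "k1 \<noteq> 0" "k2 \<noteq> 0"
  defines "\<sigma> \<equiv> sect c U \<theta> \<alpha>1 \<alpha>2 \<beta>" and "\<epsilon> \<equiv> (x, \<lambda>u. l * \<theta> x u)" and "\<epsilon>' \<equiv> (x, \<lambda>u. (k1 * k2 * l) * \<theta> x u)"
  shows "H_act A T1 T2 (\<epsilon>, twist (\<sigma> \<epsilon>) t) (H_mat k1 k2 w1 w2 r) = (\<epsilon>', twist (\<sigma> \<epsilon>') (act_params k1 k2 w1 w2 r t))"
proof -
  let ?k = "k1 * k2" and ?C = "Echart c U \<theta>"
  obtain a v1 v2 s where t': "t = (a, v1, v2, s)" by (cases t)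
  have a: "a \<noteq> 0" using t t' by simp
  have kn: "?k \<noteq> 0" "1 / ?k \<noteq> 0" "?k * l \<noteq> 0" using k x by auto
  note E = BdataD(1)[OF B]
  have e: "\<epsilon> \<in> fst ?C" "\<epsilon>' \<in> fst ?C"
    unfolding \<epsilon>_def \<epsilon>'_def using Echart_pt[OF E x(1)] x kn by blast+
  have d: "dilate ?k \<epsilon> = \<epsilon>'" "dilate (1 / ?k) \<epsilon>' = \<epsilon>"
    using kn k by (simp_all add: dilate_def \<epsilon>_def \<epsilon>'_def mult.assoc)
  let ?L = "tangent_map EA EA (dilate (1 / ?k)) \<epsilon>'"
  have L: "?L (from_chart EA ?C \<epsilon>' (u, m)) = from_chart EA ?C \<epsilon> (u, 1 / ?k * m)" for u m
    using smooth_at_dilate(2)[OF E e(2) kn(2), of u m] d(2) by simp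
  obtain W0 W1 W2 W3 where W: "\<sigma> \<epsilon> = (W0, W1, W2, W3)" by (cases "\<sigma> \<epsilon>")
  obtain W0' W1' W2' W3' where W': "\<sigma> \<epsilon>' = (W0', W1', W2', W3')" by (cases "\<sigma> \<epsilon>'")
  let ?f = "\<lambda>\<alpha> u. form_comp A \<alpha> c u (snd c x)"
  have v: "W0 (from_chart EA ?C \<epsilon> (u, m)) = l * ?f \<theta> u" "W1 (from_chart EA ?C \<epsilon> (u, m)) = l * ?f \<alpha>1 u"
    "W2 (from_chart EA ?C \<epsilon> (u, m)) = ?f \<alpha>2 u" "W3 (from_chart EA ?C \<epsilon> (u, m)) = ?f \<beta> u - m / l" for u m
    using sect_from_chart[OF B x, of u m, folded \<epsilon>_def \<sigma>_def] unfolding W by simp_all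
  have v': "W0' (from_chart EA ?C \<epsilon>' (u, m)) = ?k * l * ?f \<theta> u" "W1' (from_chart EA ?C \<epsilon>' (u, m)) = ?k * l * ?f \<alpha>1 u"
    "W2' (from_chart EA ?C \<epsilon>' (u, m)) = ?f \<alpha>2 u" "W3' (from_chart EA ?C \<epsilon>' (u, m)) = ?f \<beta> u - m / (?k * l)" for u m
    using sect_from_chart[OF B x(1) kn(3), of u m, folded \<epsilon>'_def \<sigma>_def] unfolding W' by simp_all
  have ext: "F = G" if "\<And>u m. F (from_chart EA ?C \<epsilon>' (u, m)) = G (from_chart EA ?C \<epsilon>' (u, m))" for F G :: "Emod covec"
  proof
    fix v
    obtain u m where "to_chart EA ?C \<epsilon>' v = (u, m)" by fastforce
    then show "F v = G v" using that[of u m] from_to_chart[OF E_atlas_smooth Echart_in[OF E] e(2), of v] by simp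
  qed
  show ?thesis
    unfolding H_act_def Let_def H_mat_11 fst_conv snd_conv d W W' t' twist_def split coframe_mult_H_mat coframe_pull_def act_params_def
    using k a x(2)
    by (intro conjI prod_eqI ext) (simp_all add: L v v' field_simps)
qed

lemma SY_H_act:
  assumes B: "Bdata c U \<theta> \<alpha>1 \<alpha>2 \<beta>" and y: "y \<in> fst (SY c U \<theta> \<alpha>1 \<alpha>2 \<beta>)" and k: "k1 \<noteq> 0" "k2 \<noteq> 0"
  shows "H_act A T1 T2 y (H_mat k1 k2 w1 w2 r) \<in> fst (SY c U \<theta> \<alpha>1 \<alpha>2 \<beta>)"
    and "snd (SY c U \<theta> \<alpha>1 \<alpha>2 \<beta>) (H_act A T1 T2 y (H_mat k1 k2 w1 w2 r)) =
      (let q = snd (SY c U \<theta> \<alpha>1 \<alpha>2 \<beta>) y in ((fst (fst q), k1 * k2 * snd (fst q)), act_params k1 k2 w1 w2 r (snd q)))"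
proof -
  note E = BdataD(1)[OF B] and Y = sect_Ydata[OF B]
  obtain \<epsilon> t where e: "\<epsilon> \<in> fst (Echart c U \<theta>)" "fst t \<noteq> 0" "y = (\<epsilon>, twist (sect c U \<theta> \<alpha>1 \<alpha>2 \<beta> \<epsilon>) t)"
    by (rule Ychart_cases[OF Y y])
  obtain x l where x: "x \<in> U" "l \<noteq> 0" "\<epsilon> = (x, \<lambda>u. l * \<theta> x u)" by (rule Echart_cases[OF E e(1)])
  have kl: "k1 * k2 * l \<noteq> 0" using k x by simp
  have t': "fst (act_params k1 k2 w1 w2 r t) \<noteq> 0" using e(2) k by (simp add: act_params_def case_prod_unfold)
  note H = H_act_twist[OF B x(1,2) e(2) k, of w1 w2 r, folded x(3), folded e(3)]
  note p = Echart_pt[OF E x(1) kl]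
  show "H_act A T1 T2 y (H_mat k1 k2 w1 w2 r) \<in> fst (SY c U \<theta> \<alpha>1 \<alpha>2 \<beta>)"
    unfolding H by (rule Ychart_pt[OF Y p t'])
  have "snd (SY c U \<theta> \<alpha>1 \<alpha>2 \<beta>) y = ((snd c x, l), t)"
    unfolding e(3) Ychart_val[OF Y e(1,2)] unfolding x(3) Echart_val[OF E x(1)] ..
  then show "snd (SY c U \<theta> \<alpha>1 \<alpha>2 \<beta>) (H_act A T1 T2 y (H_mat k1 k2 w1 w2 r)) =
      (let q = snd (SY c U \<theta> \<alpha>1 \<alpha>2 \<beta>) y in ((fst (fst q), k1 * k2 * snd (fst q)), act_params k1 k2 w1 w2 r (snd q)))"
    unfolding H Ychart_val[OF Y p t'] Echart_val[OF E x(1)] by simp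
qed

lemma act_params_smooth:
  assumes "k1 \<noteq> 0" "k2 \<noteq> 0" "open S"
  shows "smooth_on S (\<lambda>q :: Ymod. ((fst (fst q), k * snd (fst q)), act_params k1 k2 w1 w2 r (snd q)))"
  unfolding act_params_def case_prod_unfold using assms(1,2)
  by (intro smooth_on_intros assms(3)) simp_all

abbreviation "R k \<equiv> \<lambda>y. H_act A T1 T2 y k"

lemma fst_H_act: "fst (R (H_mat k1 k2 w1 w2 r) y) = dilate (k1 * k2) (fst y)"
  by (simp add: H_act_def Let_def H_mat_11)

lemma H_act_in:
  assumes "y \<in> YS" "k1 \<noteq> 0" "k2 \<noteq> 0"
  shows "R (H_mat k1 k2 w1 w2 r) y \<in> YS"
proof -
  obtain c U \<theta> \<alpha>1 \<alpha>2 \<beta> where B: "Bdata c U \<theta> \<alpha>1 \<alpha>2 \<beta>" "y \<in> fst (SY c U \<theta> \<alpha>1 \<alpha>2 \<beta>)" using Y_special_chart[OF assms(1)] .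
  show ?thesis using SY_H_act(1)[OF B assms(2,3)] by (simp add: Ychart_dom)
qed

lemma H_act_smooth_at:
  assumes "y \<in> YS" "k1 \<noteq> 0" "k2 \<noteq> 0"
  shows "smooth_at YA YA (R (H_mat k1 k2 w1 w2 r)) y"
proof -
  obtain c U \<theta> \<alpha>1 \<alpha>2 \<beta> where B: "Bdata c U \<theta> \<alpha>1 \<alpha>2 \<beta>" "y \<in> fst (SY c U \<theta> \<alpha>1 \<alpha>2 \<beta>)" using Y_special_chart[OF assms(1)] .
  note Yc = Ychart_in[OF sect_Ydata[OF B(1)]]
  show ?thesis
    by (rule smooth_at_coordI(1)[OF Y_atlas_smooth Y_atlas_smooth Yc B(2) Yc SY_H_act(1)[OF B(1) _ assms(2,3)]
          SY_H_act(2)[OF B(1) _ assms(2,3), unfolded Let_def] act_params_smooth[OF assms(2,3) open_chart_image[OF Y_atlas_smooth Yc]]])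
qed

text \<open>The dilation by \<open>1 / \<lambda>\<close> undoes the action of \<open>H\<close> on \<open>E\<close>, so the chain rule identifies the transport of the
  covectors in \<open>H_act\<close> with the pull-back along the projection.\<close>

lemma TY_H_act:
  fixes w1 w2 r :: complex
  assumes y: "y \<in> YS" and k: "k1 \<noteq> 0" "k2 \<noteq> 0"
  defines "h \<equiv> H_mat k1 k2 w1 w2 r"
  shows "tangent_map EA EA (dilate (1 / (k1 * k2))) (fst (R h y)) (TY (R h y) (tangent_map YA YA (R h) y v)) = TY y v"
proof -
  have Rs: "smooth_at YA YA (R h) y" and Rin: "R h y \<in> YS"
    unfolding h_def by (rule H_act_smooth_at[OF y k], rule H_act_in[OF y k])
  have F: "smooth_at YA EA fst (R h y)"
    using Y_special_chart[OF Rin] smooth_at_Y_fst(1) sect_Ydata by metis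
  have F0: "smooth_at YA EA fst y"
    using Y_special_chart[OF y] smooth_at_Y_fst(1) sect_Ydata by metis
  have kn: "1 / (k1 * k2) \<noteq> 0" using k by simp
  have D: "smooth_at EA EA (dilate (1 / (k1 * k2))) (fst (R h y))"
    using E_cases[OF Y_set_E[OF Rin]] smooth_at_dilate(1)[OF _ _ kn] by metis
  note c1 = smooth_at_compose[OF Y_atlas_smooth Y_atlas_smooth E_atlas_smooth Rs F]
  note c2 = smooth_at_compose[OF Y_atlas_smooth E_atlas_smooth E_atlas_smooth c1(1) D]
  have "dilate (1 / (k1 * k2)) (fst (R h q)) = fst q" for q
    unfolding h_def fst_H_act dilate_dilate using k by simp
  then have "tangent_map YA EA (\<lambda>q. dilate (1 / (k1 * k2)) (fst (R h q))) y v = TY y v"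
    by simp
  then show ?thesis
    using c2(2)[of v] unfolding c1(2) by simp
qed

text \<open>The coframe at the image point is the product with h, transported by the inverse
  dilation; \<open>TY_H_act\<close> cancels this transport, and the columns of h remain.\<close>

lemma Y_forms_H_act:
  fixes w1 w2 r :: complex
  assumes y: "y \<in> YS" and k: "k1 \<noteq> 0" "k2 \<noteq> 0"
  defines "h \<equiv> H_mat k1 k2 w1 w2 r"
  shows "Y_\<omega> A T1 T2 (R h y) (tangent_map YA YA (R h) y v) = k1 * k2 * Y_\<omega> A T1 T2 y v"
    "Y_\<omega>1 A T1 T2 (R h y) (tangent_map YA YA (R h) y v) = w1 * (k1 * k2) * Y_\<omega> A T1 T2 y v + k1 * Y_\<omega>1 A T1 T2 y v"
    "Y_\<omega>2 A T1 T2 (R h y) (tangent_map YA YA (R h) y v) = w2 * (k1 * k2) * Y_\<omega> A T1 T2 y v + k2 * Y_\<omega>2 A T1 T2 y v"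
    "Y_\<phi> A T1 T2 (R h y) (tangent_map YA YA (R h) y v)
      = r * Y_\<omega> A T1 T2 y v + k1 * w2 * Y_\<omega>1 A T1 T2 y v - k2 * w1 * Y_\<omega>2 A T1 T2 y v + Y_\<phi> A T1 T2 y v"
proof -
  obtain \<epsilon> W0 W1 W2 W3 where q: "y = (\<epsilon>, W0, W1, W2, W3)" by (cases y)
  note T = TY_H_act[OF y k, of w1 w2 r v, folded h_def]
  have s: "snd (R h y) = coframe_pull (tangent_map EA EA (dilate (1 / (k1 * k2))) (fst (R h y))) (coframe_mult (snd y) h)"
    unfolding H_act_def Let_def h_def H_mat_11 by simp
  show "Y_\<omega> A T1 T2 (R h y) (tangent_map YA YA (R h) y v) = k1 * k2 * Y_\<omega> A T1 T2 y v"
    "Y_\<omega>1 A T1 T2 (R h y) (tangent_map YA YA (R h) y v) = w1 * (k1 * k2) * Y_\<omega> A T1 T2 y v + k1 * Y_\<omega>1 A T1 T2 y v"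
    "Y_\<omega>2 A T1 T2 (R h y) (tangent_map YA YA (R h) y v) = w2 * (k1 * k2) * Y_\<omega> A T1 T2 y v + k2 * Y_\<omega>2 A T1 T2 y v"
    "Y_\<phi> A T1 T2 (R h y) (tangent_map YA YA (R h) y v)
      = r * Y_\<omega> A T1 T2 y v + k1 * w2 * Y_\<omega>1 A T1 T2 y v - k2 * w1 * Y_\<omega>2 A T1 T2 y v + Y_\<phi> A T1 T2 y v"
    unfolding Y_forms s
    by (simp_all add: coframe_pull_def case_prod_unfold T)
      (simp_all add: q h_def coframe_mult_H_mat)
qed

subsection \<open>Fundamental vector fields\<close>

text \<open>The velocity at t = 0 of the chart coordinates of y acted on by j(exp(tX)), obtained by
  differentiating \<open>act_params\<close>. The letters a to e match those in j, so the arguments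
  are the entries 11, 33, 12, 23 and 13 of X; the component 0 records that the base point stays
  fixed.\<close>

definition vert :: "complex \<Rightarrow> complex \<Rightarrow> complex \<Rightarrow> complex \<Rightarrow> complex \<Rightarrow> Ymod \<Rightarrow> Ymod" where
  "vert Xa Xb Xc Xd Xe q = (case q of ((z, l), a, v1, v2, s) \<Rightarrow>
     ((0, l * (Xa - Xb)), a * (Xa + 2 * Xb), - 2 * Xd + v1 * (Xa + 2 * Xb), Xc - v2 * (2 * Xa + Xb),
      4 * Xe + Xc * v1 + 2 * Xd * v2 - s * (Xa - Xb)))"

text \<open>The coordinate formula for the action requires nonzero diagonal entries of the
  exponential. Continuity grants them near t = 0, which suffices for a velocity. Every coordinate of
  the curve is the restriction to real t of an expression that is complex differentiable at
  0.\<close>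

lemma fund_field_coord:
  assumes B: "Bdata c U \<theta> \<alpha>1 \<alpha>2 \<beta>" and y: "y \<in> fst (SY c U \<theta> \<alpha>1 \<alpha>2 \<beta>)"
  shows "fund_field A T1 T2 X y = from_chart YA (SY c U \<theta> \<alpha>1 \<alpha>2 \<beta>) y
    (vert (X $ 1 $ 1) (X $ 3 $ 3) (X $ 1 $ 2) (X $ 2 $ 3) (X $ 1 $ 3) (snd (SY c U \<theta> \<alpha>1 \<alpha>2 \<beta>) y))"
proof -
  let ?Y = "SY c U \<theta> \<alpha>1 \<alpha>2 \<beta>"
  note Yc = Ychart_in[OF sect_Ydata[OF B]]
  obtain z l a v1 v2 s where q: "snd ?Y y = ((z, l), a, v1, v2, s)" by (metis prod.collapse)
  define f where "f i j w = (\<Sum>n. mat_pow X n $ i $ j / fact n * w ^ n)" for i j w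
  note f = mat_exp_entry[where X = X, folded f_def]
  define g where "g = (\<lambda>t :: real. B_act A T1 T2 (mat_exp (t *\<^sub>R X)) y)"
  let ?N = "{w. f 1 1 w \<noteq> 0 \<and> f 3 3 w \<noteq> 0}"
  have cont: "isCont (f i j) 0" for i j using f(2) DERIV_isCont by blast
  have one: "f 1 1 0 = 1" "f 3 3 0 = 1" "f 1 2 0 = 0" "f 1 3 0 = 0" "f 2 3 0 = 0"
    by (simp_all add: f(3) mat_def)
  have cr: "isCont (\<lambda>t. f i j (complex_of_real t)) 0" for i j
    by (rule isCont_o2[of 0 complex_of_real]) (auto simp: cont)
  have cn: "((\<lambda>t. f i j (complex_of_real t)) \<longlongrightarrow> f i j (complex_of_real 0)) (nhds 0)" for i j
    using cr[of i j] tendsto_at_iff_tendsto_nhds[of "\<lambda>t. f i j (complex_of_real t)" 0] unfolding isCont_def by blast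
  have ev: "\<forall>\<^sub>F t in nhds 0. f 1 1 (of_real t) \<noteq> 0 \<and> f 3 3 (of_real t) \<noteq> 0"
    by (intro eventually_conj tendsto_imp_eventually_ne[OF cn]) (simp_all add: one)
  have val: "g t \<in> fst ?Y" "snd ?Y (g t) = ((z, f 1 1 (of_real t) / f 3 3 (of_real t) * l),
     a * f 1 1 (of_real t) * (f 3 3 (of_real t))\<^sup>2,
     - 2 * f 1 1 (of_real t) * f 3 3 (of_real t) * f 2 3 (of_real t) + v1 * f 1 1 (of_real t) * (f 3 3 (of_real t))\<^sup>2,
     f 1 2 (of_real t) / f 1 1 (of_real t) + v2 / ((f 1 1 (of_real t))\<^sup>2 * f 3 3 (of_real t)),
     (4 * f 1 3 (of_real t) / f 3 3 (of_real t) - 2 * f 1 1 (of_real t) * f 1 2 (of_real t) * f 2 3 (of_real t)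
       + f 1 1 (of_real t) * f 3 3 (of_real t) * f 1 2 (of_real t) * v1 + 2 * f 2 3 (of_real t) / f 3 3 (of_real t) * v2 + s)
      * f 3 3 (of_real t) / f 1 1 (of_real t))"
    if nz: "f 1 1 (of_real t) \<noteq> 0 \<and> f 3 3 (of_real t) \<noteq> 0" for t
  proof -
    have nz': "mat_exp (t *\<^sub>R X) $ 1 $ 1 \<noteq> 0" "mat_exp (t *\<^sub>R X) $ 3 $ 3 \<noteq> 0" using nz f(1) by auto
    have k: "(f 1 1 (of_real t))\<^sup>2 * f 3 3 (of_real t) \<noteq> 0" "1 / (f 1 1 (of_real t) * (f 3 3 (of_real t))\<^sup>2) \<noteq> 0" using nz by auto
    have gt: "g t = R (H_mat ((f 1 1 (of_real t))\<^sup>2 * f 3 3 (of_real t)) (1 / (f 1 1 (of_real t) * (f 3 3 (of_real t))\<^sup>2))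
      (- 2 * f 1 1 (of_real t) * f 3 3 (of_real t) * f 2 3 (of_real t))
      (f 1 2 (of_real t) / f 1 1 (of_real t)) (4 * f 1 3 (of_real t) / f 3 3 (of_real t) - 2 * f 1 1 (of_real t) * f 1 2 (of_real t) * f 2 3 (of_real t))) y"
      unfolding g_def B_act_def j_hom_eq[OF nz'] f(1) ..
    show "g t \<in> fst ?Y" unfolding gt by (rule SY_H_act(1)[OF B y k])
    show "snd ?Y (g t) = ((z, f 1 1 (of_real t) / f 3 3 (of_real t) * l),
     a * f 1 1 (of_real t) * (f 3 3 (of_real t))\<^sup>2,
     - 2 * f 1 1 (of_real t) * f 3 3 (of_real t) * f 2 3 (of_real t) + v1 * f 1 1 (of_real t) * (f 3 3 (of_real t))\<^sup>2,
     f 1 2 (of_real t) / f 1 1 (of_real t) + v2 / ((f 1 1 (of_real t))\<^sup>2 * f 3 3 (of_real t)),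
     (4 * f 1 3 (of_real t) / f 3 3 (of_real t) - 2 * f 1 1 (of_real t) * f 1 2 (of_real t) * f 2 3 (of_real t)
       + f 1 1 (of_real t) * f 3 3 (of_real t) * f 1 2 (of_real t) * v1 + 2 * f 2 3 (of_real t) / f 3 3 (of_real t) * v2 + s)
      * f 3 3 (of_real t) / f 1 1 (of_real t))"
      unfolding gt SY_H_act(2)[OF B y k] q using nz
      by (simp add: Let_def act_params_def) (simp add: field_simps power2_eq_square)
  qed
  have g0: "g 0 = y"
  proof -
    have "snd ?Y (g 0) = snd ?Y y" using val(2)[of 0] one q by simp
    then show ?thesis
      using chart_inj[OF Y_atlas_smooth Yc] val(1)[of 0] one y by (auto simp: inj_on_def)
  qed
  define V where "V = vert (X $ 1 $ 1) (X $ 3 $ 3) (X $ 1 $ 2) (X $ 2 $ 3) (X $ 1 $ 3) ((z, l), a, v1, v2, s)"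
  have dv: "((\<lambda>t. F (complex_of_real t)) has_vector_derivative D) (at 0)" if "(F has_field_derivative D) (at 0)" for F D
    using has_vector_derivative_real_field[of F D 0 UNIV] that by simp
  have nz0: "f 1 1 0 \<noteq> 0" "f 3 3 0 \<noteq> 0" by (simp_all add: one)
  have d: "((\<lambda>w. f 1 1 w / f 3 3 w * l) has_field_derivative l * (X $ 1 $ 1 - X $ 3 $ 3)) (at 0)"
    "((\<lambda>w. a * f 1 1 w * (f 3 3 w)\<^sup>2) has_field_derivative a * (X $ 1 $ 1 + 2 * X $ 3 $ 3)) (at 0)"
    "((\<lambda>w. - 2 * f 1 1 w * f 3 3 w * f 2 3 w + v1 * f 1 1 w * (f 3 3 w)\<^sup>2) has_field_derivative
       - 2 * X $ 2 $ 3 + v1 * (X $ 1 $ 1 + 2 * X $ 3 $ 3)) (at 0)"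
    "((\<lambda>w. f 1 2 w / f 1 1 w + v2 / ((f 1 1 w)\<^sup>2 * f 3 3 w)) has_field_derivative X $ 1 $ 2 - v2 * (2 * X $ 1 $ 1 + X $ 3 $ 3)) (at 0)"
    by (auto intro!: derivative_eq_intros f(2) simp: one algebra_simps)
  have d5: "((\<lambda>w. (4 * f 1 3 w / f 3 3 w - 2 * f 1 1 w * f 1 2 w * f 2 3 w + f 1 1 w * f 3 3 w * f 1 2 w * v1 + 2 * f 2 3 w / f 3 3 w * v2 + s)
      * f 3 3 w / f 1 1 w) has_field_derivative 4 * X $ 1 $ 3 + X $ 1 $ 2 * v1 + 2 * X $ 2 $ 3 * v2 - s * (X $ 1 $ 1 - X $ 3 $ 3)) (at 0)"
    by (rule DERIV_cong, (rule derivative_intros f(2) nz0)+) (simp_all add: one algebra_simps)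
  have DV: "((\<lambda>t. ((z, f 1 1 (of_real t) / f 3 3 (of_real t) * l),
     a * f 1 1 (of_real t) * (f 3 3 (of_real t))\<^sup>2,
     - 2 * f 1 1 (of_real t) * f 3 3 (of_real t) * f 2 3 (of_real t) + v1 * f 1 1 (of_real t) * (f 3 3 (of_real t))\<^sup>2,
     f 1 2 (of_real t) / f 1 1 (of_real t) + v2 / ((f 1 1 (of_real t))\<^sup>2 * f 3 3 (of_real t)),
     (4 * f 1 3 (of_real t) / f 3 3 (of_real t) - 2 * f 1 1 (of_real t) * f 1 2 (of_real t) * f 2 3 (of_real t)
       + f 1 1 (of_real t) * f 3 3 (of_real t) * f 1 2 (of_real t) * v1 + 2 * f 2 3 (of_real t) / f 3 3 (of_real t) * v2 + s)
      * f 3 3 (of_real t) / f 1 1 (of_real t))) has_vector_derivative V) (at 0)"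
    unfolding V_def vert_def split
    by (intro has_vector_derivative_Pair has_vector_derivative_const dv[OF d(1)] dv[OF d(2)] dv[OF d(3)] dv[OF d(4)] dv[OF d5])
  obtain N where N: "open N" "0 \<in> N" "\<And>t. t \<in> N \<Longrightarrow> f 1 1 (of_real t) \<noteq> 0 \<and> f 3 3 (of_real t) \<noteq> 0"
    using ev unfolding eventually_nhds by blast
  have "((\<lambda>t. snd ?Y (g t)) has_vector_derivative V) (at 0)"
    unfolding has_vector_derivative_def
    by (rule has_derivative_transform_within_open[OF DV[unfolded has_vector_derivative_def] N(1,2)]) (simp only: val(2)[OF N(3)])
  moreover have "\<forall>\<^sub>F t in nhds 0. g t \<in> fst ?Y" using ev by (rule eventually_mono) (rule val(1))
  ultimately have "velocity YA g = from_chart YA ?Y (g 0) V"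
    by (intro velocity_from_chart[OF Y_atlas_smooth Yc])
  then show ?thesis
    unfolding fund_field_def g0 g_def[symmetric] V_def q .
qed

lemma special_comp:
  fixes u :: "real ^ 3" and v1 v2 s :: complex
  assumes B: "Bdata c U \<theta> \<alpha>1 \<alpha>2 \<beta>" and x: "x \<in> U" "l \<noteq> 0" and a: "a \<noteq> 0"
  defines "f \<equiv> \<lambda>\<alpha>. form_comp A \<alpha> c u (snd c x)" and "q \<equiv> ((snd c x, l), a, v1, v2, s)" and "Y \<equiv> SY c U \<theta> \<alpha>1 \<alpha>2 \<beta>"
  shows "form_comp YA (Y_\<omega> A T1 T2) Y ((u, m), t) q = l * f \<theta>"
    "form_comp YA (Y_\<omega>1 A T1 T2) Y ((u, m), t) q = v1 * l * f \<theta> + a * l * f \<alpha>1"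
    "form_comp YA (Y_\<omega>2 A T1 T2) Y ((u, m), t) q = v2 * l * f \<theta> + f \<alpha>2 / a"
    "form_comp YA (Y_\<phi> A T1 T2) Y ((u, m), t) q = s * l * f \<theta> + a * v2 * l * f \<alpha>1 - v1 / a * f \<alpha>2 + f \<beta> - m / l"
proof -
  note E = BdataD(1)[OF B] and Yd = sect_Ydata[OF B]
  let ?\<epsilon> = "(x, \<lambda>u. l * \<theta> x u)"
  have e: "?\<epsilon> \<in> fst (Echart c U \<theta>)" by (rule Echart_pt[OF E x])
  have q: "q = (snd (Echart c U \<theta>) ?\<epsilon>, (a, v1, v2, s))" using Echart_val[OF E x(1)] by (simp add: q_def)
  have a': "fst (a, v1, v2, s) \<noteq> 0" using a by simp
  note F = Y_form_comp[OF Yd e a', of "((u, m), t)", folded q Y_def, unfolded section_comp_at[OF Yd e] fst_conv snd_conv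
    sect_from_chart[OF B x, of u m]]
  show "form_comp YA (Y_\<omega> A T1 T2) Y ((u, m), t) q = l * f \<theta>"
    "form_comp YA (Y_\<omega>1 A T1 T2) Y ((u, m), t) q = v1 * l * f \<theta> + a * l * f \<alpha>1"
    "form_comp YA (Y_\<omega>2 A T1 T2) Y ((u, m), t) q = v2 * l * f \<theta> + f \<alpha>2 / a"
    "form_comp YA (Y_\<phi> A T1 T2) Y ((u, m), t) q = s * l * f \<theta> + a * v2 * l * f \<alpha>1 - v1 / a * f \<alpha>2 + f \<beta> - m / l"
    unfolding F f_def by (simp_all add: mult_ac)
qed

end

text \<open>A directional derivative is read off from the restriction to a line. When this
  restriction comes from a function of one complex variable, the usual rules for quotients and
  products compute it.\<close>

lemma fd_along_line:
  fixes F :: "'a::real_normed_vector \<Rightarrow> complex"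
  assumes "(F has_derivative F') (at q)" "(g has_field_derivative d) (at 0)"
    and eq: "\<forall>\<^sub>F \<tau> in nhds 0. F (q + \<tau> *\<^sub>R V) = g (of_real \<tau>)"
  shows "F' V = d"
proof -
  have "((\<lambda>\<tau>. q + \<tau> *\<^sub>R V) has_derivative (\<lambda>\<tau>. \<tau> *\<^sub>R V)) (at 0)"
    by (auto intro!: derivative_eq_intros)
  from has_derivative_compose[OF this, of F F']
  have 1: "((\<lambda>\<tau>. F (q + \<tau> *\<^sub>R V)) has_vector_derivative F' V) (at 0)"
    using assms(1) linear_scale[OF has_derivative_linear[OF assms(1)]] by (simp add: has_vector_derivative_def)
  obtain N where N: "open N" "0 \<in> N" "\<And>\<tau>. \<tau> \<in> N \<Longrightarrow> F (q + \<tau> *\<^sub>R V) = g (of_real \<tau>)"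
    using eq unfolding eventually_nhds by blast
  have gd: "((\<lambda>\<tau>. g (of_real \<tau>)) has_vector_derivative d) (at 0)"
    using has_vector_derivative_real_field[of g d 0 UNIV] assms(2) by simp
  have "((\<lambda>\<tau>. F (q + \<tau> *\<^sub>R V)) has_vector_derivative d) (at 0)"
    unfolding has_vector_derivative_def
    by (rule has_derivative_transform_within_open[OF gd[unfolded has_vector_derivative_def] N(1,2)]) (simp add: N(3))
  with 1 show ?thesis by (rule vector_derivative_unique_at)
qed

lemma cx_eval_simps:
  "cx_eval (\<lambda>v. f v + g v) p q = cx_eval f p q + cx_eval g p q"
  "cx_eval (\<lambda>v. f v - g v) p q = cx_eval f p q - cx_eval g p q"
  "cx_eval (\<lambda>v. - f v) p q = - cx_eval f p q"
  "cx_eval (\<lambda>v. k * f v) p q = k * cx_eval f p q"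
  "cx_eval (\<lambda>v. f v * k) p q = cx_eval f p q * k"
  "cx_eval (\<lambda>v. f v / k) p q = cx_eval f p q / k"
  "cx_eval (\<lambda>v. 0) p q = 0"
  by (simp_all add: cx_eval_def algebra_simps add_divide_distrib)

lemma ext_deriv_cong:
  fixes A :: "('a, 'e::euclidean_space) atlas"
  assumes A: "smooth_atlas A" and W: "is_open A W" "p \<in> W" and eq: "\<And>q v. q \<in> W \<Longrightarrow> \<alpha> q v = \<beta> q v"
  shows "ext_deriv A \<alpha> p u v = ext_deriv A \<beta> p u v"
proof -
  let ?c = "chart_at A p"
  have c: "?c \<in> A" "p \<in> fst ?c" using chart_at[of p A] W by (auto simp: is_open_def)
  have "fd (form_comp A \<alpha> ?c e) (snd ?c p) = fd (form_comp A \<beta> ?c e) (snd ?c p)" for e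
    using W c(2) by (intro fd_cong[OF is_openD[OF W(1) c(1)]]) (auto simp: form_comp_at[OF A c(1)] eq)
  then show ?thesis by (simp add: ext_deriv_def Let_def)
qed

lemma ext_deriv_zero: "ext_deriv A (\<lambda>q v. 0) p u v = 0"
proof -
  have "form_comp A (\<lambda>q v. 0) c e = (\<lambda>x. 0)" for c e by (simp add: form_comp_def fun_eq_iff)
  then show ?thesis by (simp add: ext_deriv_def Let_def)
qed

lemma linear_comb2:
  assumes A: "smooth_atlas A" and W: "is_open A W" and \<alpha>: "smooth_form A W \<alpha>" "smooth_form A W \<beta>"
  shows "smooth_form A W (\<lambda>q v. k * \<alpha> q v + l * \<beta> q v)"
    and "p \<in> W \<Longrightarrow> ext_deriv A (\<lambda>q v. k * \<alpha> q v + l * \<beta> q v) p u v = k * ext_deriv A \<alpha> p u v + l * ext_deriv A \<beta> p u v"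
proof -
  define kl \<alpha>\<beta> where "kl = (\<lambda>b. if b then k else l)" and "\<alpha>\<beta> = (\<lambda>b. if b then \<alpha> else \<beta>)"
  have s: "smooth_form A W (\<alpha>\<beta> b)" for b using \<alpha> by (simp add: \<alpha>\<beta>_def)
  show "smooth_form A W (\<lambda>q v. k * \<alpha> q v + l * \<beta> q v)"
    using smooth_form_linear_comb[of UNIV A W \<alpha>\<beta> kl] s W by (simp add: UNIV_bool add.commute kl_def \<alpha>\<beta>_def)
  show "p \<in> W \<Longrightarrow> ext_deriv A (\<lambda>q v. k * \<alpha> q v + l * \<beta> q v) p u v = k * ext_deriv A \<alpha> p u v + l * ext_deriv A \<beta> p u v"
    using ext_deriv_linear_comb[OF A W, of p UNIV \<alpha>\<beta> kl u v] s by (simp add: UNIV_bool add.commute kl_def \<alpha>\<beta>_def)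
qed

lemma linear_cmult1:
  assumes A: "smooth_atlas A" and W: "is_open A W" and \<alpha>: "smooth_form A W \<alpha>"
  shows "smooth_form A W (\<lambda>q v. k * \<alpha> q v)"
    and "p \<in> W \<Longrightarrow> ext_deriv A (\<lambda>q v. k * \<alpha> q v) p u v = k * ext_deriv A \<alpha> p u v"
  using linear_comb2(1)[OF A W \<alpha> \<alpha>, of k 0] linear_comb2(2)[OF A W \<alpha> \<alpha>, of p k 0 u v] by simp_all

text \<open>The factor y comes from pointwise choices and carries no smoothness assumption. Near p
  it is the quotient of the u0-components of \<alpha> and \<beta>, hence smooth, and the product
  rule d\<alpha> = dy \<and> \<beta> + y d\<beta> applies.\<close>

lemma ext_deriv_multiple:
  fixes A :: "('a, 'e::euclidean_space) atlas"
  assumes A: "smooth_atlas A" and W: "is_open A W" "p \<in> W" and \<alpha>: "smooth_form A W \<alpha>" "smooth_form A W \<beta>"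
    and eq: "\<And>q v. q \<in> W \<Longrightarrow> \<alpha> q v = y q * \<beta> q v" and u0: "\<beta> p u0 \<noteq> 0"
  obtains D where "\<And>u v. ext_deriv A \<alpha> p u v = D u * \<beta> p v - D v * \<beta> p u + y p * ext_deriv A \<beta> p u v"
proof -
  let ?c = "chart_at A p"
  have p: "p \<in> points A" using W by (auto simp: is_open_def)
  have c: "?c \<in> A" "p \<in> fst ?c" using chart_at[OF p] by auto
  let ?a = "form_comp A \<alpha> ?c" and ?b = "form_comp A \<beta> ?c" and ?x = "snd ?c p"
  let ?S = "snd ?c ` (W \<inter> fst ?c)"
  have S: "open ?S" "?x \<in> ?S" using is_openD[OF W(1) c(1)] W(2) c(2) by auto
  define r where "r x = y (chart_inv ?c x)" for x
  have sm: "smooth_on ?S (?a e)" "smooth_on ?S (?b e)" for e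
    using smooth_formD(2)[OF \<alpha>(1) c(1)] smooth_formD(2)[OF \<alpha>(2) c(1)] .
  have ab: "?a e x = r x * ?b e x" if "x \<in> ?S" for e x
    using that by (auto simp: form_comp_at[OF A c(1)] eq r_def chart_inv_left[OF A c(1)])
  let ?T = "{x \<in> ?S. ?b u0 x \<in> - {0}}"
  have T: "open ?T" by (rule open_Collect_mem[OF sm(2) S(1)]) auto
  have bx: "?b e ?x = \<beta> p e" for e
    using form_comp_at[OF A c] from_chart_at[OF A p] by simp
  have xT: "?x \<in> ?T" using S(2) u0 bx by simp
  have "smooth_on ?T (\<lambda>x. ?a u0 x / ?b u0 x)"
    by (intro smooth_on_divide T smooth_on_subset[OF sm(1)] smooth_on_subset[OF sm(2)]) auto
  then have "smooth_on ?T r"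
    by (rule smooth_on_cong[OF _ T]) (auto simp: ab)
  then have dr: "(r has_derivative fd r ?x) (at ?x)" using T xT by (rule smooth_on_has_derivative)
  have da: "fd (?a e) ?x h = fd r ?x h * \<beta> p e + y p * fd (?b e) ?x h" for e h
  proof -
    have "((\<lambda>x. r x * ?b e x) has_derivative (\<lambda>h. r ?x * fd (?b e) ?x h + fd r ?x h * ?b e ?x)) (at ?x)"
      by (rule has_derivative_mult[OF dr smooth_on_has_derivative[OF sm(2) S]])
    then have "(?a e has_derivative (\<lambda>h. r ?x * fd (?b e) ?x h + fd r ?x h * ?b e ?x)) (at ?x)"
      by (rule has_derivative_transform_within_open[OF _ S]) (simp add: ab)
    then show ?thesis
      by (simp add: fd_eqI bx r_def chart_inv_left[OF A c])
  qed
  show thesis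
    by (rule that[of "fd r ?x"]) (simp add: ext_deriv_def Let_def da algebra_simps)
qed

text \<open>Contracting E1 with the vector dual to w1, and E2 with the one dual to w2, writes a in
  terms of w, w1 and also in terms of w, w2. By independence a is a multiple of w. Contraction with
  the vector dual to w then expresses b1, b2 and g, and the coefficients y, z, x, t are the
  remaining freedom.\<close>

lemma cartan_lemma:
  fixes w :: "'v \<Rightarrow> complex"
  assumes ind: "coframe_indep w w1 w2"
    and E1: "\<And>u v. w1 u * a v - w1 v * a u + (w u * b1 v - w v * b1 u) = 0"
    and E2: "\<And>u v. - (w2 u * a v - w2 v * a u) + (w u * b2 v - w v * b2 u) = 0"
    and E3: "\<And>u v. w1 u * b2 v - w1 v * b2 u - (w2 u * b1 v - w2 v * b1 u) + (w u * g v - w v * g u) = 0"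
  obtains y z x t where "\<And>v. a v = y * w v" "\<And>v. b1 v = y * w1 v + z * w v" "\<And>v. b2 v = - (y * w2 v) + x * w v"
    "\<And>v. g v = x * w1 v - z * w2 v + t * w v"
proof -
  obtain p0 q0 p1 q1 p2 q2 where
    E: "cx_eval w p0 q0 = 1" "cx_eval w1 p0 q0 = 0" "cx_eval w2 p0 q0 = 0"
     "cx_eval w p1 q1 = 0" "cx_eval w1 p1 q1 = 1" "cx_eval w2 p1 q1 = 0"
     "cx_eval w p2 q2 = 0" "cx_eval w1 p2 q2 = 0" "cx_eval w2 p2 q2 = 1"
    using ind unfolding coframe_indep_def by blast
  have F1: "cx_eval w1 p q * a v - w1 v * cx_eval a p q + (cx_eval w p q * b1 v - w v * cx_eval b1 p q) = 0" for p q v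
    using arg_cong[OF ext[OF E1[of _ v]], of "\<lambda>f. cx_eval f p q"] by (simp add: cx_eval_simps)
  have F2: "- (cx_eval w2 p q * a v - w2 v * cx_eval a p q) + (cx_eval w p q * b2 v - w v * cx_eval b2 p q) = 0" for p q v
    using arg_cong[OF ext[OF E2[of _ v]], of "\<lambda>f. cx_eval f p q"] by (simp add: cx_eval_simps)
  have F3: "cx_eval w1 p q * b2 v - w1 v * cx_eval b2 p q - (cx_eval w2 p q * b1 v - w2 v * cx_eval b1 p q)
      + (cx_eval w p q * g v - w v * cx_eval g p q) = 0" for p q v
    using arg_cong[OF ext[OF E3[of _ v]], of "\<lambda>f. cx_eval f p q"] by (simp add: cx_eval_simps)
  have a2: "a v = w2 v * cx_eval a p2 q2 - w v * cx_eval b2 p2 q2" for v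
    using F2[of p2 q2 v] by (simp add: E algebra_simps)
  have a1: "a v = w1 v * cx_eval a p1 q1 + w v * cx_eval b1 p1 q1" for v
    using F1[of p1 q1 v] by (simp add: E algebra_simps)
  have "cx_eval a p1 q1 = cx_eval (\<lambda>v. w2 v * cx_eval a p2 q2 - w v * cx_eval b2 p2 q2) p1 q1"
    by (rule arg_cong[OF ext[OF a2], of "\<lambda>f. cx_eval f p1 q1"])
  then have "cx_eval a p1 q1 = 0" by (simp add: cx_eval_simps E)
  then have av: "a v = cx_eval b1 p1 q1 * w v" for v using a1[of v] by simp
  define y where "y = cx_eval a p0 q0"
  have "y = cx_eval (\<lambda>v. cx_eval b1 p1 q1 * w v) p0 q0"
    unfolding y_def by (rule arg_cong[OF ext[OF av], of "\<lambda>f. cx_eval f p0 q0"])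
  then have y: "y = cx_eval b1 p1 q1" by (simp add: cx_eval_simps E)
  show thesis
  proof (rule that[of y "cx_eval b1 p0 q0" "cx_eval b2 p0 q0" "cx_eval g p0 q0"])
    fix v
    show "a v = y * w v" using av y by simp
    show "b1 v = y * w1 v + cx_eval b1 p0 q0 * w v"
      using F1[of p0 q0 v] unfolding y_def by (simp add: E algebra_simps)
    show "b2 v = - (y * w2 v) + cx_eval b2 p0 q0 * w v"
      using F2[of p0 q0 v] unfolding y_def by (simp add: E algebra_simps)
    show "g v = cx_eval b2 p0 q0 * w1 v - cx_eval b1 p0 q0 * w2 v + cx_eval g p0 q0 * w v"
      using F3[of p0 q0 v] by (simp add: E algebra_simps)
  qed
qed

section \<open>Contraction of the tautological forms with fundamental fields\<close>

context flag_manifold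
begin

abbreviation "w0 \<equiv> Y_\<omega> A T1 T2"
abbreviation "wf1 \<equiv> Y_\<omega>1 A T1 T2"
abbreviation "wf2 \<equiv> Y_\<omega>2 A T1 T2"
abbreviation "ph \<equiv> Y_\<phi> A T1 T2"

lemma special_fd_vert:
  fixes v1 v2 s L a' v1' v2' s' :: complex
  assumes B: "Bdata c U \<theta> \<alpha>1 \<alpha>2 \<beta>" and x: "x \<in> U" "l \<noteq> 0" and a: "a \<noteq> 0"
  defines "f \<equiv> \<lambda>\<alpha> u. form_comp A \<alpha> c u (snd c x)" and "q \<equiv> ((snd c x, l), a, v1, v2, s)" and "Y \<equiv> SY c U \<theta> \<alpha>1 \<alpha>2 \<beta>"
    and "V \<equiv> ((0, L), a', v1', v2', s')"
  shows "fd (form_comp YA w0 Y ((u, m), t)) q V = L * f \<theta> u"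
    "fd (form_comp YA wf1 Y ((u, m), t)) q V = (v1' * l + v1 * L) * f \<theta> u + (a' * l + a * L) * f \<alpha>1 u"
    "fd (form_comp YA wf2 Y ((u, m), t)) q V = (v2' * l + v2 * L) * f \<theta> u - a' / a\<^sup>2 * f \<alpha>2 u"
    "fd (form_comp YA ph Y ((u, m), t)) q V = (s' * l + s * L) * f \<theta> u + (a' * v2 * l + a * v2' * l + a * v2 * L) * f \<alpha>1 u
       - (v1' / a - v1 * a' / a\<^sup>2) * f \<alpha>2 u + m * L / l\<^sup>2"
proof -
  note E = BdataD(1)[OF B] and Yd = sect_Ydata[OF B]
  note Yc = Ychart_in[OF Yd, folded Y_def]
  have e: "(x, \<lambda>u. l * \<theta> x u) \<in> fst (Echart c U \<theta>)" by (rule Echart_pt[OF E x])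
  have a0: "fst (a, v1, v2, s) \<noteq> 0" using a by simp
  have y: "(x, \<lambda>u. l * \<theta> x u) \<in> fst (Echart c U \<theta>)" by (rule e)
  let ?y = "((x, \<lambda>u. l * \<theta> x u), twist (sect c U \<theta> \<alpha>1 \<alpha>2 \<beta> (x, \<lambda>u. l * \<theta> x u)) (a, v1, v2, s))"
  have yY: "?y \<in> fst Y" "snd Y ?y = q"
    using Ychart_pt[OF Yd e a0] Ychart_val[OF Yd e a0] Echart_val[OF E x(1), of l] by (simp_all add: Y_def q_def)
  have D: "(form_comp YA F Y e has_derivative fd (form_comp YA F Y e) q) (at q)" if "smooth_form YA YS F" for F e
  proof (rule smooth_on_has_derivative[OF smooth_formD(2)[OF that Yc] is_openD[OF Y_open Yc]])
    have "?y \<in> YS" using yY(1) by (simp add: Y_def Ychart_dom)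
    then show "q \<in> snd Y ` (YS \<inter> fst Y)" using yY by blast
  qed
  have ev: "\<forall>\<^sub>F \<tau> in nhds (0::real). l + of_real \<tau> * L \<noteq> 0 \<and> a + of_real \<tau> * a' \<noteq> 0"
  proof -
    have "((\<lambda>\<tau>. b + of_real \<tau> * k) \<longlongrightarrow> b + of_real 0 * k) (nhds (0::real))" for b k :: complex
      by (intro tendsto_intros filterlim_ident)
    from tendsto_imp_eventually_ne[OF this] show ?thesis
      using x(2) a by (intro eventually_conj) simp_all
  qed
  have line: "q + \<tau> *\<^sub>R V = ((snd c x, l + of_real \<tau> * L), a + of_real \<tau> * a', v1 + of_real \<tau> * v1', v2 + of_real \<tau> * v2', s + of_real \<tau> * s')" for \<tau>
    by (simp add: q_def V_def scaleR_conv_of_real[of _ "_ :: complex"])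
  note S = special_comp[OF B x(1), folded Y_def]
  have nz: "l + 0 * L \<noteq> 0" "a + 0 * a' \<noteq> 0" using x a by auto
  have d1: "((\<lambda>\<tau>. (l + \<tau> * L) * f \<theta> u) has_field_derivative L * f \<theta> u) (at 0)"
    by (auto intro!: derivative_eq_intros)
  have d2: "((\<lambda>\<tau>. (v1 + \<tau> * v1') * (l + \<tau> * L) * f \<theta> u + (a + \<tau> * a') * (l + \<tau> * L) * f \<alpha>1 u) has_field_derivative
     (v1' * l + v1 * L) * f \<theta> u + (a' * l + a * L) * f \<alpha>1 u) (at 0)"
    by (auto intro!: derivative_eq_intros simp: algebra_simps)
  have d3: "((\<lambda>\<tau>. (v2 + \<tau> * v2') * (l + \<tau> * L) * f \<theta> u + f \<alpha>2 u / (a + \<tau> * a')) has_field_derivative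
     (v2' * l + v2 * L) * f \<theta> u - a' / a\<^sup>2 * f \<alpha>2 u) (at 0)"
    by (rule DERIV_cong, (rule derivative_intros nz)+) (use a in \<open>simp_all add: field_simps power2_eq_square\<close>)
  have d4: "((\<lambda>\<tau>. (s + \<tau> * s') * (l + \<tau> * L) * f \<theta> u + (a + \<tau> * a') * (v2 + \<tau> * v2') * (l + \<tau> * L) * f \<alpha>1 u
       - (v1 + \<tau> * v1') / (a + \<tau> * a') * f \<alpha>2 u + f \<beta> u - m / (l + \<tau> * L)) has_field_derivative
     (s' * l + s * L) * f \<theta> u + (a' * v2 * l + a * v2' * l + a * v2 * L) * f \<alpha>1 u
       - (v1' / a - v1 * a' / a\<^sup>2) * f \<alpha>2 u + m * L / l\<^sup>2) (at 0)"
    by (rule DERIV_cong, (rule derivative_intros nz)+) (use a x(2) in \<open>simp_all add: field_simps power2_eq_square\<close>)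
  show "fd (form_comp YA w0 Y ((u, m), t)) q V = L * f \<theta> u"
    by (rule fd_along_line[OF D[OF Y_forms_smooth(1)] d1], rule eventually_mono[OF ev]) (simp add: line S f_def)
  show "fd (form_comp YA wf1 Y ((u, m), t)) q V = (v1' * l + v1 * L) * f \<theta> u + (a' * l + a * L) * f \<alpha>1 u"
    by (rule fd_along_line[OF D[OF Y_forms_smooth(2)] d2], rule eventually_mono[OF ev]) (simp add: line S f_def)
  show "fd (form_comp YA wf2 Y ((u, m), t)) q V = (v2' * l + v2 * L) * f \<theta> u - a' / a\<^sup>2 * f \<alpha>2 u"
    by (rule fd_along_line[OF D[OF Y_forms_smooth(3)] d3], rule eventually_mono[OF ev]) (simp add: line S f_def)
  show "fd (form_comp YA ph Y ((u, m), t)) q V = (s' * l + s * L) * f \<theta> u + (a' * v2 * l + a * v2' * l + a * v2 * L) * f \<alpha>1 u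
       - (v1' / a - v1 * a' / a\<^sup>2) * f \<alpha>2 u + m * L / l\<^sup>2"
    by (rule fd_along_line[OF D[OF Y_forms_smooth(4)] d4], rule eventually_mono[OF ev]) (simp add: line S f_def)
qed

lemma special_comp_vert:
  fixes v1 v2 s :: complex
  assumes B: "Bdata c U \<theta> \<alpha>1 \<alpha>2 \<beta>" and x: "x \<in> U" "l \<noteq> 0" and a: "a \<noteq> 0"
  defines "q \<equiv> ((snd c x, l), a, v1, v2, s)" and "Y \<equiv> SY c U \<theta> \<alpha>1 \<alpha>2 \<beta>"
  shows "form_comp YA w0 Y ((0, L), t) q = 0" "form_comp YA wf1 Y ((0, L), t) q = 0"
    "form_comp YA wf2 Y ((0, L), t) q = 0" "form_comp YA ph Y ((0, L), t) q = - (L / l)"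
proof -
  note D = EdataD[OF BdataD(1)[OF B]]
  have xc: "x \<in> fst c" using D(3) x by blast
  have z: "form_comp A \<alpha> c 0 (snd c x) = 0" if "linear (\<alpha> x)" for \<alpha>
    using linear_0[OF form_comp_linear[where \<alpha> = \<alpha>, OF smA D(1) xc that]] .
  from z[where \<alpha> = \<theta>, OF smooth_formD(1)[OF D(4) x(1)]] z[where \<alpha> = \<alpha>1, OF smooth_formD(1)[OF BdataD(2)[OF B] x(1)]]
    z[where \<alpha> = \<alpha>2, OF smooth_formD(1)[OF BdataD(3)[OF B] x(1)]] z[where \<alpha> = \<beta>, OF smooth_formD(1)[OF BdataD(4)[OF B] x(1)]]
  show "form_comp YA w0 Y ((0, L), t) q = 0" "form_comp YA wf1 Y ((0, L), t) q = 0"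
    "form_comp YA wf2 Y ((0, L), t) q = 0" "form_comp YA ph Y ((0, L), t) q = - (L / l)"
    unfolding q_def Y_def special_comp[OF B x a] by simp_all
qed

lemma SY_cases:
  assumes B: "Bdata c U \<theta> \<alpha>1 \<alpha>2 \<beta>" and y: "y \<in> fst (SY c U \<theta> \<alpha>1 \<alpha>2 \<beta>)"
  obtains x l a v1 v2 s where "x \<in> U" "l \<noteq> 0" "a \<noteq> 0" "snd (SY c U \<theta> \<alpha>1 \<alpha>2 \<beta>) y = ((snd c x, l), a, v1, v2, s)"
    "fst (fst y) = x"
proof -
  note E = BdataD(1)[OF B] and Yd = sect_Ydata[OF B]
  obtain \<epsilon> t where e: "\<epsilon> \<in> fst (Echart c U \<theta>)" "fst t \<noteq> 0" "y = (\<epsilon>, twist (sect c U \<theta> \<alpha>1 \<alpha>2 \<beta> \<epsilon>) t)"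
    by (rule Ychart_cases[OF Yd y])
  obtain x l where x: "x \<in> U" "l \<noteq> 0" "\<epsilon> = (x, \<lambda>u. l * \<theta> x u)" by (rule Echart_cases[OF E e(1)])
  obtain a v1 v2 s where t: "t = (a, v1, v2, s)" by (cases t)
  show thesis
  proof (rule that[of x l a v1 v2 s])
    show "snd (SY c U \<theta> \<alpha>1 \<alpha>2 \<beta>) y = ((snd c x, l), a, v1, v2, s)"
      unfolding e(3) Ychart_val[OF Yd e(1,2)] unfolding x(3) Echart_val[OF E x(1)] t ..
  qed (use x e t in auto)
qed

text \<open>The tautological forms have constant values on a fundamental field, so by Cartan's
  formula contracting their differentials gives their Lie derivatives. The coefficients are
  therefore the columns of the derivative of j at the identity. The proof verifies this in
  coordinates, extending the vector by constant components.\<close>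

lemma fund_field_contraction:
  fixes X :: "complex ^ 3 ^ 3"
  assumes y: "y \<in> YS"
  defines "F \<equiv> fund_field A T1 T2 X y" and "Xa \<equiv> X $ 1 $ 1" and "Xb \<equiv> X $ 3 $ 3" and "Xc \<equiv> X $ 1 $ 2"
    and "Xd \<equiv> X $ 2 $ 3" and "Xe \<equiv> X $ 1 $ 3"
  shows "w0 y F = 0" "wf1 y F = 0" "wf2 y F = 0" "ph y F = - (Xa - Xb)"
    "ext_deriv YA w0 y F v = (Xa - Xb) * w0 y v"
    "ext_deriv YA wf1 y F v = - 2 * Xd * w0 y v + (2 * Xa + Xb) * wf1 y v"
    "ext_deriv YA wf2 y F v = Xc * w0 y v - (Xa + 2 * Xb) * wf2 y v"
    "ext_deriv YA ph y F v = 4 * Xe * w0 y v + Xc * wf1 y v + 2 * Xd * wf2 y v"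
proof -
  obtain c U \<theta> \<alpha>1 \<alpha>2 \<beta> where B: "Bdata c U \<theta> \<alpha>1 \<alpha>2 \<beta>" and yY: "y \<in> fst (SY c U \<theta> \<alpha>1 \<alpha>2 \<beta>)"
    using Y_special_chart[OF y] .
  let ?Y = "SY c U \<theta> \<alpha>1 \<alpha>2 \<beta>"
  note Yd = sect_Ydata[OF B] and E = BdataD(1)[OF B]
  note Yc = Ychart_in[OF Yd]
  obtain x l a v1 v2 s where q: "x \<in> U" "l \<noteq> 0" "a \<noteq> 0" "snd ?Y y = ((snd c x, l), a, v1, v2, s)"
    using SY_cases[OF B yY] by metis
  define L where "L = l * (Xa - Xb)"
  define a' where "a' = a * (Xa + 2 * Xb)"
  define v1' where "v1' = - 2 * Xd + v1 * (Xa + 2 * Xb)"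
  define v2' where "v2' = Xc - v2 * (2 * Xa + Xb)"
  define s' where "s' = 4 * Xe + Xc * v1 + 2 * Xd * v2 - s * (Xa - Xb)"
  let ?V = "((0, L), a', v1', v2', s')"
  have F: "F = from_chart YA ?Y y ?V"
    unfolding F_def fund_field_coord[OF B yY] q(4) vert_def Xa_def Xb_def Xc_def Xd_def Xe_def
      L_def a'_def v1'_def v2'_def s'_def by simp
  let ?q = "((snd c x, l), a, v1, v2, s)"
  have at: "\<alpha> y (from_chart YA ?Y y e) = form_comp YA \<alpha> ?Y e ?q" for \<alpha> e
    using form_comp_at[OF Y_atlas_smooth Yc yY, of \<alpha> e] q(4) by simp
  show "w0 y F = 0" "wf1 y F = 0" "wf2 y F = 0" "ph y F = - (Xa - Xb)"
    unfolding F at special_comp_vert[OF B q(1-3)] using q(2) by (simp_all add: L_def)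
  obtain u m t where e: "v = from_chart YA ?Y y ((u, m), t)"
    using from_to_chart[OF Y_atlas_smooth Yc yY, of v] by (metis prod.collapse)
  let ?S = "snd ?Y ` (YS \<inter> fst ?Y)"
  have S: "open ?S" "?q \<in> ?S" using is_openD[OF Y_open Yc] y yY q(4) by (simp, metis IntI imageI)
  have rd: "\<exists>x' l' a' v1' v2' s'. x' \<in> U \<and> l' \<noteq> 0 \<and> a' \<noteq> 0 \<and> r = ((snd c x', l'), a', v1', v2', s')" if r: "r \<in> ?S" for r
  proof -
    obtain y' where "y' \<in> fst ?Y" "r = snd ?Y y'" using r by blast
    then show ?thesis using SY_cases[OF B, of y'] by metis
  qed
  have zero: "fd (form_comp YA \<alpha> ?Y ?V) ?q e = 0" if "\<And>r. r \<in> ?S \<Longrightarrow> form_comp YA \<alpha> ?Y ?V r = 0" for \<alpha> e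
  proof -
    have "fd (form_comp YA \<alpha> ?Y ?V) ?q = fd (\<lambda>r. 0) ?q" by (rule fd_cong[OF S that])
    then show ?thesis by simp
  qed
  \<comment> \<open>The vector extended with constant components is vertical throughout the chart,
    so these three forms vanish on it identically; only \<phi> keeps a varying value, coming from
    -dl/l.\<close>
  have z: "fd (form_comp YA w0 ?Y ?V) ?q e = 0" "fd (form_comp YA wf1 ?Y ?V) ?q e = 0" "fd (form_comp YA wf2 ?Y ?V) ?q e = 0" for e
    by (rule zero, drule rd, elim exE conjE, simp add: special_comp_vert[OF B])+
  have zp: "fd (form_comp YA ph ?Y ?V) ?q ((u, m), t) = L * m / l\<^sup>2"
  proof -
    have "fd (form_comp YA ph ?Y ?V) ?q = fd (\<lambda>r. - (L / snd (fst r))) ?q"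
    proof (rule fd_cong[OF S])
      fix r assume "r \<in> ?S"
      then obtain x' l' a' v1' v2' s' where "x' \<in> U" "l' \<noteq> 0" "a' \<noteq> 0" "r = ((snd c x', l'), a', v1', v2', s')" using rd by blast
      then show "form_comp YA ph ?Y ?V r = - (L / snd (fst r))" using special_comp_vert(4)[OF B] by simp
    qed
    moreover have "((\<lambda>r :: Ymod. - (L / snd (fst r))) has_derivative (\<lambda>h. L * snd (fst h) / l\<^sup>2)) (at ?q)"
      using q(2) by (auto intro!: derivative_eq_intros simp: field_simps power2_eq_square)
    ultimately show ?thesis by (simp add: fd_eqI)
  qed
  note ed = ext_deriv_from_chart[OF Y_atlas_smooth _ Y_open y Yc yY, unfolded q(4)]
  note A1 = ed[OF Y_forms_smooth(1), of ?V "((u, m), t)"] and A2 = ed[OF Y_forms_smooth(2), of ?V "((u, m), t)"]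
    and A3 = ed[OF Y_forms_smooth(3), of ?V "((u, m), t)"] and A4 = ed[OF Y_forms_smooth(4), of ?V "((u, m), t)"]
  show "ext_deriv YA w0 y F v = (Xa - Xb) * w0 y v"
    unfolding e F A1 at z special_fd_vert[OF B q(1-3)] special_comp[OF B q(1-3)] by (simp add: L_def)
  show "ext_deriv YA wf1 y F v = - 2 * Xd * w0 y v + (2 * Xa + Xb) * wf1 y v"
    unfolding e F A2 at z special_fd_vert[OF B q(1-3)] special_comp[OF B q(1-3)]
    by (simp add: L_def a'_def v1'_def algebra_simps)
  show "ext_deriv YA wf2 y F v = Xc * w0 y v - (Xa + 2 * Xb) * wf2 y v"
    unfolding e F A3 at z special_fd_vert[OF B q(1-3)] special_comp[OF B q(1-3)]
    using q(2,3) by (simp add: L_def a'_def v2'_def field_simps power2_eq_square)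
  show "ext_deriv YA ph y F v = 4 * Xe * w0 y v + Xc * wf1 y v + 2 * Xd * wf2 y v"
    unfolding e F A4 at zp special_fd_vert[OF B q(1-3)] special_comp[OF B q(1-3)]
    using q(2,3) by (simp add: L_def a'_def v1'_def v2'_def s'_def field_simps power2_eq_square)
qed

lemma fund_field_zero: "y \<in> YS \<Longrightarrow> fund_field A T1 T2 0 y = 0"
proof -
  assume "y \<in> YS"
  then obtain c U \<theta> \<alpha>1 \<alpha>2 \<beta> where B: "Bdata c U \<theta> \<alpha>1 \<alpha>2 \<beta>" "y \<in> fst (SY c U \<theta> \<alpha>1 \<alpha>2 \<beta>)" by (rule Y_special_chart)
  show ?thesis
    unfolding fund_field_coord[OF B] vert_def case_prod_unfold
    using linear_0[OF from_chart_linear[OF Y_atlas_smooth Ychart_in[OF sect_Ydata[OF B(1)]] B(2)]]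
    by (simp add: zero_prod_def)
qed

text \<open>Such a vector lies in the complexified contact plane, so it splits into parts along T1
  and T2, and each leg detects the part on which it does not vanish.\<close>

lemma adapted_kernel:
  assumes "(x, \<theta>) \<in> ES" "adapted x \<alpha>1 \<alpha>2" "\<theta> u = 0" "\<alpha>1 u = 0" "\<alpha>2 u = 0"
  shows "u = 0"
proof -
  note D = adaptedD[OF assms(2)]
  have "cx_vec u \<in> plane_sum (T1 x) (T2 x)"
    unfolding E_setD(3)[OF assms(1), symmetric] cx_ker_def using assms(3) E_setD(2)[OF assms(1)] by simp
  then obtain z1 z2 where z: "cx_vec u = z1 + z2" "z1 \<in> T1 x" "z2 \<in> T2 x" unfolding plane_sum_def by blast
  have "cx_covec \<alpha>1 (cx_vec u) = 0" "cx_covec \<alpha>2 (cx_vec u) = 0" using assms(4,5) D(1,2) by simp_all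
  then have "cx_covec \<alpha>1 z1 = 0" "cx_covec \<alpha>2 z2 = 0"
    unfolding z(1) using D(1,2,4,5) z(2,3) by (simp_all add: cx_covec_add)
  then have "z1 = 0" "z2 = 0" using D(3,6) z(2,3) by blast+
  then have "cx_vec u = 0" using z(1) by simp
  then show ?thesis by (simp add: cx_vec_def vec_eq_iff)
qed

lemma vertical_fund_field:
  assumes y: "y \<in> YS" and v: "w0 y v = 0" "wf1 y v = 0" "wf2 y v = 0"
  obtains X where "X \<in> borel_lie" "v = fund_field A T1 T2 X y"
proof -
  obtain c U \<theta> \<alpha>1 \<alpha>2 \<beta> where B: "Bdata c U \<theta> \<alpha>1 \<alpha>2 \<beta>" and yY: "y \<in> fst (SY c U \<theta> \<alpha>1 \<alpha>2 \<beta>)"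
    using Y_special_chart[OF y] .
  let ?Y = "SY c U \<theta> \<alpha>1 \<alpha>2 \<beta>"
  note Yd = sect_Ydata[OF B] and E = BdataD(1)[OF B]
  note Yc = Ychart_in[OF Yd] and D = EdataD[OF E]
  obtain x l a v1 v2 s where q: "x \<in> U" "l \<noteq> 0" "a \<noteq> 0" "snd ?Y y = ((snd c x, l), a, v1, v2, s)"
    using SY_cases[OF B yY] by metis
  obtain u m a' v1' v2' s' where e: "v = from_chart YA ?Y y ((u, m), a', v1', v2', s')"
    using from_to_chart[OF Y_atlas_smooth Yc yY, of v] by (metis prod.collapse)
  have at: "\<alpha> y (from_chart YA ?Y y e) = form_comp YA \<alpha> ?Y e ((snd c x, l), a, v1, v2, s)" for \<alpha> e
    using form_comp_at[OF Y_atlas_smooth Yc yY, of \<alpha> e] q(4) by simp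
  have xc: "x \<in> fst c" using D(3) q(1) by blast
  have "form_comp A \<theta> c u (snd c x) = 0" "form_comp A \<alpha>1 c u (snd c x) = 0" "form_comp A \<alpha>2 c u (snd c x) = 0"
    using v q(2,3) unfolding e at special_comp[OF B q(1-3)] by auto
  then have "from_chart A c x u = 0"
    by (intro adapted_kernel[OF D(5)[OF q(1)] BdataD(5)[OF B q(1)]]) (simp_all add: form_comp_at[OF smA D(1) xc])
  then have "u = 0"
    using to_from_chart[OF smA D(1) xc, of u] linear_0[OF to_chart_linear[OF smA D(1) xc]] by simp
  \<comment> \<open>Solves m / l = Xa - Xb and a' / a = Xa + 2 Xb, the l- and a-components of
    \<open>vert\<close>; the remaining entries follow from its other components one at a
    time.\<close>
  define Xb where "Xb = (a' / a - m / l) / 3"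
  define Xa where "Xa = Xb + m / l"
  define Xd where "Xd = (v1 * (Xa + 2 * Xb) - v1') / 2"
  define Xc where "Xc = v2' + v2 * (2 * Xa + Xb)"
  define Xe where "Xe = (s' - Xc * v1 - 2 * Xd * v2 + s * (Xa - Xb)) / 4"
  define X :: "complex ^ 3 ^ 3" where "X = vector [vector [Xa, Xc, Xe], vector [0, - Xa - Xb, Xd], vector [0, 0, Xb]]"
  have X: "X $ 1 $ 1 = Xa" "X $ 1 $ 2 = Xc" "X $ 1 $ 3 = Xe" "X $ 2 $ 1 = 0" "X $ 2 $ 2 = - Xa - Xb" "X $ 2 $ 3 = Xd"
    "X $ 3 $ 1 = 0" "X $ 3 $ 2 = 0" "X $ 3 $ 3 = Xb" by (simp_all add: X_def)
  have "X \<in> borel_lie" by (simp add: borel_lie_def trace_def sum_3 X)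
  moreover have "v = fund_field A T1 T2 X y"
  proof -
    have "m = l * (Xa - Xb)" using q(2) by (simp add: Xa_def)
    moreover have "3 * Xb = a' / a - m / l"
      unfolding Xb_def times_divide_eq_right by (rule nonzero_mult_div_cancel_left) simp
    then have "Xa + 2 * Xb = a' / a" by (simp add: Xa_def algebra_simps)
    then have "a' = a * (Xa + 2 * Xb)" using q(3) by simp
    moreover have "2 * Xd = v1 * (Xa + 2 * Xb) - v1'"
      unfolding Xd_def times_divide_eq_right by (rule nonzero_mult_div_cancel_left) simp
    then have "v1' = - 2 * Xd + v1 * (Xa + 2 * Xb)" by simp
    moreover have "v2' = Xc - v2 * (2 * Xa + Xb)" by (simp add: Xc_def)
    moreover have "4 * Xe = s' - Xc * v1 - 2 * Xd * v2 + s * (Xa - Xb)"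
      unfolding Xe_def times_divide_eq_right by (rule nonzero_mult_div_cancel_left) simp
    then have "s' = 4 * Xe + Xc * v1 + 2 * Xd * v2 - s * (Xa - Xb)" by simp
    ultimately show ?thesis
      unfolding e fund_field_coord[OF B yY] q(4) vert_def split X \<open>u = 0\<close> by simp
  qed
  ultimately show thesis by (rule that)
qed

end

section \<open>Uniqueness of the canonical forms\<close>

context flag_manifold
begin

text \<open>Stated at one point and with numbers in place of the functions \<open>Q\<^sup>1\<close>
  and \<open>Q\<^sup>2\<close>, so that solutions with different values can be compared. The
  equation for d\<omega> contains none of the four unknown forms and is carried separately.\<close>

definition canonical_eqs where
  "canonical_eqs o1 f1 f2 s Q1 Q2 y u v \<longleftrightarrow>
     ext_deriv YA wf1 y u v = 1/2 * (wf1 y \<and>\<^sub>f ph y) u v + (wf1 y \<and>\<^sub>f o1 y) u v + (w0 y \<and>\<^sub>f f1 y) u v \<and>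
     ext_deriv YA wf2 y u v = 1/2 * (wf2 y \<and>\<^sub>f ph y) u v - (wf2 y \<and>\<^sub>f o1 y) u v + (w0 y \<and>\<^sub>f f2 y) u v \<and>
     ext_deriv YA ph y u v = (wf1 y \<and>\<^sub>f f2 y) u v - (wf2 y \<and>\<^sub>f f1 y) u v + (w0 y \<and>\<^sub>f s y) u v \<and>
     ext_deriv YA o1 y u v = 3/2 * (wf2 y \<and>\<^sub>f f1 y) u v + 3/2 * (wf1 y \<and>\<^sub>f f2 y) u v \<and>
     ext_deriv YA f1 y u v = (f1 y \<and>\<^sub>f o1 y) u v + 1/2 * (wf1 y \<and>\<^sub>f s y) u v + 1/2 * (ph y \<and>\<^sub>f f1 y) u v
       + Q1 * (w0 y \<and>\<^sub>f wf2 y) u v \<and>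
     ext_deriv YA f2 y u v = - (f2 y \<and>\<^sub>f o1 y) u v + 1/2 * (wf2 y \<and>\<^sub>f s y) u v + 1/2 * (ph y \<and>\<^sub>f f2 y) u v
       + Q2 * (w0 y \<and>\<^sub>f wf1 y) u v"

definition smooth_forms4 where
  "smooth_forms4 o1 f1 f2 s \<longleftrightarrow> smooth_form YA YS o1 \<and> smooth_form YA YS f1 \<and> smooth_form YA YS f2 \<and> smooth_form YA YS s"

lemma canonical_formsD:
  assumes "canonical_forms A T1 T2 o1 f1 f2 s"
  shows "smooth_forms4 o1 f1 f2 s"
    and "\<exists>Q1 Q2. \<forall>y\<in>YS. \<forall>u v. ext_deriv YA w0 y u v = (w0 y \<and>\<^sub>f ph y) u v + (wf1 y \<and>\<^sub>f wf2 y) u v \<and>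
       canonical_eqs o1 f1 f2 s (Q1 y) (Q2 y) y u v"
proof -
  show "smooth_forms4 o1 f1 f2 s" using assms by (simp add: canonical_forms_def smooth_forms4_def)
  obtain Q1 Q2 where Q: "\<forall>y\<in>YS. \<forall>u v.
        ext_deriv YA w0 y u v = (w0 y \<and>\<^sub>f ph y) u v + (wf1 y \<and>\<^sub>f wf2 y) u v \<and>
        ext_deriv YA wf1 y u v =
          1/2 * (wf1 y \<and>\<^sub>f ph y) u v + (wf1 y \<and>\<^sub>f o1 y) u v + (w0 y \<and>\<^sub>f f1 y) u v \<and>
        ext_deriv YA wf2 y u v =
          1/2 * (wf2 y \<and>\<^sub>f ph y) u v - (wf2 y \<and>\<^sub>f o1 y) u v + (w0 y \<and>\<^sub>f f2 y) u v \<and>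
        ext_deriv YA ph y u v =
          (wf1 y \<and>\<^sub>f f2 y) u v - (wf2 y \<and>\<^sub>f f1 y) u v + (w0 y \<and>\<^sub>f s y) u v \<and>
        ext_deriv YA o1 y u v =
          3/2 * (wf2 y \<and>\<^sub>f f1 y) u v + 3/2 * (wf1 y \<and>\<^sub>f f2 y) u v \<and>
        ext_deriv YA f1 y u v - (f1 y \<and>\<^sub>f o1 y) u v
          - 1/2 * (wf1 y \<and>\<^sub>f s y) u v - 1/2 * (ph y \<and>\<^sub>f f1 y) u v
          = Q1 y * (w0 y \<and>\<^sub>f wf2 y) u v \<and>
        ext_deriv YA f2 y u v + (f2 y \<and>\<^sub>f o1 y) u v
          - 1/2 * (wf2 y \<and>\<^sub>f s y) u v - 1/2 * (ph y \<and>\<^sub>f f2 y) u v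
          = Q2 y * (w0 y \<and>\<^sub>f wf1 y) u v"
    using assms unfolding canonical_forms_def by (elim conjE exE) (rule that)
  have "ext_deriv YA w0 y u v = (w0 y \<and>\<^sub>f ph y) u v + (wf1 y \<and>\<^sub>f wf2 y) u v \<and>
       canonical_eqs o1 f1 f2 s (Q1 y) (Q2 y) y u v" if "y \<in> YS" for y u v
  proof -
    have *: "x - a - b - c = d \<Longrightarrow> x = a + b + c + d" "x + a - b - c = d \<Longrightarrow> x = - a + b + c + d" for x a b c d :: complex
      by (auto simp: algebra_simps)
    show ?thesis
      using Q[rule_format, OF that, of u v] unfolding canonical_eqs_def by (elim conjE) (intro conjI *; assumption)
  qed
  then show "\<exists>Q1 Q2. \<forall>y\<in>YS. \<forall>u v. ext_deriv YA w0 y u v = (w0 y \<and>\<^sub>f ph y) u v + (wf1 y \<and>\<^sub>f wf2 y) u v \<and>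
       canonical_eqs o1 f1 f2 s (Q1 y) (Q2 y) y u v"
    by (intro exI[of _ Q1] exI[of _ Q2]) blast
qed

lemma canonical_eqs_unique:
  assumes sm: "smooth_forms4 o1 f1 f2 s" "smooth_forms4 o1' f1' f2' s'"
    and d0: "\<And>y u v. y \<in> YS \<Longrightarrow> ext_deriv YA w0 y u v = (w0 y \<and>\<^sub>f ph y) u v + (wf1 y \<and>\<^sub>f wf2 y) u v"
    and C: "\<And>y u v. y \<in> YS \<Longrightarrow> canonical_eqs o1 f1 f2 s (Q1 y) (Q2 y) y u v"
    and C': "\<And>y u v. y \<in> YS \<Longrightarrow> canonical_eqs o1' f1' f2' s' (Q1' y) (Q2' y) y u v"
    and y: "y \<in> YS"
  shows "o1' y v = o1 y v" "f1' y v = f1 y v" "f2' y v = f2 y v" "s' y v = s y v"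
proof -
  define a b1 b2 g where "a = (\<lambda>y v. 1 * o1' y v + (- 1) * o1 y v)" and "b1 = (\<lambda>y v. 1 * f1' y v + (- 1) * f1 y v)"
    and "b2 = (\<lambda>y v. 1 * f2' y v + (- 1) * f2 y v)" and "g = (\<lambda>y v. 1 * s' y v + (- 1) * s y v)"
  note S = sm[unfolded smooth_forms4_def]
  note lc = linear_comb2[OF Y_atlas_smooth Y_open]
  have sa: "smooth_form YA YS a" unfolding a_def using S by (intro lc(1)) auto
  have da: "ext_deriv YA a y u v = ext_deriv YA o1' y u v - ext_deriv YA o1 y u v" if "y \<in> YS" for y u v
    unfolding a_def using S that by (subst lc(2)) auto
  have "\<exists>k z x t. (\<forall>v. a y v = k * w0 y v) \<and> (\<forall>v. b1 y v = k * wf1 y v + z * w0 y v) \<and>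
     (\<forall>v. b2 y v = - (k * wf2 y v) + x * w0 y v) \<and> (\<forall>v. g y v = x * wf1 y v - z * wf2 y v + t * w0 y v)"
    if y: "y \<in> YS" for y
  proof -
    note e = C[OF y, unfolded canonical_eqs_def wedge_def] C'[OF y, unfolded canonical_eqs_def wedge_def]
    have E1: "wf1 y u * a y v - wf1 y v * a y u + (w0 y u * b1 y v - w0 y v * b1 y u) = 0" for u v
    proof -
      have "1/2 * (wf1 y u * ph y v - wf1 y v * ph y u) + (wf1 y u * o1 y v - wf1 y v * o1 y u) + (w0 y u * f1 y v - w0 y v * f1 y u)
        = 1/2 * (wf1 y u * ph y v - wf1 y v * ph y u) + (wf1 y u * o1' y v - wf1 y v * o1' y u) + (w0 y u * f1' y v - w0 y v * f1' y u)"
        using e(1)[of u v] e(2)[of u v] by (metis (no_types))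
      then show ?thesis by (simp add: a_def b1_def algebra_simps)
    qed
    have E2: "- (wf2 y u * a y v - wf2 y v * a y u) + (w0 y u * b2 y v - w0 y v * b2 y u) = 0" for u v
    proof -
      have "1/2 * (wf2 y u * ph y v - wf2 y v * ph y u) - (wf2 y u * o1 y v - wf2 y v * o1 y u) + (w0 y u * f2 y v - w0 y v * f2 y u)
        = 1/2 * (wf2 y u * ph y v - wf2 y v * ph y u) - (wf2 y u * o1' y v - wf2 y v * o1' y u) + (w0 y u * f2' y v - w0 y v * f2' y u)"
        using e(1)[of u v] e(2)[of u v] by (metis (no_types))
      then show ?thesis by (simp add: a_def b2_def algebra_simps)
    qed
    have E3: "wf1 y u * b2 y v - wf1 y v * b2 y u - (wf2 y u * b1 y v - wf2 y v * b1 y u) + (w0 y u * g y v - w0 y v * g y u) = 0" for u v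
    proof -
      have "(wf1 y u * f2 y v - wf1 y v * f2 y u) - (wf2 y u * f1 y v - wf2 y v * f1 y u) + (w0 y u * s y v - w0 y v * s y u)
        = (wf1 y u * f2' y v - wf1 y v * f2' y u) - (wf2 y u * f1' y v - wf2 y v * f1' y u) + (w0 y u * s' y v - w0 y v * s' y u)"
        using e(1)[of u v] e(2)[of u v] by (metis (no_types))
      then show ?thesis by (simp add: b1_def b2_def g_def algebra_simps)
    qed
    obtain k z x t where "\<And>v. a y v = k * w0 y v" "\<And>v. b1 y v = k * wf1 y v + z * w0 y v" "\<And>v. b2 y v = - (k * wf2 y v) + x * w0 y v"
      "\<And>v. g y v = x * wf1 y v - z * wf2 y v + t * w0 y v"
      by (rule cartan_lemma[OF Y_forms_indep[OF y] E1 E2 E3]) (rule that)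
    then show ?thesis by blast
  qed
  then obtain k z x t where K: "\<And>y v. y \<in> YS \<Longrightarrow> a y v = k y * w0 y v" "\<And>y v. y \<in> YS \<Longrightarrow> b1 y v = k y * wf1 y v + z y * w0 y v"
    "\<And>y v. y \<in> YS \<Longrightarrow> b2 y v = - (k y * wf2 y v) + x y * w0 y v"
    "\<And>y v. y \<in> YS \<Longrightarrow> g y v = x y * wf1 y v - z y * wf2 y v + t y * w0 y v" by metis
  have da': "ext_deriv YA a y u v = 3/2 * (wf2 y u * b1 y v - wf2 y v * b1 y u) + 3/2 * (wf1 y u * b2 y v - wf1 y v * b2 y u)"
    if y: "y \<in> YS" for y u v
    unfolding da[OF y] C[OF y, unfolded canonical_eqs_def, THEN conjunct2, THEN conjunct2, THEN conjunct2, THEN conjunct1]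
      C'[OF y, unfolded canonical_eqs_def, THEN conjunct2, THEN conjunct2, THEN conjunct2, THEN conjunct1]
    by (simp add: wedge_def b1_def b2_def field_simps)
  \<comment> \<open>The functions k, z, x, t are chosen point by point, so the differential of a = k
    \<omega> is taken through \<open>ext_deriv_multiple\<close>. In its \<omega>1 \<and> \<omega>2
    coefficient, k d\<omega> contributes k, while the right-hand side 3/2 (\<omega>2 \<and> b1 +
    \<omega>1 \<and> b2) contributes -3k.\<close>
  have k0: "k y = 0" if y: "y \<in> YS" for y
  proof -
    obtain p0 q0 p1 q1 p2 q2 where
      E: "cx_eval (w0 y) p1 q1 = 0" "cx_eval (wf1 y) p1 q1 = 1" "cx_eval (wf2 y) p1 q1 = 0"
      "cx_eval (w0 y) p2 q2 = 0" "cx_eval (wf1 y) p2 q2 = 0" "cx_eval (wf2 y) p2 q2 = 1"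
      using Y_forms_indep[OF y] unfolding coframe_indep_def by blast
    obtain u0 where "w0 y u0 \<noteq> 0" using coframe_indep_nonzero(1)[OF Y_forms_indep[OF y]] by blast
    then obtain D where D: "\<And>u v. ext_deriv YA a y u v = D u * w0 y v - D v * w0 y u + k y * ext_deriv YA w0 y u v"
      using ext_deriv_multiple[OF Y_atlas_smooth Y_open y sa Y_forms_smooth(1) K(1)] by metis
    have eq: "D u * w0 y v - D v * w0 y u + k y * (w0 y u * ph y v - w0 y v * ph y u + (wf1 y u * wf2 y v - wf1 y v * wf2 y u))
      = 3/2 * (wf2 y u * (k y * wf1 y v + z y * w0 y v) - wf2 y v * (k y * wf1 y u + z y * w0 y u))
       + 3/2 * (wf1 y u * (- (k y * wf2 y v) + x y * w0 y v) - wf1 y v * (- (k y * wf2 y u) + x y * w0 y u))" for u v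
      using da'[OF y, of u v] unfolding D d0[OF y] wedge_def K(2,3)[OF y] by simp
    have "cx_eval (\<lambda>u. cx_eval (\<lambda>v. D u * w0 y v - D v * w0 y u + k y * (w0 y u * ph y v - w0 y v * ph y u + (wf1 y u * wf2 y v - wf1 y v * wf2 y u))) p2 q2) p1 q1
      = cx_eval (\<lambda>u. cx_eval (\<lambda>v. 3/2 * (wf2 y u * (k y * wf1 y v + z y * w0 y v) - wf2 y v * (k y * wf1 y u + z y * w0 y u))
       + 3/2 * (wf1 y u * (- (k y * wf2 y v) + x y * w0 y v) - wf1 y v * (- (k y * wf2 y u) + x y * w0 y u))) p2 q2) p1 q1"
      by (simp only: eq)
    then show ?thesis by (simp add: cx_eval_simps E)
  qed
  have a0: "a y v = 0" if "y \<in> YS" for y v using K(1)[OF that] k0[OF that] by simp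
  have "ext_deriv YA a y u v = 0" if y: "y \<in> YS" for y u v
    using ext_deriv_cong[OF Y_atlas_smooth Y_open y, of a "\<lambda>q v. 0" u v] a0 ext_deriv_zero[of YA] by auto
  \<comment> \<open>With k = 0 the form a vanishes on all of Y, hence so does its differential, and
    its equation reduces to z \<omega>2 \<and> \<omega> + x \<omega>1 \<and> \<omega> = 0.\<close>
  then have zx: "z y = 0 \<and> x y = 0" if y: "y \<in> YS" for y
  proof -
    obtain p0 q0 p1 q1 p2 q2 where
      E: "cx_eval (w0 y) p0 q0 = 1" "cx_eval (wf1 y) p0 q0 = 0" "cx_eval (wf2 y) p0 q0 = 0"
      "cx_eval (w0 y) p1 q1 = 0" "cx_eval (wf1 y) p1 q1 = 1" "cx_eval (wf2 y) p1 q1 = 0"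
      "cx_eval (w0 y) p2 q2 = 0" "cx_eval (wf1 y) p2 q2 = 0" "cx_eval (wf2 y) p2 q2 = 1"
      using Y_forms_indep[OF y] unfolding coframe_indep_def by blast
    have eq: "3/2 * (wf2 y u * (z y * w0 y v) - wf2 y v * (z y * w0 y u))
       + 3/2 * (wf1 y u * (x y * w0 y v) - wf1 y v * (x y * w0 y u)) = 0" for u v
      using da'[OF y, of u v] \<open>\<And>y u v. y \<in> YS \<Longrightarrow> ext_deriv YA a y u v = 0\<close>[OF y] unfolding K(2,3)[OF y] k0[OF y] by simp
    have ev: "cx_eval (\<lambda>u. cx_eval (\<lambda>v. 3/2 * (wf2 y u * (z y * w0 y v) - wf2 y v * (z y * w0 y u))
       + 3/2 * (wf1 y u * (x y * w0 y v) - wf1 y v * (x y * w0 y u))) p q) p' q' = 0" for p q p' q'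
      by (simp only: eq cx_eval_simps)
    show ?thesis using ev[of p0 q0 p1 q1] ev[of p0 q0 p2 q2] by (simp add: cx_eval_simps E)
  qed
  have b0: "b1 y v = 0" "b2 y v = 0" if "y \<in> YS" for y v
    using K(2,3)[OF that] k0[OF that] zx[OF that] by simp_all
  have df: "ext_deriv YA f1' y u v = ext_deriv YA f1 y u v" for u v
    by (rule ext_deriv_cong[OF Y_atlas_smooth Y_open y]) (use b0(1) in \<open>simp add: b1_def\<close>)
  have same: "o1' y v = o1 y v" "f1' y v = f1 y v" "f2' y v = f2 y v" for v
    using a0[OF y, of v] b0[OF y, of v] by (simp_all add: a_def b1_def b2_def)
  have gy: "s' y v = s y v + t y * w0 y v" for v
    using K(4)[OF y, of v] zx[OF y] by (simp add: g_def algebra_simps)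
  \<comment> \<open>Both solutions now share \<phi>1, so their two expressions for its differential
    agree. The unknown difference of the Q1 multiplies \<omega> \<and> \<omega>2 only, and the
    \<omega>1 \<and> \<omega> coefficient isolates t.\<close>
  have "t y = 0"
  proof -
    obtain p0 q0 p1 q1 where
      E: "cx_eval (w0 y) p0 q0 = 1" "cx_eval (wf1 y) p0 q0 = 0" "cx_eval (wf2 y) p0 q0 = 0"
      "cx_eval (w0 y) p1 q1 = 0" "cx_eval (wf1 y) p1 q1 = 1" "cx_eval (wf2 y) p1 q1 = 0"
      using Y_forms_indep[OF y] unfolding coframe_indep_def by blast
    have eq: "1/2 * (wf1 y u * (t y * w0 y v) - wf1 y v * (t y * w0 y u)) + (Q1' y - Q1 y) * (w0 y u * wf2 y v - w0 y v * wf2 y u) = 0" for u v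
      using trans[OF C'[OF y, of u v, unfolded canonical_eqs_def, THEN conjunct2, THEN conjunct2, THEN conjunct2, THEN conjunct2, THEN conjunct1, symmetric]
        trans[OF df C[OF y, of u v, unfolded canonical_eqs_def, THEN conjunct2, THEN conjunct2, THEN conjunct2, THEN conjunct2, THEN conjunct1]]]
      by (simp add: wedge_def same gy field_simps) algebra
    have "cx_eval (\<lambda>u. cx_eval (\<lambda>v. 1/2 * (wf1 y u * (t y * w0 y v) - wf1 y v * (t y * w0 y u))
        + (Q1' y - Q1 y) * (w0 y u * wf2 y v - w0 y v * wf2 y u)) p0 q0) p1 q1 = 0"
      by (simp only: eq cx_eval_simps)
    then show ?thesis by (simp add: cx_eval_simps E)
  qed
  then show "o1' y v = o1 y v" "f1' y v = f1 y v" "f2' y v = f2 y v" "s' y v = s y v"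
    using same gy by simp_all
qed

section \<open>The connection\<close>

definition conn where
  "conn o1 f1 f2 s y v = (let \<omega> = w0 y v; \<omega>1 = wf1 y v; \<omega>2 = wf2 y v; \<phi> = ph y v in
       vector
        [vector [- (1/2) * \<phi> - 1/3 * o1 y v, - f2 y v,          - (1/4) * s y v],
         vector [\<omega>1,                            2/3 * o1 y v,    1/2 * f1 y v],
         vector [2 * \<omega>,                         2 * \<omega>2,           1/2 * \<phi> - 1/3 * o1 y v]] :: complex ^ 3 ^ 3)"

lemma conn_entries:
  "conn o1 f1 f2 s y v $ 1 $ 1 = - (1/2) * ph y v + - (1/3) * o1 y v"
  "conn o1 f1 f2 s y v $ 1 $ 2 = - 1 * f2 y v"
  "conn o1 f1 f2 s y v $ 1 $ 3 = - (1/4) * s y v"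
  "conn o1 f1 f2 s y v $ 2 $ 1 = 1 * wf1 y v"
  "conn o1 f1 f2 s y v $ 2 $ 2 = 2/3 * o1 y v"
  "conn o1 f1 f2 s y v $ 2 $ 3 = 1/2 * f1 y v"
  "conn o1 f1 f2 s y v $ 3 $ 1 = 2 * w0 y v"
  "conn o1 f1 f2 s y v $ 3 $ 2 = 2 * wf2 y v"
  "conn o1 f1 f2 s y v $ 3 $ 3 = 1/2 * ph y v + - (1/3) * o1 y v"
  by (simp_all add: conn_def Let_def)

abbreviation "conn_form o1 f1 f2 s i j \<equiv> \<lambda>y v. conn o1 f1 f2 s y v $ i $ j"

lemma conn_smooth:
  assumes "smooth_forms4 o1 f1 f2 s"
  shows "smooth_form YA YS (conn_form o1 f1 f2 s i j)"
proof -
  note S = assms[unfolded smooth_forms4_def] and F = Y_forms_smooth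
  note l1 = linear_cmult1(1)[OF Y_atlas_smooth Y_open] and l2 = linear_comb2(1)[OF Y_atlas_smooth Y_open]
  have "\<forall>i j. smooth_form YA YS (conn_form o1 f1 f2 s i j)"
    unfolding forall_3 conn_entries using S F by (intro conjI l1 l2) simp_all
  then show ?thesis by blast
qed

lemma conn_linear:
  assumes "smooth_forms4 o1 f1 f2 s" "y \<in> YS"
  shows "linear (conn o1 f1 f2 s y)"
proof -
  have "linear (\<lambda>v. conn o1 f1 f2 s y v $ i $ j)" for i j
    by (rule smooth_formD(1)[OF conn_smooth[OF assms(1)] assms(2)])
  then show ?thesis by (simp add: linear_iff vec_eq_iff)
qed

text \<open>This is d\<pi> + \<pi> \<and> \<pi>: for a matrix-valued 1-form the second term,
  evaluated on u and v, is the commutator of the two values.\<close>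

definition curvature where
  "curvature o1 f1 f2 s y u v = (\<chi> i j. ext_deriv YA (conn_form o1 f1 f2 s i j) y u v)
     + (conn o1 f1 f2 s y u ** conn o1 f1 f2 s y v - conn o1 f1 f2 s y v ** conn o1 f1 f2 s y u)"

text \<open>Each structure equation is one entry of d\<pi> + \<pi> \<and> \<pi>, up to the constants
  in the matrix; the diagonal entries combine those for d\<phi> and the differential of
  \<open>\<omega>\<^sup>1\<^sub>1\<close>. The entry (1,3) would require d\<psi>.\<close>

lemma curvature_entries:
  assumes S: "smooth_forms4 o1 f1 f2 s" and y: "y \<in> YS"
    and d0: "ext_deriv YA w0 y u v = (w0 y \<and>\<^sub>f ph y) u v + (wf1 y \<and>\<^sub>f wf2 y) u v"
    and C: "canonical_eqs o1 f1 f2 s Q1 Q2 y u v"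
  defines "K \<equiv> curvature o1 f1 f2 s y u v"
  shows "K $ 1 $ 1 = 0" "K $ 2 $ 1 = 0" "K $ 2 $ 2 = 0" "K $ 3 $ 1 = 0" "K $ 3 $ 2 = 0" "K $ 3 $ 3 = 0"
    "K $ 1 $ 2 = - Q2 * (w0 y \<and>\<^sub>f wf1 y) u v" "K $ 2 $ 3 = 1/2 * Q1 * (w0 y \<and>\<^sub>f wf2 y) u v"
proof -
  note S' = S[unfolded smooth_forms4_def] and F = Y_forms_smooth
  have l1: "ext_deriv YA (\<lambda>q v. k * \<alpha> q v) y u v = k * ext_deriv YA \<alpha> y u v" if "smooth_form YA YS \<alpha>" for k \<alpha>
    using linear_cmult1(2)[OF Y_atlas_smooth Y_open that y] .
  have l2: "ext_deriv YA (\<lambda>q v. k * \<alpha> q v + l * \<beta> q v) y u v = k * ext_deriv YA \<alpha> y u v + l * ext_deriv YA \<beta> y u v"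
    if "smooth_form YA YS \<alpha>" "smooth_form YA YS \<beta>" for k l \<alpha> \<beta>
    using linear_comb2(2)[OF Y_atlas_smooth Y_open that y] .
  have D: "ext_deriv YA (conn_form o1 f1 f2 s 1 1) y u v = - (1/2) * ext_deriv YA ph y u v + - (1/3) * ext_deriv YA o1 y u v"
    "ext_deriv YA (conn_form o1 f1 f2 s 1 2) y u v = - 1 * ext_deriv YA f2 y u v"
    "ext_deriv YA (conn_form o1 f1 f2 s 2 1) y u v = 1 * ext_deriv YA wf1 y u v"
    "ext_deriv YA (conn_form o1 f1 f2 s 2 2) y u v = 2/3 * ext_deriv YA o1 y u v"
    "ext_deriv YA (conn_form o1 f1 f2 s 2 3) y u v = 1/2 * ext_deriv YA f1 y u v"
    "ext_deriv YA (conn_form o1 f1 f2 s 3 1) y u v = 2 * ext_deriv YA w0 y u v"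
    "ext_deriv YA (conn_form o1 f1 f2 s 3 2) y u v = 2 * ext_deriv YA wf2 y u v"
    "ext_deriv YA (conn_form o1 f1 f2 s 3 3) y u v = 1/2 * ext_deriv YA ph y u v + - (1/3) * ext_deriv YA o1 y u v"
    unfolding conn_entries using S' F by (intro l1 l2; simp)+
  note c = C[unfolded canonical_eqs_def]
  note e = c[THEN conjunct1] c[THEN conjunct2, THEN conjunct1] c[THEN conjunct2, THEN conjunct2, THEN conjunct1]
    c[THEN conjunct2, THEN conjunct2, THEN conjunct2, THEN conjunct1]
    c[THEN conjunct2, THEN conjunct2, THEN conjunct2, THEN conjunct2, THEN conjunct1]
    c[THEN conjunct2, THEN conjunct2, THEN conjunct2, THEN conjunct2, THEN conjunct2]
  show "K $ 1 $ 1 = 0" "K $ 2 $ 1 = 0" "K $ 2 $ 2 = 0" "K $ 3 $ 1 = 0" "K $ 3 $ 2 = 0" "K $ 3 $ 3 = 0"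
    "K $ 1 $ 2 = - Q2 * (w0 y \<and>\<^sub>f wf1 y) u v" "K $ 2 $ 3 = 1/2 * Q1 * (w0 y \<and>\<^sub>f wf2 y) u v"
    unfolding K_def curvature_def
    by (simp_all add: D e d0 matrix_matrix_mult_def sum_3) (simp_all add: conn_entries wedge_def field_simps)
qed

text \<open>The way back from curvature to structure equations, for any traceless form whose
  tautological entries are those of \<pi>. The factors 3/2, 2, -1 and -4 invert the constants with
  which the unknown forms enter \<open>conn\<close>.\<close>

lemma curvature_canonical:
  fixes P :: "'m Ypt \<Rightarrow> Ymod \<Rightarrow> complex ^ 3 ^ 3" and u v :: Ymod
  assumes sm: "\<And>i j. smooth_form YA YS (\<lambda>y v. P y v $ i $ j)"
    and taut: "\<And>y v. y \<in> YS \<Longrightarrow> P y v $ 2 $ 1 = wf1 y v" "\<And>y v. y \<in> YS \<Longrightarrow> P y v $ 3 $ 2 = 2 * wf2 y v"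
      "\<And>y v. y \<in> YS \<Longrightarrow> P y v $ 3 $ 1 = 2 * w0 y v"
      "\<And>y v. y \<in> YS \<Longrightarrow> P y v $ 3 $ 3 - P y v $ 1 $ 1 = ph y v" "\<And>y v. y \<in> YS \<Longrightarrow> trace (P y v) = 0"
    and y: "y \<in> YS"
  defines "K \<equiv> (\<chi> i j. ext_deriv YA (\<lambda>y v. P y v $ i $ j) y u v) + (P y u ** P y v - P y v ** P y u)"
  assumes K: "K $ 1 $ 1 = 0" "K $ 2 $ 1 = 0" "K $ 2 $ 2 = 0" "K $ 3 $ 2 = 0" "K $ 3 $ 3 = 0"
    "K $ 1 $ 2 = - Q2 * (w0 y \<and>\<^sub>f wf1 y) u v" "K $ 2 $ 3 = 1/2 * Q1 * (w0 y \<and>\<^sub>f wf2 y) u v"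
  shows "canonical_eqs (\<lambda>y v. 3/2 * P y v $ 2 $ 2) (\<lambda>y v. 2 * P y v $ 2 $ 3) (\<lambda>y v. - 1 * P y v $ 1 $ 2)
    (\<lambda>y v. - 4 * P y v $ 1 $ 3) Q1 Q2 y u v"
proof -
  note F = Y_forms_smooth
  have l1: "ext_deriv YA (\<lambda>q v. k * P q v $ i $ j) y u v = k * ext_deriv YA (\<lambda>q v. P q v $ i $ j) y u v" for k i j
    using linear_cmult1(2)[OF Y_atlas_smooth Y_open sm y] .
  have cg: "ext_deriv YA \<alpha> y u v = ext_deriv YA \<beta> y u v" if "\<And>q v. q \<in> YS \<Longrightarrow> \<alpha> q v = \<beta> q v" for \<alpha> \<beta>
    by (rule ext_deriv_cong[OF Y_atlas_smooth Y_open y that])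
  define E where "E i j = ext_deriv YA (\<lambda>y v. P y v $ i $ j) y u v" for i j
  have d1: "ext_deriv YA wf1 y u v = E 2 1" unfolding E_def by (rule cg) (simp add: taut)
  have "ext_deriv YA wf2 y u v = ext_deriv YA (\<lambda>y v. 1/2 * P y v $ 3 $ 2) y u v" by (rule cg) (simp add: taut)
  then have d2: "ext_deriv YA wf2 y u v = 1/2 * E 3 2" unfolding E_def l1 .
  have "ext_deriv YA ph y u v = ext_deriv YA (\<lambda>y v. 1 * P y v $ 3 $ 3 + - 1 * P y v $ 1 $ 1) y u v"
    by (rule cg) (simp add: taut(4)[symmetric])
  also have "\<dots> = 1 * E 3 3 + - 1 * E 1 1"
    unfolding E_def by (rule linear_comb2(2)[OF Y_atlas_smooth Y_open sm sm y])
  finally have d3: "ext_deriv YA ph y u v = E 3 3 - E 1 1" by simp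
  have Ke: "K $ i $ j = E i j + ((P y u ** P y v) $ i $ j - (P y v ** P y u) $ i $ j)" for i j
    by (simp add: K_def E_def)
  have E: "E i j = K $ i $ j - ((P y u ** P y v) $ i $ j - (P y v ** P y u) $ i $ j)" for i j
    by (simp add: Ke)
  have tr: "P y w $ 2 $ 2 = - P y w $ 1 $ 1 - P y w $ 3 $ 3" for w
    using taut(5)[OF y, of w] by (simp add: trace_def sum_3 add_eq_0_iff algebra_simps)
  have p3: "P y w $ 3 $ 3 = ph y w + P y w $ 1 $ 1" for w
    using taut(4)[OF y, of w] by (simp add: algebra_simps)
  have "E 2 1 = 1/2 * (wf1 y \<and>\<^sub>f ph y) u v + (wf1 y \<and>\<^sub>f (\<lambda>v. 3/2 * P y v $ 2 $ 2)) u v + (w0 y \<and>\<^sub>f (\<lambda>v. 2 * P y v $ 2 $ 3)) u v"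
    "1/2 * E 3 2 = 1/2 * (wf2 y \<and>\<^sub>f ph y) u v - (wf2 y \<and>\<^sub>f (\<lambda>v. 3/2 * P y v $ 2 $ 2)) u v + (w0 y \<and>\<^sub>f (\<lambda>v. - 1 * P y v $ 1 $ 2)) u v"
    "E 3 3 - E 1 1 = (wf1 y \<and>\<^sub>f (\<lambda>v. - 1 * P y v $ 1 $ 2)) u v - (wf2 y \<and>\<^sub>f (\<lambda>v. 2 * P y v $ 2 $ 3)) u v + (w0 y \<and>\<^sub>f (\<lambda>v. - 4 * P y v $ 1 $ 3)) u v"
    "3/2 * E 2 2 = 3/2 * (wf2 y \<and>\<^sub>f (\<lambda>v. 2 * P y v $ 2 $ 3)) u v + 3/2 * (wf1 y \<and>\<^sub>f (\<lambda>v. - 1 * P y v $ 1 $ 2)) u v"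
    "2 * E 2 3 = ((\<lambda>v. 2 * P y v $ 2 $ 3) \<and>\<^sub>f (\<lambda>v. 3/2 * P y v $ 2 $ 2)) u v + 1/2 * (wf1 y \<and>\<^sub>f (\<lambda>v. - 4 * P y v $ 1 $ 3)) u v
       + 1/2 * (ph y \<and>\<^sub>f (\<lambda>v. 2 * P y v $ 2 $ 3)) u v + Q1 * (w0 y \<and>\<^sub>f wf2 y) u v"
    "- 1 * E 1 2 = - ((\<lambda>v. - 1 * P y v $ 1 $ 2) \<and>\<^sub>f (\<lambda>v. 3/2 * P y v $ 2 $ 2)) u v + 1/2 * (wf2 y \<and>\<^sub>f (\<lambda>v. - 4 * P y v $ 1 $ 3)) u v
       + 1/2 * (ph y \<and>\<^sub>f (\<lambda>v. - 1 * P y v $ 1 $ 2)) u v + Q2 * (w0 y \<and>\<^sub>f wf1 y) u v"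
    unfolding E K wedge_def
    by (simp_all add: matrix_matrix_mult_def sum_3 taut(1-3)[OF y] tr p3) (simp_all add: field_simps)
  then show ?thesis
    unfolding canonical_eqs_def l1 E_def[symmetric] d1 d2 d3 by blast
qed

end

lemma coframe_indep_coeff:
  assumes "coframe_indep w w1 w2" "\<And>v. x * w v + y * w1 v + z * w2 v = 0"
  shows "x = 0" "y = 0" "z = 0"
proof -
  obtain p0 q0 p1 q1 p2 q2 where
    E: "cx_eval w p0 q0 = 1" "cx_eval w1 p0 q0 = 0" "cx_eval w2 p0 q0 = 0"
     "cx_eval w p1 q1 = 0" "cx_eval w1 p1 q1 = 1" "cx_eval w2 p1 q1 = 0"
     "cx_eval w p2 q2 = 0" "cx_eval w1 p2 q2 = 0" "cx_eval w2 p2 q2 = 1"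
    using assms(1) unfolding coframe_indep_def by blast
  have ev: "cx_eval (\<lambda>v. x * w v + y * w1 v + z * w2 v) p q = 0" for p q
    by (simp only: assms(2) cx_eval_simps)
  show "x = 0" "y = 0" "z = 0"
    using ev[of p0 q0] ev[of p1 q1] ev[of p2 q2] by (simp_all add: cx_eval_simps E)
qed

text \<open>The adjugate of an upper triangular matrix, an inverse when the determinant is 1. Its
  explicit entries are used to conjugate.\<close>

definition borel_inverse :: "complex ^ 3 ^ 3 \<Rightarrow> complex ^ 3 ^ 3" where
  "borel_inverse h = (let a = h $ 1 $ 1; c = h $ 1 $ 2; e = h $ 1 $ 3; m = h $ 2 $ 2; d = h $ 2 $ 3; b = h $ 3 $ 3 in
     vector [vector [m * b, - c * b, c * d - m * e], vector [0, a * b, - a * d], vector [0, 0, a * m]])"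

lemma borel_groupD:
  assumes "h \<in> borel_group"
  shows "h $ 1 $ 1 * h $ 2 $ 2 * h $ 3 $ 3 = 1" "h $ 2 $ 1 = 0" "h $ 3 $ 1 = 0" "h $ 3 $ 2 = 0"
    "h $ 1 $ 1 \<noteq> 0" "h $ 3 $ 3 \<noteq> 0" "h $ 2 $ 2 = 1 / (h $ 1 $ 1 * h $ 3 $ 3)"
proof -
  show 1: "h $ 1 $ 1 * h $ 2 $ 2 * h $ 3 $ 3 = 1" "h $ 2 $ 1 = 0" "h $ 3 $ 1 = 0" "h $ 3 $ 2 = 0"
    using assms by (auto simp: borel_group_def det_3)
  then show 2: "h $ 1 $ 1 \<noteq> 0" "h $ 3 $ 3 \<noteq> 0" by auto
  show "h $ 2 $ 2 = 1 / (h $ 1 $ 1 * h $ 3 $ 3)" using 1(1) 2 by (simp add: field_simps)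
qed

lemma borel_inverse_entries:
  "borel_inverse h $ 1 $ 1 = h $ 2 $ 2 * h $ 3 $ 3" "borel_inverse h $ 1 $ 2 = - h $ 1 $ 2 * h $ 3 $ 3"
  "borel_inverse h $ 1 $ 3 = h $ 1 $ 2 * h $ 2 $ 3 - h $ 2 $ 2 * h $ 1 $ 3"
  "borel_inverse h $ 2 $ 1 = 0" "borel_inverse h $ 2 $ 2 = h $ 1 $ 1 * h $ 3 $ 3" "borel_inverse h $ 2 $ 3 = - h $ 1 $ 1 * h $ 2 $ 3"
  "borel_inverse h $ 3 $ 1 = 0" "borel_inverse h $ 3 $ 2 = 0" "borel_inverse h $ 3 $ 3 = h $ 1 $ 1 * h $ 2 $ 2"
  by (simp_all add: borel_inverse_def Let_def)

lemma borel_inverse: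
  assumes "h \<in> borel_group"
  shows "h ** borel_inverse h = mat 1" "borel_inverse h ** h = mat 1" "matrix_inv h = borel_inverse h"
proof -
  note B = borel_groupD[OF assms]
  show 1: "h ** borel_inverse h = mat 1" "borel_inverse h ** h = mat 1"
    using B(5,6) by (simp_all add: vec_eq_iff forall_3 matrix_matrix_mult_def sum_3 mat_def borel_inverse_entries B(2-4,7))
      (simp_all add: field_simps)
  show "matrix_inv h = borel_inverse h"
    unfolding matrix_inv_def
  proof (rule some_equality)
    fix g assume g: "h ** g = mat 1 \<and> g ** h = mat 1"
    have "g = g ** (h ** borel_inverse h)" by (simp add: 1)
    also have "\<dots> = borel_inverse h" by (simp add: matrix_mul_assoc g)
    finally show "g = borel_inverse h" .
  qed (simp add: 1)
qed

text \<open>Presents an entry of a conjugate as a linear combination, with constant coefficients, of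
  the entries of M, the shape required by \<open>ext_deriv_linear_comb\<close> and
  \<open>smooth_form_linear_comb\<close>.\<close>

lemma triple_product_entry:
  fixes h M g :: "complex ^ 3 ^ 3"
  shows "(h ** M ** g) $ i $ j = (\<Sum>p\<in>UNIV. (h $ i $ fst p * g $ snd p $ j) * M $ fst p $ snd p)"
proof -
  have "(h ** M ** g) $ i $ j = (\<Sum>l\<in>UNIV. \<Sum>k\<in>UNIV. h $ i $ k * M $ k $ l * g $ l $ j)"
    by (simp add: matrix_matrix_mult_def sum_distrib_right)
  also have "\<dots> = (\<Sum>k\<in>UNIV. \<Sum>l\<in>UNIV. (h $ i $ k * g $ l $ j) * M $ k $ l)"
    by (subst sum.swap) (simp add: mult_ac)
  also have "\<dots> = (\<Sum>p\<in>UNIV \<times> UNIV. (h $ i $ fst p * g $ snd p $ j) * M $ fst p $ snd p)"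
    by (simp add: sum.cartesian_product case_prod_unfold)
  finally show ?thesis by simp
qed

lemma matrix_diff_distrib:
  fixes A B C :: "complex ^ 3 ^ 3"
  shows "A ** (B - C) = A ** B - A ** C" "(B - C) ** A = B ** A - C ** A"
  by (simp_all add: vec_eq_iff matrix_matrix_mult_def algebra_simps sum_subtractf)

lemma matrix_add_distrib:
  fixes A B C :: "complex ^ 3 ^ 3"
  shows "A ** (B + C) = A ** B + A ** C" "(B + C) ** A = B ** A + C ** A"
  by (simp_all add: vec_eq_iff matrix_matrix_mult_def algebra_simps sum.distrib)

context flag_manifold
begin

text \<open>With the fundamental field in one slot, the equations for the differentials of the two
  legs and of \<phi> become linear relations between \<omega>, \<omega>1 and \<omega>2. Their
  coefficients vanish by independence, and these are equations for the values of the four unknown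
  forms on the field.\<close>

lemma conn_fund_field:
  assumes d0: "\<And>y u v. y \<in> YS \<Longrightarrow> ext_deriv YA w0 y u v = (w0 y \<and>\<^sub>f ph y) u v + (wf1 y \<and>\<^sub>f wf2 y) u v"
    and C: "\<And>y u v. y \<in> YS \<Longrightarrow> canonical_eqs o1 f1 f2 s (Q1 y) (Q2 y) y u v"
    and y: "y \<in> YS" and X: "X \<in> borel_lie"
  shows "conn o1 f1 f2 s y (fund_field A T1 T2 X y) = X"
proof -
  let ?F = "fund_field A T1 T2 X y"
  let ?a = "X $ 1 $ 1" and ?b = "X $ 3 $ 3" and ?c = "X $ 1 $ 2" and ?d = "X $ 2 $ 3" and ?e = "X $ 1 $ 3"
  note f = fund_field_contraction[OF y, of X]
  note I = coframe_indep_coeff[OF Y_forms_indep[OF y]]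
  note c = C[OF y, of ?F, unfolded canonical_eqs_def wedge_def f]
  have 1: "(2 * ?d - f1 y ?F) * w0 y v + (1/2 * (?a - ?b) - o1 y ?F - (2 * ?a + ?b)) * wf1 y v + 0 * wf2 y v = 0" for v
    using c[of v, THEN conjunct1] by (simp add: field_simps; algebra)
  have 2: "(- ?c - f2 y ?F) * w0 y v + 0 * wf1 y v + (1/2 * (?a - ?b) + o1 y ?F + (?a + 2 * ?b)) * wf2 y v = 0" for v
    using c[of v, THEN conjunct2, THEN conjunct1] by (simp add: field_simps; algebra)
  have 3: "(- s y ?F - 4 * ?e) * w0 y v + (- f2 y ?F - ?c) * wf1 y v + (f1 y ?F - 2 * ?d) * wf2 y v = 0" for v
    using c[of v, THEN conjunct2, THEN conjunct2, THEN conjunct1] by (simp add: field_simps; algebra)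
  have v: "f1 y ?F = 2 * ?d" "f2 y ?F = - ?c" "s y ?F = - 4 * ?e"
    using I(1)[OF 1] I(1)[OF 2] I(1)[OF 3] by algebra+
  have o: "2 * o1 y ?F = - 3 * (?a + ?b)"
    using I(2)[OF 1] by (simp add: field_simps; algebra)
  have t: "X $ 2 $ 2 = - ?a - ?b" "X $ 2 $ 1 = 0" "X $ 3 $ 1 = 0" "X $ 3 $ 2 = 0"
    using X by (simp_all add: borel_lie_def trace_def sum_3 add_eq_0_iff algebra_simps)
  have o': "o1 y ?F = - (3/2) * (?a + ?b)" using o by (simp add: field_simps)
  show ?thesis
    unfolding vec_eq_iff forall_3 conn_entries f v o' t by (simp add: field_simps)
qed

lemma conn_equivariant:
  assumes S: "smooth_forms4 o1 f1 f2 s"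
    and d0: "\<And>y u v. y \<in> YS \<Longrightarrow> ext_deriv YA w0 y u v = (w0 y \<and>\<^sub>f ph y) u v + (wf1 y \<and>\<^sub>f wf2 y) u v"
    and C: "\<And>y u v. y \<in> YS \<Longrightarrow> canonical_eqs o1 f1 f2 s (Q1 y) (Q2 y) y u v"
    and h: "h \<in> borel_group" and y: "y \<in> YS"
  shows "conn o1 f1 f2 s (B_act A T1 T2 h y) (tangent_map YA YA (B_act A T1 T2 h) y v) = matrix_inv h ** conn o1 f1 f2 s y v ** h"
proof -
  note Bd = borel_groupD[OF h] and inv = borel_inverse[OF h] and ge = borel_inverse_entries[of h]
  define g where "g = borel_inverse h"
  define k1 k2 w1 w2 r where "k1 = (h $ 1 $ 1)\<^sup>2 * h $ 3 $ 3" and "k2 = 1 / (h $ 1 $ 1 * (h $ 3 $ 3)\<^sup>2)"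
    and "w1 = - 2 * h $ 1 $ 1 * h $ 3 $ 3 * h $ 2 $ 3" and "w2 = h $ 1 $ 2 / h $ 1 $ 1"
    and "r = 4 * h $ 1 $ 3 / h $ 3 $ 3 - 2 * h $ 1 $ 1 * h $ 1 $ 2 * h $ 2 $ 3"
  have k: "k1 \<noteq> 0" "k2 \<noteq> 0" using Bd(5,6) by (simp_all add: k1_def k2_def)
  define b where "b = B_act A T1 T2 h"
  have bR: "b = R (H_mat k1 k2 w1 w2 r)"
    unfolding b_def k1_def k2_def w1_def w2_def r_def B_act_def[abs_def] j_hom_eq[OF Bd(5,6)] ..
  define T where "T y = tangent_map YA YA b y" for y
  let ?\<pi> = "conn o1 f1 f2 s"
  have bin: "b y \<in> YS" and bsm: "smooth_at YA YA b y" if "y \<in> YS" for y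
    unfolding bR using H_act_in[OF that k] H_act_smooth_at[OF that k] by blast+
  have F: "w0 (b y) (T y v) = k1 * k2 * w0 y v"
    "wf1 (b y) (T y v) = w1 * (k1 * k2) * w0 y v + k1 * wf1 y v"
    "wf2 (b y) (T y v) = w2 * (k1 * k2) * w0 y v + k2 * wf2 y v"
    "ph (b y) (T y v) = r * w0 y v + k1 * w2 * wf1 y v - k2 * w1 * wf2 y v + ph y v" if "y \<in> YS" for y v
    unfolding T_def bR by (rule Y_forms_H_act[OF that k])+
  define P where "P y v = h ** ?\<pi> (b y) (T y v) ** g" for y v
  have Pent: "(\<lambda>y v. P y v $ i $ j) = (\<lambda>y v. \<Sum>p\<in>UNIV. (h $ i $ fst p * g $ snd p $ j) * pull YA YA b (conn_form o1 f1 f2 s (fst p) (snd p)) y v)" for i j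
    by (simp add: P_def triple_product_entry pull_def T_def)
  have bYS: "b ` YS \<subseteq> YS" using bin by blast
  note sp = smooth_form_pull[OF Y_atlas_smooth Y_atlas_smooth bsm Y_open conn_smooth[OF S] Y_open bYS]
  note ep = ext_deriv_pull[OF Y_atlas_smooth Y_atlas_smooth bsm Y_open conn_smooth[OF S] Y_open bYS]
  have Psm: "smooth_form YA YS (\<lambda>y v. P y v $ i $ j)" for i j
    unfolding Pent by (rule smooth_form_linear_comb[OF sp _ Y_open]) auto
  have gh: "g ** h = mat 1" using inv(2) by (simp add: g_def)
  \<comment> \<open>d commutes with the pull-back and with constant matrix factors, and in the
    product of two values of P the inner factors g and h cancel; so curvature is conjugated as a
    whole.\<close>
  have PK: "(\<chi> i j. ext_deriv YA (\<lambda>y v. P y v $ i $ j) y u v) + (P y u ** P y v - P y v ** P y u)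
      = h ** curvature o1 f1 f2 s (b y) (T y u) (T y v) ** g" if y: "y \<in> YS" for y u v
  proof -
    define E :: "complex ^ 3 ^ 3" where "E = (\<chi> i j. ext_deriv YA (conn_form o1 f1 f2 s i j) (b y) (T y u) (T y v))"
    have "ext_deriv YA (\<lambda>y v. P y v $ i $ j) y u v = (h ** E ** g) $ i $ j" for i j
      unfolding Pent triple_product_entry
      by (subst ext_deriv_linear_comb[OF Y_atlas_smooth Y_open y sp]) (simp_all add: ep y E_def T_def)
    then have "(\<chi> i j. ext_deriv YA (\<lambda>y v. P y v $ i $ j) y u v) = h ** E ** g" by (simp add: vec_eq_iff)
    moreover have "P y u ** P y v = h ** (?\<pi> (b y) (T y u) ** ?\<pi> (b y) (T y v)) ** g" for u v
    proof -
      have "P y u ** P y v = h ** ?\<pi> (b y) (T y u) ** (g ** h) ** ?\<pi> (b y) (T y v) ** g"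
        by (simp add: P_def matrix_mul_assoc)
      then show ?thesis by (simp add: gh matrix_mul_assoc)
    qed
    ultimately show ?thesis
      unfolding curvature_def E_def[symmetric] by (simp add: matrix_add_distrib matrix_diff_distrib)
  qed
  have gl: "g $ 2 $ 1 = 0" "g $ 3 $ 1 = 0" "g $ 3 $ 2 = 0" "g $ 1 $ 1 = 1 / h $ 1 $ 1" "g $ 2 $ 2 = h $ 1 $ 1 * h $ 3 $ 3"
    "g $ 3 $ 3 = 1 / h $ 3 $ 3" "g $ 1 $ 2 = - h $ 1 $ 2 * h $ 3 $ 3" "g $ 2 $ 3 = - h $ 1 $ 1 * h $ 2 $ 3"
    "g $ 1 $ 3 = h $ 1 $ 2 * h $ 2 $ 3 - h $ 1 $ 3 / (h $ 1 $ 1 * h $ 3 $ 3)"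
    using Bd(5,6) by (simp_all add: g_def ge Bd(7))
  \<comment> \<open>Here the formula for j matters: j(h) describes how conjugation by h acts on the
    entries (3,1), (2,1), (3,2) and on the difference of (3,3) and (1,1), so conjugating back
    cancels the effect of \<open>b\<close> on the tautological forms.\<close>
  have Pt: "P y v $ 2 $ 1 = wf1 y v" "P y v $ 3 $ 2 = 2 * wf2 y v" "P y v $ 3 $ 1 = 2 * w0 y v"
    "P y v $ 3 $ 3 - P y v $ 1 $ 1 = ph y v" "trace (P y v) = 0" if y: "y \<in> YS" for y v
  proof -
    show "P y v $ 2 $ 1 = wf1 y v" "P y v $ 3 $ 2 = 2 * wf2 y v" "P y v $ 3 $ 1 = 2 * w0 y v"
      "P y v $ 3 $ 3 - P y v $ 1 $ 1 = ph y v"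
      unfolding P_def using Bd(5,6)
      by (simp_all add: matrix_matrix_mult_def sum_3 Bd(2-4,7) gl conn_entries F[OF y] k1_def k2_def w1_def w2_def r_def)
        (simp_all add: field_simps power2_eq_square)
    have "trace (P y v) = trace (g ** (h ** ?\<pi> (b y) (T y v)))" unfolding P_def by (rule trace_mul_sym)
    also have "\<dots> = trace (?\<pi> (b y) (T y v))" by (simp add: matrix_mul_assoc gh)
    also have "\<dots> = 0" by (simp add: trace_def sum_3 conn_entries)
    finally show "trace (P y v) = 0" .
  qed
  \<comment> \<open>Conjugation multiplies the entry (1,2) by h11 / h22 = a^2 b and the entry (2,3)
    by h22 / h33 = 1 / (a b^2), with a and b the outer diagonal entries of h. The products of k1 and
    k2 are the factors acquired by \<omega> \<and> \<omega>1 and \<omega> \<and> \<omega>2.\<close>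
  define Q1' Q2' where "Q1' y = k1 * k2 * k2 / (h $ 1 $ 1 * (h $ 3 $ 3)\<^sup>2) * Q1 (b y)" and
    "Q2' y = k1 * k2 * k1 * ((h $ 1 $ 1)\<^sup>2 * h $ 3 $ 3) * Q2 (b y)" for y
  have CP: "canonical_eqs (\<lambda>y v. 3/2 * P y v $ 2 $ 2) (\<lambda>y v. 2 * P y v $ 2 $ 3) (\<lambda>y v. - 1 * P y v $ 1 $ 2)
    (\<lambda>y v. - 4 * P y v $ 1 $ 3) (Q1' y) (Q2' y) y u v" if y: "y \<in> YS" for y u v
  proof (rule curvature_canonical[OF Psm Pt y], assumption+, unfold PK[OF y])
    note K = curvature_entries[OF S bin[OF y] d0[OF bin[OF y]] C[OF bin[OF y]], of "T y u" "T y v"]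
    have w: "(w0 (b y) \<and>\<^sub>f wf1 (b y)) (T y u) (T y v) = k1 * k2 * k1 * (w0 y \<and>\<^sub>f wf1 y) u v"
      "(w0 (b y) \<and>\<^sub>f wf2 (b y)) (T y u) (T y v) = k1 * k2 * k2 * (w0 y \<and>\<^sub>f wf2 y) u v"
      by (simp_all add: wedge_def F[OF y] algebra_simps)
    \<comment> \<open>Conjugation by upper triangular matrices preserves strict upper triangularity,
      and the unknown corner entry of the curvature reaches the corner only.\<close>
    show "(h ** curvature o1 f1 f2 s (b y) (T y u) (T y v) ** g) $ 1 $ 1 = 0"
      "(h ** curvature o1 f1 f2 s (b y) (T y u) (T y v) ** g) $ 2 $ 1 = 0"
      "(h ** curvature o1 f1 f2 s (b y) (T y u) (T y v) ** g) $ 2 $ 2 = 0"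
      "(h ** curvature o1 f1 f2 s (b y) (T y u) (T y v) ** g) $ 3 $ 2 = 0"
      "(h ** curvature o1 f1 f2 s (b y) (T y u) (T y v) ** g) $ 3 $ 3 = 0"
      by (simp_all add: matrix_matrix_mult_def sum_3 K Bd(2-4) gl(1-3))
    show "(h ** curvature o1 f1 f2 s (b y) (T y u) (T y v) ** g) $ 1 $ 2 = - Q2' y * (w0 y \<and>\<^sub>f wf1 y) u v"
      "(h ** curvature o1 f1 f2 s (b y) (T y u) (T y v) ** g) $ 2 $ 3 = 1/2 * Q1' y * (w0 y \<and>\<^sub>f wf2 y) u v"
      using Bd(5,6)
      by (simp_all add: matrix_matrix_mult_def sum_3 K Bd(2-4,7) gl w Q1'_def Q2'_def power2_eq_square) (simp add: mult_ac)
  qed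
  have SP: "smooth_forms4 (\<lambda>y v. 3/2 * P y v $ 2 $ 2) (\<lambda>y v. 2 * P y v $ 2 $ 3) (\<lambda>y v. - 1 * P y v $ 1 $ 2) (\<lambda>y v. - 4 * P y v $ 1 $ 3)"
    unfolding smooth_forms4_def by (intro conjI linear_cmult1(1)[OF Y_atlas_smooth Y_open Psm])
  have U1: "3/2 * P y v $ 2 $ 2 = o1 y v" by (rule canonical_eqs_unique(1)[OF S SP d0 C CP y])
  have U2: "2 * P y v $ 2 $ 3 = f1 y v" by (rule canonical_eqs_unique(2)[OF S SP d0 C CP y])
  have U3: "- 1 * P y v $ 1 $ 2 = f2 y v" by (rule canonical_eqs_unique(3)[OF S SP d0 C CP y])
  have U4: "- 4 * P y v $ 1 $ 3 = s y v" by (rule canonical_eqs_unique(4)[OF S SP d0 C CP y])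
  have e: "P y v $ 2 $ 2 = 2/3 * o1 y v" "P y v $ 2 $ 3 = 1/2 * f1 y v" "P y v $ 1 $ 2 = - 1 * f2 y v" "P y v $ 1 $ 3 = - (1/4) * s y v"
    by (simp_all add: U1[symmetric] U2[symmetric] U3[symmetric] U4[symmetric])
  have tr: "P y v $ 1 $ 1 + P y v $ 2 $ 2 + P y v $ 3 $ 3 = 0" using Pt(5)[OF y, of v] by (simp add: trace_def sum_3)
  \<comment> \<open>Trace zero, the middle entry and the difference of the outer entries determine
    the whole diagonal.\<close>
  have diag: "p = - (1/2) * f + - (1/3) * t" "r = 1/2 * f + - (1/3) * t"
    if "r - p = f" "p + q + r = 0" "q = 2/3 * t" for p q r f t :: complex
  proof -
    have "r = f + p" "p + 2/3 * t + (f + p) = 0" using that by (auto simp: algebra_simps)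
    then have "3 * (p + 2/3 * t + (f + p)) = 0" "r = f + p" by simp_all
    then have "6 * p = - 3 * f - 2 * t" "r = f + p" by (simp_all add: algebra_simps eq_neg_iff_add_eq_0)
    then have "6 * p = 6 * (- (1/2) * f + - (1/3) * t)" "r = f + p" by (simp_all add: algebra_simps)
    then show "p = - (1/2) * f + - (1/3) * t" by (simp only: mult_cancel_left) simp
    then show "r = 1/2 * f + - (1/3) * t" using \<open>r = f + p\<close> by simp
  qed
  note diag[OF Pt(4)[OF y, of v] tr e(1)]
  then have "P y v $ 1 $ 1 = - (1/2) * ph y v + - (1/3) * o1 y v" "P y v $ 3 $ 3 = 1/2 * ph y v + - (1/3) * o1 y v" .
  then have "P y v = ?\<pi> y v"
    unfolding vec_eq_iff forall_3 conn_entries using e Pt(1-3)[OF y, of v] by simp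
  then have "g ** P y v ** h = g ** ?\<pi> y v ** h" by simp
  moreover have "g ** P y v ** h = (g ** h) ** ?\<pi> (b y) (T y v) ** (g ** h)"
    by (simp add: P_def matrix_mul_assoc)
  ultimately show ?thesis
    by (simp add: gh inv(3) g_def[symmetric] T_def b_def)
qed

lemma conn_cartan_connection:
  assumes "canonical_forms A T1 T2 o1 f1 f2 s"
  shows "cartan_connection A T1 T2 (conn o1 f1 f2 s)"
proof -
  note S = canonical_formsD(1)[OF assms]
  obtain Q1 Q2 where Q: "\<forall>y\<in>YS. \<forall>u v. ext_deriv YA w0 y u v = (w0 y \<and>\<^sub>f ph y) u v + (wf1 y \<and>\<^sub>f wf2 y) u v \<and>
       canonical_eqs o1 f1 f2 s (Q1 y) (Q2 y) y u v"
    using canonical_formsD(2)[OF assms] by (elim exE) (rule that)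
  have d0: "ext_deriv YA w0 y u v = (w0 y \<and>\<^sub>f ph y) u v + (wf1 y \<and>\<^sub>f wf2 y) u v"
    and C: "canonical_eqs o1 f1 f2 s (Q1 y) (Q2 y) y u v" if "y \<in> YS" for y u v
    using Q[rule_format, OF that] by blast+
  have fund: "conn o1 f1 f2 s y (fund_field A T1 T2 X y) = X" if "X \<in> borel_lie" "y \<in> YS" for X y
    by (rule conn_fund_field[OF d0 C that(2,1)])
  have inj: "inj (conn o1 f1 f2 s y)" if y: "y \<in> YS" for y
    unfolding linear_injective_0[OF conn_linear[OF S y]]
  proof (intro allI impI)
    fix v assume z: "conn o1 f1 f2 s y v = 0"
    have "w0 y v = 0" "wf1 y v = 0" "wf2 y v = 0"
      using arg_cong[OF z, of "\<lambda>M. M $ 3 $ 1"] arg_cong[OF z, of "\<lambda>M. M $ 2 $ 1"] arg_cong[OF z, of "\<lambda>M. M $ 3 $ 2"]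
      by (simp_all add: conn_entries)
    then obtain X where X: "X \<in> borel_lie" "v = fund_field A T1 T2 X y" by (rule vertical_fund_field[OF y])
    then have "X = 0" using fund[OF X(1) y] z by simp
    then show "v = 0" using X(2) fund_field_zero[OF y] by simp
  qed
  show ?thesis
    unfolding cartan_connection_def
    using conn_smooth[OF S] inj fund conn_equivariant[OF S d0 C]
    by (simp add: trace_def sum_3 conn_entries)
qed

end

theorem theorem5p2:
  fixes A :: "('m, real ^ 3) atlas"
    and T1 T2 :: "'m \<Rightarrow> (complex ^ 3) set"
    and \<omega>11 \<phi>1 \<phi>2 \<psi> :: "'m Ypt \<Rightarrow> Ymod covec"
  assumes "smooth_manifold A"
    and "flag_structure A T1 T2"
    and "canonical_forms A T1 T2 \<omega>11 \<phi>1 \<phi>2 \<psi>"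
  shows "cartan_connection A T1 T2
    (\<lambda>y v. let \<omega> = Y_\<omega> A T1 T2 y v; \<omega>1 = Y_\<omega>1 A T1 T2 y v; \<omega>2 = Y_\<omega>2 A T1 T2 y v; \<phi> = Y_\<phi> A T1 T2 y v in
       vector
        [vector [- (1/2) * \<phi> - 1/3 * \<omega>11 y v, - \<phi>2 y v,          - (1/4) * \<psi> y v],
         vector [\<omega>1,                            2/3 * \<omega>11 y v,    1/2 * \<phi>1 y v],
         vector [2 * \<omega>,                         2 * \<omega>2,           1/2 * \<phi> - 1/3 * \<omega>11 y v]])"
proof -
  interpret flag_manifold A T1 T2 by (rule flag_manifold.intro) (rule assms)+
  show ?thesis using conn_cartan_connection[OF assms(3)] unfolding conn_def[abs_def] .
qed

end
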